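(* Let $G$ be a locally compact Hausdorff group, let $Y$ be a locally compact Hausdorff $G$-space and let $B$ be a $G\ltimes Y$-Banach algebra. If $Y$ is a proper $G$-space or a discrete $G$-space, then the canonical norm-decreasing homomorphism $\psi_B:L^1(G,\Gamma_0(Y,B))\to L^1(G\ltimes Y,B)$ induces an isomorphism $$\psi_{B,*}:\mathrm K_*(L^1(G,\Gamma_0(Y,B)))\cong \mathrm K_*(L^1(G\ltimes Y,B)).$$
   Context: All Banach spaces and algebras are complex; algebras need not be unital; $dg$ is a left Haar measure on $G$. $\mathrm K_*$ is topological K-theory of Banach algebras. A u.s.c. field of Banach spaces over a locally compact Hausdorff space $Y$ is a family $E=(E_y)_{y\in Y}$ of Banach spaces with a set of sections $\Gamma(Y,E)\subseteq\prod_yE_y$ such that (C1) it is a linear subspace; (C2) $\{\xi(y):\xi\in\Gamma(Y,E)\}$ is dense in $E_y$ for all $y$; (C3) $y\mapsto\|\xi(y)\|$ is upper semi-continuous for all $\xi\in\Gamma(Y,E)$; (C4) if $\xi\in\prod_yE_y$ and for all $y$ and $\varepsilon>0$ there are a neighbourhood $U$ of $y$ and $\xi'\in\Gamma(Y,E)$ with $\|\xi-\xi'\|\le\varepsilon$ on $U$, then $\xi\in\Gamma(Y,E)$. A set satisfying (C1)–(C3) generates a unique structure satisfying (C1)–(C4). $\Gamma_0$ (resp. $\Gamma_c$) denotes the sections vanishing at infinity (resp. compactly supported). The pullback $f^*E$ along a continuous map $f$ has fibres $E_{f(\cdot)}$ and structure generated by the $\xi\circ f$. The transformation groupoid $G\ltimes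 Y=G\times Y$ has unit space $Y$, range $r(g,y)=y$ and source $s(g,y)=g^{-1}y$. A $G\ltimes Y$-Banach algebra is a u.s.c. field $B$ of Banach spaces over $Y$ with a continuous field of associative products of norm $\le1$ on the fibres (sections multiply to sections) and isometric algebra isomorphisms $(g,y):B_{g^{-1}y}\to B_y$, forming a continuous field of maps $s^*B\to r^*B$ and compatible with composition in the groupoid. Then $\Gamma_0(Y,B)$ with sup norm is a Banach algebra with $G$-action $(g\xi)(y)=(g,y)(\xi(g^{-1}y))$. $L^1(G,\Gamma_0(Y,B))$ is the completion of $C_c(G,\Gamma_0(Y,B))$ for $\|\xi\|=\int_G\|\xi(g)\|\,dg=\int_G\sup_{y}\|\xi(g)(y)\|\,dg$ with product $(\xi*\eta)(g)=\int_G\xi(h)\,h(\eta(h^{-1}g))\,dh$. $L^1(G\ltimes Y,B)$ is the completion of $\Gamma_c(G\ltimes Y,r^*B)$ for the norm $\sup_{y\in Y}\int_G\|\xi(g,y)\|\,dg$ with product $(\xi*\eta)(g,y)=\int_G\xi(h,y)\cdot(h,y)(\eta(h^{-1}g,h^{-1}y))\,dh$. For $\xi\in\Gamma_c(G\ltimes Y,r^*B)$ let $\hat\iota(\xi)\in C_c(G,\Gamma_0(Y,B))$ be $\hat\iota(\xi)(g)(y)=\xi(g,y)$. The image of $\hat\iota$ is dense in $L^1(G,\Gamma_0(Y,B))$, and $\psi_B$ is the unique continuous (norm-decreasing) homomorphism with $\psi_B(\hat\iota(\xi))=\xi$. The $G$-space $Y$ is proper if $G\times Y\to Y\times Y$,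 $(g,y)\mapsto(gy,y)$, is a proper map, and discrete if its topology is discrete. *)

theory Defs
  imports "HOL-Analysis.Analysis" "HOL-Algebra.Coset" "Jordan_Normal_Form.Matrix"
begin

section \<open>Complex Banach algebras as a type class\<close>

class complex_banach_algebra = real_normed_algebra + banach +
  fixes scaleC :: "complex \<Rightarrow> 'a \<Rightarrow> 'a"  (infixr \<open>*\<^sub>C\<close> 75)
  assumes scaleC_add_right: "c *\<^sub>C (x + y) = c *\<^sub>C x + c *\<^sub>C y"
    and scaleC_add_left: "(c + d) *\<^sub>C x = c *\<^sub>C x + d *\<^sub>C x"
    and scaleC_scaleC: "c *\<^sub>C (d *\<^sub>C x) = (c * d) *\<^sub>C x"
    and scaleC_of_real: "of_real r *\<^sub>C x = r *\<^sub>R x"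
    and norm_scaleC: "norm (c *\<^sub>C x) = cmod c * norm x"
    and mult_scaleC_left: "(c *\<^sub>C x) * y = c *\<^sub>C (x * y)"
    and mult_scaleC_right: "x * (c *\<^sub>C y) = c *\<^sub>C (x * y)"

definition banach_algebra_hom ::
  "('a::complex_banach_algebra \<Rightarrow> 'b::complex_banach_algebra) \<Rightarrow> bool" where
  "banach_algebra_hom \<phi> \<longleftrightarrow> bounded_linear \<phi>
     \<and> (\<forall>c x. \<phi> (c *\<^sub>C x) = c *\<^sub>C \<phi> x) \<and> (\<forall>x y. \<phi> (x * y) = \<phi> x * \<phi> y)"


section \<open>Topological K-theory\<close>

text \<open>A unit is adjoined even if the algebra already has one.  The datatype package provides the
  functorial action \<open>map_unitization\<close>.\<close>

datatype 'a unitization = Unitization (alg_part: 'a) (scalar_part: complex)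

instantiation unitization :: (complex_banach_algebra) ring_1
begin

definition "0 = Unitization 0 0"
definition "1 = Unitization 0 1"
definition "x + y = Unitization (alg_part x + alg_part y) (scalar_part x + scalar_part y)"
definition "x - y = Unitization (alg_part x - alg_part y) (scalar_part x - scalar_part y)"
definition "- x = Unitization (- alg_part x) (- scalar_part x)"
definition "x * y =
  Unitization (alg_part x * alg_part y + scalar_part x *\<^sub>C alg_part y + scalar_part y *\<^sub>C alg_part x)
    (scalar_part x * scalar_part y)"

lemmas unitization_defs = zero_unitization_def one_unitization_def plus_unitization_def
  minus_unitization_def uminus_unitization_def times_unitization_def

instance
proof
  have scaleC_one: "1 *\<^sub>C x = x" for x :: 'a
    using scaleC_of_real[of 1 x] by simp
  have scaleC_zero: "0 *\<^sub>C x = 0" for x :: 'a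
    using scaleC_of_real[of 0 x] by simp
  have scaleC_zero': "c *\<^sub>C 0 = (0::'a)" for c
    using scaleC_add_right[of c 0 "0::'a"] by simp
  fix a b c :: "'a unitization"
  show "a * b * c = a * (b * c)"
    by (simp add: unitization_defs scaleC_add_right scaleC_add_left scaleC_scaleC
        mult_scaleC_left mult_scaleC_right algebra_simps)
  show "(a + b) * c = a * c + b * c" "a * (b + c) = a * b + a * c"
    by (simp_all add: unitization_defs scaleC_add_right scaleC_add_left algebra_simps)
  show "1 * a = a" "a * 1 = a"
    by (simp_all add: unitization_defs scaleC_one scaleC_zero')
qed (auto simp: unitization_defs algebra_simps)

end

text \<open>\<open>K\<^sub>0\<close> of a unital ring: formal differences of idempotent matrices of arbitrary size, i.e. the
  Grothendieck group of the monoid of idempotents up to (Murray-von Neumann) equivalence.\<close>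

definition idempotents :: "'r::ring_1 mat set" where
  "idempotents = {e. square_mat e \<and> e * e = e}"

definition direct_sum :: "'r::ring_1 mat \<Rightarrow> 'r mat \<Rightarrow> 'r mat"  (infixr \<open>\<oplus>\<^sub>d\<close> 65) where
  "x \<oplus>\<^sub>d y = four_block_mat x (0\<^sub>m (dim_row x) (dim_col y)) (0\<^sub>m (dim_row y) (dim_col x)) y"

definition idem_equiv :: "'r::ring_1 mat \<Rightarrow> 'r mat \<Rightarrow> bool" where
  "idem_equiv e f \<longleftrightarrow> (\<exists>x \<in> carrier_mat (dim_row e) (dim_row f).
     \<exists>y \<in> carrier_mat (dim_row f) (dim_row e). x * y = e \<and> y * x = f)"

definition K0_rel :: "(('r::ring_1 mat \<times> 'r mat) \<times> ('r mat \<times> 'r mat)) set" where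
  "K0_rel = {((e, f), (e', f')). {e, f, e', f'} \<subseteq> idempotents
     \<and> (\<exists>g \<in> idempotents. idem_equiv (e \<oplus>\<^sub>d f' \<oplus>\<^sub>d g) (e' \<oplus>\<^sub>d f \<oplus>\<^sub>d g))}"

definition K0_unital :: "'r::ring_1 itself \<Rightarrow> ('r mat \<times> 'r mat) set monoid" where
  "K0_unital _ =
    \<lparr>carrier = (idempotents \<times> idempotents) // K0_rel,
     monoid.mult = (\<lambda>X Y. \<Union>(e, f) \<in> X. \<Union>(e', f') \<in> Y. K0_rel `` {(e \<oplus>\<^sub>d e', f \<oplus>\<^sub>d f')}),
     one = K0_rel `` {(0\<^sub>m 0 0, 0\<^sub>m 0 0)}\<rparr>"

definition K0_unital_map ::
  "('r::ring_1 \<Rightarrow> 's::ring_1) \<Rightarrow> ('r mat \<times> 'r mat) set \<Rightarrow> ('s mat \<times> 's mat) set" where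
  "K0_unital_map h X = (\<Union>(e, f) \<in> X. K0_rel `` {(map_mat h e, map_mat h f)})"

definition K0 :: "'a::complex_banach_algebra itself
    \<Rightarrow> ('a unitization mat \<times> 'a unitization mat) set monoid" where
  "K0 _ = K0_unital TYPE('a unitization)
     \<lparr>carrier := kernel (K0_unital TYPE('a unitization)) (K0_unital TYPE(complex))
        (K0_unital_map scalar_part)\<rparr>"

definition K0_map :: "('a::complex_banach_algebra \<Rightarrow> 'b::complex_banach_algebra)
    \<Rightarrow> ('a unitization mat \<times> 'a unitization mat) set
    \<Rightarrow> ('b unitization mat \<times> 'b unitization mat) set" where
  "K0_map \<phi> = K0_unital_map (map_unitization \<phi>)"

text \<open>\<open>K\<^sub>1(A) = GL\<^sub>\<infinity>(A) / GL\<^sub>\<infinity>(A)\<^sub>0\<close>, where \<open>GL\<^sub>n(A)\<close> consists of the invertible matrices over the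
  unitization which become the identity in \<open>M\<^sub>n(\<complex>)\<close>.  Since \<open>GL\<^sub>n(A)\<close> is open in a translate of
  \<open>M\<^sub>n(A)\<close>, a coset of the identity component is a path component.\<close>

definition GL :: "nat \<Rightarrow> 'a::complex_banach_algebra unitization mat set" where
  "GL n = {x \<in> carrier_mat n n. invertible_mat x \<and> map_mat scalar_part x = 1\<^sub>m n}"

definition pad_one :: "nat \<Rightarrow> 'r::ring_1 mat \<Rightarrow> 'r mat" where
  "pad_one k x = x \<oplus>\<^sub>d 1\<^sub>m (k - dim_row x)"

definition GL_path_connected ::
  "nat \<Rightarrow> 'a::complex_banach_algebra unitization mat \<Rightarrow> 'a unitization mat \<Rightarrow> bool" where
  "GL_path_connected k x y \<longleftrightarrow> (\<exists>F :: real \<Rightarrow> 'a unitization mat.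
     (\<forall>t \<in> {0..1}. F t \<in> GL k)
     \<and> (\<forall>i < k. \<forall>j < k. continuous_on {0..1} (\<lambda>t. alg_part (F t $$ (i, j))))
     \<and> F 0 = x \<and> F 1 = y)"

definition K1_rel ::
  "('a::complex_banach_algebra unitization mat \<times> 'a unitization mat) set" where
  "K1_rel = {(x, y). \<exists>n m k. x \<in> GL n \<and> y \<in> GL m \<and> n \<le> k \<and> m \<le> k
     \<and> GL_path_connected k (pad_one k x) (pad_one k y)}"

definition K1 :: "'a::complex_banach_algebra itself \<Rightarrow> 'a unitization mat set monoid" where
  "K1 _ =
    \<lparr>carrier = (\<Union>n. GL n) // K1_rel,
     monoid.mult = (\<lambda>X Y. \<Union>x \<in> X. \<Union>y \<in> Y. let k = max (dim_row x) (dim_row y)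
        in K1_rel `` {pad_one k x * pad_one k y}),
     one = K1_rel `` {1\<^sub>m 0}\<rparr>"

definition K1_map :: "('a::complex_banach_algebra \<Rightarrow> 'b::complex_banach_algebra)
    \<Rightarrow> 'a unitization mat set \<Rightarrow> 'b unitization mat set" where
  "K1_map \<phi> X = (\<Union>x \<in> X. K1_rel `` {map_mat (map_unitization \<phi>) x})"


section \<open>Banach spaces and algebras on carrier sets\<close>

text \<open>The fibres of a field are different Banach spaces over different points, so they cannot be
  types; they are carrier sets with explicit operations.\<close>

record 'e bspace =
  ncar :: "'e set"
  nzero :: 'e
  nadd :: "'e \<Rightarrow> 'e \<Rightarrow> 'e"
  nscale :: "complex \<Rightarrow> 'e \<Rightarrow> 'e"
  nnorm :: "'e \<Rightarrow> real"

record 'e balgebra = "'e bspace" +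
  nmul :: "'e \<Rightarrow> 'e \<Rightarrow> 'e"

definition ndiff :: "('e, 'm) bspace_scheme \<Rightarrow> 'e \<Rightarrow> 'e \<Rightarrow> 'e" where
  "ndiff E x y = nadd E x (nscale E (-1) y)"

locale banach_space_on =
  fixes E :: "('e, 'm) bspace_scheme" (structure)
  assumes zero_closed: "nzero E \<in> ncar E"
    and add_closed: "\<lbrakk>x \<in> ncar E; y \<in> ncar E\<rbrakk> \<Longrightarrow> nadd E x y \<in> ncar E"
    and scale_closed: "x \<in> ncar E \<Longrightarrow> nscale E c x \<in> ncar E"
    and add_assoc: "\<lbrakk>x \<in> ncar E; y \<in> ncar E; z \<in> ncar E\<rbrakk>
      \<Longrightarrow> nadd E (nadd E x y) z = nadd E x (nadd E y z)"
    and add_commute: "\<lbrakk>x \<in> ncar E; y \<in> ncar E\<rbrakk> \<Longrightarrow> nadd E x y = nadd E y x"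
    and add_zero: "x \<in> ncar E \<Longrightarrow> nadd E x (nzero E) = x"
    and diff_self: "x \<in> ncar E \<Longrightarrow> ndiff E x x = nzero E"
    and scale_add: "\<lbrakk>x \<in> ncar E; y \<in> ncar E\<rbrakk>
      \<Longrightarrow> nscale E c (nadd E x y) = nadd E (nscale E c x) (nscale E c y)"
    and add_scale: "x \<in> ncar E \<Longrightarrow> nscale E (c + d) x = nadd E (nscale E c x) (nscale E d x)"
    and scale_scale: "x \<in> ncar E \<Longrightarrow> nscale E c (nscale E d x) = nscale E (c * d) x"
    and scale_one: "x \<in> ncar E \<Longrightarrow> nscale E 1 x = x"
    and norm_nonneg: "x \<in> ncar E \<Longrightarrow> 0 \<le> nnorm E x"
    and norm_eq_zero: "x \<in> ncar E \<Longrightarrow> nnorm E x = 0 \<longleftrightarrow> x = nzero E"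
    and norm_triangle: "\<lbrakk>x \<in> ncar E; y \<in> ncar E\<rbrakk>
      \<Longrightarrow> nnorm E (nadd E x y) \<le> nnorm E x + nnorm E y"
    and norm_scale: "x \<in> ncar E \<Longrightarrow> nnorm E (nscale E c x) = cmod c * nnorm E x"
    and complete: "\<lbrakk>\<forall>n::nat. X n \<in> ncar E;
        \<forall>\<epsilon>>0. \<exists>N. \<forall>m\<ge>N. \<forall>n\<ge>N. nnorm E (ndiff E (X m) (X n)) < \<epsilon>\<rbrakk>
      \<Longrightarrow> \<exists>x \<in> ncar E. (\<lambda>n. nnorm E (ndiff E (X n) x)) \<longlonglongrightarrow> 0"

locale banach_algebra_on = banach_space_on E for E :: "('e, 'm) balgebra_scheme" (structure) +
  assumes mul_closed: "\<lbrakk>x \<in> ncar E; y \<in> ncar E\<rbrakk> \<Longrightarrow> nmul E x y \<in> ncar E"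
    and mul_assoc: "\<lbrakk>x \<in> ncar E; y \<in> ncar E; z \<in> ncar E\<rbrakk>
      \<Longrightarrow> nmul E (nmul E x y) z = nmul E x (nmul E y z)"
    and mul_add_left: "\<lbrakk>x \<in> ncar E; y \<in> ncar E; z \<in> ncar E\<rbrakk>
      \<Longrightarrow> nmul E (nadd E x y) z = nadd E (nmul E x z) (nmul E y z)"
    and mul_add_right: "\<lbrakk>x \<in> ncar E; y \<in> ncar E; z \<in> ncar E\<rbrakk>
      \<Longrightarrow> nmul E x (nadd E y z) = nadd E (nmul E x y) (nmul E x z)"
    and mul_scale_left: "\<lbrakk>x \<in> ncar E; y \<in> ncar E\<rbrakk>
      \<Longrightarrow> nmul E (nscale E c x) y = nscale E c (nmul E x y)"
    and mul_scale_right: "\<lbrakk>x \<in> ncar E; y \<in> ncar E\<rbrakk>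
      \<Longrightarrow> nmul E x (nscale E c y) = nscale E c (nmul E x y)"
    and norm_mul: "\<lbrakk>x \<in> ncar E; y \<in> ncar E\<rbrakk> \<Longrightarrow> nnorm E (nmul E x y) \<le> nnorm E x * nnorm E y"

definition isometric_algebra_iso ::
  "('e, 'm) balgebra_scheme \<Rightarrow> ('f, 'n) balgebra_scheme \<Rightarrow> ('e \<Rightarrow> 'f) \<Rightarrow> bool" where
  "isometric_algebra_iso E F T \<longleftrightarrow> bij_betw T (ncar E) (ncar F)
     \<and> (\<forall>x \<in> ncar E. \<forall>y \<in> ncar E. T (nadd E x y) = nadd F (T x) (T y))
     \<and> (\<forall>x \<in> ncar E. \<forall>c. T (nscale E c x) = nscale F c (T x))
     \<and> (\<forall>x \<in> ncar E. \<forall>y \<in> ncar E. T (nmul E x y) = nmul F (T x) (T y))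
     \<and> (\<forall>x \<in> ncar E. nnorm F (T x) = nnorm E x)"

text \<open>\<open>j\<close> exhibits the Banach algebra \<open>'l\<close> as the completion of the normed algebra \<open>N\<close>.\<close>

definition is_completion ::
  "('e, 'm) balgebra_scheme \<Rightarrow> ('e \<Rightarrow> 'l::complex_banach_algebra) \<Rightarrow> bool" where
  "is_completion N j \<longleftrightarrow>
     (\<forall>x \<in> ncar N. \<forall>y \<in> ncar N. j (nadd N x y) = j x + j y)
     \<and> (\<forall>x \<in> ncar N. \<forall>c. j (nscale N c x) = c *\<^sub>C j x)
     \<and> (\<forall>x \<in> ncar N. \<forall>y \<in> ncar N. j (nmul N x y) = j x * j y)
     \<and> (\<forall>x \<in> ncar N. norm (j x) = nnorm N x)
     \<and> closure (j ` ncar N) = UNIV"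

text \<open>The Bochner integral (the library version needs the values in a type of class
  \<open>second_countable_topology\<close>).  A list of pairs \<open>(A, e)\<close> stands for the simple function
  \<open>\<Sum> 1\<^sub>A e\<close>.\<close>

definition nsum :: "('e, 'm) bspace_scheme \<Rightarrow> 'e list \<Rightarrow> 'e" where
  "nsum E xs = foldr (nadd E) xs (nzero E)"

definition simple_repr ::
  "'x measure \<Rightarrow> ('e, 'm) bspace_scheme \<Rightarrow> ('x set \<times> 'e) list \<Rightarrow> bool" where
  "simple_repr \<mu> E L \<longleftrightarrow>
     (\<forall>(A, e) \<in> set L. A \<in> sets \<mu> \<and> emeasure \<mu> A < \<infinity> \<and> e \<in> ncar E)"

definition simple_value :: "('e, 'm) bspace_scheme \<Rightarrow> ('x set \<times> 'e) list \<Rightarrow> 'x \<Rightarrow> 'e" where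
  "simple_value E L x = nsum E (map (\<lambda>(A, e). if x \<in> A then e else nzero E) L)"

definition simple_integral_on ::
  "'x measure \<Rightarrow> ('e, 'm) bspace_scheme \<Rightarrow> ('x set \<times> 'e) list \<Rightarrow> 'e" where
  "simple_integral_on \<mu> E L =
     nsum E (map (\<lambda>(A, e). nscale E (complex_of_real (measure \<mu> A)) e) L)"

definition has_bochner_integral_on ::
  "'x measure \<Rightarrow> ('e, 'm) bspace_scheme \<Rightarrow> ('x \<Rightarrow> 'e) \<Rightarrow> 'e \<Rightarrow> bool" where
  "has_bochner_integral_on \<mu> E f v \<longleftrightarrow> v \<in> ncar E \<and> (\<forall>\<epsilon>>0. \<exists>L. simple_repr \<mu> E L
     \<and> (\<lambda>x. nnorm E (ndiff E (f x) (simple_value E L x))) \<in> borel_measurable \<mu>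
     \<and> (\<integral>\<^sup>+x. ennreal (nnorm E (ndiff E (f x) (simple_value E L x))) \<partial>\<mu>) < ennreal \<epsilon>
     \<and> nnorm E (ndiff E v (simple_integral_on \<mu> E L)) < \<epsilon>)"

definition bochner_integral_on ::
  "'x measure \<Rightarrow> ('e, 'm) bspace_scheme \<Rightarrow> ('x \<Rightarrow> 'e) \<Rightarrow> 'e" where
  "bochner_integral_on \<mu> E f = (THE v. has_bochner_integral_on \<mu> E f v)"


section \<open>Upper semicontinuous fields of Banach spaces\<close>

text \<open>Elements of \<open>\<Pi>\<^sub>x E\<^sub>x\<close> are functions which are \<open>undefined\<close> outside \<open>topspace X\<close>.\<close>

definition all_sections :: "'x topology \<Rightarrow> ('x \<Rightarrow> ('e, 'm) bspace_scheme) \<Rightarrow> ('x \<Rightarrow> 'e) set" where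
  "all_sections X E = (\<Pi>\<^sub>E x \<in> topspace X. ncar (E x))"

definition sec_zero :: "'x topology \<Rightarrow> ('x \<Rightarrow> ('e, 'm) bspace_scheme) \<Rightarrow> 'x \<Rightarrow> 'e" where
  "sec_zero X E = (\<lambda>x \<in> topspace X. nzero (E x))"

definition sec_add ::
  "'x topology \<Rightarrow> ('x \<Rightarrow> ('e, 'm) bspace_scheme) \<Rightarrow> ('x \<Rightarrow> 'e) \<Rightarrow> ('x \<Rightarrow> 'e) \<Rightarrow> 'x \<Rightarrow> 'e" where
  "sec_add X E \<xi> \<eta> = (\<lambda>x \<in> topspace X. nadd (E x) (\<xi> x) (\<eta> x))"

definition sec_scale ::
  "'x topology \<Rightarrow> ('x \<Rightarrow> ('e, 'm) bspace_scheme) \<Rightarrow> complex \<Rightarrow> ('x \<Rightarrow> 'e) \<Rightarrow> 'x \<Rightarrow> 'e" where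
  "sec_scale X E c \<xi> = (\<lambda>x \<in> topspace X. nscale (E x) c (\<xi> x))"

definition sec_mul ::
  "'x topology \<Rightarrow> ('x \<Rightarrow> ('e, 'm) balgebra_scheme) \<Rightarrow> ('x \<Rightarrow> 'e) \<Rightarrow> ('x \<Rightarrow> 'e) \<Rightarrow> 'x \<Rightarrow> 'e" where
  "sec_mul X E \<xi> \<eta> = (\<lambda>x \<in> topspace X. nmul (E x) (\<xi> x) (\<eta> x))"

locale usc_field =
  fixes X :: "'x topology" and E :: "'x \<Rightarrow> ('e, 'm) bspace_scheme" and \<Gamma> :: "('x \<Rightarrow> 'e) set"
  assumes fibre_banach: "x \<in> topspace X \<Longrightarrow> banach_space_on (E x)"
    and sections: "\<Gamma> \<subseteq> all_sections X E"
    and C1_zero: "sec_zero X E \<in> \<Gamma>"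
    and C1_add: "\<lbrakk>\<xi> \<in> \<Gamma>; \<eta> \<in> \<Gamma>\<rbrakk> \<Longrightarrow> sec_add X E \<xi> \<eta> \<in> \<Gamma>"
    and C1_scale: "\<xi> \<in> \<Gamma> \<Longrightarrow> sec_scale X E c \<xi> \<in> \<Gamma>"
    and C2: "\<lbrakk>x \<in> topspace X; e \<in> ncar (E x); 0 < \<epsilon>\<rbrakk>
      \<Longrightarrow> \<exists>\<xi> \<in> \<Gamma>. nnorm (E x) (ndiff (E x) (\<xi> x) e) < \<epsilon>"
    and C3: "\<xi> \<in> \<Gamma> \<Longrightarrow> openin X {x \<in> topspace X. nnorm (E x) (\<xi> x) < r}"
    and C4: "\<lbrakk>\<xi> \<in> all_sections X E;
        \<forall>x \<in> topspace X. \<forall>\<epsilon>>0. \<exists>U. openin X U \<and> x \<in> U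
          \<and> (\<exists>\<xi>' \<in> \<Gamma>. \<forall>z \<in> U. nnorm (E z) (ndiff (E z) (\<xi> z) (\<xi>' z)) \<le> \<epsilon>)\<rbrakk>
      \<Longrightarrow> \<xi> \<in> \<Gamma>"

text \<open>The structure generated by a set with (C1)--(C3) is the only one containing it, so that it is
  also the intersection of all of them.\<close>

definition pullback_sections ::
  "'z topology \<Rightarrow> ('z \<Rightarrow> 'x) \<Rightarrow> ('x \<Rightarrow> ('e, 'm) bspace_scheme) \<Rightarrow> ('x \<Rightarrow> 'e) set
    \<Rightarrow> ('z \<Rightarrow> 'e) set" where
  "pullback_sections Z f E \<Gamma> = usc_field Z (E \<circ> f) hull ((\<lambda>\<xi>. restrict (\<xi> \<circ> f) (topspace Z)) ` \<Gamma>)"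

definition sections_vanishing ::
  "'x topology \<Rightarrow> ('x \<Rightarrow> ('e, 'm) bspace_scheme) \<Rightarrow> ('x \<Rightarrow> 'e) set \<Rightarrow> ('x \<Rightarrow> 'e) set" where
  "sections_vanishing X E \<Gamma> = {\<xi> \<in> \<Gamma>. \<forall>\<epsilon>>0. \<exists>K. compactin X K
     \<and> (\<forall>x \<in> topspace X - K. nnorm (E x) (\<xi> x) < \<epsilon>)}"

definition sections_compact ::
  "'x topology \<Rightarrow> ('x \<Rightarrow> ('e, 'm) bspace_scheme) \<Rightarrow> ('x \<Rightarrow> 'e) set \<Rightarrow> ('x \<Rightarrow> 'e) set" where
  "sections_compact X E \<Gamma> = {\<xi> \<in> \<Gamma>. \<exists>K. compactin X K
     \<and> (\<forall>x \<in> topspace X - K. \<xi> x = nzero (E x))}"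

text \<open>The zero is inserted in the supremum only for the case of an empty base space.\<close>

definition Gamma0 ::
  "'x topology \<Rightarrow> ('x \<Rightarrow> ('e, 'm) balgebra_scheme) \<Rightarrow> ('x \<Rightarrow> 'e) set \<Rightarrow> ('x \<Rightarrow> 'e) balgebra" where
  "Gamma0 X B \<Gamma> =
    \<lparr>ncar = sections_vanishing X B \<Gamma>,
     nzero = sec_zero X B,
     nadd = sec_add X B,
     nscale = sec_scale X B,
     nnorm = (\<lambda>\<xi>. Sup (insert 0 ((\<lambda>x. nnorm (B x) (\<xi> x)) ` topspace X))),
     nmul = sec_mul X B\<rparr>"


section \<open>Locally compact groups and their Banach algebras\<close>

text \<open>Groups are types of class \<open>topological_group_add\<close>, which does not assume commutativity:
  \<open>g + h\<close>, \<open>- g\<close> and \<open>0\<close> are the product \<open>gh\<close>, the inverse of \<open>g\<close> and the neutral element.\<close>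

definition left_haar_measure :: "'g::{topological_group_add, t2_space} measure \<Rightarrow> bool" where
  "left_haar_measure \<mu> \<longleftrightarrow> sets \<mu> = sets borel
     \<and> (\<forall>K. compact K \<longrightarrow> emeasure \<mu> K < \<infinity>)
     \<and> (\<forall>A \<in> sets borel. emeasure \<mu> A = (INF U \<in> {U. open U \<and> A \<subseteq> U}. emeasure \<mu> U))
     \<and> (\<forall>U. open U \<longrightarrow> emeasure \<mu> U = (SUP K \<in> {K. compact K \<and> K \<subseteq> U}. emeasure \<mu> K))
     \<and> (\<forall>g. \<forall>A \<in> sets borel. emeasure \<mu> ((\<lambda>x. g + x) ` A) = emeasure \<mu> A)
     \<and> emeasure \<mu> UNIV \<noteq> 0"

definition continuous_action ::
  "'y topology \<Rightarrow> ('g::{topological_group_add, t2_space} \<Rightarrow> 'y \<Rightarrow> 'y) \<Rightarrow> bool" where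
  "continuous_action Y act \<longleftrightarrow>
     continuous_map (prod_topology euclidean Y) Y (\<lambda>(g, y). act g y)
     \<and> (\<forall>y \<in> topspace Y. act 0 y = y)
     \<and> (\<forall>g h. \<forall>y \<in> topspace Y. act (g + h) y = act g (act h y))"

definition proper_action ::
  "'y topology \<Rightarrow> ('g::{topological_group_add, t2_space} \<Rightarrow> 'y \<Rightarrow> 'y) \<Rightarrow> bool" where
  "proper_action Y act \<longleftrightarrow>
     proper_map (prod_topology euclidean Y) (prod_topology Y Y) (\<lambda>(g, y). (act g y, y))"

abbreviation groupoid_space :: "'y topology \<Rightarrow> ('g::topological_space \<times> 'y) topology" where
  "groupoid_space Y \<equiv> prod_topology euclidean Y"

abbreviation groupoid_range :: "'g \<times> 'y \<Rightarrow> 'y" where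
  "groupoid_range \<equiv> snd"

definition groupoid_source :: "('g::uminus \<Rightarrow> 'y \<Rightarrow> 'y) \<Rightarrow> 'g \<times> 'y \<Rightarrow> 'y" where
  "groupoid_source act = (\<lambda>(g, y). act (- g) y)"

locale groupoid_banach_algebra = usc_field Y B \<Gamma>
  for Y :: "'y topology"
    and act :: "'g::{topological_group_add, t2_space} \<Rightarrow> 'y \<Rightarrow> 'y"
    and B :: "'y \<Rightarrow> ('e, 'm) balgebra_scheme"
    and \<Gamma> :: "('y \<Rightarrow> 'e) set"
    and \<alpha> :: "'g \<Rightarrow> 'y \<Rightarrow> 'e \<Rightarrow> 'e" +
  assumes fibre_algebra: "y \<in> topspace Y \<Longrightarrow> banach_algebra_on (B y)"
    and continuous_mul: "\<lbrakk>\<xi> \<in> \<Gamma>; \<eta> \<in> \<Gamma>\<rbrakk> \<Longrightarrow> sec_mul Y B \<xi> \<eta> \<in> \<Gamma>"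
    and translation_iso: "y \<in> topspace Y \<Longrightarrow> isometric_algebra_iso (B (act (- g) y)) (B y) (\<alpha> g y)"
    and translation_continuous:
      "\<zeta> \<in> pullback_sections (groupoid_space Y) (groupoid_source act) B \<Gamma>
        \<Longrightarrow> (\<lambda>(g, y) \<in> topspace (groupoid_space Y). \<alpha> g y (\<zeta> (g, y)))
              \<in> pullback_sections (groupoid_space Y) groupoid_range B \<Gamma>"
    and translation_compose: "\<lbrakk>y \<in> topspace Y; b \<in> ncar (B (act (- (g + h)) y))\<rbrakk>
      \<Longrightarrow> \<alpha> (g + h) y b = \<alpha> g y (\<alpha> h (act (- g) y) b)"

definition section_action :: "'y topology \<Rightarrow> ('g::uminus \<Rightarrow> 'y \<Rightarrow> 'y) \<Rightarrow> ('g \<Rightarrow> 'y \<Rightarrow> 'e \<Rightarrow> 'e)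
    \<Rightarrow> 'g \<Rightarrow> ('y \<Rightarrow> 'e) \<Rightarrow> 'y \<Rightarrow> 'e" where
  "section_action Y act \<alpha> g \<xi> = (\<lambda>y \<in> topspace Y. \<alpha> g y (\<xi> (act (- g) y)))"

definition Cc :: "('a, 'm) bspace_scheme \<Rightarrow> ('g::topological_space \<Rightarrow> 'a) set" where
  "Cc A = {f. (\<forall>g. f g \<in> ncar A)
     \<and> (\<forall>g. \<forall>\<epsilon>>0. \<exists>U. open U \<and> g \<in> U \<and> (\<forall>h \<in> U. nnorm A (ndiff A (f h) (f g)) < \<epsilon>))
     \<and> (\<exists>K. compact K \<and> (\<forall>g. g \<notin> K \<longrightarrow> f g = nzero A))}"

text \<open>The normed convolution algebra \<open>C\<^sub>c(G, A)\<close>, whose completion is \<open>L\<^sup>1(G, A)\<close>, for an action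
  \<open>\<gamma>\<close> of \<open>G\<close> on \<open>A\<close>.\<close>

definition group_convolution_algebra ::
  "'g::{topological_group_add, t2_space} measure \<Rightarrow> ('a, 'm) balgebra_scheme
    \<Rightarrow> ('g \<Rightarrow> 'a \<Rightarrow> 'a) \<Rightarrow> ('g \<Rightarrow> 'a) balgebra" where
  "group_convolution_algebra \<mu> A \<gamma> =
    \<lparr>ncar = Cc A,
     nzero = (\<lambda>g. nzero A),
     nadd = (\<lambda>\<xi> \<eta> g. nadd A (\<xi> g) (\<eta> g)),
     nscale = (\<lambda>c \<xi> g. nscale A c (\<xi> g)),
     nnorm = (\<lambda>\<xi>. \<integral>g. nnorm A (\<xi> g) \<partial>\<mu>),
     nmul = (\<lambda>\<xi> \<eta> g. bochner_integral_on \<mu> A (\<lambda>h. nmul A (\<xi> h) (\<gamma> h (\<eta> (- h + g)))))\<rparr>"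

text \<open>The normed convolution algebra \<open>\<Gamma>\<^sub>c(G \<ltimes> Y, r\<^sup>* B)\<close>, whose completion is \<open>L\<^sup>1(G \<ltimes> Y, B)\<close>.\<close>

definition groupoid_convolution_algebra ::
  "'g::{topological_group_add, t2_space} measure \<Rightarrow> 'y topology \<Rightarrow> ('g \<Rightarrow> 'y \<Rightarrow> 'y)
    \<Rightarrow> ('y \<Rightarrow> ('e, 'm) balgebra_scheme) \<Rightarrow> ('y \<Rightarrow> 'e) set \<Rightarrow> ('g \<Rightarrow> 'y \<Rightarrow> 'e \<Rightarrow> 'e)
    \<Rightarrow> ('g \<times> 'y \<Rightarrow> 'e) balgebra" where
  "groupoid_convolution_algebra \<mu> Y act B \<Gamma> \<alpha> =
    (let Z = groupoid_space Y; rB = B \<circ> groupoid_range in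
    \<lparr>ncar = sections_compact Z rB (pullback_sections Z groupoid_range B \<Gamma>),
     nzero = sec_zero Z rB,
     nadd = sec_add Z rB,
     nscale = sec_scale Z rB,
     nnorm = (\<lambda>\<xi>. Sup (insert 0 ((\<lambda>y. \<integral>g. nnorm (B y) (\<xi> (g, y)) \<partial>\<mu>) ` topspace Y))),
     nmul = (\<lambda>\<xi> \<eta>. \<lambda>(g, y) \<in> topspace Z. bochner_integral_on \<mu> (B y)
        (\<lambda>h. nmul (B y) (\<xi> (h, y)) (\<alpha> h y (\<eta> (- h + g, act (- h) y)))))\<rparr>)"

end

theory Submission
  imports Defs
begin

text \<open>
  Both Banach algebras are completions of the sections \<open>\<Gamma>\<^sub>c(G \<ltimes> Y, r\<^sup>*B)\<close> with compact support, and \<open>\<psi>\<close> is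
  the identity on them.  The two norms take the supremum over \<open>Y\<close> and the integral over \<open>G\<close> in opposite
  orders, so \<open>\<psi>\<close> decreases the norm but need not have a bounded inverse.  Multiplication from both sides repairs
  this: for \<open>\<xi>, \<eta>\<close> in \<open>\<Gamma>\<^sub>c\<close> there is a constant \<open>M\<close> with \<open>\<parallel>\<xi> * a * \<eta>\<parallel> \<le> M \<parallel>\<psi> a\<parallel>\<close> for all \<open>a\<close>, where the left
  hand side is the larger norm.

  The support of \<open>\<zeta> = \<xi> * a\<close> in the direction of \<open>Y\<close> lies in a compact set \<open>L\<close> determined by \<open>\<xi>\<close> alone.  If
  \<open>Y\<close> is discrete, then \<open>L\<close> is finite, a supremum over \<open>L\<close> is at most the sum over \<open>L\<close>, and the order
  matters only up to the factor \<open>card L\<close>.  If \<open>Y\<close> is proper, then \<open>(\<zeta> * \<eta>)(g, y) \<noteq> 0\<close> forces \<open>y \<in> L\<close> and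
  \<open>g\<^sup>-\<^sup>1 y \<in> L'\<close>, with \<open>L'\<close> compact and determined by \<open>\<eta>\<close>, so that \<open>g\<close> lies in a compact set \<open>K\<close>
  independent of \<open>a\<close>; there the integral over \<open>G\<close> is at most the measure of \<open>K\<close> times a supremum, and
  pointwise \<open>\<parallel>(\<zeta> * \<eta>)(g, y)\<parallel>\<close> is at most \<open>sup \<parallel>\<eta>\<parallel>\<close> times the integral of \<open>\<parallel>\<zeta>\<parallel>\<close> over the fibre of \<open>y\<close>
  (\<open>right_multiplication_bounded\<close>, \<open>core_sandwich\<close>).

  The estimate extends by continuity in \<open>a\<close>, and to all \<open>\<xi>, \<eta>\<close> in the two-sided ideal \<open>I\<close> generated by
  \<open>\<Gamma>\<^sub>c\<close>; this is \<open>hereditary_morphism_of_dense\<close>, and the locale \<open>hereditary_morphism\<close> records the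
  situation: dense range, and a dense ideal on which the estimate holds.  Two consequences drive
  everything else.  Approximating \<open>b\<close> by images, \<open>\<psi> x * b * \<psi> y\<close> lies in the range of \<open>\<psi>\<close> for \<open>x, y \<in> I\<close>
  (\<open>sandwich_in_range\<close>).  And \<open>u * v * w = 0\<close> if \<open>\<psi> v = 0\<close> (\<open>kernel_annihilates\<close>), so that errors in the
  kernel are nilpotent and can be corrected by algebra.  Hence a matrix in \<open>1 + M\<^sub>n(I)\<close> is invertible as
  soon as its image is (\<open>invertible_of_image_invertible\<close>).

  For \<open>K\<^sub>1\<close>, invertible matrices over the target are approximated by images from \<open>1 + M\<^sub>n(I)\<close>, and a path
  between images is lifted by cutting it into pieces so short that each may be replaced by a segment
  (\<open>GL_image_dense\<close>, \<open>GL_path_lift\<close>).  For \<open>K\<^sub>0\<close>, an equivalence between images of idempotents over \<open>I\<close> is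
  approximated by matrices over \<open>I\<close> and then repaired (\<open>reflect_idem_equiv\<close>).  Surjectivity is more
  delicate because the range need not be closed under the functional calculus: an idempotent is conjugated twice, first on one
  side and then on the other, and the sandwich property places the result in the range
  (\<open>idempotent_equiv_image\<close>).
\<close>

section \<open>Square matrices as elements of a ring\<close>

text \<open>Matrices of size \<open>n\<close> form a ring only relative to a carrier, whereas simplification with ring laws
needs a type.  Additive maps on sequences form a ring type, and \<open>n \<times> n\<close> matrices embed into it.\<close>

typedef (overloaded) 'r endo =
  "{f :: (nat \<Rightarrow> 'r::ring_1) \<Rightarrow> nat \<Rightarrow> 'r. \<forall>u v. f (\<lambda>i. u i + v i) = (\<lambda>i. f u i + f v i)}"
  by (rule exI[of _ id]) simp

setup_lifting type_definition_endo

instantiation endo :: (ring_1) ring_1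
begin

lift_definition zero_endo :: "'a endo" is "\<lambda>u i. 0" by simp
lift_definition one_endo :: "'a endo" is "\<lambda>u. u" by simp
lift_definition plus_endo :: "'a endo \<Rightarrow> 'a endo \<Rightarrow> 'a endo" is "\<lambda>f g u i. f u i + g u i"
  by (simp add: algebra_simps)
lift_definition minus_endo :: "'a endo \<Rightarrow> 'a endo \<Rightarrow> 'a endo" is "\<lambda>f g u i. f u i - g u i"
  by (simp add: algebra_simps)
lift_definition uminus_endo :: "'a endo \<Rightarrow> 'a endo" is "\<lambda>f u i. - f u i"
  by simp
lift_definition times_endo :: "'a endo \<Rightarrow> 'a endo \<Rightarrow> 'a endo" is "\<lambda>f g u. f (g u)"
  by simp

instance
proof
  show "(0::'a endo) \<noteq> 1"
    by transfer (metis zero_neq_one)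
qed (transfer; simp add: algebra_simps)+

end

text \<open>The matrix acts on every block of \<open>n\<close> consecutive entries, so that the identity matrix becomes the
identity map and the embedding is unital.\<close>

lift_definition block_endo :: "nat \<Rightarrow> 'r::ring_1 mat \<Rightarrow> 'r endo" is
  "\<lambda>n x u i. \<Sum>j<n. x $$ (i mod n, j) * u (i div n * n + j)"
  by (simp add: sum.distrib algebra_simps)

lemma block_endo_add:
  "x \<in> carrier_mat n n \<Longrightarrow> y \<in> carrier_mat n n \<Longrightarrow> 0 < n
    \<Longrightarrow> block_endo n (x + y) = block_endo n x + block_endo n y"
  by transfer (simp add: sum.distrib algebra_simps fun_eq_iff)

lemma block_endo_minus:
  "x \<in> carrier_mat n n \<Longrightarrow> y \<in> carrier_mat n n \<Longrightarrow> 0 < n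
    \<Longrightarrow> block_endo n (x - y) = block_endo n x - block_endo n y"
  by transfer (simp add: sum_subtractf algebra_simps fun_eq_iff)

lemma block_endo_zero: "0 < n \<Longrightarrow> block_endo n (0\<^sub>m n n) = 0"
  by transfer (simp add: fun_eq_iff)

lemma block_endo_one: "0 < n \<Longrightarrow> block_endo n (1\<^sub>m n) = 1"
proof (transfer, intro ext)
  fix n :: nat and u :: "nat \<Rightarrow> 'a" and i :: nat
  assume n: "0 < n"
  have "(\<Sum>j<n. 1\<^sub>m n $$ (i mod n, j) * u (i div n * n + j))
      = (\<Sum>j<n. if j = i mod n then u (i div n * n + j) else 0)"
    using n by (intro sum.cong) auto
  also have "\<dots> = u i" using n by (simp add: sum.delta)
  finally show "(\<Sum>j<n. 1\<^sub>m n $$ (i mod n, j) * u (i div n * n + j)) = u i" .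
qed

lemma mult_mat_entry:
  "x \<in> carrier_mat n m \<Longrightarrow> y \<in> carrier_mat m k \<Longrightarrow> i < n \<Longrightarrow> j < k
    \<Longrightarrow> (x * y) $$ (i, j) = (\<Sum>l<m. x $$ (i, l) * y $$ (l, j))"
  by (simp add: scalar_prod_def atLeast0LessThan)

lemma block_endo_mult:
  assumes "x \<in> carrier_mat n n" "y \<in> carrier_mat n n" "0 < n"
  shows "block_endo n (x * y) = block_endo n x * block_endo n y"
  using assms
proof (transfer, intro ext)
  fix n :: nat and x y :: "'a mat" and u :: "nat \<Rightarrow> 'a" and i :: nat
  assume x: "x \<in> carrier_mat n n" and y: "y \<in> carrier_mat n n" and n: "0 < n"
  let ?q = "i div n * n"
  have "(\<Sum>k<n. (x * y) $$ (i mod n, k) * u (?q + k))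
      = (\<Sum>k<n. \<Sum>j<n. x $$ (i mod n, j) * (y $$ (j, k) * u (?q + k)))"
    using n by (intro sum.cong)
      (simp_all add: mult_mat_entry[OF x y] sum_distrib_right mult.assoc)
  also have "\<dots> = (\<Sum>j<n. x $$ (i mod n, j) * (\<Sum>k<n. y $$ (j, k) * u (?q + k)))"
    by (subst sum.swap) (simp add: sum_distrib_left)
  also have "\<dots> = (\<Sum>j<n. x $$ (i mod n, j) * (\<Sum>k<n. y $$ ((?q + j) mod n, k) * u ((?q + j) div n * n + k)))"
    using n by (intro sum.cong) (simp_all add: div_mult_self3)
  finally show "(\<Sum>k<n. (x * y) $$ (i mod n, k) * u (?q + k)) = \<dots>" .
qed

lemma block_endo_inj:
  assumes x: "x \<in> carrier_mat n n" and y: "y \<in> carrier_mat n n" and n: "0 < n"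
    and eq: "block_endo n x = block_endo n y"
  shows "x = y"
proof (rule eq_matI)
  fix i j assume "i < dim_row y" "j < dim_col y"
  hence ij: "i < n" "j < n" using y by auto
  have entry: "Rep_endo (block_endo n z) (\<lambda>k. if k = j then 1 else 0) i = z $$ (i, j)" for z :: "'a mat"
  proof -
    have "(\<Sum>k<n. z $$ (i mod n, k) * (if i div n * n + k = j then 1 else 0))
        = (\<Sum>k<n. if k = j then z $$ (i, k) else 0)"
      using ij by (intro sum.cong) auto
    thus ?thesis using ij by (simp add: block_endo.rep_eq sum.delta)
  qed
  show "x $$ (i, j) = y $$ (i, j)" using entry[of x] entry[of y] eq by simp
qed (use x y in auto)

lemmas block_endo_hom = block_endo_add block_endo_minus block_endo_zero block_endo_one block_endo_mult

section \<open>The norm on a unitization\<close>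

context
  fixes type_param :: "'a::complex_banach_algebra itself"
begin

lemma scaleC_zero_left: "0 *\<^sub>C x = (0::'a)"
  using scaleC_of_real[of 0 x] by simp

lemma scaleC_minus_one: "(-1) *\<^sub>C x = - (x::'a)"
  using scaleC_of_real[of "-1" x] by simp

lemma scaleC_scaleR: "c *\<^sub>C (r *\<^sub>R x) = r *\<^sub>R (c *\<^sub>C (x::'a))"
  by (simp add: scaleC_of_real[symmetric] scaleC_scaleC mult.commute)

lemma scaleC_scaleR_left: "(r *\<^sub>R c) *\<^sub>C (x::'a) = r *\<^sub>R (c *\<^sub>C x)"
  by (simp add: scaleC_of_real[symmetric] scaleC_scaleC scaleR_conv_of_real)

end

text \<open>With the norm \<open>\<parallel>a\<parallel> + \<bar>c\<bar>\<close> the unitization is a Banach algebra, in which the Neumann series converges.\<close>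

instantiation unitization :: (complex_banach_algebra) real_normed_algebra_1
begin

definition scaleR_unitization :: "real \<Rightarrow> 'a unitization \<Rightarrow> 'a unitization" where
  "r *\<^sub>R x = Unitization (r *\<^sub>R alg_part x) (r *\<^sub>R scalar_part x)"
definition norm_unitization :: "'a unitization \<Rightarrow> real" where
  "norm x = norm (alg_part x) + cmod (scalar_part x)"
definition dist_unitization_def: "dist x y = norm (x - y)" for x y :: "'a unitization"
definition sgn_unitization_def: "sgn x = inverse (norm x) *\<^sub>R x" for x :: "'a unitization"
definition uniformity_unitization_def:
  "(uniformity :: ('a unitization \<times> 'a unitization) filter) = (INF e\<in>{0 <..}. principal {(x, y). dist x y < e})"
definition open_unitization_def:
  "open U \<longleftrightarrow> (\<forall>x\<in>U. \<forall>\<^sub>F (x', y) in uniformity. x' = x \<longrightarrow> y \<in> U)" for U :: "'a unitization set"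

instance
proof
  fix x y :: "'a unitization" and r s :: real and U :: "'a unitization set"
  show "norm (x + y) \<le> norm x + norm y"
    using norm_triangle_ineq[of "alg_part x" "alg_part y"] norm_triangle_ineq[of "scalar_part x" "scalar_part y"]
    by (simp add: norm_unitization_def plus_unitization_def)
  show "norm (x * y) \<le> norm x * norm y"
  proof -
    have "norm (alg_part x * alg_part y + scalar_part x *\<^sub>C alg_part y + scalar_part y *\<^sub>C alg_part x)
        \<le> norm (alg_part x) * norm (alg_part y) + cmod (scalar_part x) * norm (alg_part y)
          + cmod (scalar_part y) * norm (alg_part x)"
      by (intro norm_triangle_le add_mono norm_mult_ineq) (simp_all add: norm_scaleC)
    thus ?thesis
      by (simp add: norm_unitization_def times_unitization_def norm_mult algebra_simps)
  qed
  show "norm x = 0 \<longleftrightarrow> x = 0"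
    by (cases x) (simp add: norm_unitization_def zero_unitization_def add_nonneg_eq_0_iff)
  show "norm (r *\<^sub>R x) = \<bar>r\<bar> * norm x"
    by (simp add: norm_unitization_def scaleR_unitization_def algebra_simps)
  show "r *\<^sub>R x * y = r *\<^sub>R (x * y)" "x * r *\<^sub>R y = r *\<^sub>R (x * y)"
    by (simp_all add: scaleR_unitization_def times_unitization_def scaleC_scaleR scaleR_right_distrib
        scaleC_scaleR_left del: scaleR_conv_of_real)
qed (auto simp: unitization_defs scaleR_unitization_def norm_unitization_def dist_unitization_def
    sgn_unitization_def uniformity_unitization_def open_unitization_def algebra_simps)

end

lemma alg_part_ops [simp]:
  "alg_part 0 = 0" "alg_part 1 = 0" "alg_part (x + y) = alg_part x + alg_part y"
  "alg_part (x - y) = alg_part x - alg_part y" "alg_part (- x) = - alg_part x"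
  by (simp_all add: unitization_defs)

lemma scalar_part_ops [simp]:
  "scalar_part 0 = 0" "scalar_part 1 = 1" "scalar_part (x + y) = scalar_part x + scalar_part y"
  "scalar_part (x - y) = scalar_part x - scalar_part y" "scalar_part (- x) = - scalar_part x"
  "scalar_part (x * y) = scalar_part x * scalar_part y"
  by (simp_all add: unitization_defs)

lemma alg_part_mult:
  "alg_part (x * y) = alg_part x * alg_part y + scalar_part x *\<^sub>C alg_part y + scalar_part y *\<^sub>C alg_part x"
  by (simp add: unitization_defs)

lemma unitization_eq_iff: "x = y \<longleftrightarrow> alg_part x = alg_part y \<and> scalar_part x = scalar_part y"
  by (cases x; cases y) simp

lemma bounded_linear_alg_part: "bounded_linear alg_part"
  by (rule bounded_linear_intro[where K = 1])
    (simp_all add: norm_unitization_def scaleR_unitization_def)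

lemma bounded_linear_scalar_part: "bounded_linear scalar_part"
  by (rule bounded_linear_intro[where K = 1])
    (simp_all add: norm_unitization_def scaleR_unitization_def)

lemma tendsto_Unitization:
  assumes "(f \<longlongrightarrow> a) F" "(g \<longlongrightarrow> c) F"
  shows "((\<lambda>n. Unitization (f n) (g n)) \<longlongrightarrow> Unitization a c) F"
proof -
  have "((\<lambda>n. norm (f n - a) + cmod (g n - c)) \<longlongrightarrow> 0 + 0) F"
    using assms by (intro tendsto_add) (simp_all add: LIM_zero tendsto_norm_zero)
  thus ?thesis
    by (simp add: tendsto_dist_iff[of _ "Unitization a c"] dist_norm norm_unitization_def
        minus_unitization_def)
qed

instance unitization :: (complex_banach_algebra) banach
proof
  fix X :: "nat \<Rightarrow> 'a unitization" assume X: "Cauchy X"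
  have "convergent (\<lambda>n. alg_part (X n))" "convergent (\<lambda>n. scalar_part (X n))"
    using bounded_linear.Cauchy[OF bounded_linear_alg_part X]
      bounded_linear.Cauchy[OF bounded_linear_scalar_part X]
    by (simp_all add: Cauchy_convergent_iff)
  then obtain a c where "(\<lambda>n. alg_part (X n)) \<longlonglongrightarrow> a" "(\<lambda>n. scalar_part (X n)) \<longlonglongrightarrow> c"
    unfolding convergent_def by blast
  from tendsto_Unitization[OF this] show "convergent X"
    by (auto simp: convergent_def)
qed

section \<open>Invertibility of matrices close to the identity\<close>

text \<open>The sum of the norms of the entries is submultiplicative, which is all that perturbation arguments need.\<close>

definition mnorm :: "'r::real_normed_vector mat \<Rightarrow> real" where
  "mnorm x = (\<Sum>i<dim_row x. \<Sum>j<dim_col x. norm (x $$ (i, j)))"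

lemma mnorm_nonneg: "0 \<le> mnorm x"
  by (simp add: mnorm_def sum_nonneg)

lemma norm_entry_le_mnorm:
  assumes "x \<in> carrier_mat n m" "i < n" "j < m"
  shows "norm (x $$ (i, j)) \<le> mnorm x"
proof -
  have "norm (x $$ (i, j)) \<le> (\<Sum>j<m. norm (x $$ (i, j)))"
    using assms by (intro member_le_sum[of j]) auto
  also have "\<dots> \<le> (\<Sum>i<n. \<Sum>j<m. norm (x $$ (i, j)))"
    using assms by (intro member_le_sum[of i "{..<n}" "\<lambda>i. \<Sum>j<m. norm (x $$ (i, j))"]) (auto intro: sum_nonneg)
  finally show ?thesis using assms by (simp add: mnorm_def)
qed

lemma mnorm_add_le:
  assumes "x \<in> carrier_mat n m" "y \<in> carrier_mat n m"
  shows "mnorm (x + y) \<le> mnorm x + mnorm y"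
  using assms by (auto simp: mnorm_def sum.distrib[symmetric] intro!: sum_mono norm_triangle_ineq)

lemma mnorm_mult_le:
  fixes x y :: "'r::{real_normed_algebra} mat"
  assumes x: "x \<in> carrier_mat n m" and y: "y \<in> carrier_mat m k"
  shows "mnorm (x * y) \<le> mnorm x * mnorm y"
proof -
  have row: "(\<Sum>j<k. norm (y $$ (l, j))) \<le> mnorm y" if "l < m" for l
    using y that by (auto simp: mnorm_def intro!: member_le_sum[of l "{..<m}" "\<lambda>i. \<Sum>j<k. norm (y $$ (i, j))"] sum_nonneg)
  have "mnorm (x * y) = (\<Sum>i<n. \<Sum>j<k. norm (\<Sum>l<m. x $$ (i, l) * y $$ (l, j)))"
    using x y by (simp add: mnorm_def mult_mat_entry[OF x y] del: index_mult_mat(1))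
  also have "\<dots> \<le> (\<Sum>i<n. \<Sum>j<k. \<Sum>l<m. norm (x $$ (i, l)) * norm (y $$ (l, j)))"
    by (intro sum_mono order_trans[OF norm_sum] norm_mult_ineq)
  also have "\<dots> = (\<Sum>i<n. \<Sum>l<m. norm (x $$ (i, l)) * (\<Sum>j<k. norm (y $$ (l, j))))"
    by (subst sum.swap) (simp add: sum_distrib_left)
  also have "\<dots> \<le> (\<Sum>i<n. \<Sum>l<m. norm (x $$ (i, l)) * mnorm y)"
    using row by (intro sum_mono mult_left_mono) auto
  also have "\<dots> = mnorm x * mnorm y"
    using x by (simp add: mnorm_def sum_distrib_right)
  finally show ?thesis .
qed

text \<open>The inverse is the Neumann series, summed entry by entry.\<close>

lemma neumann_inverse:
  fixes x :: "'r::{real_normed_algebra_1, banach} mat"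
  assumes x: "x \<in> carrier_mat n n" and small: "mnorm x < 1"
  shows "\<exists>y \<in> carrier_mat n n. (1\<^sub>m n - x) * y = 1\<^sub>m n \<and> y * (1\<^sub>m n - x) = 1\<^sub>m n"
proof -
  have pow: "x ^\<^sub>m k \<in> carrier_mat n n" for k using x by simp
  have bound: "norm ((x ^\<^sub>m k) $$ (i, j)) \<le> (mnorm (1\<^sub>m n :: 'r mat)) * mnorm x ^ k"
    if "i < n" "j < n" for i j k
  proof -
    have "mnorm (x ^\<^sub>m k) \<le> mnorm (1\<^sub>m n :: 'r mat) * mnorm x ^ k"
    proof (induction k)
      case 0 show ?case using x by simp
    next
      case (Suc k)
      have "mnorm (x ^\<^sub>m k * x) \<le> mnorm (x ^\<^sub>m k) * mnorm x" by (rule mnorm_mult_le[OF pow x])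
      also have "\<dots> \<le> (mnorm (1\<^sub>m n :: 'r mat) * mnorm x ^ k) * mnorm x"
        by (intro mult_right_mono Suc.IH mnorm_nonneg)
      finally show ?case by (simp add: mult_ac)
    qed
    thus ?thesis using norm_entry_le_mnorm[OF pow that] by (rule order_trans[rotated])
  qed
  have summ: "summable (\<lambda>k. (x ^\<^sub>m k) $$ (i, j))" if "i < n" "j < n" for i j
    using bound[OF that] small mnorm_nonneg[of x]
    by (intro summable_comparison_test[OF _ summable_mult[OF summable_geometric]] exI[of _ 0]) auto
  define y where "y = mat n n (\<lambda>(i, j). \<Sum>k. (x ^\<^sub>m k) $$ (i, j))"
  have y: "y \<in> carrier_mat n n" by (simp add: y_def)
  have comm: "x * x ^\<^sub>m k = x ^\<^sub>m k * x" for k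
  proof (induction k)
    case (Suc k)
    have "x * (x ^\<^sub>m k * x) = x * x ^\<^sub>m k * x" using assoc_mult_mat[OF x pow x] by simp
    thus ?case using Suc by simp
  qed (use x in simp)
  have step: "(\<Sum>k. (x ^\<^sub>m Suc k) $$ (i, j)) = y $$ (i, j) - 1\<^sub>m n $$ (i, j)" if "i < n" "j < n" for i j
    using suminf_split_head[OF summ[OF that]] that x by (simp add: y_def)
  have "(x * y) $$ (i, j) = y $$ (i, j) - 1\<^sub>m n $$ (i, j)" if ij: "i < n" "j < n" for i j
  proof -
    have "(x * y) $$ (i, j) = (\<Sum>l<n. \<Sum>k. x $$ (i, l) * (x ^\<^sub>m k) $$ (l, j))"
      using ij unfolding mult_mat_entry[OF x y ij]
      by (intro sum.cong) (simp_all add: y_def suminf_mult[OF summ])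
    also have "\<dots> = (\<Sum>k. \<Sum>l<n. x $$ (i, l) * (x ^\<^sub>m k) $$ (l, j))"
      using ij by (intro suminf_sum[symmetric] summable_mult summ) auto
    also have "\<dots> = (\<Sum>k. (x * x ^\<^sub>m k) $$ (i, j))"
      using ij by (simp add: mult_mat_entry[OF x pow] del: index_mult_mat(1))
    finally show ?thesis using step[OF ij] by (simp add: comm)
  qed
  moreover have "(y * x) $$ (i, j) = y $$ (i, j) - 1\<^sub>m n $$ (i, j)" if ij: "i < n" "j < n" for i j
  proof -
    have "(y * x) $$ (i, j) = (\<Sum>l<n. \<Sum>k. (x ^\<^sub>m k) $$ (i, l) * x $$ (l, j))"
      using ij unfolding mult_mat_entry[OF y x ij]
      by (intro sum.cong) (simp_all add: y_def suminf_mult2[OF summ])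
    also have "\<dots> = (\<Sum>k. \<Sum>l<n. (x ^\<^sub>m k) $$ (i, l) * x $$ (l, j))"
      using ij by (intro suminf_sum[symmetric] summable_mult2 summ) auto
    also have "\<dots> = (\<Sum>k. (x ^\<^sub>m k * x) $$ (i, j))"
      using ij by (simp add: mult_mat_entry[OF pow x] del: index_mult_mat(1))
    finally show ?thesis using step[OF ij] by simp
  qed
  moreover have "(1\<^sub>m n - x) * y = y - x * y" "y * (1\<^sub>m n - x) = y - y * x"
    using x y minus_mult_distrib_mat[of "1\<^sub>m n" n n x y n] mult_minus_distrib_mat[of y n n "1\<^sub>m n" n x]
    by simp_all
  ultimately show ?thesis
    using x y by (intro bexI[of _ y] conjI eq_matI) auto
qed

section \<open>Ring identities\<close>

text \<open>The inverse of \<open>1 + \<nu>\<close> is the geometric series, which stops because \<open>\<nu>\<^sup>3 = 0\<close>.\<close>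

lemma nilpotent_defect_invertible:
  fixes x z \<nu> :: "'e::ring_1"
  assumes "x * z = 1 + \<nu>" "\<nu> * \<nu> * \<nu> = 0"
  shows "x * (z * (1 - \<nu> + \<nu> * \<nu>)) = 1"
proof -
  have "x * (z * (1 - \<nu> + \<nu> * \<nu>)) = (1 + \<nu>) * (1 - \<nu> + \<nu> * \<nu>)"
    by (simp only: mult.assoc[symmetric] assms(1))
  thus ?thesis using assms(2) by (simp add: algebra_simps)
qed

lemma left_right_inverse_eq:
  fixes x y z :: "'e::ring_1"
  assumes "x * y = 1" "z * x = 1"
  shows "y = z"
  by (metis assms mult.assoc mult_1_left mult_1_right)

text \<open>With \<open>v = c e + (1 - c)(1 - e)\<close> one has \<open>v e = c e\<close>, and if \<open>v\<close> is invertible then \<open>v e v\<^sup>-\<^sup>1\<close> is an idempotent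
which differs from \<open>c\<close> only by a multiple of the defect \<open>c\<^sup>2 - c\<close>.  So an idempotent can be moved by
conjugation into any ideal coset that contains an approximation \<open>c\<close> of it with defect in the ideal.
The formula is exact, which replaces the functional calculus.\<close>

lemma conjugate_idempotent_left:
  fixes e c w :: "'e::ring_1"
  assumes e: "e * e = e" and w: "(c * e + (1 - c) * (1 - e)) * w = 1" 
  shows "(c * e + (1 - c) * (1 - e)) * e * w = c + (c * c - c) * ((1 - (e + e)) * w)"
proof -
  let ?v = "c * e + (1 - c) * (1 - e)"
  have "?v * e = c * e" using e by (simp add: algebra_simps)
  also have "\<dots> = c * ?v + (c * c - c) * (1 - (e + e))"
    by (simp add: algebra_simps)
  finally have "?v * e * w = c * (?v * w) + (c * c - c) * ((1 - (e + e)) * w)"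
    by (simp only: distrib_right mult.assoc)
  thus ?thesis using w by simp
qed

text \<open>The mirror image: here the defect is multiplied from the left.\<close>

lemma conjugate_idempotent_right:
  fixes e c w :: "'e::ring_1"
  assumes e: "e * e = e" and w: "w * (e * c + (1 - e) * (1 - c)) = 1" 
  shows "w * e * (e * c + (1 - e) * (1 - c)) = c + w * (1 - (e + e)) * (c * c - c)"
proof -
  let ?v = "e * c + (1 - e) * (1 - c)"
  have ee: "e * (e * z) = e * z" for z using e by (simp flip: mult.assoc)
  have "e * ?v = e * c" using e by (simp add: algebra_simps ee)
  also have "\<dots> = ?v * c + (1 - (e + e)) * (c * c - c)"
    by (simp add: algebra_simps)
  finally have "w * (e * ?v) = w * (?v * c) + w * ((1 - (e + e)) * (c * c - c))"
    using distrib_left by (metis (no_types))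
  thus ?thesis using w by (simp flip: mult.assoc)
qed

text \<open>The polynomial \<open>p(y) = 3 y\<^sup>2 - 2 y\<^sup>3\<close> fixes 0 and 1 with vanishing derivative there, so it replaces the
defect \<open>d = y\<^sup>2 - y\<close> by a multiple of \<open>d\<^sup>2\<close>.  Two applications kill a defect with \<open>d\<^sup>3 = 0\<close>.\<close>

lemma lift_idempotent_along_nilpotent:
  fixes x :: "'e::ring_1"
  assumes q: "(x * x - x) * (x * x - x) * (x * x - x) = 0"
  defines "p \<equiv> \<lambda>y::'e. y * y + y * y + y * y - y * y * y - y * y * y"
  shows "p (p x) * p (p x) = p (p x)"
proof -
  let ?k = "\<lambda>d::'e. d + d + d + d - 1 - 1 - 1"
  have defect: "p y * p y - p y = (y * y - y) * (y * y - y) * ?k (y * y - y)" for y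
    unfolding p_def by (simp add: algebra_simps)
  have nil: "(d * d * ?k d) * (d * d * ?k d) = 0" if "d * d * d = 0" for d
  proof -
    let ?a = "d * d"
    have a: "?a * ?a = 0" and d: "?a * d = 0" using that by (simp_all flip: mult.assoc)
    have "?a * ?k d = - (?a + ?a + ?a)"
      by (simp only: right_diff_distrib distrib_left d mult_1_right) simp
    thus ?thesis
      by (simp only: minus_mult_minus distrib_left distrib_right a add_0_left)
  qed
  have "p (p x) * p (p x) - p (p x) = 0"
    using defect[of "p x"] nil[OF q] by (simp only: defect[of x] mult_zero_left)
  thus ?thesis by simp
qed

text \<open>If \<open>x\<close> and \<open>y\<close> are partially inverse up to a factor invertible in the corners of \<open>e\<close> and \<open>f\<close>, then
rescaling \<open>y\<close> makes them an equivalence.\<close>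

lemma equivalence_from_approximate_inverses:
  fixes e f x y w w' :: "'e::ring_1"
  assumes e: "e * e = e" and f: "f * f = f"
    and x: "e * x = x" "x * f = x" and y: "f * y = y" "y * e = y"
    and u: "(x * y + 1 - e) * w = 1" and u': "w' * (y * x + 1 - f) = 1"
  shows "x * (y * w) = e" "y * w * x = f"
proof -
  have "e * ((x * y + 1 - e) * w) = x * y * w"
    using e x(1) by (simp add: algebra_simps flip: mult.assoc)
  thus 1: "x * (y * w) = e" using u by (simp add: mult.assoc)
  have "w' * (y * x + 1 - f) * f = w' * (y * x)"
    using f x(2) by (simp add: algebra_simps)
  hence fw: "w' * (y * x) = f" using u' by simp
  have "y * w * x = f * (y * w * x)" using y by (simp flip: mult.assoc)
  also have "\<dots> = w' * (y * (x * (y * w)) * x)" by (simp add: fw[symmetric] mult.assoc)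
  also have "\<dots> = f" using y 1 fw by simp
  finally show "y * w * x = f" .
qed

section \<open>Hereditarily dense morphisms\<close>

text \<open>The hypotheses under which \<open>\<psi>\<close> is an isomorphism in K-theory.  The set \<open>I\<close> is an ideal in the algebraic sense, in the
application the one generated by the sections with compact support.\<close>

locale hereditary_morphism =
  fixes \<psi> :: "'a::complex_banach_algebra \<Rightarrow> 'b::complex_banach_algebra" and I :: "'a set"
  assumes hom: "banach_algebra_hom \<psi>"
    and ideal_add: "x \<in> I \<Longrightarrow> y \<in> I \<Longrightarrow> x + y \<in> I"
    and ideal_scaleC: "x \<in> I \<Longrightarrow> c *\<^sub>C x \<in> I"
    and ideal_left: "x \<in> I \<Longrightarrow> a * x \<in> I"
    and ideal_right: "x \<in> I \<Longrightarrow> x * a \<in> I"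
    and ideal_dense: "closure I = UNIV"
    and range_dense: "closure (range \<psi>) = UNIV"
    and sandwich_bounded: "x \<in> I \<Longrightarrow> y \<in> I \<Longrightarrow> \<exists>M. \<forall>a. norm (x * a * y) \<le> M * norm (\<psi> a)"
begin

lemma bounded_linear_\<psi>: "bounded_linear \<psi>"
  and \<psi>_scaleC: "\<psi> (c *\<^sub>C x) = c *\<^sub>C \<psi> x"
  and \<psi>_mult: "\<psi> (x * y) = \<psi> x * \<psi> y"
  using hom unfolding banach_algebra_hom_def by blast+

interpretation \<psi>: bounded_linear \<psi> by (rule bounded_linear_\<psi>)

lemma ideal_zero: "0 \<in> I"
proof -
  obtain x where "x \<in> I" using ideal_dense by fastforce
  from ideal_scaleC[OF this, of 0] show ?thesis by (simp add: scaleC_zero_left)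
qed

lemma ideal_uminus: "x \<in> I \<Longrightarrow> - x \<in> I"
  using ideal_scaleC[of x "-1"] by (simp add: scaleC_minus_one)

lemma ideal_sum: "(\<And>i. i \<in> S \<Longrightarrow> f i \<in> I) \<Longrightarrow> sum f S \<in> I"
  by (induction S rule: infinite_finite_induct) (auto intro: ideal_add ideal_zero)

lemma ideal_image_dense: "0 < \<epsilon> \<Longrightarrow> \<exists>x \<in> I. norm (\<psi> x - b) < \<epsilon>"
proof -
  assume e: "0 < \<epsilon>"
  have "\<psi> ` closure I \<subseteq> closure (\<psi> ` I)"
    by (rule image_closure_subset[OF \<psi>.continuous_on[OF continuous_on_id] closed_closure closure_subset])
  hence "closure (range \<psi>) \<subseteq> closure (\<psi> ` I)"
    using ideal_dense by (simp add: closure_minimal)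
  hence "b \<in> closure (\<psi> ` I)" using range_dense by auto
  thus ?thesis using e by (auto simp: closure_approachable dist_norm)
qed

text \<open>If \<open>\<psi> a\<^sub>n\<close> converges to \<open>b\<close>, then the estimate makes \<open>x * a\<^sub>n * y\<close> a Cauchy sequence, and its limit is a
preimage.\<close>

lemma sandwich_in_range:
  assumes x: "x \<in> I" and y: "y \<in> I"
  shows "\<psi> x * b * \<psi> y \<in> range \<psi>"
proof -
  obtain M where M: "norm (x * a * y) \<le> M * norm (\<psi> a)" for a
    using sandwich_bounded[OF x y] by blast
  have "b \<in> closure (range \<psi>)" using range_dense by simp
  then obtain c where c: "\<And>n. c n \<in> range \<psi>" "c \<longlonglongrightarrow> b"
    unfolding closure_sequential by blast
  from c(1) have "\<forall>n. \<exists>a. c n = \<psi> a" by blast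
  then obtain a where "\<And>n. c n = \<psi> (a n)" by metis
  hence a: "(\<lambda>n. \<psi> (a n)) \<longlonglongrightarrow> b" using c(2) by presburger
  have "Cauchy (\<lambda>n. x * a n * y)"
  proof (rule metric_CauchyI)
    fix e :: real assume e: "0 < e"
    have M1: "norm (x * a * y) \<le> (\<bar>M\<bar> + 1) * norm (\<psi> a)" for a
      by (rule order_trans[OF M mult_right_mono]) auto
    have "Cauchy (\<lambda>n. \<psi> (a n))" using a by (rule LIMSEQ_imp_Cauchy)
    moreover have "0 < e / (\<bar>M\<bar> + 1)" using e by (simp add: add_nonneg_pos)
    ultimately obtain N where N: "\<And>m n. m \<ge> N \<Longrightarrow> n \<ge> N \<Longrightarrow> norm (\<psi> (a m) - \<psi> (a n)) < e / (\<bar>M\<bar> + 1)"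
      using CauchyD by blast
    show "\<exists>N. \<forall>m\<ge>N. \<forall>n\<ge>N. dist (x * a m * y) (x * a n * y) < e"
    proof (intro exI[of _ N] allI impI)
      fix m n assume mn: "m \<ge> N" "n \<ge> N"
      have "dist (x * a m * y) (x * a n * y) = norm (x * (a m - a n) * y)"
        by (simp add: dist_norm algebra_simps)
      also have "\<dots> \<le> (\<bar>M\<bar> + 1) * norm (\<psi> (a m) - \<psi> (a n))"
        using M1[of "a m - a n"] by (simp add: \<psi>.diff)
      also have "\<dots> < e"
        using N[OF mn] by (simp add: pos_less_divide_eq mult.commute add_pos_nonneg add.commute)
      finally show "dist (x * a m * y) (x * a n * y) < e" .
    qed
  qed
  then obtain t where t: "(\<lambda>n. x * a n * y) \<longlonglongrightarrow> t" unfolding Cauchy_convergent_iff convergent_def by blast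
  have "(\<lambda>n. \<psi> (x * a n * y)) \<longlonglongrightarrow> \<psi> t" by (rule \<psi>.tendsto[OF t])
  moreover have "(\<lambda>n. \<psi> (x * a n * y)) \<longlonglongrightarrow> \<psi> x * b * \<psi> y"
    unfolding \<psi>_mult by (intro tendsto_intros a)
  ultimately show ?thesis using LIMSEQ_unique by blast
qed

text \<open>For \<open>u\<close> and \<open>w\<close> in \<open>I\<close> this is the estimate with right hand side zero; the general case follows because \<open>I\<close>
is dense.\<close>

lemma kernel_annihilates:
  assumes v: "\<psi> v = 0"
  shows "u * v * w = 0"
proof -
  have I0: "x * v * y = 0" if xy: "x \<in> I" "y \<in> I" for x y
  proof -
    obtain M where "norm (x * v * y) \<le> M * norm (\<psi> v)" using sandwich_bounded[OF xy] by blast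
    thus ?thesis using v by simp
  qed
  have "closure I \<subseteq> {x. x * v * y = 0}" if "y \<in> I" for y
    using I0 that by (intro closure_minimal closed_Collect_eq continuous_intros) auto
  hence "closure I \<subseteq> {y. x * v * y = 0}" for x
    using ideal_dense by (intro closure_minimal closed_Collect_eq continuous_intros) auto
  thus ?thesis using ideal_dense by auto
qed

abbreviation \<Phi> :: "'a unitization \<Rightarrow> 'b unitization" where "\<Phi> \<equiv> map_unitization \<psi>"

lemma alg_part_\<Phi> [simp]: "alg_part (\<Phi> x) = \<psi> (alg_part x)"
  and scalar_part_\<Phi> [simp]: "scalar_part (\<Phi> x) = scalar_part x"
  by (cases x; simp)+

lemma \<Phi>_hom:
  "\<Phi> 0 = 0" "\<Phi> 1 = 1" "\<Phi> (x + y) = \<Phi> x + \<Phi> y" "\<Phi> (x - y) = \<Phi> x - \<Phi> y" "\<Phi> (x * y) = \<Phi> x * \<Phi> y"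
  by (simp_all add: unitization_eq_iff alg_part_mult \<psi>.zero \<psi>.add \<psi>.diff \<psi>_mult \<psi>_scaleC)

lemma range_\<Phi>: "b \<in> range \<Phi> \<longleftrightarrow> alg_part b \<in> range \<psi>"
proof
  assume "alg_part b \<in> range \<psi>"
  then obtain a where "alg_part b = \<psi> a" by blast
  hence "b = \<Phi> (Unitization a (scalar_part b))" by (simp add: unitization_eq_iff)
  thus "b \<in> range \<Phi>" by blast
qed auto

lemma sum_in_range_\<Phi>: "(\<And>i. i \<in> S \<Longrightarrow> f i \<in> range \<Phi>) \<Longrightarrow> sum f S \<in> range \<Phi>"
proof (induction S rule: infinite_finite_induct)
  case (insert x F)
  then obtain a b where "f x = \<Phi> a" "sum f F = \<Phi> b" by blast
  hence "sum f (insert x F) = \<Phi> (a + b)" using insert.hyps by (simp add: \<Phi>_hom)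
  thus ?case by blast
qed (use \<Phi>_hom(1) in \<open>auto simp: range_\<Phi> \<psi>.zero intro: rev_image_eqI[of 0]\<close>)

end

section \<open>Matrices over the unitization of the ideal\<close>

lemma square_closed:
  "x \<in> carrier_mat n n \<Longrightarrow> y \<in> carrier_mat n n \<Longrightarrow> x * y \<in> carrier_mat n n"
  "x \<in> carrier_mat n n \<Longrightarrow> y \<in> carrier_mat n n \<Longrightarrow> x + y \<in> carrier_mat n n"
  "x \<in> carrier_mat n n \<Longrightarrow> y \<in> carrier_mat n n \<Longrightarrow> x - y \<in> carrier_mat n n"
  by auto

lemma mnorm_minus_commute:
  assumes "x \<in> carrier_mat n m" "y \<in> carrier_mat n m"
  shows "mnorm (x - y) = mnorm (y - x)"
  using assms by (simp add: mnorm_def norm_minus_commute)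

lemma mnorm_diff_triangle:
  assumes "x \<in> carrier_mat n m" "y \<in> carrier_mat n m" "z \<in> carrier_mat n m"
  shows "mnorm (x - z) \<le> mnorm (x - y) + mnorm (y - z)"
proof -
  have "x - z = (x - y) + (y - z)" using assms by (intro eq_matI) auto
  thus ?thesis using mnorm_add_le[of "x - y" n m "y - z"] assms minus_carrier_mat by metis
qed

text \<open>Both elements are of the form \<open>1 - (c - e)(1 - 2e)\<close>, up to the order of the factors, hence close to 1.\<close>

lemma conjugator_invertible:
  fixes e c :: "'r::{real_normed_algebra_1, banach} mat"
  assumes e: "e \<in> carrier_mat n n" and c: "c \<in> carrier_mat n n" and n: "0 < n"
    and idem: "e * e = e"
    and small: "mnorm (c - e) * mnorm (1\<^sub>m n - (e + e)) < 1"
  shows "\<exists>w \<in> carrier_mat n n. (c * e + (1\<^sub>m n - c) * (1\<^sub>m n - e)) * w = 1\<^sub>m n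
      \<and> w * (c * e + (1\<^sub>m n - c) * (1\<^sub>m n - e)) = 1\<^sub>m n" (is ?L)
    and "\<exists>w \<in> carrier_mat n n. (e * c + (1\<^sub>m n - e) * (1\<^sub>m n - c)) * w = 1\<^sub>m n
      \<and> w * (e * c + (1\<^sub>m n - e) * (1\<^sub>m n - c)) = 1\<^sub>m n" (is ?R)
proof -
  note [simp] = square_closed block_endo_hom n e c
  let ?s = "1\<^sub>m n - (e + e)"
  have idem': "block_endo n e * block_endo n e = block_endo n e"
    using block_endo_mult[OF e e n] idem by simp
  have L: "c * e + (1\<^sub>m n - c) * (1\<^sub>m n - e) = 1\<^sub>m n - (c - e) * ?s"
    by (rule block_endo_inj[OF _ _ n]) (simp_all add: algebra_simps idem' del: minus_mult_distrib_mat)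
  have R: "e * c + (1\<^sub>m n - e) * (1\<^sub>m n - c) = 1\<^sub>m n - ?s * (c - e)"
    by (rule block_endo_inj[OF _ _ n]) (simp_all add: algebra_simps idem')
  have "mnorm ((c - e) * ?s) \<le> mnorm (c - e) * mnorm ?s" "mnorm (?s * (c - e)) \<le> mnorm ?s * mnorm (c - e)"
    by (rule mnorm_mult_le[where m = n and n = n and k = n]; simp)+
  hence "mnorm ((c - e) * ?s) < 1" "mnorm (?s * (c - e)) < 1" using small by (simp_all add: mult.commute)
  thus ?L ?R unfolding L R
    by (intro neumann_inverse; simp)+
qed

text \<open>The algebraic core of surjectivity on \<open>K\<^sub>0\<close>.  Here \<open>E\<close> is the ring of matrices over the target, \<open>P\<close> the
image of the source and \<open>X\<close> the image of the ideal; \<open>X\<close> absorbs elements of \<open>P\<close>, but products from \<open>X E X\<close>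
only lie in \<open>P\<close>.  The idempotent \<open>f\<close> differs from \<open>c \<in> P\<close> by an element of \<open>E X\<close>.  Conjugating \<open>f\<close> towards
\<open>c' \<in> P\<close> from the other side multiplies the defect \<open>c'\<^sup>2 - c' \<in> X\<close> by \<open>(1 - 2f) w\<close> from the right, and the
claim is that this product is again in \<open>P\<close>.\<close>

lemma two_step_sandwich:
  fixes E P X :: "'e::ring_1 set"
  assumes E: "1 \<in> E" "\<And>a b. a \<in> E \<Longrightarrow> b \<in> E \<Longrightarrow> a + b \<in> E \<and> a - b \<in> E \<and> a * b \<in> E"
    and P: "1 \<in> P" "\<And>a b. a \<in> P \<Longrightarrow> b \<in> P \<Longrightarrow> a + b \<in> P \<and> a - b \<in> P \<and> a * b \<in> P"
    and sub: "X \<subseteq> P" "P \<subseteq> E"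
    and X: "\<And>x p. x \<in> X \<Longrightarrow> p \<in> P \<Longrightarrow> x * p \<in> X"
    and sandwich: "\<And>x b y. x \<in> X \<Longrightarrow> b \<in> E \<Longrightarrow> y \<in> X \<Longrightarrow> x * b * y \<in> P"
    and c: "c \<in> P" "c' \<in> P" "c' - c \<in> X" "c * c - c \<in> X" "c' * c' - c' \<in> X"
    and uw: "u \<in> E" "w \<in> E" and f: "f = c + u * (c * c - c)" "f * f = f"
    and w: "w * (c' * f + (1 - c') * (1 - f)) = 1"
  shows "c' + (c' * c' - c') * ((1 - (f + f)) * w) \<in> P"
proof -
  \<comment> \<open>\<open>D\<close> collects the elements that pull \<open>X E\<close> back into \<open>P\<close> when multiplied from the right.  It is a left ideal
of \<open>E\<close> that contains \<open>X\<close>, hence \<open>f - c\<close>.\<close>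
  define D where "D = {d \<in> E. \<forall>x \<in> X. \<forall>b \<in> E. x * b * d \<in> P}"
  have D_add: "a + b \<in> D" "a - b \<in> D" if "a \<in> D" "b \<in> D" for a b
    using that E P by (auto simp: D_def distrib_left right_diff_distrib)
  have D_left: "a * b \<in> D" if "a \<in> E" "b \<in> D" for a b
    using that E by (auto simp: D_def) (metis mult.assoc)
  have D_right: "a * p \<in> D" if "a \<in> D" "p \<in> P" for a p
    using that E P sub by (auto simp: D_def mult.assoc[symmetric])
  have XD: "x \<in> D" if "x \<in> X" for x using that sub sandwich by (auto simp: D_def)
  have DE: "a \<in> E" if "a \<in> D" for a using that by (simp add: D_def)
  define r where "r = c * c - c"
  have ur: "u * r \<in> D" using uw c by (intro D_left XD) (simp_all add: r_def)
  define d where "d = (c' - f) * (1 - (f + f))"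
  have cf: "c' - f \<in> D" using D_add(2)[OF XD[OF c(3)] ur] by (simp add: f r_def algebra_simps)
  have split: "1 - (f + f) = (1 - (c + c)) - (u * r + u * r)"
    by (simp add: f(1) r_def)
  have "(c' - f) * (1 - (c + c)) \<in> D" using cf P c by (intro D_right) auto
  moreover have "(c' - f) * (u * r + u * r) \<in> D" by (rule D_left[OF DE[OF cf] D_add(1)[OF ur ur]])
  ultimately have d: "d \<in> D" unfolding d_def split right_diff_distrib by (rule D_add)
  have v: "c' * f + (1 - c') * (1 - f) = 1 - d"
    unfolding d_def using f(2) by (simp add: algebra_simps)
  have "w * (1 - d) = 1" using w by (simp only: v)
  \<comment> \<open>The inverse \<open>w\<close> of \<open>1 - d\<close> is 1 plus an element of \<open>D\<close>.\<close>
  hence wd: "w = 1 + w * d" by (simp add: algebra_simps)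
  have r': "(c' * c' - c') * (1 - (c + c)) \<in> P" using c P sub by (metis subsetD)
  have r'': "(c' * c' - c') * 1 * (u * r + u * r) \<in> P" 
    using D_add(1)[OF ur ur] c(5) E(1) unfolding D_def by blast
  have sE: "1 - (f + f) \<in> E" using E P sub c DE[OF ur] by (simp add: split subset_iff)
  hence "(c' * c' - c') * ((1 - (f + f)) * w) * d \<in> P"
    using d c(5) E(2)[OF sE uw(2)] unfolding D_def by blast
  moreover have "(c' * c' - c') * (1 - (f + f)) \<in> P"
    using r' r'' P by (simp add: split right_diff_distrib)
  moreover have "(c' * c' - c') * ((1 - (f + f)) * w)
      = (c' * c' - c') * (1 - (f + f)) + (c' * c' - c') * ((1 - (f + f)) * w) * d"
    by (subst wd) (simp add: distrib_left mult.assoc)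
  ultimately have "(c' * c' - c') * ((1 - (f + f)) * w) \<in> P" using P(2) by metis
  thus ?thesis using P(2) c(2) by blast
qed

lemma (in ring_hom) mat_hom_square:
  "x \<in> carrier_mat n n \<Longrightarrow> y \<in> carrier_mat n n \<Longrightarrow> map_mat hom (x + y) = map_mat hom x + map_mat hom y"
  "x \<in> carrier_mat n n \<Longrightarrow> y \<in> carrier_mat n n \<Longrightarrow> map_mat hom (x - y) = map_mat hom x - map_mat hom y"
  "x \<in> carrier_mat n n \<Longrightarrow> y \<in> carrier_mat n n \<Longrightarrow> map_mat hom (x * y) = map_mat hom x * map_mat hom y"
  "map_mat hom (1\<^sub>m n) = 1\<^sub>m n"
  using mat_hom_mult[of x n n y n] mat_hom_one[of n]
  by (auto intro!: eq_matI simp: hom_minus hom_add)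

lemma alg_part_sum: "alg_part (sum f S) = (\<Sum>i\<in>S. alg_part (f i))"
  by (rule linear_sum[OF bounded_linear.linear[OF bounded_linear_alg_part]])

lemma ring_hom_scalar_part: "Ring_Hom.ring_hom (scalar_part :: 'a::complex_banach_algebra unitization \<Rightarrow> complex)"
  by unfold_locales auto

abbreviation scalar_mat :: "'a unitization mat \<Rightarrow> complex mat" where
  "scalar_mat \<equiv> map_mat scalar_part"

lemmas scalar_mat_square = ring_hom.mat_hom_square[OF ring_hom_scalar_part]

context hereditary_morphism
begin

lemma ring_hom_\<Phi>: "Ring_Hom.ring_hom \<Phi>"
  by unfold_locales (auto simp: \<Phi>_hom)

lemma norm_\<Phi>_le: "\<exists>K>0. \<forall>x. norm (\<Phi> x) \<le> K * norm x"
proof -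
  obtain K where K: "\<And>x. norm (\<psi> x) \<le> norm x * K" "0 < K"
    using bounded_linear.pos_bounded[OF bounded_linear_\<psi>] by blast
  have "norm (\<Phi> x) \<le> (K + 1) * norm x" for x
  proof -
    have "norm (\<psi> (alg_part x)) \<le> (K + 1) * norm (alg_part x)"
      "cmod (scalar_part x) \<le> (K + 1) * cmod (scalar_part x)"
      using K(1)[of "alg_part x"] K(2) by (simp_all add: algebra_simps add_increasing)
    thus ?thesis by (simp add: norm_unitization_def distrib_left)
  qed
  thus ?thesis using K(2) by (intro exI[of _ "K + 1"]) auto
qed

abbreviation M\<Phi> :: "'a unitization mat \<Rightarrow> 'b unitization mat" where
  "M\<Phi> \<equiv> map_mat \<Phi>"

lemmas M\<Phi>_square = ring_hom.mat_hom_square[OF ring_hom_\<Phi>]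

lemma scalar_mat_M\<Phi> [simp]: "scalar_mat (M\<Phi> x) = scalar_mat x"
  by (auto intro!: eq_matI)

text \<open>Matrices over the unitization of \<open>I\<close>, viewed inside the unitization of the whole algebra.\<close>

definition ideal_unit_mats :: "nat \<Rightarrow> 'a unitization mat set" where
  "ideal_unit_mats n = {x \<in> carrier_mat n n. \<forall>i<n. \<forall>j<n. alg_part (x $$ (i, j)) \<in> I}"

definition ideal_mats :: "nat \<Rightarrow> 'a unitization mat set" where
  "ideal_mats n = {x \<in> ideal_unit_mats n. scalar_mat x = 0\<^sub>m n n}"

lemma ideal_unit_mats_carrier: "x \<in> ideal_unit_mats n \<Longrightarrow> x \<in> carrier_mat n n"
  by (simp add: ideal_unit_mats_def)

lemma ideal_mats_carrier: "x \<in> ideal_mats n \<Longrightarrow> x \<in> carrier_mat n n"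
  by (simp add: ideal_mats_def ideal_unit_mats_def)

lemma ideal_minus: "x \<in> I \<Longrightarrow> y \<in> I \<Longrightarrow> x - y \<in> I"
  using ideal_add[OF _ ideal_uminus, of x y] by simp

lemma ideal_unit_mats_ops:
  assumes "x \<in> ideal_unit_mats n" "y \<in> ideal_unit_mats n"
  shows "x + y \<in> ideal_unit_mats n" "x - y \<in> ideal_unit_mats n" "x * y \<in> ideal_unit_mats n"
proof -
  show "x + y \<in> ideal_unit_mats n" "x - y \<in> ideal_unit_mats n"
    using assms by (auto simp: ideal_unit_mats_def intro!: ideal_add ideal_minus)
  show "x * y \<in> ideal_unit_mats n"
    using assms unfolding ideal_unit_mats_def
    by (auto simp: mult_mat_entry[of x n n y n] alg_part_sum alg_part_mult simp del: index_mult_mat(1)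
        intro!: ideal_sum ideal_add ideal_scaleC ideal_left)
qed

lemma one_ideal_unit_mats: "1\<^sub>m n \<in> ideal_unit_mats n"
  by (auto simp: ideal_unit_mats_def ideal_zero)

lemma ideal_matsI: "x \<in> ideal_unit_mats n \<Longrightarrow> scalar_mat x = 0\<^sub>m n n \<Longrightarrow> x \<in> ideal_mats n"
  by (simp add: ideal_mats_def)

lemma ideal_matsD:
  assumes "x \<in> ideal_mats n" "i < n" "j < n"
  shows "alg_part (x $$ (i, j)) \<in> I" "scalar_part (x $$ (i, j)) = 0"
proof -
  have x: "x \<in> carrier_mat n n" "scalar_mat x = 0\<^sub>m n n"
    using assms by (simp_all add: ideal_mats_def ideal_unit_mats_def)
  show "scalar_part (x $$ (i, j)) = 0"
    using arg_cong[OF x(2), of "\<lambda>m. m $$ (i, j)"] x(1) assms by simp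
  show "alg_part (x $$ (i, j)) \<in> I"
    using assms by (simp add: ideal_mats_def ideal_unit_mats_def)
qed

lemma ideal_matsI_entries:
  assumes "x \<in> carrier_mat n n"
    and "\<And>i j. i < n \<Longrightarrow> j < n \<Longrightarrow> alg_part (x $$ (i, j)) \<in> I \<and> scalar_part (x $$ (i, j)) = 0"
  shows "x \<in> ideal_mats n"
  using assms by (auto simp: ideal_mats_def ideal_unit_mats_def intro!: eq_matI)

lemma scalar_part_sum: "scalar_part (sum f S) = (\<Sum>i\<in>S. scalar_part (f i))"
  by (rule linear_sum[OF bounded_linear.linear[OF bounded_linear_scalar_part]])

lemma ideal_mats_mult:
  assumes x: "x \<in> ideal_mats n" and y: "y \<in> carrier_mat n n"
  shows "x * y \<in> ideal_mats n" "y * x \<in> ideal_mats n"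
proof -
  note xy = y ideal_mats_carrier[OF x] ideal_matsD[OF x]
  note entry = mult_mat_entry[of _ n n _ n] alg_part_sum scalar_part_sum alg_part_mult scaleC_zero_left
  show "x * y \<in> ideal_mats n"
    using xy by (auto simp: entry simp del: index_mult_mat(1)
      intro!: ideal_matsI_entries ideal_sum ideal_add ideal_scaleC ideal_right sum.neutral)
  show "y * x \<in> ideal_mats n"
    using xy by (auto simp: entry simp del: index_mult_mat(1)
      intro!: ideal_matsI_entries ideal_sum ideal_add ideal_scaleC ideal_left sum.neutral)
qed

text \<open>Only the algebra part has to be approximated, so that the scalar part can be kept exactly.  The map \<open>L\<close>
is \<open>\<psi>\<close> or the identity.\<close>

lemma ideal_unit_mats_approx:
  fixes L :: "'a \<Rightarrow> 'c::complex_banach_algebra"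
  assumes dense: "\<And>b \<epsilon>. 0 < \<epsilon> \<Longrightarrow> \<exists>x \<in> I. norm (L x - b) < \<epsilon>"
    and y: "y \<in> carrier_mat n n" and e: "0 < \<epsilon>"
  shows "\<exists>c \<in> ideal_unit_mats n. scalar_mat c = scalar_mat y \<and> mnorm (map_mat (map_unitization L) c - y) < \<epsilon>"
proof -
  define \<delta> where "\<delta> = \<epsilon> / (real (n * n) + 1)"
  have d: "0 < \<delta>" using e by (simp add: \<delta>_def add_nonneg_pos)
  obtain h where h: "\<And>b. h b \<in> I" "\<And>b. norm (L (h b) - b) < \<delta>"
    using dense[OF d] by metis
  define c where "c = mat n n (\<lambda>ij. Unitization (h (alg_part (y $$ ij))) (scalar_part (y $$ ij)))"
  have "c \<in> ideal_unit_mats n" by (simp add: c_def ideal_unit_mats_def h)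
  moreover have "scalar_mat c = scalar_mat y" using y by (auto simp: c_def intro!: eq_matI)
  moreover have "mnorm (map_mat (map_unitization L) c - y) < \<epsilon>"
  proof -
    let ?d = "map_mat (map_unitization L) c - y"
    have "norm (?d $$ (i, j)) \<le> \<delta>" if "i < n" "j < n" for i j
      using y that h(2) by (simp add: c_def norm_unitization_def less_imp_le)
    moreover have "dim_row ?d = n" "dim_col ?d = n" using y by auto
    ultimately have "mnorm ?d \<le> (\<Sum>i<n. \<Sum>j<n. \<delta>)"
      unfolding mnorm_def by (simp only:) (intro sum_mono, simp)
    also have "\<dots> = real (n * n) * \<delta>" by simp
    also have "\<dots> < (real (n * n) + 1) * \<delta>" using d by (intro mult_strict_right_mono) auto
    also have "\<dots> = \<epsilon>" using add_nonneg_pos[of "real (n * n)" 1] unfolding \<delta>_def by simp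
    finally show ?thesis .
  qed
  ultimately show ?thesis by blast
qed

lemma approx_image:
  "y \<in> carrier_mat n n \<Longrightarrow> 0 < \<epsilon>
    \<Longrightarrow> \<exists>c \<in> ideal_unit_mats n. scalar_mat c = scalar_mat y \<and> mnorm (M\<Phi> c - y) < \<epsilon>"
  by (rule ideal_unit_mats_approx[OF ideal_image_dense])

lemma approx_domain:
  assumes "y \<in> carrier_mat n n" "0 < \<epsilon>"
  shows "\<exists>c \<in> ideal_unit_mats n. scalar_mat c = scalar_mat y \<and> mnorm (c - y) < \<epsilon>"
proof -
  have "\<exists>x \<in> I. norm (id x - b) < e" if "0 < e" for b e
    using closure_approachable[of b I] ideal_dense that by (auto simp: dist_norm)
  moreover have "map_mat (map_unitization id) c = c" for c :: "'a unitization mat"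
    by (auto intro!: eq_matI simp: unitization.map_id)
  ultimately show ?thesis using ideal_unit_mats_approx[of id, OF _ assms] by simp
qed

lemma sandwich_mats:
  assumes x: "x \<in> ideal_mats n" and b: "b \<in> carrier_mat n n" and y: "y \<in> ideal_mats n"
  shows "M\<Phi> x * b * M\<Phi> y \<in> M\<Phi> ` carrier_mat n n"
proof -
  note c = ideal_mats_carrier[OF x] ideal_mats_carrier[OF y] b
  have "\<Phi> (x $$ (i, k)) * (b $$ (k, l) * \<Phi> (y $$ (l, j))) \<in> range \<Phi>" if "i < n" "k < n" "l < n" "j < n" for i k l j
  proof -
    let ?u = "alg_part (x $$ (i, k))" and ?v = "alg_part (y $$ (l, j))"
    have u: "?u \<in> I" "scalar_part (x $$ (i, k)) = 0" and v: "?v \<in> I" "scalar_part (y $$ (l, j)) = 0"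
      using ideal_matsD[OF x, of i k] ideal_matsD[OF y, of l j] that by auto
    obtain t where t: "\<psi> ?u * alg_part (b $$ (k, l)) * \<psi> ?v = \<psi> t"
      using sandwich_in_range[OF u(1) v(1)] by blast
    have "alg_part (\<Phi> (x $$ (i, k)) * b $$ (k, l) * \<Phi> (y $$ (l, j)))
        = \<psi> (t + scalar_part (b $$ (k, l)) *\<^sub>C (?u * ?v))"
      using u v by (simp add: alg_part_mult scaleC_zero_left t \<psi>_scaleC \<psi>_mult distrib_right mult_scaleC_left
          linear_add[OF bounded_linear.linear[OF bounded_linear_\<psi>]])
    thus ?thesis unfolding range_\<Phi> mult.assoc[symmetric] by blast
  qed
  hence entry: "(M\<Phi> x * b * M\<Phi> y) $$ (i, j) \<in> range \<Phi>" if "i < n" "j < n" for i j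
    using c that
    by (auto simp: mult_mat_entry[of _ n n _ n] sum_distrib_left simp del: index_mult_mat(1)
        intro!: sum_in_range_\<Phi>)
  define m where "m = M\<Phi> x * b * M\<Phi> y"
  have m: "m \<in> carrier_mat n n" using c by (simp add: m_def)
  have "\<exists>a. i < n \<longrightarrow> j < n \<longrightarrow> m $$ (i, j) = \<Phi> a" for i j
    using entry[of i j] unfolding m_def by blast
  then obtain g where g: "\<And>i j. i < n \<Longrightarrow> j < n \<Longrightarrow> m $$ (i, j) = \<Phi> (g i j)" by metis
  have "m = M\<Phi> (mat n n (\<lambda>(i, j). g i j))"
    using m by (intro eq_matI) (simp_all add: g)
  hence "M\<Phi> x * b * M\<Phi> y = M\<Phi> (mat n n (\<lambda>(i, j). g i j))" by (simp only: m_def)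
  thus ?thesis by auto
qed

lemma kernel_mats_nilpotent:
  assumes v: "v \<in> carrier_mat n n" and ker: "M\<Phi> v = 0\<^sub>m n n"
  shows "v * v * v = 0\<^sub>m n n"
proof (rule eq_matI)
  fix i j assume "i < dim_row (0\<^sub>m n n :: 'a unitization mat)" "j < dim_col (0\<^sub>m n n :: 'a unitization mat)"
  hence ij: "i < n" "j < n" by auto
  have k: "\<Phi> (v $$ (i, j)) = 0" if "i < n" "j < n" for i j
    using arg_cong[OF ker, of "\<lambda>m. m $$ (i, j)"] v that by simp
  have "a * (b * c) = 0" if "\<Phi> a = 0" "\<Phi> b = 0" "\<Phi> c = 0" for a b c
    using that kernel_annihilates[of "alg_part b" "alg_part a" "alg_part c"]
    by (simp add: unitization_eq_iff alg_part_mult scaleC_zero_left mult.assoc)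
  thus "(v * v * v) $$ (i, j) = 0\<^sub>m n n $$ (i, j)"
    using v ij k by (auto simp: mult_mat_entry[of _ n n _ n] sum_distrib_left simp del: index_mult_mat(1)
        intro!: sum.neutral)
qed (use v in auto)

text \<open>Write \<open>x = 1 + a\<close> with \<open>a\<close> over \<open>I\<close>.  The inverse \<open>w\<close> of the image satisfies \<open>w = 1 - \<psi> a + \<psi> a * w * \<psi> a\<close>, so by
the sandwich property it is itself an image, of some \<open>z\<close>.  Then \<open>x z - 1\<close> and \<open>z x - 1\<close> are in the kernel
and therefore nilpotent, and \<open>z\<close> can be corrected to an inverse of \<open>x\<close>.\<close>

lemma invertible_of_image_invertible:
  assumes x: "x \<in> ideal_unit_mats n" and sx: "scalar_mat x = 1\<^sub>m n" and n: "0 < n"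
    and w: "w \<in> carrier_mat n n" "M\<Phi> x * w = 1\<^sub>m n" "w * M\<Phi> x = 1\<^sub>m n"
  shows "\<exists>z \<in> carrier_mat n n. x * z = 1\<^sub>m n \<and> z * x = 1\<^sub>m n"
proof -
  note xc = ideal_unit_mats_carrier[OF x]
  define a where "a = x - 1\<^sub>m n"
  have a: "a \<in> ideal_mats n"
    using x sx one_ideal_unit_mats[of n] xc unfolding a_def
    by (intro ideal_matsI ideal_unit_mats_ops) (simp_all add: scalar_mat_square[where n = n])
  note ac = ideal_mats_carrier[OF a]
  obtain t where t: "t \<in> carrier_mat n n" "M\<Phi> a * w * M\<Phi> a = M\<Phi> t"
    using sandwich_mats[OF a w(1) a] by auto
  define z where "z = 1\<^sub>m n - a + t"
  let ?r = "block_endo n"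
  note [simp] = square_closed block_endo_hom n xc ac t(1) w(1)
  have zc [simp]: "z \<in> carrier_mat n n" by (simp add: z_def)
  have xa: "x = 1\<^sub>m n + a" using carrier_matD[OF xc] by (auto simp: a_def intro!: eq_matI)
  have "(1 + ?r (M\<Phi> a)) * ?r w = 1" "?r w * (1 + ?r (M\<Phi> a)) = 1"
    using arg_cong[OF w(2), of ?r] arg_cong[OF w(3), of ?r]
    by (simp_all add: xa M\<Phi>_square[where n = n])
  hence W: "?r w = 1 - ?r (M\<Phi> a) * ?r w" "?r w = 1 - ?r w * ?r (M\<Phi> a)"
    by (simp_all only: distrib_left distrib_right mult_1_left mult_1_right eq_diff_eq)
  have "M\<Phi> z = w"
  proof (rule block_endo_inj[OF _ _ n])
    have "?r (M\<Phi> z) = 1 - ?r (M\<Phi> a) + ?r (M\<Phi> a) * ?r w * ?r (M\<Phi> a)"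
      by (simp add: z_def M\<Phi>_square[where n = n] t(2)[symmetric])
    also have "\<dots> = 1 - (1 - ?r (M\<Phi> a) * ?r w) * ?r (M\<Phi> a)" by (simp add: algebra_simps)
    also have "\<dots> = ?r w" using W by metis
    finally show "?r (M\<Phi> z) = ?r w" .
  qed simp_all
  define \<nu> \<nu>' where "\<nu> = x * z - 1\<^sub>m n" and "\<nu>' = z * x - 1\<^sub>m n"
  have [simp]: "\<nu> \<in> carrier_mat n n" "\<nu>' \<in> carrier_mat n n" by (simp_all add: \<nu>_def \<nu>'_def)
  have "M\<Phi> \<nu> = 0\<^sub>m n n" "M\<Phi> \<nu>' = 0\<^sub>m n n"
    using w by (simp_all add: \<nu>_def \<nu>'_def M\<Phi>_square[where n = n] \<open>M\<Phi> z = w\<close>)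
  from this[THEN kernel_mats_nilpotent[rotated]]
  have nil: "?r \<nu> * ?r \<nu> * ?r \<nu> = 0" "?r \<nu>' * ?r \<nu>' * ?r \<nu>' = 0"
    by (metis \<open>\<nu> \<in> carrier_mat n n\<close> \<open>\<nu>' \<in> carrier_mat n n\<close> block_endo_mult block_endo_zero n square_closed(1))+
  define y where "y = z * (1\<^sub>m n - \<nu> + \<nu> * \<nu>)"
  have yc [simp]: "y \<in> carrier_mat n n" by (simp add: y_def)
  have 1: "?r x * ?r y = 1"
    using nilpotent_defect_invertible[OF _ nil(1), of "?r x" "?r z"] by (simp add: y_def \<nu>_def)
  have 2: "(1 - ?r \<nu>' + ?r \<nu>' * ?r \<nu>') * ?r z * ?r x = 1"
  proof -
    have "?r z * ?r x = 1 + ?r \<nu>'" by (simp add: \<nu>'_def)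
    hence "(1 - ?r \<nu>' + ?r \<nu>' * ?r \<nu>') * ?r z * ?r x = (1 - ?r \<nu>' + ?r \<nu>' * ?r \<nu>') * (1 + ?r \<nu>')"
      by (simp only: mult.assoc)
    thus ?thesis using nil(2) by (simp add: algebra_simps)
  qed
  have "?r y * ?r x = 1" using left_right_inverse_eq[OF 1 2] 2 by simp
  hence "x * y = 1\<^sub>m n" "y * x = 1\<^sub>m n"
    using 1 by (auto intro!: block_endo_inj[OF _ _ n])
  thus ?thesis by (intro bexI[of _ y]) auto
qed

end

section \<open>Equivalence of idempotents\<close>

lemma idem_equivI:
  "x \<in> carrier_mat n m \<Longrightarrow> y \<in> carrier_mat m n \<Longrightarrow> e \<in> carrier_mat n n \<Longrightarrow> f \<in> carrier_mat m m
    \<Longrightarrow> x * y = e \<Longrightarrow> y * x = f \<Longrightarrow> idem_equiv e f"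
  unfolding idem_equiv_def by auto

lemma idem_equivE:
  assumes "idem_equiv e f" "e \<in> carrier_mat n n" "f \<in> carrier_mat m m"
  obtains x y where "x \<in> carrier_mat n m" "y \<in> carrier_mat m n" "x * y = e" "y * x = f"
  using assms unfolding idem_equiv_def by auto

lemma idem_equiv_trans:
  assumes ef: "idem_equiv e f" and fg: "idem_equiv f g"
    and c: "e \<in> carrier_mat n n" "f \<in> carrier_mat m m" "g \<in> carrier_mat k k"
    and e: "e * e = e" and g: "g * g = g"
  shows "idem_equiv e g"
proof -
  obtain x y where xy [simp]: "x \<in> carrier_mat n m" "y \<in> carrier_mat m n" and p: "x * y = e" "y * x = f"
    using idem_equivE[OF ef c(1,2)] .
  obtain x' y' where xy' [simp]: "x' \<in> carrier_mat m k" "y' \<in> carrier_mat k m" and p': "x' * y' = f" "y' * x' = g"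
    using idem_equivE[OF fg c(2,3)] .
  have [simp]: "y' * y \<in> carrier_mat k n" "x * x' \<in> carrier_mat n k" "x * y \<in> carrier_mat n n"
    "y' * x' \<in> carrier_mat k k"
    using mult_carrier_mat[OF xy'(2) xy(2)] mult_carrier_mat[OF xy(1) xy'(1)]
      mult_carrier_mat[OF xy] mult_carrier_mat[OF xy'(2,1)] by simp_all
  have "(x * x') * (y' * y) = x * ((x' * y') * y)"
    using assoc_mult_mat[of x n m x' k "y' * y" n] assoc_mult_mat[of x' m k y' m y n] by simp
  also have "\<dots> = x * ((y * x) * y)" by (simp only: p p')
  also have "\<dots> = (x * y) * (x * y)"
    using assoc_mult_mat[of x n m y n "x * y" n] assoc_mult_mat[of y m n x m y n] by simp
  finally have 1: "(x * x') * (y' * y) = e" by (simp only: p e)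
  have "(y' * y) * (x * x') = y' * ((y * x) * x')"
    using assoc_mult_mat[of y' k m y n "x * x'" k] assoc_mult_mat[of y m n x m x' k] by simp
  also have "\<dots> = y' * ((x' * y') * x')" by (simp only: p p')
  also have "\<dots> = (y' * x') * (y' * x')"
    using assoc_mult_mat[of y' k m x' k "y' * x'" k] assoc_mult_mat[of x' m k y' m x' k] by simp
  finally have 2: "(y' * y) * (x * x') = g" by (simp only: p' g)
  show ?thesis by (rule idem_equivI[OF _ _ c(1,3) 1 2]) simp_all
qed

lemma conjugate_idem_equiv:
  assumes c: "e \<in> carrier_mat n n" "v \<in> carrier_mat n n" "w \<in> carrier_mat n n"
    and e: "e * e = e" and wv: "w * v = 1\<^sub>m n"
  shows "v * e * w * (v * e * w) = v * e * w" "idem_equiv e (v * e * w)"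
proof -
  note [simp] = square_closed c
  note a = assoc_mult_mat[where n\<^sub>1 = n and n\<^sub>2 = n and n\<^sub>3 = n and n\<^sub>4 = n]
  have ewv: "e * (w * (v * z)) = e * z" if "z \<in> carrier_mat n n" for z
    using that a[of w v z] by (simp add: wv)
  have ee: "e * (e * z) = e * z" if "z \<in> carrier_mat n n" for z
    using that a[of e e z] by (simp add: e)
  show "v * e * w * (v * e * w) = v * e * w"
    by (simp add: a ewv ee)
  show "idem_equiv e (v * e * w)"
    by (rule idem_equivI[of "e * w" n n "v * e"]) (simp_all add: a ewv ee e)
qed

context hereditary_morphism
begin

lemma block_endo_idempotent:
  "e \<in> carrier_mat n n \<Longrightarrow> 0 < n \<Longrightarrow> e * e = e \<Longrightarrow> block_endo n e * block_endo n e = block_endo n e"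
  by (metis block_endo_mult)

lemma scaled_bound:
  fixes K :: real assumes "0 \<le> K" shows "\<exists>\<epsilon>>0. \<forall>d. d < \<epsilon> \<longrightarrow> 0 \<le> d \<longrightarrow> d * K < 1"
proof (intro exI[of _ "1 / (K + 1)"] conjI allI impI)
  fix d assume d: "d < 1 / (K + 1)" "0 \<le> d"
  have "d * K \<le> d * (K + 1)" using d assms by (intro mult_left_mono) auto
  also have "\<dots> < 1" using d assms by (simp add: pos_less_divide_eq)
  finally show "d * K < 1" .
qed (use assms in auto)

lemma idempotent_defect_ideal:
  assumes c: "c \<in> ideal_unit_mats n" "scalar_mat c * scalar_mat c = scalar_mat c"
  shows "c * c - c \<in> ideal_mats n"
proof (rule ideal_matsI)
  note cc = ideal_unit_mats_carrier[OF c(1)]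
  show "c * c - c \<in> ideal_unit_mats n" by (intro ideal_unit_mats_ops c)
  have "scalar_mat (c * c - c) = scalar_mat c - scalar_mat c"
    using cc c(2) by (simp add: scalar_mat_square[where n = n] square_closed)
  thus "scalar_mat (c * c - c) = 0\<^sub>m n n" using cc by simp
qed

text \<open>Approximate \<open>e\<close> by a matrix \<open>c\<close> over the unitization of \<open>I\<close> with the same scalar part; its defect lies over
\<open>I\<close>, and so does the correction in \<open>conjugate_idempotent_left\<close>.\<close>

lemma idempotent_equiv_ideal:
  assumes e: "e \<in> carrier_mat n n" "e * e = e" and n: "0 < n"
  shows "\<exists>f \<in> ideal_unit_mats n. f * f = f \<and> idem_equiv e f"
proof -
  obtain \<epsilon> where eps: "0 < \<epsilon>" "\<And>d. d < \<epsilon> \<Longrightarrow> 0 \<le> d \<Longrightarrow> d * mnorm (1\<^sub>m n - (e + e)) < 1"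
    using scaled_bound[OF mnorm_nonneg] by blast
  obtain c where c: "c \<in> ideal_unit_mats n" "scalar_mat c = scalar_mat e" "mnorm (c - e) < \<epsilon>"
    using approx_domain[OF e(1) eps(1)] by blast
  note cc = ideal_unit_mats_carrier[OF c(1)]
  let ?v = "c * e + (1\<^sub>m n - c) * (1\<^sub>m n - e)"
  obtain w where w: "w \<in> carrier_mat n n" "?v * w = 1\<^sub>m n" "w * ?v = 1\<^sub>m n"
    using conjugator_invertible(1)[OF e(1) cc n e(2) eps(2)[OF c(3) mnorm_nonneg]] by blast
  let ?r = "block_endo n"
  note [simp] = square_closed block_endo_hom n cc e(1) w(1) block_endo_idempotent[OF e(1) n e(2)]
  have W: "?r ?v * ?r w = 1" "?r w * ?r ?v = 1"
    using arg_cong[OF w(2), of ?r] arg_cong[OF w(3), of ?r] by simp_all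
  define f where "f = ?v * e * w"
  have fc [simp]: "f \<in> carrier_mat n n" by (simp add: f_def)
  have "?r f = ?r (c + (c * c - c) * ((1\<^sub>m n - (e + e)) * w))"
    using conjugate_idempotent_left[of "?r e" "?r c" "?r w"] W by (simp add: f_def)
  hence f: "f = c + (c * c - c) * ((1\<^sub>m n - (e + e)) * w)"
    by (rule block_endo_inj[rotated 3]) simp_all
  have "c * c - c \<in> ideal_mats n"
    using c e by (intro idempotent_defect_ideal) (simp_all flip: scalar_mat_square(3)[where n = n])
  hence "(c * c - c) * ((1\<^sub>m n - (e + e)) * w) \<in> ideal_mats n"
    by (rule ideal_mats_mult) simp
  hence fi: "f \<in> ideal_unit_mats n" unfolding f ideal_mats_def
    using ideal_unit_mats_ops(1)[OF c(1)] by blast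
  have "f * f = f" "idem_equiv e f"
    unfolding f_def by (rule conjugate_idem_equiv[OF e(1) _ w(1) e(2) w(3)]; simp)+
  thus ?thesis using fi by blast
qed

lemma lift_idempotent:
  assumes x: "x \<in> carrier_mat n n" and n: "0 < n" and idem: "M\<Phi> x * M\<Phi> x = M\<Phi> x"
  shows "\<exists>e \<in> carrier_mat n n. e * e = e \<and> M\<Phi> e = M\<Phi> x"
proof -
  let ?r = "block_endo n"
  note [simp] = square_closed block_endo_hom n x
  define p where "p = (\<lambda>y :: 'a unitization mat. y * y + y * y + y * y - y * y * y - y * y * y)"
  have pc [simp]: "p y \<in> carrier_mat n n" if "y \<in> carrier_mat n n" for y
    using that by (simp add: p_def)
  have rp: "?r (p y) = ?r y * ?r y + ?r y * ?r y + ?r y * ?r y - ?r y * ?r y * ?r y - ?r y * ?r y * ?r y"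
    if "y \<in> carrier_mat n n" for y using that by (simp add: p_def mult.assoc)
  let ?q = "x * x - x"
  have "M\<Phi> ?q = 0\<^sub>m n n" using idem by (simp add: M\<Phi>_square[where n = n])
  hence "?q * ?q * ?q = 0\<^sub>m n n" by (rule kernel_mats_nilpotent[rotated]) simp
  from arg_cong[OF this, of ?r]
  have nil: "(?r x * ?r x - ?r x) * (?r x * ?r x - ?r x) * (?r x * ?r x - ?r x) = 0" by simp
  have "?r (p (p x)) * ?r (p (p x)) = ?r (p (p x))"
    using lift_idempotent_along_nilpotent[OF nil] by (simp add: rp)
  hence "p (p x) * p (p x) = p (p x)" by (intro block_endo_inj[OF _ _ n]) simp_all
  moreover have "M\<Phi> (p y) = M\<Phi> x" if y: "y \<in> carrier_mat n n" "M\<Phi> y = M\<Phi> x" for y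
  proof -
    have "M\<Phi> (p y) = M\<Phi> x + M\<Phi> x + M\<Phi> x - M\<Phi> x - M\<Phi> x"
      using y idem by (simp add: p_def M\<Phi>_square[where n = n])
    also have "\<dots> = M\<Phi> x" using carrier_matD[OF x] by (intro eq_matI) auto
    finally show ?thesis .
  qed
  ultimately show ?thesis by (intro bexI[of _ "p (p x)"]) simp_all
qed

text \<open>A single conjugation towards the image of some \<open>c\<close> produces an idempotent \<open>f\<close> in the range plus a multiple
of the image of \<open>I\<close>, which need not be in the range.  A second conjugation with the factors in the
other order encloses the new factor between two elements of the image of \<open>I\<close>
(\<open>two_step_sandwich\<close>), so the result \<open>g\<close> is an image, and it lifts to an idempotent because the kernel is
nilpotent.\<close>

lemma idempotent_equiv_image:
  assumes e: "e \<in> carrier_mat n n" "e * e = e" and n: "0 < n"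
  shows "\<exists>g \<in> carrier_mat n n. g * g = g \<and> idem_equiv e (M\<Phi> g)"
proof -
  obtain \<epsilon> where eps: "0 < \<epsilon>" "\<And>d. d < \<epsilon> \<Longrightarrow> 0 \<le> d \<Longrightarrow> d * mnorm (1\<^sub>m n - (e + e)) < 1"
    using scaled_bound[OF mnorm_nonneg] by blast
  obtain c where c: "c \<in> ideal_unit_mats n" "scalar_mat c = scalar_mat e" "mnorm (M\<Phi> c - e) < \<epsilon>"
    using approx_image[OF e(1) eps(1)] by blast
  note cc = ideal_unit_mats_carrier[OF c(1)]
  let ?C = "M\<Phi> c"
  have Cc: "?C \<in> carrier_mat n n" using cc by simp
  let ?v = "e * ?C + (1\<^sub>m n - e) * (1\<^sub>m n - ?C)"
  obtain w where w: "w \<in> carrier_mat n n" "?v * w = 1\<^sub>m n" "w * ?v = 1\<^sub>m n"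
    using conjugator_invertible(2)[OF e(1) Cc n e(2) eps(2)[OF c(3) mnorm_nonneg]] by blast
  let ?r = "block_endo n"
  note [simp] = square_closed block_endo_hom n cc Cc e(1) w(1) block_endo_idempotent[OF e(1) n e(2)]
  have W: "?r ?v * ?r w = 1" "?r w * ?r ?v = 1"
    using arg_cong[OF w(2), of ?r] arg_cong[OF w(3), of ?r] by simp_all
  define f where "f = w * e * ?v"
  have fc [simp]: "f \<in> carrier_mat n n" by (simp add: f_def)
  define u where "u = w * (1\<^sub>m n - (e + e))"
  have uc [simp]: "u \<in> carrier_mat n n" by (simp add: u_def)
  have "?r f = ?r (?C + u * (?C * ?C - ?C))"
    using conjugate_idempotent_right[of "?r e" "?r w" "?r ?C"] W by (simp add: f_def u_def)
  hence f: "f = ?C + u * (?C * ?C - ?C)"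
    by (rule block_endo_inj[rotated 3]) simp_all
  have sc: "scalar_mat c * scalar_mat c = scalar_mat c"
    using e by (simp add: c(2) flip: scalar_mat_square(3)[where n = n])
  have ff: "f * f = f" and ef: "idem_equiv e f"
    unfolding f_def by (rule conjugate_idem_equiv[OF e(1) w(1) _ e(2) w(2)]; simp)+
  note rff = block_endo_idempotent[OF fc n ff]
  have sf: "scalar_mat f = scalar_mat c"
  proof -
    have "scalar_mat (?C * ?C - ?C) = 0\<^sub>m n n"
      using sc by (simp add: scalar_mat_square[where n = n])
    hence "scalar_mat (u * (?C * ?C - ?C)) = 0\<^sub>m n n"
      by (simp add: scalar_mat_square(3)[where n = n] right_mult_zero_mat[of _ n n n])
    thus ?thesis unfolding f using carrier_matD[OF cc] by (simp add: scalar_mat_square(1)[where n = n])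
  qed
  obtain \<epsilon>' where eps': "0 < \<epsilon>'" "\<And>d. d < \<epsilon>' \<Longrightarrow> 0 \<le> d \<Longrightarrow> d * mnorm (1\<^sub>m n - (f + f)) < 1"
    using scaled_bound[OF mnorm_nonneg] by blast
  obtain c' where c': "c' \<in> ideal_unit_mats n" "scalar_mat c' = scalar_mat f" "mnorm (M\<Phi> c' - f) < \<epsilon>'"
    using approx_image[OF fc eps'(1)] by blast
  note cc' = ideal_unit_mats_carrier[OF c'(1)]
  let ?C' = "M\<Phi> c'"
  have Cc': "?C' \<in> carrier_mat n n" using cc' by simp
  let ?v' = "?C' * f + (1\<^sub>m n - ?C') * (1\<^sub>m n - f)"
  obtain w' where w': "w' \<in> carrier_mat n n" "?v' * w' = 1\<^sub>m n" "w' * ?v' = 1\<^sub>m n"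
    using conjugator_invertible(1)[OF fc Cc' n ff eps'(2)[OF c'(3) mnorm_nonneg]] by blast
  note [simp] = cc' Cc' w'(1)
  have W': "?r ?v' * ?r w' = 1" "?r w' * ?r ?v' = 1"
    using arg_cong[OF w'(2), of ?r] arg_cong[OF w'(3), of ?r] by simp_all
  define g where "g = ?v' * f * w'"
  have gc [simp]: "g \<in> carrier_mat n n" by (simp add: g_def)
  have rg: "?r g = ?r ?C' + (?r ?C' * ?r ?C' - ?r ?C') * ((1 - (?r f + ?r f)) * ?r w')"
    using conjugate_idempotent_left[of "?r f" "?r ?C'" "?r w'"] W' rff by (simp add: g_def)
  define E where "E = ?r ` (carrier_mat n n :: 'b unitization mat set)"
  define P where "P = ?r ` M\<Phi> ` carrier_mat n n"
  define X where "X = ?r ` M\<Phi> ` ideal_mats n"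
  have EI: "?r x \<in> E" if "x \<in> carrier_mat n n" for x using that by (simp add: E_def)
  have PI: "?r (M\<Phi> x) \<in> P" if "x \<in> carrier_mat n n" for x using that by (simp add: P_def)
  have XI: "?r (M\<Phi> x) \<in> X" if "x \<in> ideal_mats n" for x using that by (simp add: X_def)
  have "?r ?C' + (?r ?C' * ?r ?C' - ?r ?C') * ((1 - (?r f + ?r f)) * ?r w') \<in> P"
  proof (rule two_step_sandwich[where E = E and X = X and c = "?r ?C" and u = "?r u"])
    show "1 \<in> E" using EI[of "1\<^sub>m n"] by simp
    show "a + b \<in> E \<and> a - b \<in> E \<and> a * b \<in> E" if "a \<in> E" "b \<in> E" for a b
    proof -
      obtain x y where "x \<in> carrier_mat n n" "y \<in> carrier_mat n n" "a = ?r x" "b = ?r y"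
        using \<open>a \<in> E\<close> \<open>b \<in> E\<close> unfolding E_def by blast
      thus ?thesis using EI[of "x + y"] EI[of "x - y"] EI[of "x * y"] by simp
    qed
    show "1 \<in> P" using PI[of "1\<^sub>m n"] by (simp add: M\<Phi>_square)
    show "a + b \<in> P \<and> a - b \<in> P \<and> a * b \<in> P" if "a \<in> P" "b \<in> P" for a b
    proof -
      obtain x y where "x \<in> carrier_mat n n" "y \<in> carrier_mat n n" "a = ?r (M\<Phi> x)" "b = ?r (M\<Phi> y)"
        using \<open>a \<in> P\<close> \<open>b \<in> P\<close> unfolding P_def by blast
      thus ?thesis using PI[of "x + y"] PI[of "x - y"] PI[of "x * y"]
        by (simp add: M\<Phi>_square[where n = n])
    qed
    show "X \<subseteq> P" using ideal_mats_carrier by (auto simp: X_def P_def)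
    show "P \<subseteq> E" by (auto simp: P_def E_def)
    show "x * p \<in> X" if "x \<in> X" "p \<in> P" for x p
    proof -
      obtain a b where ab: "a \<in> ideal_mats n" "b \<in> carrier_mat n n" "x = ?r (M\<Phi> a)" "p = ?r (M\<Phi> b)"
        using \<open>x \<in> X\<close> \<open>p \<in> P\<close> unfolding P_def X_def by blast
      thus ?thesis using XI[OF ideal_mats_mult(1)[OF ab(1,2)]] ideal_mats_carrier[OF ab(1)]
        by (simp add: M\<Phi>_square[where n = n])
    qed
    show "x * b * y \<in> P" if "x \<in> X" "b \<in> E" "y \<in> X" for x b y
    proof -
      obtain p q z where p: "p \<in> ideal_mats n" "q \<in> ideal_mats n" "z \<in> carrier_mat n n"
        "x = ?r (M\<Phi> p)" "y = ?r (M\<Phi> q)" "b = ?r z"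
        using \<open>x \<in> X\<close> \<open>b \<in> E\<close> \<open>y \<in> X\<close> unfolding E_def X_def by blast
      obtain t where "t \<in> carrier_mat n n" "M\<Phi> p * z * M\<Phi> q = M\<Phi> t"
        using sandwich_mats[OF p(1,3,2)] by auto
      thus ?thesis using p PI[of t] ideal_mats_carrier[OF p(1)] ideal_mats_carrier[OF p(2)]
        by (simp flip: block_endo_mult)
    qed
    show "?r ?C \<in> P" "?r ?C' \<in> P" by (simp_all add: PI)
    have "c' - c \<in> ideal_mats n"
      using c'(1) c(1) c'(2) sf by (intro ideal_matsI ideal_unit_mats_ops) (simp_all add: scalar_mat_square[where n = n])
    from XI[OF this] show "?r ?C' - ?r ?C \<in> X" by (simp add: M\<Phi>_square[where n = n])
    from XI[OF idempotent_defect_ideal[OF c(1) sc]]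
    show "?r ?C * ?r ?C - ?r ?C \<in> X" by (simp add: M\<Phi>_square[where n = n])
    have "scalar_mat c' * scalar_mat c' = scalar_mat c'" using sc sf c'(2) by simp
    from XI[OF idempotent_defect_ideal[OF c'(1) this]]
    show "?r ?C' * ?r ?C' - ?r ?C' \<in> X" by (simp add: M\<Phi>_square[where n = n])
    show "?r u \<in> E" "?r w' \<in> E" by (simp_all add: EI)
    show "?r f = ?r ?C + ?r u * (?r ?C * ?r ?C - ?r ?C)" by (subst f) simp
    show "?r f * ?r f = ?r f" by (rule rff)
    show "?r w' * (?r ?C' * ?r f + (1 - ?r ?C') * (1 - ?r f)) = 1" using W'(2) by simp
  qed
  then obtain x where x: "x \<in> carrier_mat n n" "?r g = ?r (M\<Phi> x)" unfolding rg P_def by auto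
  hence gx: "g = M\<Phi> x" by (intro block_endo_inj[OF _ _ n]) simp_all
  have gg: "g * g = g" and fg: "idem_equiv f g"
    unfolding g_def by (rule conjugate_idem_equiv[OF fc _ w'(1) ff w'(3)]; simp)+
  obtain g' where g': "g' \<in> carrier_mat n n" "g' * g' = g'" "M\<Phi> g' = g"
    using lift_idempotent[OF x(1) n] gg unfolding gx by blast
  have "idem_equiv e g" by (rule idem_equiv_trans[OF ef fg e(1) fc gc e(2) gg])
  thus ?thesis using g' by blast
qed

subsection \<open>Reflecting equivalence of idempotents\<close>

text \<open>If \<open>x, y\<close> implement the equivalence of the images, then approximations \<open>x\<^sub>0, y\<^sub>0\<close> over \<open>I\<close> yield
\<open>x\<^sub>1 = e x\<^sub>0 f\<close> and \<open>y\<^sub>1 = f y\<^sub>0 e\<close>, for which \<open>u = x\<^sub>1 y\<^sub>1 + 1 - e\<close> is close to 1 in the target.  The scalar part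
of \<open>u\<close> is exactly 1, so \<open>u\<close> lies in \<open>1 + M\<^sub>n(I)\<close> and is invertible, as is its counterpart for \<open>f\<close>.\<close>

lemma reflect_idem_equiv:
  assumes e: "e \<in> ideal_unit_mats n" "e * e = e" and f: "f \<in> ideal_unit_mats n" "f * f = f" and n: "0 < n"
    and equiv: "idem_equiv (M\<Phi> e) (M\<Phi> f)"
  shows "idem_equiv e f"
proof -
  note ec = ideal_unit_mats_carrier[OF e(1)] and fc = ideal_unit_mats_carrier[OF f(1)]
  obtain x y where xy: "x \<in> carrier_mat n n" "y \<in> carrier_mat n n" "x * y = M\<Phi> e" "y * x = M\<Phi> f"
    by (rule idem_equivE[OF equiv, of n n]) (use ec fc in auto)
  let ?r = "block_endo n" and ?E = "M\<Phi> e" and ?F = "M\<Phi> f"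
  have Ec: "?E \<in> carrier_mat n n" and Fc: "?F \<in> carrier_mat n n" using ec fc by simp_all
  note [simp] = square_closed block_endo_hom n ec fc Ec Fc xy(1,2)
    block_endo_idempotent[OF ec n e(2)] block_endo_idempotent[OF fc n f(2)]
  have EE: "?E * ?E = ?E" and FF: "?F * ?F = ?F"
    using e(2) f(2) M\<Phi>_square(3)[OF ec ec] M\<Phi>_square(3)[OF fc fc] by simp_all
  have [simp]: "?r ?E * ?r ?E = ?r ?E" "?r ?F * ?r ?F = ?r ?F"
    using block_endo_idempotent[OF Ec n EE] block_endo_idempotent[OF Fc n FF] by simp_all
  have XY: "?r x * ?r y = ?r ?E" "?r y * ?r x = ?r ?F"
    using arg_cong[OF xy(3), of ?r] arg_cong[OF xy(4), of ?r] by simp_all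
  define x' y' where "x' = ?E * x * ?F" and "y' = ?F * y * ?E"
  have c' [simp]: "x' \<in> carrier_mat n n" "y' \<in> carrier_mat n n" by (simp_all add: x'_def y'_def)
  have X': "?r x' = ?r ?E * ?r x * ?r ?F" "?r y' = ?r ?F * ?r y * ?r ?E" by (simp_all add: x'_def y'_def)
  have XF: "?r x * ?r ?F = ?r ?E * ?r x" "?r y * ?r ?E = ?r ?F * ?r y"
    by (simp_all add: XY[symmetric] mult.assoc)
  have X'': "?r x' = ?r ?E * ?r x" "?r y' = ?r ?F * ?r y"
    unfolding X' by (simp_all add: mult.assoc XF) (simp_all flip: mult.assoc)
  have X'Y': "?r x' * ?r ?F * ?r y' = ?r ?E" "?r y' * ?r ?E * ?r x' = ?r ?F"
  proof -
    have "?r x' * ?r ?F * ?r y' = ?r ?E * (?r x * ?r ?F) * (?r ?F * ?r y)"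
      unfolding X'' by (simp add: mult.assoc)
    also have "\<dots> = ?r ?E * (?r x * (?r ?F * ?r y))"
      unfolding XF by (simp add: mult.assoc XF[symmetric]) (simp add: XF flip: mult.assoc)
    also have "\<dots> = ?r ?E * ((?r x * ?r y) * ?r ?E)" by (simp add: mult.assoc XF(2)[symmetric])
    finally show "?r x' * ?r ?F * ?r y' = ?r ?E" by (simp add: XY)
    have "?r y' * ?r ?E * ?r x' = ?r ?F * (?r y * ?r ?E) * (?r ?E * ?r x)"
      unfolding X'' by (simp add: mult.assoc)
    also have "\<dots> = ?r ?F * (?r y * (?r ?E * ?r x))"
      unfolding XF by (simp add: mult.assoc XF[symmetric]) (simp add: XF flip: mult.assoc)
    also have "\<dots> = ?r ?F * ((?r y * ?r x) * ?r ?F)" by (simp add: mult.assoc XF(1)[symmetric])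
    finally show "?r y' * ?r ?E * ?r x' = ?r ?F" by (simp add: XY)
  qed
  have EEz: "?r ?E * (?r ?E * z) = ?r ?E * z" and FFz: "?r ?F * (?r ?F * z) = ?r ?F * z" for z
    by (simp_all flip: mult.assoc)
  \<comment> \<open>The bound for \<open>x\<^sub>0\<close> uses \<open>y'\<close>, and the one for \<open>y\<^sub>0\<close> uses the \<open>x\<^sub>0\<close> already chosen, so that each of
    the two terms of the error is below one half.\<close>
  define \<alpha> where "\<alpha> = mnorm ?E * mnorm (?F * y' * ?E) + mnorm (?F * y' * ?E) * mnorm ?F"
  have \<alpha>: "0 \<le> \<alpha>" by (simp add: \<alpha>_def mnorm_nonneg)
  obtain \<epsilon> where eps: "0 < \<epsilon>" "\<And>d. d < \<epsilon> \<Longrightarrow> 0 \<le> d \<Longrightarrow> d * (2 * \<alpha>) < 1"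
    using scaled_bound[of "2 * \<alpha>"] \<alpha> by auto
  obtain x0 where x0: "x0 \<in> ideal_unit_mats n" "scalar_mat x0 = scalar_mat x'" "mnorm (M\<Phi> x0 - x') < \<epsilon>"
    using approx_image[OF c'(1) eps(1)] by blast
  note x0c = ideal_unit_mats_carrier[OF x0(1)]
  have X0c: "M\<Phi> x0 \<in> carrier_mat n n" using x0c by simp
  let ?X = "M\<Phi> x0"
  define \<beta> where "\<beta> = mnorm (?E * ?X * ?F) * mnorm ?E + mnorm ?F * mnorm (?E * ?X * ?F)"
  have \<beta>: "0 \<le> \<beta>" by (simp add: \<beta>_def mnorm_nonneg)
  obtain \<delta> where del: "0 < \<delta>" "\<And>d. d < \<delta> \<Longrightarrow> 0 \<le> d \<Longrightarrow> d * (2 * \<beta>) < 1"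
    using scaled_bound[of "2 * \<beta>"] \<beta> by auto
  obtain y0 where y0: "y0 \<in> ideal_unit_mats n" "scalar_mat y0 = scalar_mat y'" "mnorm (M\<Phi> y0 - y') < \<delta>"
    using approx_image[OF c'(2) del(1)] by blast
  note y0c = ideal_unit_mats_carrier[OF y0(1)]
  have Y0c: "M\<Phi> y0 \<in> carrier_mat n n" using y0c by simp
  let ?Y = "M\<Phi> y0"
  note [simp] = x0c X0c y0c Y0c
  define x1 y1 where "x1 = e * x0 * f" and "y1 = f * y0 * e"
  have c1 [simp]: "x1 \<in> carrier_mat n n" "y1 \<in> carrier_mat n n" by (simp_all add: x1_def y1_def)
  define u u' where "u = x1 * y1 + 1\<^sub>m n - e" and "u' = y1 * x1 + 1\<^sub>m n - f"
  have ui: "u \<in> ideal_unit_mats n" "u' \<in> ideal_unit_mats n"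
    unfolding u_def u'_def x1_def y1_def
    by (intro ideal_unit_mats_ops e f x0 y0 one_ideal_unit_mats)+
  note uc = this[THEN ideal_unit_mats_carrier]
  have su: "scalar_mat u = 1\<^sub>m n" "scalar_mat u' = 1\<^sub>m n"
  proof -
    let ?s = "scalar_mat"
    have sc: "?s z \<in> carrier_mat n n" if "z \<in> carrier_mat n n" for z :: "'z::complex_banach_algebra unitization mat"
      using that by simp
    have idem: "?s e * ?s e = ?s e" "?s f * ?s f = ?s f"
      using e(2) f(2) by (simp_all flip: scalar_mat_square(3)[where n = n])
    have "?s (x' * ?F * y') = ?s e" "?s (y' * ?E * x') = ?s f"
    proof -
      have "x' * ?F * y' = ?E" "y' * ?E * x' = ?F"
        using X'Y' by (intro block_endo_inj[OF _ _ n]; simp)+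
      thus "?s (x' * ?F * y') = ?s e" "?s (y' * ?E * x') = ?s f" by simp_all
    qed
    hence s: "?s x' * ?s f * ?s y' = ?s e" "?s y' * ?s e * ?s x' = ?s f"
      by (simp_all add: scalar_mat_square(3)[where n = n])
    let ?q = "block_endo n :: complex mat \<Rightarrow> complex endo"
    have q: "?q (?s x') * ?q (?s f) * ?q (?s y') = ?q (?s e)" "?q (?s y') * ?q (?s e) * ?q (?s x') = ?q (?s f)"
      "?q (?s e) * ?q (?s e) = ?q (?s e)" "?q (?s f) * ?q (?s f) = ?q (?s f)"
      using s[THEN arg_cong[of _ _ ?q]] idem[THEN arg_cong[of _ _ ?q]] by (simp_all add: sc)
    have "?q (?s u) = ?q (?s e) * (?q (?s x') * (?q (?s f) * ?q (?s f)) * ?q (?s y')) * ?q (?s e) + 1 - ?q (?s e)"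
      by (simp add: u_def x1_def y1_def scalar_mat_square[where n = n] sc x0(2) y0(2) mult.assoc)
    hence 1: "?q (?s u) = 1" unfolding q by simp
    have "?q (?s u') = ?q (?s f) * (?q (?s y') * (?q (?s e) * ?q (?s e)) * ?q (?s x')) * ?q (?s f) + 1 - ?q (?s f)"
      by (simp add: u'_def x1_def y1_def scalar_mat_square[where n = n] sc x0(2) y0(2) mult.assoc)
    hence 2: "?q (?s u') = 1" unfolding q by simp
    show "scalar_mat u = 1\<^sub>m n" "scalar_mat u' = 1\<^sub>m n"
      using 1 2 uc by (auto intro!: block_endo_inj[OF _ _ n])
  qed
  have small: "mnorm (x' - ?X) * (2 * \<alpha>) < 1" "mnorm (y' - ?Y) * (2 * \<beta>) < 1"
    using eps(2)[OF x0(3) mnorm_nonneg] del(2)[OF y0(3) mnorm_nonneg]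
    by (simp_all add: mnorm_minus_commute[of x' n n ?X] mnorm_minus_commute[of y' n n ?Y])
  have inv: "\<exists>w \<in> carrier_mat n n. M\<Phi> u * w = 1\<^sub>m n \<and> w * M\<Phi> u = 1\<^sub>m n"
  proof -
    let ?d = "?E * (x' - ?X) * (?F * y' * ?E) + (?E * ?X * ?F) * (y' - ?Y) * ?E"
    have eq: "M\<Phi> u = 1\<^sub>m n - ?d"
    proof (rule block_endo_inj[OF _ _ n])
      have "?r ?d = ?r ?E * (?r x' * ?r ?F * ?r y') * ?r ?E - ?r ?E * ?r ?X * ?r ?F * ?r ?Y * ?r ?E"
        by (simp add: algebra_simps)
      also have "\<dots> = ?r ?E - ?r ?E * ?r ?X * ?r ?F * ?r ?Y * ?r ?E" unfolding X'Y' by simp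
      finally have d: "?r ?d = ?r ?E - ?r ?E * ?r ?X * ?r ?F * ?r ?Y * ?r ?E" .
      have "?r (M\<Phi> u) = ?r ?E * ?r ?X * (?r ?F * ?r ?F) * ?r ?Y * ?r ?E + 1 - ?r ?E"
        by (simp add: u_def x1_def y1_def M\<Phi>_square[where n = n] mult.assoc FFz)
      also have "\<dots> = ?r (1\<^sub>m n - ?d)" using d by (simp del: block_endo_add)
      finally show "?r (M\<Phi> u) = ?r (1\<^sub>m n - ?d)" .
    qed (use uc in simp_all)
    have "mnorm ?d \<le> mnorm (?E * (x' - ?X) * (?F * y' * ?E)) + mnorm ((?E * ?X * ?F) * (y' - ?Y) * ?E)"
      by (rule mnorm_add_le[where n = n and m = n]) simp_all
    also have "mnorm (?E * (x' - ?X) * (?F * y' * ?E)) \<le> mnorm ?E * mnorm (x' - ?X) * mnorm (?F * y' * ?E)"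
      by (intro order_trans[OF mnorm_mult_le[where n = n and m = n and k = n]] mult_right_mono mnorm_mult_le[where n = n and m = n and k = n] mnorm_nonneg) simp_all
    also have "mnorm ((?E * ?X * ?F) * (y' - ?Y) * ?E) \<le> mnorm (?E * ?X * ?F) * mnorm (y' - ?Y) * mnorm ?E"
      by (intro order_trans[OF mnorm_mult_le[where n = n and m = n and k = n]] mult_right_mono mnorm_mult_le[where n = n and m = n and k = n] mnorm_nonneg) simp_all
    finally have "mnorm ?d \<le> mnorm (x' - ?X) * (mnorm ?E * mnorm (?F * y' * ?E)) + mnorm (y' - ?Y) * (mnorm (?E * ?X * ?F) * mnorm ?E)"
      by (simp add: mult_ac)
    also have "\<dots> \<le> mnorm (x' - ?X) * \<alpha> + mnorm (y' - ?Y) * \<beta>"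
      by (intro add_mono mult_left_mono mnorm_nonneg) (simp_all add: \<alpha>_def \<beta>_def mnorm_nonneg)
    also have "\<dots> < 1" using small by simp
    finally show ?thesis unfolding eq by (intro neumann_inverse) simp_all
  qed
  have inv': "\<exists>w \<in> carrier_mat n n. M\<Phi> u' * w = 1\<^sub>m n \<and> w * M\<Phi> u' = 1\<^sub>m n"
  proof -
    let ?d = "(?F * y' * ?E) * (x' - ?X) * ?F + ?F * (y' - ?Y) * (?E * ?X * ?F)"
    have eq: "M\<Phi> u' = 1\<^sub>m n - ?d"
    proof (rule block_endo_inj[OF _ _ n])
      have "?r ?d = ?r ?F * (?r y' * ?r ?E * ?r x') * ?r ?F - ?r ?F * ?r ?Y * ?r ?E * ?r ?X * ?r ?F"
        by (simp add: algebra_simps)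
      also have "\<dots> = ?r ?F - ?r ?F * ?r ?Y * ?r ?E * ?r ?X * ?r ?F" unfolding X'Y' by simp
      finally have d: "?r ?d = ?r ?F - ?r ?F * ?r ?Y * ?r ?E * ?r ?X * ?r ?F" .
      have "?r (M\<Phi> u') = ?r ?F * ?r ?Y * (?r ?E * ?r ?E) * ?r ?X * ?r ?F + 1 - ?r ?F"
        by (simp add: u'_def x1_def y1_def M\<Phi>_square[where n = n] mult.assoc EEz)
      also have "\<dots> = ?r (1\<^sub>m n - ?d)" using d by (simp del: block_endo_add)
      finally show "?r (M\<Phi> u') = ?r (1\<^sub>m n - ?d)" .
    qed (use uc in simp_all)
    have "mnorm ?d \<le> mnorm ((?F * y' * ?E) * (x' - ?X) * ?F) + mnorm (?F * (y' - ?Y) * (?E * ?X * ?F))"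
      by (rule mnorm_add_le[where n = n and m = n]) simp_all
    also have "mnorm ((?F * y' * ?E) * (x' - ?X) * ?F) \<le> mnorm (?F * y' * ?E) * mnorm (x' - ?X) * mnorm ?F"
      by (intro order_trans[OF mnorm_mult_le[where n = n and m = n and k = n]] mult_right_mono mnorm_mult_le[where n = n and m = n and k = n] mnorm_nonneg) simp_all
    also have "mnorm (?F * (y' - ?Y) * (?E * ?X * ?F)) \<le> mnorm ?F * mnorm (y' - ?Y) * mnorm (?E * ?X * ?F)"
      by (intro order_trans[OF mnorm_mult_le[where n = n and m = n and k = n]] mult_right_mono mnorm_mult_le[where n = n and m = n and k = n] mnorm_nonneg) simp_all
    finally have "mnorm ?d \<le> mnorm (x' - ?X) * (mnorm (?F * y' * ?E) * mnorm ?F) + mnorm (y' - ?Y) * (mnorm ?F * mnorm (?E * ?X * ?F))"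
      by (simp add: mult_ac)
    also have "\<dots> \<le> mnorm (x' - ?X) * \<alpha> + mnorm (y' - ?Y) * \<beta>"
      by (intro add_mono mult_left_mono mnorm_nonneg) (simp_all add: \<alpha>_def \<beta>_def mnorm_nonneg)
    also have "\<dots> < 1" using small by simp
    finally show ?thesis unfolding eq by (intro neumann_inverse) simp_all
  qed
  obtain z where z: "z \<in> carrier_mat n n" "u * z = 1\<^sub>m n"
    using inv invertible_of_image_invertible[OF ui(1) su(1) n] by blast
  obtain z' where z': "z' \<in> carrier_mat n n" "z' * u' = 1\<^sub>m n"
    using inv' invertible_of_image_invertible[OF ui(2) su(2) n] by blast
  note [simp] = z(1) z'(1) uc
  have U: "(?r x1 * ?r y1 + 1 - ?r e) * ?r z = 1" "?r z' * (?r y1 * ?r x1 + 1 - ?r f) = 1"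
    using arg_cong[OF z(2), of ?r] arg_cong[OF z'(2), of ?r]
    by (simp_all add: u_def u'_def)
  have absorb: "?r e * ?r x1 = ?r x1" "?r x1 * ?r f = ?r x1" "?r f * ?r y1 = ?r y1" "?r y1 * ?r e = ?r y1"
  proof -
    show "?r e * ?r x1 = ?r x1" "?r f * ?r y1 = ?r y1"
      by (simp_all add: x1_def y1_def flip: mult.assoc)
    show "?r x1 * ?r f = ?r x1" "?r y1 * ?r e = ?r y1"
      by (simp_all add: x1_def y1_def mult.assoc)
  qed
  have "?r x1 * (?r y1 * ?r z) = ?r e" "?r y1 * ?r z * ?r x1 = ?r f"
    using equivalence_from_approximate_inverses[OF _ _ absorb U] by simp_all
  hence "x1 * (y1 * z) = e" "y1 * z * x1 = f" by (auto intro!: block_endo_inj[OF _ _ n])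
  thus ?thesis by (intro idem_equivI[of x1 n n "y1 * z"]) simp_all
qed

end

section \<open>Paths of invertible matrices\<close>

lemma GL_D:
  assumes "x \<in> GL n"
  shows "x \<in> carrier_mat n n" "scalar_mat x = 1\<^sub>m n"
    "\<exists>y \<in> carrier_mat n n. x * y = 1\<^sub>m n \<and> y * x = 1\<^sub>m n"
proof -
  show x: "x \<in> carrier_mat n n" and "scalar_mat x = 1\<^sub>m n" using assms by (auto simp: GL_def)
  from assms obtain y where y: "x * y = 1\<^sub>m (dim_row x)" "y * x = 1\<^sub>m (dim_row y)"
    by (auto simp: GL_def invertible_mat_def inverts_mat_def)
  have "dim_row y = n" "dim_col y = n"
    using arg_cong[OF y(1), of dim_col] arg_cong[OF y(2), of dim_col] x by auto
  thus "\<exists>y \<in> carrier_mat n n. x * y = 1\<^sub>m n \<and> y * x = 1\<^sub>m n" using x y by (intro bexI[of _ y]) auto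
qed

lemma GL_I:
  assumes "x \<in> carrier_mat n n" "scalar_mat x = 1\<^sub>m n" "y \<in> carrier_mat n n" "x * y = 1\<^sub>m n" "y * x = 1\<^sub>m n"
  shows "x \<in> GL n"
  using assms unfolding GL_def invertible_mat_def inverts_mat_def
  by (auto intro!: exI[of _ y])

lemma GL_path_connected_refl: "x \<in> GL k \<Longrightarrow> GL_path_connected k x x"
  unfolding GL_path_connected_def by (rule exI[of _ "\<lambda>t. x"]) auto

lemma GL_path_connected_sym:
  assumes "GL_path_connected k x y"
  shows "GL_path_connected k y x"
proof -
  obtain F where *: "(\<forall>t\<in>{0..1}. F t \<in> GL k)
      \<and> (\<forall>i<k. \<forall>j<k. continuous_on {0..1::real} (\<lambda>t. alg_part (F t $$ (i, j))))
      \<and> F 0 = x \<and> F 1 = y"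
    using assms unfolding GL_path_connected_def ..
  have F: "\<And>t. t \<in> {0..1} \<Longrightarrow> F t \<in> GL k" "F 0 = x" "F 1 = y"
    and cont: "\<And>i j. i < k \<Longrightarrow> j < k \<Longrightarrow> continuous_on {0..1} (\<lambda>t. alg_part (F t $$ (i, j)))"
    using * by simp_all
  have "continuous_on {0..1} (\<lambda>t. alg_part (F (1 - t) $$ (i, j)))" if "i < k" "j < k" for i j
    by (rule continuous_on_compose2[OF cont[OF that], of _ "\<lambda>t. 1 - t"]) (auto intro!: continuous_intros)
  thus ?thesis using F unfolding GL_path_connected_def
    by (intro exI[of _ "\<lambda>t. F (1 - t)"]) auto
qed

lemma GL_path_connected_trans:
  assumes "GL_path_connected k x y" "GL_path_connected k y z"
  shows "GL_path_connected k x z"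
proof -
  obtain F where *: "(\<forall>t\<in>{0..1}. F t \<in> GL k)
      \<and> (\<forall>i<k. \<forall>j<k. continuous_on {0..1::real} (\<lambda>t. alg_part (F t $$ (i, j))))
      \<and> F 0 = x \<and> F 1 = y"
    using assms(1) unfolding GL_path_connected_def ..
  have F: "\<And>t. t \<in> {0..1} \<Longrightarrow> F t \<in> GL k" "F 0 = x" "F 1 = y"
    and contF: "\<And>i j. i < k \<Longrightarrow> j < k \<Longrightarrow> continuous_on {0..1} (\<lambda>t. alg_part (F t $$ (i, j)))"
    using * by simp_all
  obtain H where *: "(\<forall>t\<in>{0..1}. H t \<in> GL k)
      \<and> (\<forall>i<k. \<forall>j<k. continuous_on {0..1::real} (\<lambda>t. alg_part (H t $$ (i, j))))
      \<and> H 0 = y \<and> H 1 = z"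
    using assms(2) unfolding GL_path_connected_def ..
  have H: "\<And>t. t \<in> {0..1} \<Longrightarrow> H t \<in> GL k" "H 0 = y" "H 1 = z"
    and contH: "\<And>i j. i < k \<Longrightarrow> j < k \<Longrightarrow> continuous_on {0..1} (\<lambda>t. alg_part (H t $$ (i, j)))"
    using * by simp_all
  define K where "K = (\<lambda>t :: real. if t \<le> 1/2 then F (2 * t) else H (2 * t - 1))"
  have "continuous_on {0..1} (\<lambda>t. alg_part (K t $$ (i, j)))" if "i < k" "j < k" for i j
  proof -
    let ?f = "\<lambda>t. alg_part (F t $$ (i, j))" and ?h = "\<lambda>t. alg_part (H t $$ (i, j))"
    have "path (?f +++ ?h)"
      using contF[OF that] contH[OF that] F(3) H(2)
      by (intro path_join_imp) (auto simp: path_def pathfinish_def pathstart_def)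
    moreover have "?f +++ ?h = (\<lambda>t. alg_part (K t $$ (i, j)))"
      by (auto simp: joinpaths_def K_def)
    ultimately show ?thesis by (simp add: path_def)
  qed
  moreover have "\<forall>t \<in> {0..1}. K t \<in> GL k" using F(1) H(1) by (auto simp: K_def)
  ultimately show ?thesis using F H unfolding GL_path_connected_def
    by (intro exI[of _ K]) (auto simp: K_def)
qed

definition segment_mat :: "nat \<Rightarrow> 'a::complex_banach_algebra unitization mat \<Rightarrow> 'a unitization mat \<Rightarrow> real
    \<Rightarrow> 'a unitization mat" where
  "segment_mat n x y t = mat n n (\<lambda>ij. (1 - t) *\<^sub>R x $$ ij + t *\<^sub>R y $$ ij)"

lemma segment_mat_carrier [simp]: "segment_mat n x y t \<in> carrier_mat n n"
  by (simp add: segment_mat_def)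

lemma scaleR_parts [simp]:
  "alg_part (r *\<^sub>R x) = r *\<^sub>R alg_part x" "scalar_part (r *\<^sub>R x) = r *\<^sub>R scalar_part x"
  by (simp_all add: scaleR_unitization_def)

lemma segment_mat_scalar:
  assumes "x \<in> carrier_mat n n" "y \<in> carrier_mat n n" "scalar_mat x = s" "scalar_mat y = s"
  shows "scalar_mat (segment_mat n x y t) = s"
proof (rule eq_matI)
  fix i j assume "i < dim_row s" "j < dim_col s"
  hence ij: "i < n" "j < n" using assms by auto
  have "scalar_part (x $$ (i, j)) = s $$ (i, j)" "scalar_part (y $$ (i, j)) = s $$ (i, j)"
    using arg_cong[OF assms(3), of "\<lambda>m. m $$ (i, j)"] arg_cong[OF assms(4), of "\<lambda>m. m $$ (i, j)"] assms(1,2) ij by simp_all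
  thus "scalar_mat (segment_mat n x y t) $$ (i, j) = s $$ (i, j)"
    using ij by (simp add: segment_mat_def flip: scaleR_left_distrib)
qed (use assms in \<open>auto simp: segment_mat_def\<close>)

lemma segment_mat_in_ball:
  assumes x: "x \<in> carrier_mat n n" and y: "y \<in> carrier_mat n n" and z: "z \<in> carrier_mat n n"
    and t: "t \<in> {0..1}" and d: "mnorm (x - z) < \<delta>" "mnorm (y - z) < \<delta>"
  shows "mnorm (segment_mat n x y t - z) < \<delta>"
proof -
  have "mnorm (segment_mat n x y t - z) \<le> (\<Sum>i<n. \<Sum>j<n. (1 - t) * norm ((x - z) $$ (i, j)) + t * norm ((y - z) $$ (i, j)))"
  proof -
    have "norm ((segment_mat n x y t - z) $$ (i, j)) \<le> (1 - t) * norm ((x - z) $$ (i, j)) + t * norm ((y - z) $$ (i, j))"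
      if "i < n" "j < n" for i j
    proof -
      have "(segment_mat n x y t - z) $$ (i, j) = (1 - t) *\<^sub>R ((x - z) $$ (i, j)) + t *\<^sub>R ((y - z) $$ (i, j))"
        using that x y z by (simp add: segment_mat_def algebra_simps)
      thus ?thesis using t by (auto intro: norm_triangle_le)
    qed
    moreover have "dim_row (segment_mat n x y t - z) = n" "dim_col (segment_mat n x y t - z) = n" using z by auto
    ultimately show ?thesis unfolding mnorm_def by (simp only:) (intro sum_mono, simp)
  qed
  also have "\<dots> = (1 - t) * mnorm (x - z) + t * mnorm (y - z)"
    using x y z by (simp add: mnorm_def sum.distrib sum_distrib_left)
  also have "\<dots> < \<delta>" using t d by (intro convex_bound_lt) auto
  finally show ?thesis .
qed

lemma segment_mat_path:
  assumes x: "x \<in> carrier_mat n n" and y: "y \<in> carrier_mat n n"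
    and GL: "\<And>t. t \<in> {0..1} \<Longrightarrow> segment_mat n x y t \<in> GL n"
  shows "GL_path_connected n x y"
  unfolding GL_path_connected_def
proof (intro exI[of _ "segment_mat n x y"] conjI ballI allI impI GL)
  show "continuous_on {0..1} (\<lambda>t. alg_part (segment_mat n x y t $$ (i, j)))" if "i < n" "j < n" for i j
    using that by (simp add: segment_mat_def) (intro continuous_intros)
  show "segment_mat n x y 0 = x" "segment_mat n x y 1 = y"
    using x y by (auto simp: segment_mat_def intro!: eq_matI)
qed

text \<open>If \<open>w\<close> is the inverse of \<open>z\<close>, then \<open>x w = 1 - (z - x) w\<close> and \<open>w x = 1 - w (z - x)\<close> are invertible for \<open>x\<close> near
\<open>z\<close>.\<close>

lemma GL_open:
  assumes z: "z \<in> GL n"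
  shows "\<exists>\<delta>>0. \<forall>x \<in> carrier_mat n n. scalar_mat x = 1\<^sub>m n \<longrightarrow> mnorm (x - z) < \<delta> \<longrightarrow> x \<in> GL n"
proof -
  note zc = GL_D(1)[OF z]
  obtain w where w: "w \<in> carrier_mat n n" "z * w = 1\<^sub>m n" "w * z = 1\<^sub>m n" using GL_D(3)[OF z] by blast
  let ?\<delta> = "1 / (mnorm w + 1)"
  have "x \<in> GL n" if x: "x \<in> carrier_mat n n" "scalar_mat x = 1\<^sub>m n" "mnorm (x - z) < ?\<delta>" for x
  proof -
    have small: "mnorm (z - x) * mnorm w < 1"
    proof -
      have "mnorm (z - x) * mnorm w \<le> mnorm (x - z) * (mnorm w + 1)"
        using mnorm_minus_commute[OF x(1) zc] by (auto intro!: mult_left_mono simp: mnorm_nonneg)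
      also have "\<dots> < 1" using x(3) mnorm_nonneg[of w] by (simp add: pos_less_divide_eq)
      finally show ?thesis .
    qed
    have d: "(z - x) * w \<in> carrier_mat n n" "w * (z - x) \<in> carrier_mat n n" using x(1) w(1) by auto
    have "mnorm ((z - x) * w) < 1" "mnorm (w * (z - x)) < 1"
      using small mnorm_mult_le[of "z - x" n n w n] mnorm_mult_le[of w n n "z - x" n] x(1) w(1)
      by (simp_all add: minus_carrier_mat mult.commute)
    then obtain p q where p: "p \<in> carrier_mat n n" "(1\<^sub>m n - (z - x) * w) * p = 1\<^sub>m n"
      and q: "q \<in> carrier_mat n n" "q * (1\<^sub>m n - w * (z - x)) = 1\<^sub>m n"
      using neumann_inverse[OF d(1)] neumann_inverse[OF d(2)] by blast
    have e: "1\<^sub>m n - (z - x) * w = x * w" "1\<^sub>m n - w * (z - x) = w * x"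
    proof -
      have "(z - x) * w = 1\<^sub>m n - x * w" "w * (z - x) = 1\<^sub>m n - w * x"
        using minus_mult_distrib_mat[OF zc x(1) w(1)] mult_minus_distrib_mat[OF w(1) zc x(1)] w by simp_all
      thus "1\<^sub>m n - (z - x) * w = x * w" "1\<^sub>m n - w * (z - x) = w * x"
        using x(1) w(1) by (auto intro!: eq_matI)
    qed
    have 1: "x * (w * p) = 1\<^sub>m n" using p(2) assoc_mult_mat[OF x(1) w(1) p(1)] by (simp add: e)
    have 2: "(q * w) * x = 1\<^sub>m n" using q(2) assoc_mult_mat[OF q(1) w(1) x(1)] by (simp add: e)
    have wp: "w * p \<in> carrier_mat n n" and qw: "q * w \<in> carrier_mat n n" using w(1) p(1) q(1) by auto
    have "q * w = q * w * (x * (w * p))" unfolding 1 by (rule right_mult_one_mat[OF qw, symmetric])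
    also have "\<dots> = q * w * x * (w * p)" by (rule assoc_mult_mat[OF qw x(1) wp, symmetric])
    finally have "q * w = w * p" unfolding 2 left_mult_one_mat[OF wp] .
    thus "x \<in> GL n" using GL_I[OF x(1,2) wp 1] 2 by simp
  qed
  moreover have "0 < ?\<delta>" using mnorm_nonneg[of w] by (simp add: add_nonneg_pos)
  ultimately show ?thesis by blast
qed

context hereditary_morphism
begin

text \<open>The set \<open>1 + M\<^sub>n(I)\<close>, in which invertibility can be tested after applying \<open>\<psi>\<close>.\<close>

definition one_plus_ideal_mats :: "nat \<Rightarrow> 'a unitization mat set" where
  "one_plus_ideal_mats n = {x \<in> ideal_unit_mats n. scalar_mat x = 1\<^sub>m n}"

lemma segment_mat_M\<Phi>:
  assumes "x \<in> carrier_mat n n" "y \<in> carrier_mat n n"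
  shows "M\<Phi> (segment_mat n x y t) = segment_mat n (M\<Phi> x) (M\<Phi> y) t"
proof -
  have "\<Phi> (r *\<^sub>R u + s *\<^sub>R v) = r *\<^sub>R \<Phi> u + s *\<^sub>R \<Phi> v" for r s u v
    using bounded_linear.linear[OF bounded_linear_\<psi>]
    by (simp add: unitization_eq_iff linear_add linear_scale)
  thus ?thesis using assms by (auto simp: segment_mat_def intro!: eq_matI)
qed

lemma segment_mat_ideal:
  assumes "x \<in> one_plus_ideal_mats n" "y \<in> one_plus_ideal_mats n"
  shows "segment_mat n x y t \<in> one_plus_ideal_mats n"
proof -
  have "r *\<^sub>R a \<in> I" if "a \<in> I" for r a using ideal_scaleC[OF that, of "of_real r"] by (simp add: scaleC_of_real)
  thus ?thesis using assms segment_mat_scalar[of x n y "1\<^sub>m n" t]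
    by (auto simp: one_plus_ideal_mats_def ideal_unit_mats_def segment_mat_def intro!: ideal_add)
qed

lemma GL_of_image_GL:
  assumes x: "x \<in> one_plus_ideal_mats n" and GL: "M\<Phi> x \<in> GL n"
  shows "x \<in> GL n"
proof (cases "n = 0")
  case True
  thus ?thesis using x by (intro GL_I[of _ _ x]) (auto simp: one_plus_ideal_mats_def ideal_unit_mats_def)
next
  case False
  have x': "x \<in> ideal_unit_mats n" "scalar_mat x = 1\<^sub>m n" using x by (auto simp: one_plus_ideal_mats_def)
  show ?thesis using invertible_of_image_invertible[OF x'] GL_D(3)[OF GL] False GL_I[OF ideal_unit_mats_carrier[OF x'(1)] x'(2)] by blast
qed

lemma one_plus_ideal_mats_dense:
  assumes "y \<in> carrier_mat n n" "scalar_mat y = 1\<^sub>m n" "0 < \<epsilon>"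
  shows "\<exists>c \<in> one_plus_ideal_mats n. mnorm (M\<Phi> c - y) < \<epsilon>"
  using approx_image[OF assms(1,3)] assms(2) by (auto simp: one_plus_ideal_mats_def)

lemma GL_image_dense:
  assumes z: "z \<in> GL n"
  shows "\<exists>x \<in> GL n. GL_path_connected n (M\<Phi> x) z"
proof -
  note zc = GL_D[OF z]
  obtain \<delta> where d: "0 < \<delta>" "\<And>x. x \<in> carrier_mat n n \<Longrightarrow> scalar_mat x = 1\<^sub>m n \<Longrightarrow> mnorm (x - z) < \<delta> \<Longrightarrow> x \<in> GL n"
    using GL_open[OF z] by blast
  obtain c where c: "c \<in> one_plus_ideal_mats n" "mnorm (M\<Phi> c - z) < \<delta>"
    using one_plus_ideal_mats_dense[OF zc(1,2) d(1)] by blast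
  have cc: "c \<in> carrier_mat n n" "scalar_mat c = 1\<^sub>m n"
    using c(1) ideal_unit_mats_carrier by (auto simp: one_plus_ideal_mats_def)
  have "M\<Phi> c \<in> GL n" using d(2)[OF _ _ c(2)] cc by simp
  hence "c \<in> GL n" by (rule GL_of_image_GL[OF c(1)])
  moreover have "mnorm (z - z) < \<delta>" using d(1) zc(1) by (simp add: mnorm_def)
  hence "GL_path_connected n (M\<Phi> c) z"
    using cc zc c(2) by (intro segment_mat_path d(2) segment_mat_in_ball segment_mat_scalar) auto
  ultimately show ?thesis by blast
qed

text \<open>Call a matrix over \<open>1 + M\<^sub>n(I)\<close> close to \<open>F t\<close> if its image lies in a ball around \<open>F t\<close> all of whose
admissible elements are invertible.  Two matrices close to the same \<open>F t\<close> are joined by a segment, since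
its image stays in the ball.  For \<open>s\<close> near \<open>t\<close> some matrix is close to both \<open>F s\<close> and \<open>F t\<close>, so by
connectedness of the unit interval all matrices close to \<open>F 0\<close> are joined to all those close to \<open>F 1\<close>.
The endpoints are joined to such matrices by segments in the source.\<close>

lemma GL_path_lift:
  assumes x: "x \<in> GL n" and y: "y \<in> GL n" and path: "GL_path_connected n (M\<Phi> x) (M\<Phi> y)"
  shows "GL_path_connected n x y"
proof -
  obtain F where *: "(\<forall>t\<in>{0..1}. F t \<in> GL n)
      \<and> (\<forall>i<n. \<forall>j<n. continuous_on {0..1::real} (\<lambda>t. alg_part (F t $$ (i, j))))
      \<and> F 0 = M\<Phi> x \<and> F 1 = M\<Phi> y"
    using path unfolding GL_path_connected_def ..
  have F: "\<And>t. t \<in> {0..1} \<Longrightarrow> F t \<in> GL n" "F 0 = M\<Phi> x" "F 1 = M\<Phi> y"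
    and cont: "\<And>i j. i < n \<Longrightarrow> j < n \<Longrightarrow> continuous_on {0..1} (\<lambda>t. alg_part (F t $$ (i, j)))"
    using * by simp_all
  have "\<exists>\<delta>>0. \<forall>z \<in> carrier_mat n n. scalar_mat z = 1\<^sub>m n \<longrightarrow> mnorm (z - F t) < \<delta> \<longrightarrow> z \<in> GL n" if "t \<in> {0..1}" for t
    by (rule GL_open[OF F(1)[OF that]])
  then obtain \<delta> where d: "\<And>t. t \<in> {0..1} \<Longrightarrow> 0 < \<delta> t"
    "\<And>t z. t \<in> {0..1} \<Longrightarrow> z \<in> carrier_mat n n \<Longrightarrow> scalar_mat z = 1\<^sub>m n \<Longrightarrow> mnorm (z - F t) < \<delta> t \<Longrightarrow> z \<in> GL n"
    by metis
  have ucarr: "c \<in> carrier_mat n n" "scalar_mat c = 1\<^sub>m n" if "c \<in> one_plus_ideal_mats n" for c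
    using that ideal_unit_mats_carrier by (auto simp: one_plus_ideal_mats_def)
  have local: "GL_path_connected n c c'"
    if t: "t \<in> {0..1}" and c: "c \<in> one_plus_ideal_mats n" "c' \<in> one_plus_ideal_mats n"
      and near: "mnorm (M\<Phi> c - F t) < \<delta> t" "mnorm (M\<Phi> c' - F t) < \<delta> t" for t c c'
  proof (rule segment_mat_path)
    fix s :: real assume s: "s \<in> {0..1}"
    have "M\<Phi> (segment_mat n c c' s) \<in> GL n"
      unfolding segment_mat_M\<Phi>[OF ucarr(1)[OF c(1)] ucarr(1)[OF c(2)]]
      using ucarr[OF c(1)] ucarr[OF c(2)] GL_D(1)[OF F(1)[OF t]] s near
      by (intro d(2)[OF t] segment_mat_in_ball segment_mat_scalar) auto
    thus "segment_mat n c c' s \<in> GL n" by (rule GL_of_image_GL[OF segment_mat_ideal[OF c]])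
  qed (use ucarr c in auto)
  define R where "R s t \<longleftrightarrow> (\<forall>c \<in> one_plus_ideal_mats n. \<forall>c' \<in> one_plus_ideal_mats n.
      mnorm (M\<Phi> c - F s) < \<delta> s \<longrightarrow> mnorm (M\<Phi> c' - F t) < \<delta> t \<longrightarrow> GL_path_connected n c c')" for s t
  have "R 0 1"
  proof (rule connected_equivalence_relation[of "{0..1::real}"])
    show "R t s" if "R s t" for s t using that GL_path_connected_sym unfolding R_def by blast
    show "R r t" if "R r s" "R s t" "s \<in> {0..1}" for r s t
    proof -
      obtain c where "c \<in> one_plus_ideal_mats n" "mnorm (M\<Phi> c - F s) < \<delta> s"
        using one_plus_ideal_mats_dense[OF GL_D(1,2)[OF F(1)] d(1)] \<open>s \<in> {0..1}\<close> by blast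
      thus ?thesis using \<open>R r s\<close> \<open>R s t\<close> GL_path_connected_trans unfolding R_def by blast
    qed
    fix s :: real assume s: "s \<in> {0..1}"
    let ?T = "{t \<in> {0..1}. mnorm (F t - F s) < \<delta> s}"
    have mn: "mnorm (F t - F s) = (\<Sum>i<n. \<Sum>j<n. norm (alg_part (F t $$ (i, j)) - alg_part (F s $$ (i, j))))"
      if "t \<in> {0..1}" for t
    proof -
      note cs = GL_D[OF F(1)[OF s]] and ct = GL_D[OF F(1)[OF that]]
      have "scalar_part (F t $$ (i, j)) = scalar_part (F s $$ (i, j))" if "i < n" "j < n" for i j
        using arg_cong[OF cs(2), of "\<lambda>m. m $$ (i, j)"] arg_cong[OF ct(2), of "\<lambda>m. m $$ (i, j)"] that cs(1) ct(1) by simp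
      thus ?thesis using cs(1) ct(1) by (simp add: mnorm_def norm_unitization_def)
    qed
    have "continuous_on {0..1} (\<lambda>t. mnorm (F t - F s))"
      by (rule continuous_on_eq[OF _ mn[symmetric]]) (auto intro!: continuous_intros cont)
    hence "openin (top_of_set {0..1}) ({0..1} \<inter> (\<lambda>t. mnorm (F t - F s)) -` {..<\<delta> s})"
      by (rule continuous_openin_preimage_gen) simp
    also have "{0..1} \<inter> (\<lambda>t. mnorm (F t - F s)) -` {..<\<delta> s} = ?T" by auto
    finally have "openin (top_of_set {0..1}) ?T" .
    moreover have "s \<in> ?T" using s d(1)[OF s] GL_D(1)[OF F(1)[OF s]] by (simp add: mnorm_def)
    moreover have "R s t" if "t \<in> ?T" for t
      unfolding R_def
    proof (intro ballI impI)
      fix c c' assume c: "c \<in> one_plus_ideal_mats n" "c' \<in> one_plus_ideal_mats n"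
        and near: "mnorm (M\<Phi> c - F s) < \<delta> s" "mnorm (M\<Phi> c' - F t) < \<delta> t"
      have t: "t \<in> {0..1}" "mnorm (F t - F s) < \<delta> s" using that by auto
      obtain p where p: "p \<in> one_plus_ideal_mats n" "mnorm (M\<Phi> p - F t) < min (\<delta> t) (\<delta> s - mnorm (F t - F s))"
        using one_plus_ideal_mats_dense[OF GL_D(1,2)[OF F(1)[OF t(1)]], of "min (\<delta> t) (\<delta> s - mnorm (F t - F s))"]
          d(1)[OF t(1)] t(2) by auto
      have "mnorm (M\<Phi> p - F s) \<le> mnorm (M\<Phi> p - F t) + mnorm (F t - F s)"
        using ucarr(1)[OF p(1)] GL_D(1)[OF F(1)[OF t(1)]] GL_D(1)[OF F(1)[OF s]]
        by (intro mnorm_diff_triangle[where n = n and m = n]) auto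
      hence "mnorm (M\<Phi> p - F s) < \<delta> s" using p(2) by simp
      thus "GL_path_connected n c c'"
        using local[OF s c(1) p(1) near(1)] local[OF t(1) p(1) c(2) _ near(2)] p(2) GL_path_connected_trans by auto
    qed
    ultimately show "\<exists>T. openin (top_of_set {0..1}) T \<and> s \<in> T \<and> (\<forall>t\<in>T. R s t)" by blast
  qed auto
  moreover have "\<exists>c \<in> one_plus_ideal_mats n. mnorm (M\<Phi> c - M\<Phi> z) < \<epsilon> \<and> GL_path_connected n z c"
    if z: "z \<in> GL n" and e: "0 < \<epsilon>" for z \<epsilon>
  proof -
    note zc = GL_D[OF z]
    obtain K where K: "0 < K" "\<And>x. norm (\<Phi> x) \<le> K * norm x" using norm_\<Phi>_le by blast
    obtain \<gamma> where g: "0 < \<gamma>" "\<And>x. x \<in> carrier_mat n n \<Longrightarrow> scalar_mat x = 1\<^sub>m n \<Longrightarrow> mnorm (x - z) < \<gamma> \<Longrightarrow> x \<in> GL n"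
      using GL_open[OF z] by blast
    obtain c where c: "c \<in> ideal_unit_mats n" "scalar_mat c = scalar_mat z" "mnorm (c - z) < min \<gamma> (\<epsilon> / K)"
      using approx_domain[OF zc(1), of "min \<gamma> (\<epsilon> / K)"] g(1) e K(1) by auto
    note cc = ideal_unit_mats_carrier[OF c(1)]
    have "mnorm (M\<Phi> c - M\<Phi> z) = mnorm (M\<Phi> (c - z))" using M\<Phi>_square(2)[OF cc zc(1)] by simp
    also have "\<dots> \<le> K * mnorm (c - z)"
      unfolding mnorm_def sum_distrib_left using K(2) by (auto intro!: sum_mono)
    also have "\<dots> < \<epsilon>" using c(3) K(1) by (simp add: pos_less_divide_eq mult.commute)
    finally have "mnorm (M\<Phi> c - M\<Phi> z) < \<epsilon>" .
    moreover have "mnorm (z - z) < \<gamma>" using g(1) zc(1) by (simp add: mnorm_def)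
    hence "GL_path_connected n z c"
      using cc zc c by (intro segment_mat_path g(2) segment_mat_in_ball segment_mat_scalar) auto
    ultimately show ?thesis using c zc(2) by (auto simp: one_plus_ideal_mats_def)
  qed
  from this[OF x, of "\<delta> 0"] this[OF y, of "\<delta> 1"] d(1)
  obtain c c' where "c \<in> one_plus_ideal_mats n" "mnorm (M\<Phi> c - F 0) < \<delta> 0" "GL_path_connected n x c"
    "c' \<in> one_plus_ideal_mats n" "mnorm (M\<Phi> c' - F 1) < \<delta> 1" "GL_path_connected n y c'"
    unfolding F by auto
  ultimately show ?thesis
    using GL_path_connected_sym GL_path_connected_trans unfolding R_def by blast
qed

end

section \<open>The monoid of idempotents\<close>

lemma idempotents_iff: "e \<in> idempotents \<longleftrightarrow> e \<in> carrier_mat (dim_row e) (dim_row e) \<and> e * e = e"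
  unfolding idempotents_def carrier_mat_def by auto

lemma idempotentsI: "e \<in> carrier_mat n n \<Longrightarrow> e * e = e \<Longrightarrow> e \<in> idempotents"
  by (auto simp: idempotents_iff)

lemma direct_sum_carrier:
  "x \<in> carrier_mat n m \<Longrightarrow> y \<in> carrier_mat n' m' \<Longrightarrow> x \<oplus>\<^sub>d y \<in> carrier_mat (n + n') (m + m')"
  by (auto simp: direct_sum_def)

lemma direct_sum_dims [simp]:
  "dim_row (x \<oplus>\<^sub>d y) = dim_row x + dim_row y" "dim_col (x \<oplus>\<^sub>d y) = dim_col x + dim_col y"
  by (auto simp: direct_sum_def)

lemma direct_sum_index:
  "i < dim_row x + dim_row y \<Longrightarrow> j < dim_col x + dim_col y \<Longrightarrow> (x \<oplus>\<^sub>d y) $$ (i, j) =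
    (if i < dim_row x then if j < dim_col x then x $$ (i, j) else 0
     else if j < dim_col x then 0 else y $$ (i - dim_row x, j - dim_col x))"
  by (auto simp: direct_sum_def)

lemma direct_sum_mult:
  assumes "x \<in> carrier_mat n m" "y \<in> carrier_mat m k" "x' \<in> carrier_mat n' m'" "y' \<in> carrier_mat m' k'"
  shows "(x \<oplus>\<^sub>d x') * (y \<oplus>\<^sub>d y') = (x * y) \<oplus>\<^sub>d (x' * y')"
proof -
  have d: "dim_row x = n" "dim_col x = m" "dim_row y = m" "dim_col y = k"
    "dim_row x' = n'" "dim_col x' = m'" "dim_row y' = m'" "dim_col y' = k'" using assms by auto
  show ?thesis unfolding direct_sum_def d index_mult_mat
    by (subst mult_four_block_mat[OF assms(1) zero_carrier_mat zero_carrier_mat assms(3,2) zero_carrier_mat zero_carrier_mat assms(4)])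
      (use assms in \<open>auto intro!: cong_four_block_mat\<close>)
qed

lemma direct_sum_assoc: "(x \<oplus>\<^sub>d y) \<oplus>\<^sub>d z = x \<oplus>\<^sub>d (y \<oplus>\<^sub>d z)"
  using assoc_four_block_mat[of x y z] by (simp add: direct_sum_def)

lemma direct_sum_zero: "0\<^sub>m 0 0 \<oplus>\<^sub>d x = x"
  by (rule eq_matI) (auto simp: direct_sum_index)

lemma direct_sum_idempotents: "e \<in> idempotents \<Longrightarrow> f \<in> idempotents \<Longrightarrow> e \<oplus>\<^sub>d f \<in> idempotents"
proof -
  assume "e \<in> idempotents" "f \<in> idempotents"
  hence e: "e \<in> carrier_mat (dim_row e) (dim_row e)" "e * e = e"
    and f: "f \<in> carrier_mat (dim_row f) (dim_row f)" "f * f = f"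
    by (simp_all add: idempotents_iff)
  show ?thesis
    by (rule idempotentsI[OF direct_sum_carrier[OF e(1) f(1)]])
      (simp only: direct_sum_mult[OF e(1) e(1) f(1) f(1)] e(2) f(2))
qed

lemma idem_equiv_refl: "e \<in> idempotents \<Longrightarrow> idem_equiv e e"
  unfolding idempotents_iff by (elim conjE) (rule idem_equivI[of e _ _ e])

lemma idem_equiv_sym: "e \<in> idempotents \<Longrightarrow> f \<in> idempotents \<Longrightarrow> idem_equiv e f \<Longrightarrow> idem_equiv f e"
  unfolding idem_equiv_def by blast

lemma idem_equiv_sum:
  assumes "e \<in> idempotents" "f \<in> idempotents" "e' \<in> idempotents" "f' \<in> idempotents"
    and "idem_equiv e f" "idem_equiv e' f'"
  shows "idem_equiv (e \<oplus>\<^sub>d e') (f \<oplus>\<^sub>d f')"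
proof -
  have c: "e \<in> carrier_mat (dim_row e) (dim_row e)" "f \<in> carrier_mat (dim_row f) (dim_row f)"
    "e' \<in> carrier_mat (dim_row e') (dim_row e')" "f' \<in> carrier_mat (dim_row f') (dim_row f')"
    using assms by (simp_all add: idempotents_iff)
  obtain x y where x: "x \<in> carrier_mat (dim_row e) (dim_row f)" "y \<in> carrier_mat (dim_row f) (dim_row e)" "x * y = e" "y * x = f"
    using idem_equivE[OF assms(5) c(1,2)] .
  obtain x' y' where x': "x' \<in> carrier_mat (dim_row e') (dim_row f')" "y' \<in> carrier_mat (dim_row f') (dim_row e')" "x' * y' = e'" "y' * x' = f'"
    using idem_equivE[OF assms(6) c(3,4)] .
  show ?thesis
    using direct_sum_mult[OF x(1,2) x'(1,2)] direct_sum_mult[OF x(2,1) x'(2,1)] x x'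
    by (intro idem_equivI[OF direct_sum_carrier[OF x(1) x'(1)] direct_sum_carrier[OF x(2) x'(2)]
          direct_sum_carrier[OF c(1,3)] direct_sum_carrier[OF c(2,4)]]) simp_all
qed

text \<open>The equivalence interchanges the two diagonal blocks.\<close>

lemma idem_equiv_sum_commute:
  assumes "e \<in> idempotents" "f \<in> idempotents"
  shows "idem_equiv (e \<oplus>\<^sub>d f) (f \<oplus>\<^sub>d e)"
proof -
  define n m where "n = dim_row e" and "m = dim_row f"
  have c: "e \<in> carrier_mat n n" "f \<in> carrier_mat m m" "e * e = e" "f * f = f"
    using assms by (simp_all add: idempotents_iff n_def m_def)
  define x y where "x = four_block_mat (0\<^sub>m n m) e f (0\<^sub>m m n)" and "y = four_block_mat (0\<^sub>m m n) f e (0\<^sub>m n m)"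
  have "x * y = e \<oplus>\<^sub>d f" "y * x = f \<oplus>\<^sub>d e"
    using c unfolding x_def y_def direct_sum_def
    by (subst mult_four_block_mat[OF zero_carrier_mat _ _ zero_carrier_mat zero_carrier_mat _ _ zero_carrier_mat];
      auto intro!: cong_four_block_mat)+
  moreover have "x \<in> carrier_mat (n + m) (m + n)" "y \<in> carrier_mat (m + n) (n + m)"
    using c by (auto simp: x_def y_def)
  ultimately show ?thesis using c
    by (intro idem_equivI[of x "n + m" "m + n" y]) (auto intro!: direct_sum_carrier)
qed

lemma idem_equiv_trans':
  "e \<in> idempotents \<Longrightarrow> f \<in> idempotents \<Longrightarrow> g \<in> idempotents \<Longrightarrow> idem_equiv e f \<Longrightarrow> idem_equiv f g
    \<Longrightarrow> idem_equiv e g"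
  using idem_equiv_trans[of e f g] unfolding idempotents_iff by blast

definition idem_rel :: "'r::ring_1 mat \<Rightarrow> 'r mat \<Rightarrow> bool" where
  "idem_rel e f \<longleftrightarrow> e \<in> idempotents \<and> f \<in> idempotents \<and> idem_equiv e f"

lemma zero_idempotent: "0\<^sub>m 0 0 \<in> idempotents"
  by (rule idempotentsI[of _ 0]) auto

text \<open>Equivalence classes of idempotents of all sizes form a commutative monoid under direct sums.  As a type
of class \<open>comm_monoid_add\<close> it makes the computations with \<open>K\<^sub>0\<close> accessible to the simplifier.\<close>

quotient_type (overloaded) 'r idem_class = "'r::ring_1 mat" / partial: idem_rel
proof (rule part_equivpI)
  show "\<exists>x. idem_rel x x"
    using zero_idempotent idem_equiv_refl unfolding idem_rel_def by blast
  show "symp idem_rel" unfolding idem_rel_def by (auto intro!: sympI idem_equiv_sym)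
  show "transp idem_rel" unfolding idem_rel_def by (intro transpI) (blast intro: idem_equiv_trans')
qed

instantiation idem_class :: (ring_1) comm_monoid_add
begin

lift_definition zero_idem_class :: "'a idem_class" is "0\<^sub>m 0 0"
  using zero_idempotent idem_equiv_refl unfolding idem_rel_def by blast

lift_definition plus_idem_class :: "'a idem_class \<Rightarrow> 'a idem_class \<Rightarrow> 'a idem_class" is direct_sum
  unfolding idem_rel_def by (blast intro: direct_sum_idempotents idem_equiv_sum)

instance
proof
  show "a + b + c = a + (b + c)" for a b c :: "'a idem_class"
    by transfer (auto simp: direct_sum_assoc idem_rel_def intro!: idem_equiv_refl direct_sum_idempotents)
  show "a + b = b + a" for a b :: "'a idem_class"
    by transfer (auto simp: idem_rel_def intro!: idem_equiv_sum_commute direct_sum_idempotents)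
  show "0 + a = a" for a :: "'a idem_class"
    by transfer (simp add: direct_sum_zero)
qed

end

abbreviation icls :: "'r::ring_1 mat \<Rightarrow> 'r idem_class" where "icls \<equiv> abs_idem_class"

lemma icls_eq_iff: "e \<in> idempotents \<Longrightarrow> f \<in> idempotents \<Longrightarrow> icls e = icls f \<longleftrightarrow> idem_equiv e f"
  using Quotient3_rel[OF Quotient3_idem_class, of e f] by (simp add: idem_rel_def idem_equiv_refl)

lemma icls_sum: "e \<in> idempotents \<Longrightarrow> f \<in> idempotents \<Longrightarrow> icls (e \<oplus>\<^sub>d f) = icls e + icls f"
  by (rule plus_idem_class.abs_eq[symmetric]) (auto simp: idem_rel_def idem_equiv_refl)

lemma icls_exhaust: obtains e where "e \<in> idempotents" "G = icls e"
proof
  show "rep_idem_class G \<in> idempotents"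
    using Quotient3_rep_reflp[OF Quotient3_idem_class, of G] by (simp add: idem_rel_def)
  show "G = icls (rep_idem_class G)"
    by (rule Quotient3_abs_rep[OF Quotient3_idem_class, symmetric])
qed

section \<open>The Grothendieck group\<close>

lemma K0_rel_iff:
  "((e, f), (e', f')) \<in> K0_rel \<longleftrightarrow> e \<in> idempotents \<and> f \<in> idempotents \<and> e' \<in> idempotents \<and> f' \<in> idempotents
    \<and> (\<exists>G. icls e + icls f' + G = icls e' + icls f + G)"
proof -
  have "(\<exists>g\<in>idempotents. idem_equiv (e \<oplus>\<^sub>d f' \<oplus>\<^sub>d g) (e' \<oplus>\<^sub>d f \<oplus>\<^sub>d g))
      \<longleftrightarrow> (\<exists>G. icls e + icls f' + G = icls e' + icls f + G)"
    if "e \<in> idempotents" "f \<in> idempotents" "e' \<in> idempotents" "f' \<in> idempotents"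
  proof -
    have "idem_equiv (e \<oplus>\<^sub>d f' \<oplus>\<^sub>d g) (e' \<oplus>\<^sub>d f \<oplus>\<^sub>d g)
        \<longleftrightarrow> icls e + icls f' + icls g = icls e' + icls f + icls g" if "g \<in> idempotents" for g
      using that \<open>e \<in> idempotents\<close> \<open>f \<in> idempotents\<close> \<open>e' \<in> idempotents\<close> \<open>f' \<in> idempotents\<close>
      by (simp add: icls_eq_iff[symmetric] icls_sum direct_sum_idempotents add.assoc)
    thus ?thesis by (metis icls_exhaust)
  qed
  thus ?thesis unfolding K0_rel_def by blast
qed

lemma equiv_K0_rel: "equiv (idempotents \<times> idempotents) (K0_rel :: (('r::ring_1 mat \<times> 'r mat) \<times> ('r mat \<times> 'r mat)) set)"
proof (rule equivI)
  show "(K0_rel :: (('r mat \<times> 'r mat) \<times> ('r mat \<times> 'r mat)) set) \<subseteq> (idempotents \<times> idempotents) \<times> (idempotents \<times> idempotents)"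
    by (auto simp: K0_rel_iff)
  show "refl_on (idempotents \<times> idempotents) (K0_rel :: (('r mat \<times> 'r mat) \<times> ('r mat \<times> 'r mat)) set)"
    by (rule refl_onI) (auto simp: K0_rel_iff)
  show "sym (K0_rel :: (('r mat \<times> 'r mat) \<times> ('r mat \<times> 'r mat)) set)"
    by (rule symI) (auto simp: K0_rel_iff, metis)
  show "trans (K0_rel :: (('r mat \<times> 'r mat) \<times> ('r mat \<times> 'r mat)) set)"
  proof (rule transI, clarify)
    fix e f e' f' e'' f'' :: "'r mat"
    assume 1: "((e, f), (e', f')) \<in> K0_rel" and 2: "((e', f'), (e'', f'')) \<in> K0_rel"
    then obtain G H where G: "icls e + icls f' + G = icls e' + icls f + G"
      and H: "icls e' + icls f'' + H = icls e'' + icls f' + H" by (auto simp: K0_rel_iff)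
    have "icls e + icls f'' + (icls f' + icls e' + G + H) = (icls e + icls f' + G) + (icls e' + icls f'' + H)"
      by (simp add: ac_simps)
    also have "\<dots> = icls e'' + icls f + (icls f' + icls e' + G + H)"
      unfolding G H by (simp add: ac_simps)
    finally show "((e, f), (e'', f'')) \<in> K0_rel" using 1 2 by (auto simp: K0_rel_iff)
  qed
qed

abbreviation K0_class :: "'r::ring_1 mat \<Rightarrow> 'r mat \<Rightarrow> ('r mat \<times> 'r mat) set" where
  "K0_class e f \<equiv> K0_rel `` {(e, f)}"

lemma K0_class_eq_iff:
  assumes "e \<in> idempotents" "f \<in> idempotents" "e' \<in> idempotents" "f' \<in> idempotents"
  shows "K0_class e f = K0_class e' f' \<longleftrightarrow> (\<exists>G. icls e + icls f' + G = icls e' + icls f + G)"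
  using eq_equiv_class_iff[OF equiv_K0_rel, of "(e, f)" "(e', f')"] assms by (simp add: K0_rel_iff)

lemma UN_const: "x \<in> X \<Longrightarrow> (\<And>x. x \<in> X \<Longrightarrow> F x = c) \<Longrightarrow> (\<Union>x\<in>X. F x) = c"
  by blast

lemma K0_class_self: "e \<in> idempotents \<Longrightarrow> f \<in> idempotents \<Longrightarrow> (e, f) \<in> K0_class e f"
  by (simp add: K0_rel_iff)

lemma K0_unital_mult:
  assumes "e \<in> idempotents" "f \<in> idempotents" "e' \<in> idempotents" "f' \<in> idempotents"
  shows "K0_class e f \<otimes>\<^bsub>K0_unital t\<^esub> K0_class e' f' = K0_class (e \<oplus>\<^sub>d e') (f \<oplus>\<^sub>d f')"
proof -
  have const: "K0_class (a \<oplus>\<^sub>d a') (b \<oplus>\<^sub>d b') = K0_class (e \<oplus>\<^sub>d e') (f \<oplus>\<^sub>d f')"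
    if ab: "(a, b) \<in> K0_class e f" "(a', b') \<in> K0_class e' f'" for a b a' b'
  proof -
    have i: "a \<in> idempotents" "b \<in> idempotents" "a' \<in> idempotents" "b' \<in> idempotents"
      using ab by (auto simp: K0_rel_iff)
    obtain G H where G: "icls e + icls b + G = icls a + icls f + G"
      and H: "icls e' + icls b' + H = icls a' + icls f' + H" using ab by (auto simp: K0_rel_iff)
    have "icls a + icls a' + (icls f + icls f') + (G + H) = (icls a + icls f + G) + (icls a' + icls f' + H)"
      by (simp add: ac_simps)
    also have "\<dots> = icls e + icls e' + (icls b + icls b') + (G + H)"
      unfolding G[symmetric] H[symmetric] by (simp add: ac_simps)
    finally show ?thesis using assms i
      by (auto simp: K0_class_eq_iff icls_sum direct_sum_idempotents)
  qed
  have "(\<Union>(a', b')\<in>K0_class e' f'. K0_class (a \<oplus>\<^sub>d a') (b \<oplus>\<^sub>d b'))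
      = K0_class (e \<oplus>\<^sub>d e') (f \<oplus>\<^sub>d f')" if "(a, b) \<in> K0_class e f" for a b
  proof (rule UN_const[OF K0_class_self[OF assms(3,4)]])
    fix p assume "p \<in> K0_class e' f'"
    thus "(case p of (a', b') \<Rightarrow> K0_class (a \<oplus>\<^sub>d a') (b \<oplus>\<^sub>d b')) = K0_class (e \<oplus>\<^sub>d e') (f \<oplus>\<^sub>d f')"
      using const[OF that] by (cases p) simp
  qed
  note inner = this
  have "(\<Union>(a, b)\<in>K0_class e f. \<Union>(a', b')\<in>K0_class e' f'. K0_class (a \<oplus>\<^sub>d a') (b \<oplus>\<^sub>d b'))
      = K0_class (e \<oplus>\<^sub>d e') (f \<oplus>\<^sub>d f')"
  proof (rule UN_const[OF K0_class_self[OF assms(1,2)]])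
    fix p assume "p \<in> K0_class e f"
    thus "(case p of (a, b) \<Rightarrow> \<Union>(a', b')\<in>K0_class e' f'. K0_class (a \<oplus>\<^sub>d a') (b \<oplus>\<^sub>d b'))
        = K0_class (e \<oplus>\<^sub>d e') (f \<oplus>\<^sub>d f')"
      using inner by (cases p) simp
  qed
  thus ?thesis by (simp add: K0_unital_def)
qed

lemma K0_unital_carrierE:
  assumes "X \<in> carrier (K0_unital t)"
  obtains e f where "e \<in> idempotents" "f \<in> idempotents" "X = K0_class e f"
  using assms by (auto simp: K0_unital_def elim!: quotientE)

lemma K0_unital_carrierI: "e \<in> idempotents \<Longrightarrow> f \<in> idempotents \<Longrightarrow> K0_class e f \<in> carrier (K0_unital t)"
  by (auto simp: K0_unital_def intro!: quotientI)

context
  fixes h :: "'r::ring_1 \<Rightarrow> 's::ring_1"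
  assumes h: "Ring_Hom.ring_hom h"
begin

interpretation h: Ring_Hom.ring_hom h by (rule h)

lemma map_mat_idempotent: "e \<in> idempotents \<Longrightarrow> map_mat h e \<in> idempotents"
  unfolding idempotents_iff using h.mat_hom_mult[of e "dim_row e" "dim_row e" e "dim_row e"]
  by (elim conjE) (simp only: map_carrier_mat index_map_mat)

lemma map_mat_idem_equiv:
  assumes "e \<in> idempotents" "f \<in> idempotents" "idem_equiv e f"
  shows "idem_equiv (map_mat h e) (map_mat h f)"
proof -
  have c: "e \<in> carrier_mat (dim_row e) (dim_row e)" "f \<in> carrier_mat (dim_row f) (dim_row f)"
    using assms by (simp_all add: idempotents_iff)
  obtain x y where x: "x \<in> carrier_mat (dim_row e) (dim_row f)" "y \<in> carrier_mat (dim_row f) (dim_row e)" "x * y = e" "y * x = f"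
    using idem_equivE[OF assms(3) c] .
  show ?thesis
    by (rule idem_equivI[where n = "dim_row e" and m = "dim_row f",
          OF _ _ _ _ h.mat_hom_mult[OF x(1,2), unfolded x(3), symmetric]
          h.mat_hom_mult[OF x(2,1), unfolded x(4), symmetric]])
      (simp_all only: map_carrier_mat x c)
qed

lemma map_mat_direct_sum: "map_mat h (x \<oplus>\<^sub>d y) = map_mat h x \<oplus>\<^sub>d map_mat h y"
  by (rule eq_matI) (auto simp: direct_sum_index)

lemma icls_map_cong: 
  "e \<in> idempotents \<Longrightarrow> f \<in> idempotents \<Longrightarrow> icls e = icls f \<Longrightarrow> icls (map_mat h e) = icls (map_mat h f)"
  by (simp add: icls_eq_iff map_mat_idempotent map_mat_idem_equiv)

lemma K0_unital_map_class:
  assumes "e \<in> idempotents" "f \<in> idempotents"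
  shows "K0_unital_map h (K0_class e f) = K0_class (map_mat h e) (map_mat h f)"
proof -
  have "K0_class (map_mat h a) (map_mat h b) = K0_class (map_mat h e) (map_mat h f)"
    if ab: "(a, b) \<in> K0_class e f" for a b
  proof -
    have i: "a \<in> idempotents" "b \<in> idempotents" using ab by (auto simp: K0_rel_iff)
    obtain G where "icls e + icls b + G = icls a + icls f + G" using ab by (auto simp: K0_rel_iff)
    moreover obtain g where g: "g \<in> idempotents" "G = icls g" using icls_exhaust .
    ultimately have "icls (e \<oplus>\<^sub>d b \<oplus>\<^sub>d g) = icls (a \<oplus>\<^sub>d f \<oplus>\<^sub>d g)"
      using assms i by (simp add: icls_sum direct_sum_idempotents add.assoc)
    hence "icls (map_mat h (e \<oplus>\<^sub>d b \<oplus>\<^sub>d g)) = icls (map_mat h (a \<oplus>\<^sub>d f \<oplus>\<^sub>d g))"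
      using assms i g by (intro icls_map_cong direct_sum_idempotents)
    hence "icls (map_mat h e) + icls (map_mat h b) + icls (map_mat h g)
        = icls (map_mat h a) + icls (map_mat h f) + icls (map_mat h g)"
      using assms i g by (simp add: map_mat_direct_sum icls_sum direct_sum_idempotents map_mat_idempotent add.assoc)
    thus ?thesis using assms i by (subst K0_class_eq_iff) (auto simp: map_mat_idempotent intro: sym)
  qed
  note const = this
  show ?thesis unfolding K0_unital_map_def
  proof (rule UN_const[OF K0_class_self[OF assms]])
    fix p assume "p \<in> K0_class e f"
    thus "(case p of (a, b) \<Rightarrow> K0_class (map_mat h a) (map_mat h b)) = K0_class (map_mat h e) (map_mat h f)"
      using const by (cases p) simp
  qed
qed

end

context hereditary_morphism
begin

text \<open>Adding zero blocks brings both idempotents to the same positive size, and passing to equivalent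
idempotents over the unitization of \<open>I\<close> makes \<open>reflect_idem_equiv\<close> applicable.\<close>

lemma idem_equiv_lift:
  assumes e: "e \<in> idempotents" and f: "f \<in> idempotents" and ef: "idem_equiv (M\<Phi> e) (M\<Phi> f)"
  shows "idem_equiv e f"
proof -
  define n where "n = Suc (dim_row e + dim_row f)"
  define z :: "nat \<Rightarrow> 'a unitization mat" where "z = (\<lambda>k. 0\<^sub>m k k)"
  have z: "z k \<in> idempotents" for k by (rule idempotentsI[of _ k]) (simp_all add: z_def)
  have z0: "icls (z k) = 0" for k
  proof -
    have "idem_equiv (z k) (0\<^sub>m 0 0)"
      by (rule idem_equivI[of "0\<^sub>m k 0" k 0 "0\<^sub>m 0 k"]) (auto simp: z_def)
    hence "icls (z k) = icls (0\<^sub>m 0 0)" using icls_eq_iff[OF z zero_idempotent] by blast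
    thus ?thesis by (simp add: zero_idem_class.abs_eq)
  qed
  define e1 f1 where "e1 = e \<oplus>\<^sub>d z (n - dim_row e)" and "f1 = f \<oplus>\<^sub>d z (n - dim_row f)"
  have i1: "e1 \<in> idempotents" "f1 \<in> idempotents" 
    unfolding e1_def f1_def by (intro direct_sum_idempotents e f z)+
  have d: "dim_row e1 = n" "dim_row f1 = n" by (simp_all add: e1_def f1_def z_def n_def)
  have c1: "e1 \<in> carrier_mat n n" "e1 * e1 = e1" "f1 \<in> carrier_mat n n" "f1 * f1 = f1"
    using i1 unfolding idempotents_iff d by blast+
  have cls1: "icls e1 = icls e" "icls f1 = icls f"
    unfolding e1_def f1_def by (simp_all add: icls_sum e f z z0)
  have n: "0 < n" by (simp add: n_def)
  obtain e2 where e2: "e2 \<in> ideal_unit_mats n" "e2 * e2 = e2" "idem_equiv e1 e2"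
    using idempotent_equiv_ideal[OF c1(1,2) n] by blast
  obtain f2 where f2: "f2 \<in> ideal_unit_mats n" "f2 * f2 = f2" "idem_equiv f1 f2"
    using idempotent_equiv_ideal[OF c1(3,4) n] by blast
  have i2: "e2 \<in> idempotents" "f2 \<in> idempotents"
    by (rule idempotentsI[OF ideal_unit_mats_carrier[OF e2(1)] e2(2)])
      (rule idempotentsI[OF ideal_unit_mats_carrier[OF f2(1)] f2(2)])
  have cls2: "icls e2 = icls e" "icls f2 = icls f"
    using icls_eq_iff i1 i2 e2(3) f2(3) cls1 by metis+
  note m = map_mat_idempotent[OF ring_hom_\<Phi>]
  have "icls (M\<Phi> e2) = icls (M\<Phi> e)" "icls (M\<Phi> f2) = icls (M\<Phi> f)"
    using icls_map_cong[OF ring_hom_\<Phi>] i2 e f cls2 by blast+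
  moreover have "icls (M\<Phi> e) = icls (M\<Phi> f)" using icls_eq_iff[OF m[OF e] m[OF f]] ef by blast
  ultimately have "idem_equiv (M\<Phi> e2) (M\<Phi> f2)" using icls_eq_iff[OF m[OF i2(1)] m[OF i2(2)]] by simp
  hence "idem_equiv e2 f2" by (rule reflect_idem_equiv[OF e2(1,2) f2(1,2) n])
  thus ?thesis using icls_eq_iff i2 e f cls2 by metis
qed

lemma idempotent_image_surj:
  assumes e: "e \<in> idempotents"
  shows "\<exists>g \<in> idempotents. icls (M\<Phi> g) = icls e"
proof (cases "dim_row e = 0")
  case True
  hence "e = 0\<^sub>m 0 0" using e unfolding idempotents_iff by (intro eq_matI) auto
  moreover have "M\<Phi> (0\<^sub>m 0 0) = 0\<^sub>m 0 0" by (rule eq_matI) auto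
  ultimately show ?thesis using zero_idempotent by (intro bexI[of _ "0\<^sub>m 0 0"]) simp_all
next
  case False
  have c: "e \<in> carrier_mat (dim_row e) (dim_row e)" "e * e = e" using e unfolding idempotents_iff by blast+
  obtain g where g: "g \<in> carrier_mat (dim_row e) (dim_row e)" "g * g = g" "idem_equiv e (M\<Phi> g)"
    using idempotent_equiv_image[OF c] False by blast
  have gi: "g \<in> idempotents" by (rule idempotentsI[OF g(1,2)])
  thus ?thesis using icls_eq_iff[OF e map_mat_idempotent[OF ring_hom_\<Phi> gi]] g(3) by (intro bexI[of _ g]) simp_all
qed

lemma K0_map_class: "e \<in> idempotents \<Longrightarrow> f \<in> idempotents \<Longrightarrow> K0_map \<psi> (K0_class e f) = K0_class (M\<Phi> e) (M\<Phi> f)"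
  unfolding K0_map_def by (rule K0_unital_map_class[OF ring_hom_\<Phi>])

lemma K0_carrier_iff:
  fixes e f :: "'c::complex_banach_algebra unitization mat"
  assumes "e \<in> idempotents" "f \<in> idempotents"
  shows "K0_class e f \<in> carrier (K0 TYPE('c))
    \<longleftrightarrow> K0_class (scalar_mat e) (scalar_mat f) = \<one>\<^bsub>K0_unital TYPE(complex)\<^esub>"
  using assms by (simp add: K0_def kernel_def K0_unital_carrierI K0_unital_map_class[OF ring_hom_scalar_part])

lemma K0_carrierE:
  assumes "X \<in> carrier (K0 TYPE('c::complex_banach_algebra))"
  obtains e f where "e \<in> idempotents" "f \<in> idempotents" "X = K0_class e f"
proof -
  have "X \<in> carrier (K0_unital TYPE('c unitization))" using assms by (simp add: K0_def kernel_def)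
  thus ?thesis using that by (rule K0_unital_carrierE)
qed

text \<open>The map on equivalence classes of idempotents is bijective, so stable equivalence can be pulled back,
including the stabilising summand, and preimages of classes can be chosen summand by summand.\<close>

theorem K0_iso: "K0_map \<psi> \<in> iso (K0 TYPE('a)) (K0 TYPE('b))"
proof -
  note m = map_mat_idempotent[OF ring_hom_\<Phi>]
  have carr: "K0_map \<psi> X \<in> carrier (K0 TYPE('b))" if X: "X \<in> carrier (K0 TYPE('a))" for X
  proof -
    obtain e f where ef: "e \<in> idempotents" "f \<in> idempotents" "X = K0_class e f" using K0_carrierE[OF X] .
    show ?thesis using X ef by (simp add: K0_map_class K0_carrier_iff m)
  qed
  have mult: "K0_map \<psi> (X \<otimes>\<^bsub>K0 TYPE('a)\<^esub> Y) = K0_map \<psi> X \<otimes>\<^bsub>K0 TYPE('b)\<^esub> K0_map \<psi> Y"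
    if X: "X \<in> carrier (K0 TYPE('a))" and Y: "Y \<in> carrier (K0 TYPE('a))" for X Y
  proof -
    obtain e f where ef: "e \<in> idempotents" "f \<in> idempotents" "X = K0_class e f" using K0_carrierE[OF X] .
    obtain e' f' where ef': "e' \<in> idempotents" "f' \<in> idempotents" "Y = K0_class e' f'" using K0_carrierE[OF Y] .
    have mm: "A \<otimes>\<^bsub>K0 TYPE('c::complex_banach_algebra)\<^esub> B = A \<otimes>\<^bsub>K0_unital TYPE('c unitization)\<^esub> B" for A B
      by (simp add: K0_def)
    show ?thesis using ef ef'
      by (simp add: mm K0_unital_mult K0_map_class m direct_sum_idempotents map_mat_direct_sum[OF ring_hom_\<Phi>])
  qed
  have inj: "X = Y" if X: "X \<in> carrier (K0 TYPE('a))" and Y: "Y \<in> carrier (K0 TYPE('a))"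
    and eq: "K0_map \<psi> X = K0_map \<psi> Y" for X Y
  proof -
    obtain e f where ef: "e \<in> idempotents" "f \<in> idempotents" "X = K0_class e f" using K0_carrierE[OF X] .
    obtain e' f' where ef': "e' \<in> idempotents" "f' \<in> idempotents" "Y = K0_class e' f'" using K0_carrierE[OF Y] .
    obtain G where "icls (M\<Phi> e) + icls (M\<Phi> f') + G = icls (M\<Phi> e') + icls (M\<Phi> f) + G"
      using eq ef ef' by (auto simp: K0_map_class K0_class_eq_iff m)
    moreover obtain g' where g': "g' \<in> idempotents" "G = icls g'" using icls_exhaust .
    moreover obtain g where g: "g \<in> idempotents" "icls (M\<Phi> g) = icls g'" using idempotent_image_surj[OF g'(1)] by blast
    ultimately have "icls (M\<Phi> (e \<oplus>\<^sub>d f' \<oplus>\<^sub>d g)) = icls (M\<Phi> (e' \<oplus>\<^sub>d f \<oplus>\<^sub>d g))"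
      using ef ef' by (simp add: map_mat_direct_sum[OF ring_hom_\<Phi>] icls_sum m direct_sum_idempotents add.assoc)
    hence "idem_equiv (e \<oplus>\<^sub>d f' \<oplus>\<^sub>d g) (e' \<oplus>\<^sub>d f \<oplus>\<^sub>d g)"
      using ef ef' g by (intro idem_equiv_lift direct_sum_idempotents) (simp_all add: icls_eq_iff m direct_sum_idempotents)
    hence "icls (e \<oplus>\<^sub>d f' \<oplus>\<^sub>d g) = icls (e' \<oplus>\<^sub>d f \<oplus>\<^sub>d g)"
      using ef ef' g by (subst icls_eq_iff) (auto intro!: direct_sum_idempotents)
    hence "icls e + icls f' + icls g = icls e' + icls f + icls g"
      using ef ef' g by (simp add: icls_sum direct_sum_idempotents add.assoc)
    thus ?thesis using ef ef' by (auto simp: K0_class_eq_iff)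
  qed
  have surj: "\<exists>X \<in> carrier (K0 TYPE('a)). K0_map \<psi> X = Y" if Y: "Y \<in> carrier (K0 TYPE('b))" for Y
  proof -
    obtain e f where ef: "e \<in> idempotents" "f \<in> idempotents" "Y = K0_class e f" using K0_carrierE[OF Y] .
    obtain g where g: "g \<in> idempotents" "icls (M\<Phi> g) = icls e" using idempotent_image_surj[OF ef(1)] by blast
    obtain h where h: "h \<in> idempotents" "icls (M\<Phi> h) = icls f" using idempotent_image_surj[OF ef(2)] by blast
    have eq: "K0_class (M\<Phi> g) (M\<Phi> h) = Y"
      using ef g h by (simp add: K0_class_eq_iff m)
    have "K0_class (scalar_mat (M\<Phi> g)) (scalar_mat (M\<Phi> h)) = \<one>\<^bsub>K0_unital TYPE(complex)\<^esub>"
      using Y K0_carrier_iff[OF m[OF g(1)] m[OF h(1)]] unfolding eq by blast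
    hence "K0_class g h \<in> carrier (K0 TYPE('a))" using g h by (simp add: K0_carrier_iff)
    thus ?thesis using eq g h by (intro bexI[of _ "K0_class g h"]) (simp_all add: K0_map_class)
  qed
  show ?thesis
    unfolding iso_def hom_def bij_betw_def inj_on_def
    using carr mult inj surj by (auto simp: image_iff) metis
qed

end

section \<open>The group \<open>K\<^sub>1\<close>\<close>

lemma continuous_on_transfer:
  "continuous_on S f \<Longrightarrow> (\<And>t. t \<in> S \<Longrightarrow> g t = f t) \<Longrightarrow> continuous_on S g"
  using continuous_on_cong[of S S g f] by simp

lemma GL_dim: "x \<in> GL n \<Longrightarrow> dim_row x = n" "x \<in> GL n \<Longrightarrow> dim_col x = n"
  using GL_D(1)[of x n] by auto

lemma pad_one_carrier: "x \<in> carrier_mat n n \<Longrightarrow> n \<le> k \<Longrightarrow> pad_one k x \<in> carrier_mat k k"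
  unfolding pad_one_def using direct_sum_carrier[of x n n "1\<^sub>m (k - n)" "k - n" "k - n"] by simp

lemma pad_one_index:
  assumes "x \<in> carrier_mat n n" "n \<le> k" "i < k" "j < k"
  shows "pad_one k x $$ (i, j) = (if i < n \<and> j < n then x $$ (i, j) else if i = j then 1 else 0)"
  using assms by (auto simp: pad_one_def direct_sum_index)

lemma pad_one_pad_one:
  assumes "x \<in> carrier_mat n n" "n \<le> m" "m \<le> k"
  shows "pad_one k (pad_one m x) = pad_one k x"
  using assms pad_one_carrier[OF assms(1,2)] pad_one_carrier[of x n k] pad_one_carrier[of "pad_one m x" m k]
  by (intro eq_matI) (auto simp: pad_one_index[of _ m k] pad_one_index[of _ n k] pad_one_index[of _ n m])

lemma pad_one_self: "x \<in> carrier_mat n n \<Longrightarrow> pad_one n x = x"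
  using pad_one_carrier[of x n n] by (intro eq_matI) (auto simp: pad_one_index)

lemma pad_one_mult:
  assumes x: "x \<in> carrier_mat n n" and y: "y \<in> carrier_mat n n" and nk: "n \<le> k"
  shows "pad_one k (x * y) = pad_one k x * pad_one k y"
  unfolding pad_one_def
  using direct_sum_mult[OF x y one_carrier_mat one_carrier_mat, of "k - n"] x y by simp

lemma pad_one_one: "n \<le> k \<Longrightarrow> pad_one k (1\<^sub>m n) = 1\<^sub>m k"
  using pad_one_carrier[of "1\<^sub>m n" n k] by (intro eq_matI) (auto simp: pad_one_index[of _ n])

lemma map_mat_pad_one:
  assumes "Ring_Hom.ring_hom h"
  shows "map_mat h (pad_one k x) = pad_one k (map_mat h x)"
proof -
  interpret h: Ring_Hom.ring_hom h by (rule assms)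
  show ?thesis unfolding pad_one_def map_mat_direct_sum[OF assms] by (simp add: h.mat_hom_one)
qed

lemma GL_mult:
  assumes x: "x \<in> GL n" and y: "y \<in> GL n"
  shows "x * y \<in> GL n"
proof -
  obtain x' where x': "x' \<in> carrier_mat n n" "x * x' = 1\<^sub>m n" "x' * x = 1\<^sub>m n" using GL_D(3)[OF x] by blast
  obtain y' where y': "y' \<in> carrier_mat n n" "y * y' = 1\<^sub>m n" "y' * y = 1\<^sub>m n" using GL_D(3)[OF y] by blast
  note [simp] = GL_D(1)[OF x] GL_D(1)[OF y] x'(1) y'(1) square_closed[of _ n]
  note a = assoc_mult_mat[where n\<^sub>1 = n and n\<^sub>2 = n and n\<^sub>3 = n and n\<^sub>4 = n]
  have "y * (y' * x') = x'" "x' * (x * y) = y"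
    using a[of y y' x'] a[of x' x y] x' y' left_mult_one_mat[OF GL_D(1)[OF y]] left_mult_one_mat[OF x'(1)]
    by simp_all
  thus ?thesis
    using x' y' GL_D(2)[OF x] GL_D(2)[OF y]
    by (intro GL_I[where y = "y' * x'"]) (simp_all add: a scalar_mat_square(3)[where n = n])
qed

lemma GL_pad_one:
  assumes x: "x \<in> GL n" and nk: "n \<le> k"
  shows "pad_one k x \<in> GL k"
proof -
  note xc = GL_D[OF x]
  obtain x' where x': "x' \<in> carrier_mat n n" "x * x' = 1\<^sub>m n" "x' * x = 1\<^sub>m n" using xc(3) by blast
  show ?thesis
    using pad_one_mult[OF xc(1) x'(1) nk] pad_one_mult[OF x'(1) xc(1) nk] x' nk xc
    by (intro GL_I[where y = "pad_one k x'"] pad_one_carrier[of _ n])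
      (simp_all add: pad_one_one map_mat_pad_one[OF ring_hom_scalar_part])
qed

lemma GL_path_connected_pad:
  assumes p: "GL_path_connected k x y" and km: "k \<le> m"
  shows "GL_path_connected m (pad_one m x) (pad_one m y)"
proof -
  obtain F where *: "(\<forall>t\<in>{0..1}. F t \<in> GL k)
      \<and> (\<forall>i<k. \<forall>j<k. continuous_on {0..1::real} (\<lambda>t. alg_part (F t $$ (i, j)))) \<and> F 0 = x \<and> F 1 = y"
    using p unfolding GL_path_connected_def ..
  have "continuous_on {0..1} (\<lambda>t. alg_part (pad_one m (F t) $$ (i, j)))" if "i < m" "j < m" for i j
  proof -
    have "alg_part (pad_one m (F t) $$ (i, j)) = (if i < k \<and> j < k then alg_part (F t $$ (i, j)) else 0)"
      if "t \<in> {0..1}" for t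
      using pad_one_index[OF GL_D(1) km \<open>i < m\<close> \<open>j < m\<close>, of "F t"] * that by auto
    moreover have "continuous_on {0..1} (\<lambda>t. if i < k \<and> j < k then alg_part (F t $$ (i, j)) else 0)"
      using * by (cases "i < k \<and> j < k") auto
    ultimately show ?thesis by (rule continuous_on_transfer[rotated])
  qed
  moreover have "pad_one m (F t) \<in> GL m" if "t \<in> {0..1}" for t using * that km by (auto intro: GL_pad_one)
  ultimately show ?thesis using * unfolding GL_path_connected_def
    by (intro exI[of _ "\<lambda>t. pad_one m (F t)"]) auto
qed

lemma GL_entry_continuous:
  assumes "\<And>t. t \<in> S \<Longrightarrow> F t \<in> GL k" "continuous_on S (\<lambda>t. alg_part (F t $$ (i, j)))" "i < k" "j < k"
  shows "continuous_on S (\<lambda>t. F t $$ (i, j))"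
proof -
  have "continuous_on S (\<lambda>t. Unitization (alg_part (F t $$ (i, j))) (if i = j then 1 else 0))"
    using assms(2) unfolding continuous_on_def by (intro ballI tendsto_Unitization) auto
  moreover have "Unitization (alg_part (F t $$ (i, j))) (if i = j then 1 else 0) = F t $$ (i, j)" if "t \<in> S" for t
    using arg_cong[OF GL_D(2)[OF assms(1)[OF that]], of "\<lambda>m. m $$ (i, j)"] GL_D(1)[OF assms(1)[OF that]] assms(3,4)
    by (simp add: unitization_eq_iff)
  ultimately show ?thesis by (rule continuous_on_eq)
qed

lemma GL_path_connected_mult:
  assumes p: "GL_path_connected k x y" and q: "GL_path_connected k x' y'"
  shows "GL_path_connected k (x * x') (y * y')"
proof -
  obtain F where F: "(\<forall>t\<in>{0..1}. F t \<in> GL k)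
      \<and> (\<forall>i<k. \<forall>j<k. continuous_on {0..1::real} (\<lambda>t. alg_part (F t $$ (i, j)))) \<and> F 0 = x \<and> F 1 = y"
    using p unfolding GL_path_connected_def ..
  obtain H where H: "(\<forall>t\<in>{0..1}. H t \<in> GL k)
      \<and> (\<forall>i<k. \<forall>j<k. continuous_on {0..1::real} (\<lambda>t. alg_part (H t $$ (i, j)))) \<and> H 0 = x' \<and> H 1 = y'"
    using q unfolding GL_path_connected_def ..
  have "continuous_on {0..1} (\<lambda>t. alg_part ((F t * H t) $$ (i, j)))" if ij: "i < k" "j < k" for i j
  proof -
    have "continuous_on {0..1} (\<lambda>t. F t $$ (i, l))" "continuous_on {0..1} (\<lambda>t. H t $$ (l, j))" if "l < k" for l
      using F H ij that by (auto intro!: GL_entry_continuous[where k = k])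
    hence "continuous_on {0..1} (\<lambda>t. alg_part (\<Sum>l<k. F t $$ (i, l) * H t $$ (l, j)))"
      by (intro bounded_linear.continuous_on[OF bounded_linear_alg_part] continuous_intros) auto
    moreover have "alg_part ((F t * H t) $$ (i, j)) = alg_part (\<Sum>l<k. F t $$ (i, l) * H t $$ (l, j))" if "t \<in> {0..1}" for t
    proof -
      have "F t \<in> GL k" "H t \<in> GL k" using F H that by blast+
      thus ?thesis by (intro arg_cong[of _ _ alg_part] mult_mat_entry[OF _ _ ij] GL_D(1))
    qed
    ultimately show ?thesis by (rule continuous_on_transfer)
  qed
  moreover have "F t * H t \<in> GL k" if "t \<in> {0..1}" for t using F H that by (auto intro: GL_mult)
  ultimately show ?thesis using F H unfolding GL_path_connected_def
    by (intro exI[of _ "\<lambda>t. F t * H t"]) auto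
qed

lemma K1_rel_iff:
  assumes x: "x \<in> GL n" and y: "y \<in> GL m"
  shows "(x, y) \<in> K1_rel \<longleftrightarrow> (\<exists>k. n \<le> k \<and> m \<le> k \<and> GL_path_connected k (pad_one k x) (pad_one k y))"
  using GL_dim(1)[OF x] GL_dim(1)[OF y] GL_dim(1) x y unfolding K1_rel_def by blast

lemma K1_relI:
  "x \<in> GL n \<Longrightarrow> y \<in> GL m \<Longrightarrow> n \<le> k \<Longrightarrow> m \<le> k \<Longrightarrow> GL_path_connected k (pad_one k x) (pad_one k y)
    \<Longrightarrow> (x, y) \<in> K1_rel"
  using K1_rel_iff by blast

lemma equiv_K1_rel: "equiv (\<Union>n. GL n) (K1_rel :: ('a::complex_banach_algebra unitization mat \<times> _) set)"
proof (rule equivI)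
  let ?R = "K1_rel :: ('a unitization mat \<times> 'a unitization mat) set"
  show "?R \<subseteq> (\<Union>n. GL n) \<times> (\<Union>n. GL n)" by (auto simp: K1_rel_def)
  show "refl_on (\<Union>n. GL n) ?R"
  proof (rule refl_onI)
    fix x :: "'a unitization mat" assume "x \<in> (\<Union>n. GL n)"
    then obtain n where x: "x \<in> GL n" by blast
    show "(x, x) \<in> K1_rel"
      by (rule K1_relI[OF x x order_refl order_refl]) (rule GL_path_connected_refl[OF GL_pad_one[OF x order_refl]])
  qed
  show "sym ?R" by (rule symI) (auto simp: K1_rel_def dest: GL_path_connected_sym)
  show "trans ?R"
  proof (rule transI)
    fix x y z :: "'a unitization mat" assume "(x, y) \<in> K1_rel" "(y, z) \<in> K1_rel"
    moreover from this obtain n m l where n: "x \<in> GL n" "y \<in> GL m" "z \<in> GL l" by (auto simp: K1_rel_def)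
    ultimately obtain k k' where k: "n \<le> k" "m \<le> k" "GL_path_connected k (pad_one k x) (pad_one k y)"
      and k': "m \<le> k'" "l \<le> k'" "GL_path_connected k' (pad_one k' y) (pad_one k' z)"
      using K1_rel_iff by metis
    let ?K = "max k k'"
    have "GL_path_connected ?K (pad_one ?K x) (pad_one ?K y)"
      using GL_path_connected_pad[OF k(3), of ?K] k(1,2)
      by (simp add: pad_one_pad_one[OF GL_D(1)[OF n(1)]] pad_one_pad_one[OF GL_D(1)[OF n(2)]])
    moreover have "GL_path_connected ?K (pad_one ?K y) (pad_one ?K z)"
      using GL_path_connected_pad[OF k'(3), of ?K] k'(1,2)
      by (simp add: pad_one_pad_one[OF GL_D(1)[OF n(2)]] pad_one_pad_one[OF GL_D(1)[OF n(3)]])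
    ultimately show "(x, z) \<in> K1_rel"
      using GL_path_connected_trans k k' by (intro K1_relI[OF n(1,3), of ?K]) (auto simp: le_max_iff_disj)
  qed
qed

abbreviation K1_class :: "'a::complex_banach_algebra unitization mat \<Rightarrow> 'a unitization mat set" where
  "K1_class x \<equiv> K1_rel `` {x}"

lemma K1_class_eq_iff: "x \<in> GL n \<Longrightarrow> y \<in> GL m \<Longrightarrow> K1_class x = K1_class y \<longleftrightarrow> (x, y) \<in> K1_rel"
  using eq_equiv_class_iff[OF equiv_K1_rel] by blast

lemma K1_class_self: "x \<in> GL n \<Longrightarrow> x \<in> K1_class x"
  using equiv_class_self[OF equiv_K1_rel] by blast

lemma K1_rel_GL: "y \<in> K1_class x \<Longrightarrow> \<exists>m. y \<in> GL m"
  by (auto simp: K1_rel_def)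

lemma K1_carrierE:
  assumes "X \<in> carrier (K1 TYPE('a::complex_banach_algebra))"
  obtains x n where "x \<in> GL n" "X = K1_class x"
  using assms by (auto simp: K1_def elim!: quotientE)

lemma K1_carrierI: "x \<in> GL n \<Longrightarrow> K1_class x \<in> carrier (K1 TYPE('a::complex_banach_algebra))"
  by (auto simp: K1_def intro!: quotientI)

lemma K1_mult_class:
  fixes x y :: "'a::complex_banach_algebra unitization mat"
  assumes x: "x \<in> GL n" and y: "y \<in> GL m"
  shows "K1_class x \<otimes>\<^bsub>K1 TYPE('a)\<^esub> K1_class y = K1_class (pad_one (max n m) x * pad_one (max n m) y)"
proof -
  have const: "K1_class (pad_one (max (dim_row x') (dim_row y')) x' * pad_one (max (dim_row x') (dim_row y')) y')
      = K1_class (pad_one (max n m) x * pad_one (max n m) y)"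
    if x': "x' \<in> K1_class x" and y': "y' \<in> K1_class y" for x' y'
  proof -
    obtain n' where n': "x' \<in> GL n'" using K1_rel_GL[OF x'] by blast
    obtain m' where m': "y' \<in> GL m'" using K1_rel_GL[OF y'] by blast
    note d = GL_dim(1)[OF n'] GL_dim(1)[OF m']
    obtain k where k: "n \<le> k" "n' \<le> k" "GL_path_connected k (pad_one k x) (pad_one k x')"
      using x' K1_rel_iff[OF x n'] by auto
    obtain l where l: "m \<le> l" "m' \<le> l" "GL_path_connected l (pad_one l y) (pad_one l y')"
      using y' K1_rel_iff[OF y m'] by auto
    let ?K = "max k l" and ?p = "max n m" and ?q = "max n' m'"
    have "GL_path_connected ?K (pad_one ?K x) (pad_one ?K x')"
      using GL_path_connected_pad[OF k(3), of ?K] k(1,2)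
      by (simp add: pad_one_pad_one[OF GL_D(1)[OF x]] pad_one_pad_one[OF GL_D(1)[OF n']])
    moreover have "GL_path_connected ?K (pad_one ?K y) (pad_one ?K y')"
      using GL_path_connected_pad[OF l(3), of ?K] l(1,2)
      by (simp add: pad_one_pad_one[OF GL_D(1)[OF y]] pad_one_pad_one[OF GL_D(1)[OF m']])
    ultimately have path: "GL_path_connected ?K (pad_one ?K x * pad_one ?K y) (pad_one ?K x' * pad_one ?K y')"
      by (rule GL_path_connected_mult)
    have pq: "?p \<le> ?K" "?q \<le> ?K" using k l by auto
    have e: "pad_one ?K (pad_one ?p x * pad_one ?p y) = pad_one ?K x * pad_one ?K y"
      "pad_one ?K (pad_one ?q x' * pad_one ?q y') = pad_one ?K x' * pad_one ?K y'"
      using pq by (simp_all add: pad_one_mult[OF GL_D(1)[OF GL_pad_one[OF x]] GL_D(1)[OF GL_pad_one[OF y]]]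
          pad_one_mult[OF GL_D(1)[OF GL_pad_one[OF n']] GL_D(1)[OF GL_pad_one[OF m']]]
          pad_one_pad_one[OF GL_D(1)[OF x]] pad_one_pad_one[OF GL_D(1)[OF y]]
          pad_one_pad_one[OF GL_D(1)[OF n']] pad_one_pad_one[OF GL_D(1)[OF m']])
    have g: "pad_one ?p x * pad_one ?p y \<in> GL ?p" "pad_one ?q x' * pad_one ?q y' \<in> GL ?q"
      by (intro GL_mult GL_pad_one[OF x] GL_pad_one[OF y] GL_pad_one[OF n'] GL_pad_one[OF m']; simp)+
    have "(pad_one ?p x * pad_one ?p y, pad_one ?q x' * pad_one ?q y') \<in> K1_rel"
      using path by (intro K1_relI[OF g pq]) (simp only: e)
    thus ?thesis using K1_class_eq_iff[OF g] unfolding d by simp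
  qed
  have "(\<Union>x'\<in>K1_class x. \<Union>y'\<in>K1_class y. let k = max (dim_row x') (dim_row y')
        in K1_class (pad_one k x' * pad_one k y')) = K1_class (pad_one (max n m) x * pad_one (max n m) y)"
    unfolding Let_def
  proof (rule UN_const[OF K1_class_self[OF x]])
    fix x' assume "x' \<in> K1_class x"
    from const[OF this] show "(\<Union>y'\<in>K1_class y. K1_class (pad_one (max (dim_row x') (dim_row y')) x' * pad_one (max (dim_row x') (dim_row y')) y'))
        = K1_class (pad_one (max n m) x * pad_one (max n m) y)"
      by (rule UN_const[OF K1_class_self[OF y]])
  qed
  thus ?thesis by (simp add: K1_def)
qed

context hereditary_morphism
begin

lemma M\<Phi>_GL:
  assumes x: "x \<in> GL n"
  shows "M\<Phi> x \<in> GL n"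
proof -
  note xc = GL_D[OF x]
  obtain x' where x': "x' \<in> carrier_mat n n" "x * x' = 1\<^sub>m n" "x' * x = 1\<^sub>m n" using xc(3) by blast
  show ?thesis
    using xc x' M\<Phi>_square(3)[OF xc(1) x'(1)] M\<Phi>_square(3)[OF x'(1) xc(1)]
    by (intro GL_I[where y = "M\<Phi> x'"]) (simp_all add: M\<Phi>_square(4))
qed

lemma M\<Phi>_path:
  assumes "GL_path_connected k x y"
  shows "GL_path_connected k (M\<Phi> x) (M\<Phi> y)"
proof -
  obtain F where F: "(\<forall>t\<in>{0..1}. F t \<in> GL k)
      \<and> (\<forall>i<k. \<forall>j<k. continuous_on {0..1::real} (\<lambda>t. alg_part (F t $$ (i, j)))) \<and> F 0 = x \<and> F 1 = y"
    using assms unfolding GL_path_connected_def ..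
  have "continuous_on {0..1} (\<lambda>t. alg_part (M\<Phi> (F t) $$ (i, j)))" if ij: "i < k" "j < k" for i j
  proof -
    have "continuous_on {0..1} (\<lambda>t. \<psi> (alg_part (F t $$ (i, j))))"
      using F ij by (intro bounded_linear.continuous_on[OF bounded_linear_\<psi>]) auto
    moreover have "alg_part (M\<Phi> (F t) $$ (i, j)) = \<psi> (alg_part (F t $$ (i, j)))" if "t \<in> {0..1}" for t
      using GL_dim[of "F t" k] F that ij by simp
    ultimately show ?thesis by (rule continuous_on_transfer)
  qed
  thus ?thesis using F M\<Phi>_GL unfolding GL_path_connected_def
    by (intro exI[of _ "\<lambda>t. M\<Phi> (F t)"]) auto
qed

lemma M\<Phi>_K1_rel:
  assumes x: "x \<in> GL n" and y: "y \<in> GL m"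
  shows "(M\<Phi> x, M\<Phi> y) \<in> K1_rel \<longleftrightarrow> (x, y) \<in> K1_rel"
proof -
  have "GL_path_connected k (pad_one k (M\<Phi> x)) (pad_one k (M\<Phi> y)) \<longleftrightarrow> GL_path_connected k (pad_one k x) (pad_one k y)"
    if "n \<le> k" "m \<le> k" for k
    unfolding map_mat_pad_one[OF ring_hom_\<Phi>, symmetric]
    using M\<Phi>_path GL_path_lift[OF GL_pad_one[OF x that(1)] GL_pad_one[OF y that(2)]] by blast
  thus ?thesis unfolding K1_rel_iff[OF x y] K1_rel_iff[OF M\<Phi>_GL[OF x] M\<Phi>_GL[OF y]] by blast
qed

lemma K1_map_class:
  assumes x: "x \<in> GL n"
  shows "K1_map \<psi> (K1_class x) = K1_class (M\<Phi> x)"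
  unfolding K1_map_def
proof (rule UN_const[OF K1_class_self[OF x]])
  fix y assume y: "y \<in> K1_class x"
  then obtain m where m: "y \<in> GL m" using K1_rel_GL by blast
  have "(M\<Phi> x, M\<Phi> y) \<in> K1_rel" using M\<Phi>_K1_rel[OF x m] y by simp
  thus "K1_class (M\<Phi> y) = K1_class (M\<Phi> x)" using K1_class_eq_iff[OF M\<Phi>_GL[OF x] M\<Phi>_GL[OF m]] by simp
qed

text \<open>Injectivity is path lifting after padding to a common size, surjectivity is density of the image.\<close>

theorem K1_iso: "K1_map \<psi> \<in> iso (K1 TYPE('a)) (K1 TYPE('b))"
proof -
  have carr: "K1_map \<psi> X \<in> carrier (K1 TYPE('b))" if X: "X \<in> carrier (K1 TYPE('a))" for X
  proof -
    obtain x n where x: "x \<in> GL n" "X = K1_class x" using K1_carrierE[OF X] .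
    show ?thesis using K1_carrierI[OF M\<Phi>_GL[OF x(1)]] by (simp add: x(2) K1_map_class[OF x(1)])
  qed
  have mult: "K1_map \<psi> (X \<otimes>\<^bsub>K1 TYPE('a)\<^esub> Y) = K1_map \<psi> X \<otimes>\<^bsub>K1 TYPE('b)\<^esub> K1_map \<psi> Y"
    if X: "X \<in> carrier (K1 TYPE('a))" and Y: "Y \<in> carrier (K1 TYPE('a))" for X Y
  proof -
    obtain x n where x: "x \<in> GL n" "X = K1_class x" using K1_carrierE[OF X] .
    obtain y m where y: "y \<in> GL m" "Y = K1_class y" using K1_carrierE[OF Y] .
    let ?k = "max n m"
    have p: "pad_one ?k x \<in> GL ?k" "pad_one ?k y \<in> GL ?k" by (rule GL_pad_one[OF x(1)] GL_pad_one[OF y(1)]; simp)+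
    show ?thesis
      by (simp add: x(2) y(2) K1_mult_class[OF x(1) y(1)] K1_map_class[OF x(1)] K1_map_class[OF y(1)]
          K1_mult_class[OF M\<Phi>_GL[OF x(1)] M\<Phi>_GL[OF y(1)]] K1_map_class[OF GL_mult[OF p]]
          M\<Phi>_square(3)[OF GL_D(1)[OF p(1)] GL_D(1)[OF p(2)]] map_mat_pad_one[OF ring_hom_\<Phi>])
  qed
  have inj: "X = Y" if X: "X \<in> carrier (K1 TYPE('a))" and Y: "Y \<in> carrier (K1 TYPE('a))"
    and eq: "K1_map \<psi> X = K1_map \<psi> Y" for X Y
  proof -
    obtain x n where x: "x \<in> GL n" "X = K1_class x" using K1_carrierE[OF X] .
    obtain y m where y: "y \<in> GL m" "Y = K1_class y" using K1_carrierE[OF Y] .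
    have "(M\<Phi> x, M\<Phi> y) \<in> K1_rel"
      using eq K1_class_eq_iff[OF M\<Phi>_GL[OF x(1)] M\<Phi>_GL[OF y(1)]] by (simp add: x(2) y(2) K1_map_class[OF x(1)] K1_map_class[OF y(1)])
    thus ?thesis using M\<Phi>_K1_rel[OF x(1) y(1)] K1_class_eq_iff[OF x(1) y(1)] x(2) y(2) by simp
  qed
  have surj: "\<exists>X \<in> carrier (K1 TYPE('a)). K1_map \<psi> X = Y" if Y: "Y \<in> carrier (K1 TYPE('b))" for Y
  proof -
    obtain y n where y: "y \<in> GL n" "Y = K1_class y" using K1_carrierE[OF Y] .
    obtain x where x: "x \<in> GL n" "GL_path_connected n (M\<Phi> x) y" using GL_image_dense[OF y(1)] by blast
    have "(M\<Phi> x, y) \<in> K1_rel"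
      using x(2) by (intro K1_relI[OF M\<Phi>_GL[OF x(1)] y(1) order_refl order_refl])
        (simp add: pad_one_self[OF GL_D(1)[OF M\<Phi>_GL[OF x(1)]]] pad_one_self[OF GL_D(1)[OF y(1)]])
    hence "K1_map \<psi> (K1_class x) = Y"
      using K1_class_eq_iff[OF M\<Phi>_GL[OF x(1)] y(1)] K1_map_class[OF x(1)] y(2) by simp
    thus ?thesis using K1_carrierI[OF x(1)] by blast
  qed
  show ?thesis
    unfolding iso_def hom_def bij_betw_def inj_on_def
    using carr mult inj surj by (auto simp: image_iff) metis
qed

end

section \<open>The ideal generated by a common dense subset\<close>

inductive_set generated_ideal :: "'a::complex_banach_algebra set \<Rightarrow> 'a set" for C where
  base: "x \<in> C \<Longrightarrow> x \<in> generated_ideal C"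
| add: "x \<in> generated_ideal C \<Longrightarrow> y \<in> generated_ideal C \<Longrightarrow> x + y \<in> generated_ideal C"
| scaleC: "x \<in> generated_ideal C \<Longrightarrow> c *\<^sub>C x \<in> generated_ideal C"
| left: "x \<in> generated_ideal C \<Longrightarrow> a * x \<in> generated_ideal C"
| right: "x \<in> generated_ideal C \<Longrightarrow> x * a \<in> generated_ideal C"

text \<open>The estimate is assumed on a dense subset \<open>C\<close> only.  For fixed \<open>x, y\<close> it is closed in \<open>a\<close>.  For fixed \<open>a\<close> it
is stable under linear combinations of \<open>x\<close> and of \<open>y\<close> and under outer factors; an inner factor \<open>b\<close>, as in
\<open>(x b) a y = x (b a) y\<close>, is absorbed into \<open>a\<close> at the cost of \<open>\<parallel>\<psi> b\<parallel>\<close>.\<close>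

lemma hereditary_morphism_of_dense:
  fixes \<psi> :: "'a::complex_banach_algebra \<Rightarrow> 'b::complex_banach_algebra"
  assumes hom: "banach_algebra_hom \<psi>" and dense: "closure C = UNIV" "closure (\<psi> ` C) = UNIV"
    and bound: "\<And>x y. x \<in> C \<Longrightarrow> y \<in> C \<Longrightarrow> \<exists>M. \<forall>a\<in>C. norm (x * a * y) \<le> M * norm (\<psi> a)"
  shows "hereditary_morphism \<psi> (generated_ideal C)"
proof -
  define S where "S x y \<longleftrightarrow> (\<exists>M\<ge>0. \<forall>a. norm (x * a * y) \<le> M * norm (\<psi> a))" for x y
  have lin: "bounded_linear \<psi>" and mult: "\<psi> (a * b) = \<psi> a * \<psi> b" for a b
    using hom by (auto simp: banach_algebra_hom_def)
  have base: "S x y" if xy: "x \<in> C" "y \<in> C" for x y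
  proof -
    from bound[OF xy] obtain M where M: "\<forall>a\<in>C. norm (x * a * y) \<le> M * norm (\<psi> a)" ..
    have "closed {a. norm (x * a * y) \<le> max M 0 * norm (\<psi> a)}"
      by (intro closed_Collect_le continuous_intros linear_continuous_on[OF lin])
    moreover have "norm (x * a * y) \<le> max M 0 * norm (\<psi> a)" if "a \<in> C" for a
      using M that by (meson max.cobounded1 mult_right_mono norm_ge_zero order_trans)
    hence "C \<subseteq> {a. norm (x * a * y) \<le> max M 0 * norm (\<psi> a)}" by blast
    ultimately have "UNIV \<subseteq> {a. norm (x * a * y) \<le> max M 0 * norm (\<psi> a)}"
      unfolding dense(1)[symmetric] by (rule closure_minimal[rotated])
    thus ?thesis unfolding S_def by (intro exI[of _ "max M 0"]) auto
  qed
  have sum: "S z w" if H: "S x y" "S x' y'" "\<And>a. norm (z * a * w) \<le> norm (x * a * y) + norm (x' * a * y')" for x y x' y' z w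
  proof -
    obtain M M' where M: "0 \<le> M" "\<forall>a. norm (x * a * y) \<le> M * norm (\<psi> a)" "0 \<le> M'" "\<forall>a. norm (x' * a * y') \<le> M' * norm (\<psi> a)"
      using H(1,2) unfolding S_def by blast
    have "norm (z * a * w) \<le> (M + M') * norm (\<psi> a)" for a
      using H(3)[of a] M(2)[rule_format, of a] M(4)[rule_format, of a] by (simp add: distrib_right)
    thus ?thesis unfolding S_def using M(1,3) by (intro exI[of _ "M + M'"]) auto
  qed
  have scaled: "S z w" if H: "S x y" "\<And>a. norm (z * a * w) \<le> r * norm (x * a * y)" "0 \<le> r" for x y z w r
  proof -
    obtain M where M: "0 \<le> M" "\<forall>a. norm (x * a * y) \<le> M * norm (\<psi> a)" using H(1) unfolding S_def by blast
    have "norm (z * a * w) \<le> (r * M) * norm (\<psi> a)" for a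
      using order_trans[OF H(2)[of a] mult_left_mono[OF M(2)[rule_format, of a] H(3)]] by (simp add: mult.assoc)
    thus ?thesis unfolding S_def using M(1) H(3) by (intro exI[of _ "r * M"]) auto
  qed
  have inner: "S z w" if H: "S x y" "\<And>a. z * a * w = x * (f a) * y" "\<And>a. norm (\<psi> (f a)) \<le> r * norm (\<psi> a)" "0 \<le> r" for x y z w r f
  proof -
    obtain M where M: "0 \<le> M" "\<forall>a. norm (x * a * y) \<le> M * norm (\<psi> a)" using H(1) unfolding S_def by blast
    have "norm (z * a * w) \<le> (M * r) * norm (\<psi> a)" for a
      unfolding H(2) using order_trans[OF M(2)[rule_format, of "f a"] mult_left_mono[OF H(3)[of a] M(1)]] by (simp add: mult.assoc)
    thus ?thesis unfolding S_def using M(1) H(4) by (intro exI[of _ "M * r"]) auto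
  qed
  have right: "S x y" if x: "x \<in> C" and y: "y \<in> generated_ideal C" for x y
    using y
  proof induction
    case (base y)
    show ?case using x base by (rule \<open>\<And>x y. x \<in> C \<Longrightarrow> y \<in> C \<Longrightarrow> S x y\<close>)
  next
    case (add y y')
    show ?case by (rule sum[OF add.IH]) (simp add: distrib_left norm_triangle_ineq)
  next
    case (scaleC y c)
    show ?case by (rule scaled[OF scaleC.IH, of _ _ "cmod c"]) (simp_all add: mult_scaleC_right norm_scaleC)
  next
    case (left y b)
    show ?case by (rule inner[OF left.IH, where f = "\<lambda>a. a * b" and r = "norm (\<psi> b)"])
      (simp_all add: mult.assoc mult norm_mult_ineq mult.commute[of "norm (\<psi> b)"])
  next
    case (right y b)
    show ?case by (rule scaled[OF right.IH, of _ _ "norm b"])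
      (simp_all add: mult.assoc[symmetric] norm_mult_ineq mult.commute[of "norm b"])
  qed
  have all: "S x y" if x: "x \<in> generated_ideal C" and y: "y \<in> generated_ideal C" for x y
    using x
  proof induction
    case (base x)
    show ?case using base y by (rule \<open>\<And>x y. x \<in> C \<Longrightarrow> y \<in> generated_ideal C \<Longrightarrow> S x y\<close>)
  next
    case (add x x')
    show ?case by (rule sum[OF add.IH]) (simp add: distrib_right norm_triangle_ineq)
  next
    case (scaleC x c)
    show ?case by (rule scaled[OF scaleC.IH, of _ _ "cmod c"]) (simp_all add: mult_scaleC_left norm_scaleC)
  next
    case (left x b)
    show ?case by (rule scaled[OF left.IH, of _ _ "norm b"]) (simp_all add: mult.assoc norm_mult_ineq)
  next
    case (right x b)
    show ?case by (rule inner[OF right.IH, where f = "\<lambda>a. b * a" and r = "norm (\<psi> b)"])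
      (simp_all add: mult.assoc mult norm_mult_ineq)
  qed
  have "\<exists>M. \<forall>a. norm (x * a * y) \<le> M * norm (\<psi> a)" if "x \<in> generated_ideal C" "y \<in> generated_ideal C" for x y
    using all[OF that] unfolding S_def by blast
  moreover have "closure (generated_ideal C) = UNIV"
    using closure_mono[of C "generated_ideal C"] dense(1) by (auto intro: generated_ideal.base)
  moreover have "closure (range \<psi>) = UNIV"
    using closure_mono[of "\<psi> ` C" "range \<psi>"] dense(2) by auto
  ultimately show ?thesis
    by unfold_locales (auto simp: hom intro: generated_ideal.intros)
qed

section \<open>Calculus in Banach spaces on carrier sets\<close>

definition ndist :: "('e, 'm) bspace_scheme \<Rightarrow> 'e \<Rightarrow> 'e \<Rightarrow> real" where
  "ndist E x y = nnorm E (ndiff E x y)"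

context banach_space_on
begin

definition nneg :: "'e \<Rightarrow> 'e" where "nneg x = nscale E (-1) x"

abbreviation nd :: "'e \<Rightarrow> 'e \<Rightarrow> real" where "nd \<equiv> ndist E"

lemma nneg_closed: "x \<in> ncar E \<Longrightarrow> nneg x \<in> ncar E"
  by (simp add: nneg_def scale_closed)

lemma ndiff_eq: "ndiff E x y = nadd E x (nneg y)"
  by (simp add: ndiff_def nneg_def)

lemma ndiff_closed: "x \<in> ncar E \<Longrightarrow> y \<in> ncar E \<Longrightarrow> ndiff E x y \<in> ncar E"
  by (simp add: ndiff_eq nneg_closed add_closed)

lemmas closed = zero_closed add_closed scale_closed nneg_closed ndiff_closed

lemma add_left_commute:
  "x \<in> ncar E \<Longrightarrow> y \<in> ncar E \<Longrightarrow> z \<in> ncar E \<Longrightarrow> nadd E x (nadd E y z) = nadd E y (nadd E x z)"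
  by (metis add_assoc add_commute)

lemmas nadd_ac = add_assoc add_commute add_left_commute

lemma zero_add: "x \<in> ncar E \<Longrightarrow> nadd E (nzero E) x = x"
  using add_commute[of "nzero E" x] add_zero zero_closed by simp

lemma add_nneg: "x \<in> ncar E \<Longrightarrow> nadd E x (nneg x) = nzero E"
  using diff_self by (simp add: ndiff_eq)

lemma nneg_add_cancel: "x \<in> ncar E \<Longrightarrow> y \<in> ncar E \<Longrightarrow> nadd E (nneg x) (nadd E x y) = y"
  "x \<in> ncar E \<Longrightarrow> y \<in> ncar E \<Longrightarrow> nadd E x (nadd E (nneg x) y) = y"
  using add_assoc[of "nneg x" x y] add_assoc[of x "nneg x" y] add_commute[of "nneg x" x]
  by (simp_all add: closed add_nneg zero_add)

lemma scale_zero_left: "x \<in> ncar E \<Longrightarrow> nscale E 0 x = nzero E"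
  using add_scale[of x 1 "-1"] add_nneg[of x] by (simp add: scale_one nneg_def)

lemma scale_zero_right: "nscale E c (nzero E) = nzero E"
  using scale_scale[OF zero_closed, of c 0] scale_zero_left[OF zero_closed] by simp

lemma nneg_zero: "nneg (nzero E) = nzero E"
  by (simp add: nneg_def scale_zero_right)

lemma nneg_add: "x \<in> ncar E \<Longrightarrow> y \<in> ncar E \<Longrightarrow> nneg (nadd E x y) = nadd E (nneg x) (nneg y)"
  by (simp add: nneg_def scale_add)

lemma nneg_nneg: "x \<in> ncar E \<Longrightarrow> nneg (nneg x) = x"
  by (simp add: nneg_def scale_scale scale_one)

lemma nneg_scale: "x \<in> ncar E \<Longrightarrow> nneg (nscale E c x) = nscale E c (nneg x)"
  by (simp add: nneg_def scale_scale)

lemma nnorm_nneg: "x \<in> ncar E \<Longrightarrow> nnorm E (nneg x) = nnorm E x"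
  by (simp add: nneg_def norm_scale)

lemma nnorm_zero: "nnorm E (nzero E) = 0"
  using norm_eq_zero[OF zero_closed] by simp

lemma ndiff_zero: "x \<in> ncar E \<Longrightarrow> ndiff E x (nzero E) = x"
  by (simp add: ndiff_eq nneg_zero add_zero)

lemma nd_nonneg: "x \<in> ncar E \<Longrightarrow> y \<in> ncar E \<Longrightarrow> 0 \<le> nd x y"
  by (simp add: ndist_def norm_nonneg closed)

lemma nd_self: "x \<in> ncar E \<Longrightarrow> nd x x = 0"
  by (simp add: ndist_def diff_self nnorm_zero)

lemma nd_zero: "x \<in> ncar E \<Longrightarrow> nd x (nzero E) = nnorm E x"
  by (simp add: ndist_def ndiff_zero)

lemma nd_eq_0: "x \<in> ncar E \<Longrightarrow> y \<in> ncar E \<Longrightarrow> nd x y = 0 \<Longrightarrow> x = y"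
proof -
  assume xy: "x \<in> ncar E" "y \<in> ncar E" "nd x y = 0"
  hence "nadd E x (nneg y) = nzero E" using norm_eq_zero[OF ndiff_closed] by (simp add: ndist_def ndiff_eq)
  hence "nadd E y (nadd E x (nneg y)) = y" using xy by (simp add: add_zero)
  thus "x = y" using xy add_left_commute[of y x "nneg y"] by (simp add: closed add_nneg add_zero)
qed

lemma nd_commute: "x \<in> ncar E \<Longrightarrow> y \<in> ncar E \<Longrightarrow> nd x y = nd y x"
proof -
  assume xy: "x \<in> ncar E" "y \<in> ncar E"
  have "ndiff E y x = nneg (ndiff E x y)"
    using xy by (simp add: ndiff_eq nneg_add nneg_nneg closed add_commute)
  thus "nd x y = nd y x" using xy by (simp add: ndist_def nnorm_nneg closed)
qed

lemma nd_triangle: "x \<in> ncar E \<Longrightarrow> y \<in> ncar E \<Longrightarrow> z \<in> ncar E \<Longrightarrow> nd x z \<le> nd x y + nd y z"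
proof -
  assume xyz: "x \<in> ncar E" "y \<in> ncar E" "z \<in> ncar E"
  have "ndiff E x z = nadd E (ndiff E x y) (ndiff E y z)"
    using xyz by (simp add: ndiff_eq add_assoc closed nneg_add_cancel)
  thus "nd x z \<le> nd x y + nd y z" using xyz by (simp add: ndist_def norm_triangle closed)
qed

lemma nd_add:
  assumes "x \<in> ncar E" "y \<in> ncar E" "x' \<in> ncar E" "y' \<in> ncar E"
  shows "nd (nadd E x y) (nadd E x' y') \<le> nd x x' + nd y y'"
proof -
  have "ndiff E (nadd E x y) (nadd E x' y') = nadd E (ndiff E x x') (ndiff E y y')"
    using assms by (simp add: ndiff_eq nneg_add closed nadd_ac)
  thus ?thesis using assms by (simp add: ndist_def norm_triangle closed)
qed

lemma nd_scale: "x \<in> ncar E \<Longrightarrow> y \<in> ncar E \<Longrightarrow> nd (nscale E c x) (nscale E c y) = cmod c * nd x y"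
  by (simp add: ndist_def ndiff_eq nneg_scale norm_scale closed flip: scale_add)

lemma norm_le_nd: "x \<in> ncar E \<Longrightarrow> y \<in> ncar E \<Longrightarrow> nnorm E x \<le> nnorm E y + nd x y"
  using nd_triangle[of x y "nzero E"] by (simp add: nd_zero closed)

section \<open>The Bochner integral\<close>

lemma simple_value_simps:
  "simple_value E [] x = nzero E"
  "simple_value E ((A, e) # L) x = nadd E (if x \<in> A then e else nzero E) (simple_value E L x)"
  by (simp_all add: simple_value_def nsum_def)

lemma simple_integral_simps:
  "simple_integral_on \<mu> E [] = nzero E"
  "simple_integral_on \<mu> E ((A, e) # L)
    = nadd E (nscale E (complex_of_real (measure \<mu> A)) e) (simple_integral_on \<mu> E L)"
  by (simp_all add: simple_integral_on_def nsum_def)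

lemma simple_repr_simps:
  "simple_repr \<mu> E []"
  "simple_repr \<mu> E ((A, e) # L) \<longleftrightarrow> A \<in> sets \<mu> \<and> emeasure \<mu> A < \<infinity> \<and> e \<in> ncar E \<and> simple_repr \<mu> E L"
  "simple_repr \<mu> E (L @ L') \<longleftrightarrow> simple_repr \<mu> E L \<and> simple_repr \<mu> E L'"
  by (auto simp: simple_repr_def)

lemma simple_value_closed: "simple_repr \<mu> E L \<Longrightarrow> simple_value E L x \<in> ncar E"
  by (induction L) (auto simp: simple_repr_simps simple_value_simps closed)

lemma simple_integral_closed: "simple_repr \<mu> E L \<Longrightarrow> simple_integral_on \<mu> E L \<in> ncar E"
  by (induction L) (auto simp: simple_repr_simps simple_integral_simps closed)

lemma simple_value_append:
  "simple_repr \<mu> E L \<Longrightarrow> simple_repr \<mu> E L'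
    \<Longrightarrow> simple_value E (L @ L') x = nadd E (simple_value E L x) (simple_value E L' x)"
  by (induction L) (auto simp: simple_repr_simps simple_value_simps closed add_assoc zero_add simple_value_closed)

lemma simple_integral_append:
  "simple_repr \<mu> E L \<Longrightarrow> simple_repr \<mu> E L'
    \<Longrightarrow> simple_integral_on \<mu> E (L @ L') = nadd E (simple_integral_on \<mu> E L) (simple_integral_on \<mu> E L')"
  by (induction L) (auto simp: simple_repr_simps simple_integral_simps closed add_assoc zero_add simple_integral_closed)

definition simple_neg :: "('b set \<times> 'e) list \<Rightarrow> ('b set \<times> 'e) list" where
  "simple_neg = map (\<lambda>(A, e). (A, nneg e))"

lemma simple_neg:
  assumes "simple_repr \<mu> E L"
  shows "simple_repr \<mu> E (simple_neg L)" "simple_value E (simple_neg L) x = nneg (simple_value E L x)"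
    "simple_integral_on \<mu> E (simple_neg L) = nneg (simple_integral_on \<mu> E L)"
  using assms
  by (induction L) (auto simp: simple_neg_def simple_repr_simps simple_value_simps simple_integral_simps
      closed nneg_add nneg_zero nneg_scale simple_value_closed simple_integral_closed)

text \<open>A list may contain overlapping sets.  Restricting all sets to a measurable set \<open>A\<close> allows an induction on
the list that splits \<open>A\<close> along the first set.\<close>

definition simple_restrict :: "'b set \<Rightarrow> ('b set \<times> 'e) list \<Rightarrow> ('b set \<times> 'e) list" where
  "simple_restrict A = map (\<lambda>(B, e). (B \<inter> A, e))"

lemma simple_restrict_simps:
  "simple_restrict A [] = []" "simple_restrict A ((B, e) # L) = (B \<inter> A, e) # simple_restrict A L"
  by (simp_all add: simple_restrict_def)

lemma finite_subset_emeasure: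
  assumes "B \<in> sets \<mu>" "emeasure \<mu> B < top_class.top"
  shows "emeasure \<mu> (B \<inter> A) < top_class.top" "emeasure \<mu> (B \<inter> A) \<noteq> top_class.top"
proof -
  have "emeasure \<mu> (B \<inter> A) \<le> emeasure \<mu> B" using assms by (intro emeasure_mono) auto
  thus "emeasure \<mu> (B \<inter> A) < top_class.top" "emeasure \<mu> (B \<inter> A) \<noteq> top_class.top" using assms by auto
qed

lemma simple_restrict_repr: "simple_repr \<mu> E L \<Longrightarrow> A \<in> sets \<mu> \<Longrightarrow> simple_repr \<mu> E (simple_restrict A L)"
  by (induction L) (auto simp: simple_restrict_simps simple_repr_simps finite_subset_emeasure)

lemma simple_integral_split:
  assumes "simple_repr \<mu> E L" "A \<in> sets \<mu>" "B \<in> sets \<mu>"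
  shows "simple_integral_on \<mu> E (simple_restrict A L)
    = nadd E (simple_integral_on \<mu> E (simple_restrict (A \<inter> B) L)) (simple_integral_on \<mu> E (simple_restrict (A - B) L))"
  using assms(1)
proof (induction L)
  case Nil
  show ?case by (simp add: simple_restrict_simps simple_integral_simps add_zero closed)
next
  case (Cons p L)
  obtain C e where p: "p = (C, e)" by (cases p)
  have C: "C \<in> sets \<mu>" "emeasure \<mu> C < \<infinity>" "e \<in> ncar E" "simple_repr \<mu> E L"
    using Cons.prems by (auto simp: p simple_repr_simps)
  have "measure \<mu> (C \<inter> A) = measure \<mu> (C \<inter> (A \<inter> B) \<union> C \<inter> (A - B))" by (rule arg_cong[where f = "measure \<mu>"]) auto
  also have "\<dots> = measure \<mu> (C \<inter> (A \<inter> B)) + measure \<mu> (C \<inter> (A - B))"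
    using C assms by (intro measure_Union) (auto simp: finite_subset_emeasure)
  finally have m: "nscale E (complex_of_real (measure \<mu> (C \<inter> A))) e
      = nadd E (nscale E (complex_of_real (measure \<mu> (C \<inter> (A \<inter> B)))) e) (nscale E (complex_of_real (measure \<mu> (C \<inter> (A - B)))) e)"
    using C by (simp add: add_scale)
  have "A \<inter> B \<in> sets \<mu>" "A - B \<in> sets \<mu>" using assms by auto
  note r = simple_integral_closed[OF simple_restrict_repr[OF C(4) this(1)]]
    simple_integral_closed[OF simple_restrict_repr[OF C(4) this(2)]]
  show ?case
    using C r unfolding p simple_restrict_simps simple_integral_simps m Cons.IH[OF C(4)]
    by (simp add: nadd_ac closed)
qed

lemma simple_shift_measurable:
  assumes "simple_repr \<mu> E L" "\<And>e. e \<in> ncar E \<Longrightarrow> (\<lambda>x. nd (f x) e) \<in> borel_measurable \<mu>" "c \<in> ncar E"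
  shows "(\<lambda>x. nd (f x) (nadd E c (simple_value E L x))) \<in> borel_measurable \<mu>"
  using assms(1,3)
proof (induction L arbitrary: c)
  case Nil
  thus ?case using assms(2) by (simp add: simple_value_simps add_zero)
next
  case (Cons p L)
  obtain B b where p: "p = (B, b)" by (cases p)
  have B: "B \<in> sets \<mu>" "b \<in> ncar E" "simple_repr \<mu> E L"
    using Cons.prems by (auto simp: p simple_repr_simps)
  have "(\<lambda>x. if x \<in> B then nd (f x) (nadd E (nadd E c b) (simple_value E L x)) else nd (f x) (nadd E c (simple_value E L x)))
      \<in> borel_measurable \<mu>"
    using B Cons.IH Cons.prems by (intro measurable_If_set) (auto simp: closed)
  moreover have "nd (f x) (nadd E c (simple_value E (p # L) x))
      = (if x \<in> B then nd (f x) (nadd E (nadd E c b) (simple_value E L x)) else nd (f x) (nadd E c (simple_value E L x)))" for x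
    using B Cons.prems simple_value_closed[OF B(3), of x]
    by (simp add: p simple_value_simps zero_add add_assoc)
  ultimately show ?case by simp
qed

lemma simple_measurable:
  assumes "simple_repr \<mu> E L" "\<And>e. e \<in> ncar E \<Longrightarrow> (\<lambda>x. nd (f x) e) \<in> borel_measurable \<mu>"
  shows "(\<lambda>x. nd (f x) (simple_value E L x)) \<in> borel_measurable \<mu>"
  using simple_shift_measurable[OF assms zero_closed] simple_value_closed[OF assms(1)]
  by (simp add: zero_add)

lemma simple_norm_measurable:
  assumes "simple_repr \<mu> E L" "c \<in> ncar E"
  shows "(\<lambda>x. nnorm E (nadd E c (simple_value E L x))) \<in> borel_measurable \<mu>"
proof -
  have "(\<lambda>x. nd (nzero E) (nadd E c (simple_value E L x))) \<in> borel_measurable \<mu>"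
    using assms by (intro simple_shift_measurable) auto
  moreover have "nd (nzero E) (nadd E c (simple_value E L x)) = nnorm E (nadd E c (simple_value E L x))" for x
    using assms simple_value_closed[OF assms(1), of x] by (subst nd_commute) (simp_all add: closed nd_zero)
  ultimately show ?thesis by simp
qed

text \<open>The triangle inequality \<open>\<parallel>\<integral>\<phi>\<parallel> \<le> \<integral>\<parallel>\<phi>\<parallel>\<close> cannot be proved by induction on the list for \<open>\<phi>\<close> alone, because
the sets overlap.  The induction works for \<open>1\<^sub>A(e + \<phi>)\<close>: the head \<open>(B, b)\<close> splits \<open>A\<close> into \<open>A \<inter> B\<close>, where the
constant becomes \<open>e + b\<close>, and \<open>A - B\<close>.\<close>

lemma simple_integral_norm_le_shifted:
  assumes "simple_repr \<mu> E L" "A \<in> sets \<mu>" "emeasure \<mu> A < \<infinity>" "e \<in> ncar E"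
  shows "ennreal (nnorm E (nadd E (nscale E (complex_of_real (measure \<mu> A)) e) (simple_integral_on \<mu> E (simple_restrict A L))))
    \<le> (\<integral>\<^sup>+x. ennreal (nnorm E (nadd E e (simple_value E L x))) * indicator A x \<partial>\<mu>)"
  using assms
proof (induction L arbitrary: A e)
  case Nil
  have "(\<integral>\<^sup>+x. ennreal (nnorm E e) * indicator A x \<partial>\<mu>) = ennreal (nnorm E e) * emeasure \<mu> A"
    using Nil by (simp add: nn_integral_cmult)
  also have "\<dots> = ennreal (measure \<mu> A * nnorm E e)"
    using Nil by (simp add: emeasure_eq_ennreal_measure ennreal_mult norm_nonneg mult.commute)
  finally show ?case
    using Nil by (simp add: simple_restrict_simps simple_integral_simps simple_value_simps add_zero closed norm_scale)
next
  case (Cons p L)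
  obtain B b where p: "p = (B, b)" by (cases p)
  have B: "B \<in> sets \<mu>" "emeasure \<mu> B < \<infinity>" "b \<in> ncar E" "simple_repr \<mu> E L"
    using Cons.prems by (auto simp: p simple_repr_simps)
  have A: "A \<in> sets \<mu>" "emeasure \<mu> A < \<infinity>" "e \<in> ncar E" using Cons.prems by auto
  have s: "A \<inter> B \<in> sets \<mu>" "A - B \<in> sets \<mu>" using A B by auto
  have fin: "emeasure \<mu> (A \<inter> B) < \<infinity>" "emeasure \<mu> (A - B) < \<infinity>"
    using A finite_subset_emeasure[of A \<mu> B] finite_subset_emeasure[of A \<mu> "- B"] by (simp_all add: Diff_eq)
  let ?S = "\<lambda>A. simple_integral_on \<mu> E (simple_restrict A L)"
  let ?m = "\<lambda>A e. nscale E (complex_of_real (measure \<mu> A)) e"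
  have Sc: "?S (A \<inter> B) \<in> ncar E" "?S (A - B) \<in> ncar E"
    using simple_integral_closed[OF simple_restrict_repr[OF B(4)]] s by auto
  have "measure \<mu> A = measure \<mu> ((A \<inter> B) \<union> (A - B))" by (rule arg_cong[where f = "measure \<mu>"]) auto
  also have "\<dots> = measure \<mu> (A \<inter> B) + measure \<mu> (A - B)"
    using s fin by (intro measure_Union) auto
  finally have mA: "?m A e = nadd E (?m (A \<inter> B) e) (?m (A - B) e)"
    using A by (simp add: add_scale)
  have "nadd E (?m A e) (simple_integral_on \<mu> E (simple_restrict A (p # L)))
      = nadd E (nadd E (?m (A \<inter> B) (nadd E e b)) (?S (A \<inter> B))) (nadd E (?m (A - B) e) (?S (A - B)))"
    using A B Sc unfolding p simple_restrict_simps simple_integral_simps mA simple_integral_split[OF B(4) A(1) B(1)]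
    by (simp add: scale_add nadd_ac closed Int_commute)
  hence "ennreal (nnorm E (nadd E (?m A e) (simple_integral_on \<mu> E (simple_restrict A (p # L)))))
      \<le> ennreal (nnorm E (nadd E (?m (A \<inter> B) (nadd E e b)) (?S (A \<inter> B)))) + ennreal (nnorm E (nadd E (?m (A - B) e) (?S (A - B))))"
    using A B Sc by (simp add: norm_triangle closed norm_nonneg flip: ennreal_plus)
  also have "\<dots> \<le> (\<integral>\<^sup>+x. ennreal (nnorm E (nadd E (nadd E e b) (simple_value E L x))) * indicator (A \<inter> B) x \<partial>\<mu>)
      + (\<integral>\<^sup>+x. ennreal (nnorm E (nadd E e (simple_value E L x))) * indicator (A - B) x \<partial>\<mu>)"
    using A B s fin by (intro add_mono Cons.IH) (auto simp: closed)
  also have "\<dots> = (\<integral>\<^sup>+x. ennreal (nnorm E (nadd E (nadd E e b) (simple_value E L x))) * indicator (A \<inter> B) x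
      + ennreal (nnorm E (nadd E e (simple_value E L x))) * indicator (A - B) x \<partial>\<mu>)"
    using A B s simple_norm_measurable[OF B(4)] by (intro nn_integral_add[symmetric]) (auto simp: closed)
  also have "\<dots> = (\<integral>\<^sup>+x. ennreal (nnorm E (nadd E e (simple_value E (p # L) x))) * indicator A x \<partial>\<mu>)"
    using A B simple_value_closed[OF B(4)]
    by (intro nn_integral_cong) (auto simp: indicator_def p simple_value_simps zero_add add_assoc)
  finally show ?case .
qed

lemma simple_integral_norm_le:
  assumes L: "simple_repr \<mu> E L"
  shows "ennreal (nnorm E (simple_integral_on \<mu> E L)) \<le> (\<integral>\<^sup>+x. ennreal (nnorm E (simple_value E L x)) \<partial>\<mu>)"
proof -
  define A where "A = \<Union>(fst ` set L)"
  have S: "B \<in> sets \<mu> \<and> emeasure \<mu> B < top_class.top" if "B \<in> fst ` set L" for B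
    using L that by (auto simp: simple_repr_def)
  have A: "A \<in> sets \<mu>" unfolding A_def using S by (intro sets.finite_Union) auto
  have "emeasure \<mu> A \<le> (\<Sum>B\<in>fst ` set L. emeasure \<mu> B)"
    unfolding A_def using S emeasure_subadditive_finite[of "fst ` set L" id \<mu>] by auto
  also have "\<dots> < \<infinity>" using S by simp
  finally have fin: "emeasure \<mu> A < \<infinity>" .
  have "simple_restrict A L = L"
    unfolding simple_restrict_def by (rule map_idI) (force simp: A_def)
  hence "ennreal (nnorm E (simple_integral_on \<mu> E L))
      \<le> (\<integral>\<^sup>+x. ennreal (nnorm E (nadd E (nzero E) (simple_value E L x))) * indicator A x \<partial>\<mu>)"
    using simple_integral_norm_le_shifted[OF L A fin zero_closed]
    by (simp add: scale_zero_right zero_add simple_integral_closed[OF L])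
  also have "\<dots> \<le> (\<integral>\<^sup>+x. ennreal (nnorm E (simple_value E L x)) \<partial>\<mu>)"
    using simple_value_closed[OF L] by (intro nn_integral_mono) (auto simp: indicator_def zero_add)
  finally show ?thesis .
qed

lemma simple_integral_nd_le:
  assumes L: "simple_repr \<mu> E L" and L': "simple_repr \<mu> E L'"
  shows "ennreal (nd (simple_integral_on \<mu> E L) (simple_integral_on \<mu> E L'))
    \<le> (\<integral>\<^sup>+x. ennreal (nd (simple_value E L x) (simple_value E L' x)) \<partial>\<mu>)"
proof -
  have "simple_repr \<mu> E (L @ simple_neg L')" using L simple_neg(1)[OF L'] by (simp add: simple_repr_simps)
  from simple_integral_norm_le[OF this] show ?thesis
    by (simp add: simple_value_append[OF L simple_neg(1)[OF L']] simple_integral_append[OF L simple_neg(1)[OF L']]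
        simple_neg[OF L'] ndist_def ndiff_eq)
qed

text \<open>Measurability is obtained from continuity of real functions, since the carrier itself has no topology as
a type.\<close>

lemma nd_continuous_measurable:
  fixes f :: "'g::topological_space \<Rightarrow> 'e"
  assumes f: "\<And>g. f g \<in> ncar E"
    and cont: "\<And>g \<epsilon>. 0 < \<epsilon> \<Longrightarrow> \<exists>U. open U \<and> g \<in> U \<and> (\<forall>h\<in>U. nd (f h) (f g) < \<epsilon>)"
    and cont': "\<And>g \<epsilon>. 0 < \<epsilon> \<Longrightarrow> \<exists>U. open U \<and> g \<in> U \<and> (\<forall>h\<in>U. nd (f' h) (f' g) < \<epsilon>)"
    and f': "\<And>g. f' g \<in> ncar E"
    and \<mu>: "sets \<mu> = sets borel"
  shows "(\<lambda>g. nd (f g) (f' g)) \<in> borel_measurable \<mu>"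
proof -
  have "continuous_on UNIV (\<lambda>g. nd (f g) (f' g))"
    unfolding continuous_on_def tendsto_iff eventually_at_topological
  proof (intro ballI allI impI)
    fix g and \<epsilon> :: real assume "0 < \<epsilon>"
    hence e2: "0 < \<epsilon> / 2" by simp
    obtain U where U: "open U" "g \<in> U" "\<forall>h\<in>U. nd (f h) (f g) < \<epsilon> / 2" using cont[OF e2, of g] by blast
    obtain V where V: "open V" "g \<in> V" "\<forall>h\<in>V. nd (f' h) (f' g) < \<epsilon> / 2" using cont'[OF e2, of g] by blast
    have "dist (nd (f h) (f' h)) (nd (f g) (f' g)) < \<epsilon>" if h: "h \<in> U \<inter> V" for h
    proof -
      have "nd (f h) (f' h) \<le> nd (f h) (f g) + (nd (f g) (f' g) + nd (f' g) (f' h))"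
        "nd (f g) (f' g) \<le> nd (f g) (f h) + (nd (f h) (f' h) + nd (f' h) (f' g))"
        using nd_triangle[OF f[of h] f[of g] f'[of h]] nd_triangle[OF f[of g] f'[of g] f'[of h]]
          nd_triangle[OF f[of g] f[of h] f'[of g]] nd_triangle[OF f[of h] f'[of h] f'[of g]] by linarith+
      moreover have "nd (f g) (f h) = nd (f h) (f g)" "nd (f' g) (f' h) = nd (f' h) (f' g)"
        using f f' by (simp_all add: nd_commute)
      ultimately show ?thesis using bspec[OF U(3), of h] bspec[OF V(3), of h] h by (simp add: dist_real_def)
    qed
    thus "\<exists>S. open S \<and> g \<in> S \<and> (\<forall>x\<in>S. x \<noteq> g \<longrightarrow> x \<in> UNIV \<longrightarrow> dist (nd (f x) (f' x)) (nd (f g) (f' g)) < \<epsilon>)"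
      using U V by (intro exI[of _ "U \<inter> V"]) auto
  qed
  hence "(\<lambda>g. nd (f g) (f' g)) \<in> borel_measurable borel" by (rule borel_measurable_continuous_onI)
  thus ?thesis using measurable_cong_sets[OF \<mu> refl] by blast
qed

lemma CcD:
  assumes "f \<in> Cc E"
  shows "f g \<in> ncar E" "0 < \<epsilon> \<Longrightarrow> \<exists>U. open U \<and> g \<in> U \<and> (\<forall>h \<in> U. nd (f h) (f g) < \<epsilon>)"
    "\<exists>K. compact K \<and> (\<forall>g. g \<notin> K \<longrightarrow> f g = nzero E)"
  using assms by (auto simp: Cc_def ndist_def)

lemma Cc_nd_measurable:
  assumes f: "f \<in> Cc E" and f': "f' \<in> Cc E" and \<mu>: "sets \<mu> = sets borel"
  shows "(\<lambda>g. nd (f g) (f' g)) \<in> borel_measurable \<mu>"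
  by (rule nd_continuous_measurable[OF CcD(1,2)[OF f] CcD(2)[OF f'] CcD(1)[OF f'] \<mu>])

lemma Cc_nd_const_measurable:
  assumes f: "f \<in> Cc E" and e: "e \<in> ncar E" and \<mu>: "sets \<mu> = sets borel"
  shows "(\<lambda>g. nd (f g) e) \<in> borel_measurable \<mu>"
  by (rule nd_continuous_measurable[OF CcD(1,2)[OF f] _ e \<mu>]) (auto simp: nd_self[OF e] intro: exI[of _ UNIV])

lemma Cc_norm_measurable:
  assumes "f \<in> Cc E" "sets \<mu> = sets borel"
  shows "(\<lambda>g. nnorm E (f g)) \<in> borel_measurable \<mu>"
  using Cc_nd_const_measurable[OF assms(1) zero_closed assms(2)] CcD(1)[OF assms(1)] by (simp add: nd_zero)

lemma has_bochner_iff: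
  "has_bochner_integral_on \<mu> E f v \<longleftrightarrow> v \<in> ncar E \<and> (\<forall>\<epsilon>>0. \<exists>L. simple_repr \<mu> E L
     \<and> (\<lambda>x. nd (f x) (simple_value E L x)) \<in> borel_measurable \<mu>
     \<and> (\<integral>\<^sup>+x. ennreal (nd (f x) (simple_value E L x)) \<partial>\<mu>) < ennreal \<epsilon>
     \<and> nd v (simple_integral_on \<mu> E L) < \<epsilon>)"
  by (simp add: has_bochner_integral_on_def ndist_def)

lemma bochner_integral_nd_le:
  assumes v: "has_bochner_integral_on \<mu> E f v" and w: "has_bochner_integral_on \<mu> E f' w"
    and f: "\<And>x. f x \<in> ncar E" and f': "\<And>x. f' x \<in> ncar E"
    and meas: "(\<lambda>x. nd (f x) (f' x)) \<in> borel_measurable \<mu>"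
  shows "ennreal (nd v w) \<le> (\<integral>\<^sup>+x. ennreal (nd (f x) (f' x)) \<partial>\<mu>)"
proof (rule ennreal_le_epsilon)
  fix e :: real assume e: "0 < e"
  have vw: "v \<in> ncar E" "w \<in> ncar E" using v w by (simp_all add: has_bochner_iff)
  obtain L where L: "simple_repr \<mu> E L" "(\<lambda>x. nd (f x) (simple_value E L x)) \<in> borel_measurable \<mu>"
    "(\<integral>\<^sup>+x. ennreal (nd (f x) (simple_value E L x)) \<partial>\<mu>) < ennreal (e / 4)" "nd v (simple_integral_on \<mu> E L) < e / 4"
    using v e unfolding has_bochner_iff by (meson divide_pos_pos zero_less_numeral)
  obtain M where M: "simple_repr \<mu> E M" "(\<lambda>x. nd (f' x) (simple_value E M x)) \<in> borel_measurable \<mu>"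
    "(\<integral>\<^sup>+x. ennreal (nd (f' x) (simple_value E M x)) \<partial>\<mu>) < ennreal (e / 4)" "nd w (simple_integral_on \<mu> E M) < e / 4"
    using w e unfolding has_bochner_iff by (meson divide_pos_pos zero_less_numeral)
  note c = simple_integral_closed[OF L(1)] simple_integral_closed[OF M(1)]
  note cv = simple_value_closed[OF L(1)] simple_value_closed[OF M(1)]
  let ?l = "simple_integral_on \<mu> E L" and ?m = "simple_integral_on \<mu> E M"
  have "nd v w \<le> nd v ?l + (nd ?l ?m + nd w ?m)"
    using nd_triangle[OF vw(1) c(1) vw(2)] nd_triangle[OF c(1,2) vw(2)] nd_commute[OF vw(2) c(2)] by linarith
  also have "\<dots> \<le> nd ?l ?m + e / 2" using L M by simp
  finally have "ennreal (nd v w) \<le> ennreal (nd ?l ?m) + ennreal (e / 2)"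
    using e c by (simp add: nd_nonneg ennreal_leI flip: ennreal_plus)
  also have "ennreal (nd ?l ?m) \<le> (\<integral>\<^sup>+x. ennreal (nd (simple_value E L x) (simple_value E M x)) \<partial>\<mu>)"
    by (rule simple_integral_nd_le[OF L(1) M(1)])
  also have "\<dots> \<le> (\<integral>\<^sup>+x. ennreal (nd (f x) (simple_value E L x)) + (ennreal (nd (f x) (f' x)) + ennreal (nd (f' x) (simple_value E M x))) \<partial>\<mu>)"
  proof (rule nn_integral_mono)
    fix x
    have "nd (simple_value E L x) (simple_value E M x) \<le> nd (f x) (simple_value E L x) + (nd (f x) (f' x) + nd (f' x) (simple_value E M x))"
      using nd_triangle[OF cv(1)[of x] f[of x] cv(2)[of x]] nd_triangle[OF f[of x] f'[of x] cv(2)[of x]]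
        nd_commute[OF cv(1)[of x] f[of x]] by linarith
    thus "ennreal (nd (simple_value E L x) (simple_value E M x))
        \<le> ennreal (nd (f x) (simple_value E L x)) + (ennreal (nd (f x) (f' x)) + ennreal (nd (f' x) (simple_value E M x)))"
      using f f' cv by (simp add: nd_nonneg ennreal_leI flip: ennreal_plus)
  qed
  also have "\<dots> = (\<integral>\<^sup>+x. ennreal (nd (f x) (simple_value E L x)) \<partial>\<mu>) + ((\<integral>\<^sup>+x. ennreal (nd (f x) (f' x)) \<partial>\<mu>) + (\<integral>\<^sup>+x. ennreal (nd (f' x) (simple_value E M x)) \<partial>\<mu>))"
    using L(2) M(2) meas by (subst nn_integral_add; (subst nn_integral_add)?) auto
  also have "\<dots> \<le> ennreal (e / 4) + ((\<integral>\<^sup>+x. ennreal (nd (f x) (f' x)) \<partial>\<mu>) + ennreal (e / 4))"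
    using L(3) M(3) by (intro add_mono) auto
  also have "ennreal (e / 4) + ((\<integral>\<^sup>+x. ennreal (nd (f x) (f' x)) \<partial>\<mu>) + ennreal (e / 4)) + ennreal (e / 2)
      = (\<integral>\<^sup>+x. ennreal (nd (f x) (f' x)) \<partial>\<mu>) + (ennreal (e / 4) + ennreal (e / 4) + ennreal (e / 2))"
    by (simp add: ac_simps)
  also have "ennreal (e / 4) + ennreal (e / 4) + ennreal (e / 2) = ennreal e"
    using e by (simp flip: ennreal_plus)
  finally show "ennreal (nd v w) \<le> (\<integral>\<^sup>+x. ennreal (nd (f x) (f' x)) \<partial>\<mu>) + ennreal e"
    by (simp add: add_right_mono)
qed

lemma bochner_integral_unique:
  assumes v: "has_bochner_integral_on \<mu> E f v" and f: "\<And>x. f x \<in> ncar E"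
  shows "bochner_integral_on \<mu> E f = v"
  unfolding bochner_integral_on_def
proof (rule the_equality)
  show "has_bochner_integral_on \<mu> E f v" by (rule v)
  fix w assume w: "has_bochner_integral_on \<mu> E f w"
  have vw: "v \<in> ncar E" "w \<in> ncar E" using v w by (simp_all add: has_bochner_iff)
  have "ennreal (nd w v) \<le> 0"
    using bochner_integral_nd_le[OF w v f f] by (simp add: nd_self f)
  hence "nd w v = 0" using nd_nonneg[OF vw(2,1)] by (simp add: ennreal_eq_0_iff)
  thus "w = v" by (rule nd_eq_0[OF vw(2,1)])
qed

lemma bochner_zero: "has_bochner_integral_on \<mu> E (\<lambda>x. nzero E) (nzero E)"
  unfolding has_bochner_iff
  by (auto intro!: exI[of _ "[]"] simp: simple_repr_simps simple_value_simps simple_integral_simps nd_self closed)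

lemma bochner_integral_norm_le:
  assumes v: "has_bochner_integral_on \<mu> E f v" and f: "\<And>x. f x \<in> ncar E"
    and meas: "(\<lambda>x. nnorm E (f x)) \<in> borel_measurable \<mu>"
  shows "ennreal (nnorm E v) \<le> (\<integral>\<^sup>+x. ennreal (nnorm E (f x)) \<partial>\<mu>)"
  using bochner_integral_nd_le[OF v bochner_zero f zero_closed] meas f v
  by (simp add: nd_zero has_bochner_iff)

text \<open>A finite cover of the support by sets of small oscillation, made disjoint, gives the simple function.\<close>

lemma Cc_simple_approx:
  fixes f :: "'g::t2_space \<Rightarrow> 'e"
  assumes f: "f \<in> Cc E" and \<mu>: "sets \<mu> = sets borel" and fin: "\<And>K. compact K \<Longrightarrow> emeasure \<mu> K < \<infinity>"
    and K: "compact K" "\<And>g. g \<notin> K \<Longrightarrow> f g = nzero E" and e: "0 < \<epsilon>"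
  shows "\<exists>L. simple_repr \<mu> E L \<and> (\<forall>g. nd (f g) (simple_value E L g) \<le> \<epsilon> * indicator K g)"
proof -
  note fc = CcD(1)[OF f]
  have "\<forall>g. \<exists>U. open U \<and> g \<in> U \<and> (\<forall>h\<in>U. nd (f h) (f g) < \<epsilon>)" using CcD(2)[OF f e] by blast
  then obtain U where U: "\<And>g. open (U g)" "\<And>g. g \<in> U g" "\<And>g h. h \<in> U g \<Longrightarrow> nd (f h) (f g) < \<epsilon>" by metis
  obtain D where D: "D \<subseteq> K" "finite D" "K \<subseteq> (\<Union>g\<in>D. U g)"
    using compactE_image[OF K(1), of K U] U by blast
  have Kb: "K \<in> sets \<mu>" using compact_imp_closed[OF K(1)] by (simp add: \<mu>)
  have "\<exists>L. simple_repr \<mu> E L \<and> (\<forall>g \<in> K \<inter> (\<Union>x\<in>D. U x). nd (f g) (simple_value E L g) \<le> \<epsilon>)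
      \<and> (\<forall>g. g \<notin> K \<inter> (\<Union>x\<in>D. U x) \<longrightarrow> simple_value E L g = nzero E)"
    using D(2)
  proof (induction D)
    case empty
    show ?case by (rule exI[of _ "[]"]) (simp add: simple_repr_simps simple_value_simps)
  next
    case (insert d D)
    then obtain L where L: "simple_repr \<mu> E L" "\<And>g. g \<in> K \<inter> (\<Union>x\<in>D. U x) \<Longrightarrow> nd (f g) (simple_value E L g) \<le> \<epsilon>"
      "\<And>g. g \<notin> K \<inter> (\<Union>x\<in>D. U x) \<Longrightarrow> simple_value E L g = nzero E" by blast
    let ?A = "K \<inter> (U d - (\<Union>x\<in>D. U x))"
    have "open (U d)" "open (\<Union>x\<in>D. U x)" using U(1) by auto
    hence A: "?A \<in> sets \<mu>" using Kb by (auto simp: \<mu>)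
    have "emeasure \<mu> ?A \<le> emeasure \<mu> K" using Kb by (intro emeasure_mono) auto
    hence Af: "emeasure \<mu> ?A < \<infinity>" using fin[OF K(1)] by (rule le_less_trans)
    have val: "simple_value E ((?A, f d) # L) g = (if g \<in> ?A then f d else simple_value E L g)" for g
      using L(3)[of g] fc simple_value_closed[OF L(1)] by (auto simp: simple_value_simps add_zero zero_add)
    show ?case
    proof (intro exI conjI ballI allI impI)
      show "simple_repr \<mu> E ((?A, f d) # L)" using A Af L(1) fc by (simp add: simple_repr_simps)
      show "nd (f g) (simple_value E ((?A, f d) # L) g) \<le> \<epsilon>" if "g \<in> K \<inter> (\<Union>x\<in>insert d D. U x)" for g
        using that L(2)[of g] U(3)[of g d] by (auto simp: val)
      show "simple_value E ((?A, f d) # L) g = nzero E" if "g \<notin> K \<inter> (\<Union>x\<in>insert d D. U x)" for g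
        using that L(3)[of g] by (auto simp: val)
    qed
  qed
  then obtain L where L: "simple_repr \<mu> E L" "\<And>g. g \<in> K \<inter> (\<Union>x\<in>D. U x) \<Longrightarrow> nd (f g) (simple_value E L g) \<le> \<epsilon>"
      "\<And>g. g \<notin> K \<inter> (\<Union>x\<in>D. U x) \<Longrightarrow> simple_value E L g = nzero E" by blast
  have "nd (f g) (simple_value E L g) \<le> \<epsilon> * indicator K g" for g
    using L(2,3)[of g] D(3) K(2)[of g] by (cases "g \<in> K") (auto simp: nd_self closed)
  thus ?thesis using L(1) by blast
qed

lemma Cc_small_integral:
  fixes f :: "'g::t2_space \<Rightarrow> 'e"
  assumes f: "f \<in> Cc E" and \<mu>: "sets \<mu> = sets borel" and fin: "\<And>K. compact K \<Longrightarrow> emeasure \<mu> K < \<infinity>"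
    and e: "0 < \<epsilon>"
  shows "\<exists>L. simple_repr \<mu> E L \<and> (\<lambda>x. nd (f x) (simple_value E L x)) \<in> borel_measurable \<mu>
    \<and> (\<integral>\<^sup>+x. ennreal (nd (f x) (simple_value E L x)) \<partial>\<mu>) < ennreal \<epsilon>"
proof -
  obtain K where K: "compact K" "\<And>g. g \<notin> K \<Longrightarrow> f g = nzero E" using CcD(3)[OF f] by blast
  have Kb: "K \<in> sets \<mu>" using compact_imp_closed[OF K(1)] by (simp add: \<mu>)
  define \<delta> where "\<delta> = \<epsilon> / (measure \<mu> K + 1)"
  have d: "0 < \<delta>" using e by (simp add: \<delta>_def add_nonneg_pos)
  obtain L where L: "simple_repr \<mu> E L" "\<And>g. nd (f g) (simple_value E L g) \<le> \<delta> * indicator K g"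
    using Cc_simple_approx[OF f \<mu> fin K d] by blast
  have "(\<integral>\<^sup>+x. ennreal (nd (f x) (simple_value E L x)) \<partial>\<mu>) \<le> (\<integral>\<^sup>+x. ennreal \<delta> * indicator K x \<partial>\<mu>)"
  proof (rule nn_integral_mono)
    fix x show "ennreal (nd (f x) (simple_value E L x)) \<le> ennreal \<delta> * indicator K x"
      using L(2)[of x] by (cases "x \<in> K") (auto intro: ennreal_leI simp: ennreal_neg)
  qed
  also have "\<dots> = ennreal (\<delta> * measure \<mu> K)"
    using fin[OF K(1)] Kb d by (simp add: nn_integral_cmult emeasure_eq_ennreal_measure ennreal_mult)
  also have "\<dots> < ennreal \<epsilon>"
  proof -
    have "\<delta> * measure \<mu> K < \<delta> * (measure \<mu> K + 1)" using d by simp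
    also have "\<dots> = \<epsilon>" using add_nonneg_pos[of "measure \<mu> K" 1] by (simp add: \<delta>_def)
    finally show ?thesis using e by (simp add: ennreal_lessI)
  qed
  finally have "(\<integral>\<^sup>+x. ennreal (nd (f x) (simple_value E L x)) \<partial>\<mu>) < ennreal \<epsilon>" .
  thus ?thesis using L(1) simple_measurable[OF L(1) Cc_nd_const_measurable[OF f _ \<mu>]] by blast
qed

text \<open>The integrals of simple functions that approximate \<open>f\<close> in mean form a Cauchy sequence, whose limit is the
integral.\<close>

lemma Cc_has_bochner:
  fixes f :: "'g::t2_space \<Rightarrow> 'e"
  assumes f: "f \<in> Cc E" and \<mu>: "sets \<mu> = sets borel" and fin: "\<And>K. compact K \<Longrightarrow> emeasure \<mu> K < \<infinity>"
  shows "\<exists>v. has_bochner_integral_on \<mu> E f v"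
proof -
  note fc = CcD(1)[OF f]
  have "\<forall>n. \<exists>L. simple_repr \<mu> E L \<and> (\<lambda>x. nd (f x) (simple_value E L x)) \<in> borel_measurable \<mu>
    \<and> (\<integral>\<^sup>+x. ennreal (nd (f x) (simple_value E L x)) \<partial>\<mu>) < ennreal (1 / real (Suc n))"
    by (intro allI Cc_small_integral[OF f \<mu> fin]) auto
  then obtain L where L: "\<And>n. simple_repr \<mu> E (L n)" "\<And>n. (\<lambda>x. nd (f x) (simple_value E (L n) x)) \<in> borel_measurable \<mu>"
    "\<And>n. (\<integral>\<^sup>+x. ennreal (nd (f x) (simple_value E (L n) x)) \<partial>\<mu>) < ennreal (1 / real (Suc n))" by metis
  let ?X = "\<lambda>n. simple_integral_on \<mu> E (L n)"
  have Xc: "?X n \<in> ncar E" for n by (rule simple_integral_closed[OF L(1)])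
  have close: "nd (?X m) (?X n) \<le> 1 / real (Suc m) + 1 / real (Suc n)" for m n
  proof -
    have "ennreal (nd (?X m) (?X n)) \<le> (\<integral>\<^sup>+x. ennreal (nd (simple_value E (L m) x) (simple_value E (L n) x)) \<partial>\<mu>)"
      by (rule simple_integral_nd_le[OF L(1) L(1)])
    also have "\<dots> \<le> (\<integral>\<^sup>+x. ennreal (nd (f x) (simple_value E (L m) x)) + ennreal (nd (f x) (simple_value E (L n) x)) \<partial>\<mu>)"
    proof (rule nn_integral_mono)
      fix x
      note cv = simple_value_closed[OF L(1)[of m], of x] simple_value_closed[OF L(1)[of n], of x]
      show "ennreal (nd (simple_value E (L m) x) (simple_value E (L n) x))
          \<le> ennreal (nd (f x) (simple_value E (L m) x)) + ennreal (nd (f x) (simple_value E (L n) x))"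
        using nd_triangle[OF cv(1) fc[of x] cv(2)] nd_commute[OF cv(1) fc[of x]] fc[of x] cv
        by (simp add: nd_nonneg ennreal_leI flip: ennreal_plus)
    qed
    also have "\<dots> = (\<integral>\<^sup>+x. ennreal (nd (f x) (simple_value E (L m) x)) \<partial>\<mu>) + (\<integral>\<^sup>+x. ennreal (nd (f x) (simple_value E (L n) x)) \<partial>\<mu>)"
      using L(2) by (intro nn_integral_add) auto
    also have "\<dots> \<le> ennreal (1 / real (Suc m)) + ennreal (1 / real (Suc n))"
      using L(3) by (intro add_mono less_imp_le)
    also have "\<dots> = ennreal (1 / real (Suc m) + 1 / real (Suc n))" by (simp flip: ennreal_plus)
    finally show ?thesis by (subst (asm) ennreal_le_iff) (auto intro: add_nonneg_nonneg)
  qed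
  have small: "\<exists>N. \<forall>n\<ge>N. 1 / real (Suc n) < \<epsilon>" if e: "0 < \<epsilon>" for \<epsilon> :: real
  proof -
    obtain N where N: "inverse (real (Suc N)) < \<epsilon>" using reals_Archimedean[OF e] by blast
    have "1 / real (Suc n) < \<epsilon>" if "n \<ge> N" for n
      using N that frac_le[of 1 1 "real (Suc N)" "real (Suc n)"] by (simp add: inverse_eq_divide)
    thus ?thesis by blast
  qed
  have "\<exists>x\<in>ncar E. (\<lambda>n. nnorm E (ndiff E (?X n) x)) \<longlonglongrightarrow> 0"
  proof (rule complete)
    show "\<forall>n. ?X n \<in> ncar E" using Xc by blast
    show "\<forall>\<epsilon>>0. \<exists>N. \<forall>m\<ge>N. \<forall>n\<ge>N. nnorm E (ndiff E (?X m) (?X n)) < \<epsilon>"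
    proof (intro allI impI)
      fix \<epsilon> :: real assume "0 < \<epsilon>"
      then obtain N where N: "\<forall>n\<ge>N. 1 / real (Suc n) < \<epsilon> / 2" using small[of "\<epsilon> / 2"] by auto
      have "nd (?X m) (?X n) < \<epsilon>" if "m \<ge> N" "n \<ge> N" for m n
        using close[of m n] N[rule_format, OF that(1)] N[rule_format, OF that(2)] by linarith
      thus "\<exists>N. \<forall>m\<ge>N. \<forall>n\<ge>N. nnorm E (ndiff E (?X m) (?X n)) < \<epsilon>"
        unfolding ndist_def by blast
    qed
  qed
  then obtain v where v: "v \<in> ncar E" "(\<lambda>n. nd (?X n) v) \<longlonglongrightarrow> 0" by (auto simp: ndist_def)
  have "\<exists>M. simple_repr \<mu> E M \<and> (\<lambda>x. nd (f x) (simple_value E M x)) \<in> borel_measurable \<mu>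
     \<and> (\<integral>\<^sup>+x. ennreal (nd (f x) (simple_value E M x)) \<partial>\<mu>) < ennreal \<epsilon> \<and> nd v (simple_integral_on \<mu> E M) < \<epsilon>"
    if e: "0 < \<epsilon>" for \<epsilon>
  proof -
    obtain N where N: "\<forall>n\<ge>N. 1 / real (Suc n) < \<epsilon>" using small[OF e] by blast
    obtain N' where N': "\<forall>n\<ge>N'. nd (?X n) v < \<epsilon>"
      using order_tendstoD(2)[OF v(2) e] by (auto simp: eventually_sequentially)
    let ?n = "max N N'"
    have "(\<integral>\<^sup>+x. ennreal (nd (f x) (simple_value E (L ?n) x)) \<partial>\<mu>) < ennreal \<epsilon>"
      using L(3)[of ?n] N e by (meson ennreal_leI less_imp_le max.cobounded1 order_less_le_trans)
    moreover have "nd v (?X ?n) < \<epsilon>" using N' nd_commute[OF v(1) Xc] by simp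
    ultimately show ?thesis using L(1,2) by blast
  qed
  thus ?thesis unfolding has_bochner_iff using v(1) by blast
qed

end

section \<open>Generated structures and pullbacks\<close>

definition locally_approximable ::
  "'x topology \<Rightarrow> ('x \<Rightarrow> ('e, 'm) bspace_scheme) \<Rightarrow> ('x \<Rightarrow> 'e) set \<Rightarrow> ('x \<Rightarrow> 'e) \<Rightarrow> bool" where
  "locally_approximable X E S \<zeta> \<longleftrightarrow> (\<forall>x \<in> topspace X. \<forall>\<epsilon>>0. \<exists>U. openin X U \<and> x \<in> U
     \<and> (\<exists>\<xi> \<in> S. \<forall>z \<in> U. ndist (E z) (\<zeta> z) (\<xi> z) \<le> \<epsilon>))"

text \<open>The closure of \<open>S\<close> under the local uniform approximation in axiom C4.\<close>

definition generated_sections ::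
  "'x topology \<Rightarrow> ('x \<Rightarrow> ('e, 'm) bspace_scheme) \<Rightarrow> ('x \<Rightarrow> 'e) set \<Rightarrow> ('x \<Rightarrow> 'e) set" where
  "generated_sections X E S = {\<zeta> \<in> all_sections X E. locally_approximable X E S \<zeta>}"

lemma locally_approximableD:
  assumes "locally_approximable X E S \<zeta>" "x \<in> topspace X" "0 < \<epsilon>"
  obtains U \<xi> where "openin X U" "x \<in> U" "\<xi> \<in> S" "\<forall>z\<in>U. ndist (E z) (\<zeta> z) (\<xi> z) \<le> \<epsilon>"
  using assms unfolding locally_approximable_def by blast

lemma all_sectionsD: "\<xi> \<in> all_sections X E \<Longrightarrow> x \<in> topspace X \<Longrightarrow> \<xi> x \<in> ncar (E x)"
  by (auto simp: all_sections_def)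

lemma restrict_all_sections:
  "(\<And>x. x \<in> topspace X \<Longrightarrow> f x \<in> ncar (E x)) \<Longrightarrow> restrict f (topspace X) \<in> all_sections X E"
  by (auto simp: all_sections_def)

lemma all_sections_eqI:
  "\<xi> \<in> all_sections X E \<Longrightarrow> \<eta> \<in> all_sections X E \<Longrightarrow> (\<And>x. x \<in> topspace X \<Longrightarrow> \<xi> x = \<eta> x) \<Longrightarrow> \<xi> = \<eta>"
  unfolding all_sections_def by (rule PiE_ext)

lemma (in usc_field) C4':
  "\<xi> \<in> all_sections X E \<Longrightarrow> locally_approximable X E \<Gamma> \<xi> \<Longrightarrow> \<xi> \<in> \<Gamma>"
  by (rule C4) (auto simp: locally_approximable_def ndist_def)

lemma open_between:
  assumes "\<And>x. x \<in> S \<Longrightarrow> \<exists>T. openin X T \<and> x \<in> T \<and> T \<subseteq> S"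
  shows "openin X S"
  using assms openin_subopen by blast

text \<open>A set with C1 to C3 generates its closure under local approximation: the axioms pass to this closure,
and a structure that contains \<open>S\<close> contains the closure by C4.\<close>

lemma usc_field_generated:
  fixes E :: "'x \<Rightarrow> ('e, 'm) bspace_scheme"
  assumes fib: "\<And>x. x \<in> topspace X \<Longrightarrow> banach_space_on (E x)"
    and S: "S \<subseteq> all_sections X E" and S0: "sec_zero X E \<in> S"
    and Sadd: "\<And>\<xi> \<eta>. \<xi> \<in> S \<Longrightarrow> \<eta> \<in> S \<Longrightarrow> sec_add X E \<xi> \<eta> \<in> S"
    and Sscale: "\<And>\<xi> c. \<xi> \<in> S \<Longrightarrow> sec_scale X E c \<xi> \<in> S"
    and Sdense: "\<And>x e \<epsilon>. x \<in> topspace X \<Longrightarrow> e \<in> ncar (E x) \<Longrightarrow> 0 < \<epsilon> \<Longrightarrow> \<exists>\<xi> \<in> S. ndist (E x) (\<xi> x) e < \<epsilon>"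
    and Susc: "\<And>\<xi> r. \<xi> \<in> S \<Longrightarrow> openin X {x \<in> topspace X. nnorm (E x) (\<xi> x) < r}"
  shows "usc_field X E (generated_sections X E S)" "S \<subseteq> generated_sections X E S"
    "usc_field X E hull S = generated_sections X E S"
proof -
  have Ssec: "\<xi> x \<in> ncar (E x)" if "\<xi> \<in> S" "x \<in> topspace X" for \<xi> x
    by (rule all_sectionsD[OF subsetD[OF S that(1)] that(2)])
  have genD: "\<zeta> \<in> all_sections X E" "locally_approximable X E S \<zeta>" if "\<zeta> \<in> generated_sections X E S" for \<zeta>
    using that by (simp_all add: generated_sections_def)
  show sub: "S \<subseteq> generated_sections X E S"
  proof
    fix \<xi> assume \<xi>: "\<xi> \<in> S"
    have "locally_approximable X E S \<xi>"
      unfolding locally_approximable_def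
    proof (intro ballI allI impI)
      fix x and \<epsilon> :: real assume x: "x \<in> topspace X" "0 < \<epsilon>"
      hence "\<forall>z\<in>topspace X. ndist (E z) (\<xi> z) (\<xi> z) \<le> \<epsilon>"
        using banach_space_on.nd_self[OF fib Ssec[OF \<xi>]] by simp
      thus "\<exists>U. openin X U \<and> x \<in> U \<and> (\<exists>\<xi>'\<in>S. \<forall>z\<in>U. ndist (E z) (\<xi> z) (\<xi>' z) \<le> \<epsilon>)"
        using \<xi> x(1) openin_topspace by blast
    qed
    thus "\<xi> \<in> generated_sections X E S" using S \<xi> by (auto simp: generated_sections_def)
  qed
  show gen: "usc_field X E (generated_sections X E S)"
  proof (rule usc_field.intro)
    show "banach_space_on (E x)" if "x \<in> topspace X" for x by (rule fib[OF that])
    show "generated_sections X E S \<subseteq> all_sections X E" by (auto simp: generated_sections_def)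
    show "sec_zero X E \<in> generated_sections X E S" using sub S0 by blast
    show "sec_add X E \<zeta> \<eta> \<in> generated_sections X E S"
      if \<zeta>: "\<zeta> \<in> generated_sections X E S" and \<eta>: "\<eta> \<in> generated_sections X E S" for \<zeta> \<eta>
    proof -
      have sec: "\<zeta> \<in> all_sections X E" "\<eta> \<in> all_sections X E" using \<zeta> \<eta> by (auto simp: generated_sections_def)
      have "locally_approximable X E S (sec_add X E \<zeta> \<eta>)"
        unfolding locally_approximable_def
      proof (intro ballI allI impI)
        fix x and \<epsilon> :: real assume x: "x \<in> topspace X" and "0 < \<epsilon>"
        hence e: "0 < \<epsilon> / 2" by simp
        obtain U \<xi> where U: "openin X U" "x \<in> U" "\<xi> \<in> S" "\<forall>z\<in>U. ndist (E z) (\<zeta> z) (\<xi> z) \<le> \<epsilon> / 2"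
          using locally_approximableD[OF genD(2)[OF \<zeta>] x e] by blast
        obtain V \<xi>' where V: "openin X V" "x \<in> V" "\<xi>' \<in> S" "\<forall>z\<in>V. ndist (E z) (\<eta> z) (\<xi>' z) \<le> \<epsilon> / 2"
          using locally_approximableD[OF genD(2)[OF \<eta>] x e] by blast
        have "ndist (E z) (sec_add X E \<zeta> \<eta> z) (sec_add X E \<xi> \<xi>' z) \<le> \<epsilon>" if z: "z \<in> U \<inter> V" for z
        proof -
          have zX: "z \<in> topspace X" using z openin_subset[OF U(1)] by blast
          note c = all_sectionsD[OF sec(1) zX] all_sectionsD[OF sec(2) zX] Ssec[OF U(3) zX] Ssec[OF V(3) zX]
          show ?thesis
            using banach_space_on.nd_add[OF fib[OF zX] c] U(4)[rule_format, of z] V(4)[rule_format, of z] z zX by (simp add: sec_add_def)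
        qed
        thus "\<exists>W. openin X W \<and> x \<in> W \<and> (\<exists>\<xi>\<in>S. \<forall>z\<in>W. ndist (E z) (sec_add X E \<zeta> \<eta> z) (\<xi> z) \<le> \<epsilon>)"
          using U V Sadd[OF U(3) V(3)] by (intro exI[of _ "U \<inter> V"] conjI bexI[of _ "sec_add X E \<xi> \<xi>'"]) auto
      qed
      moreover have "sec_add X E \<zeta> \<eta> \<in> all_sections X E"
        unfolding sec_add_def
        by (intro restrict_all_sections banach_space_on.add_closed[OF fib] all_sectionsD[OF sec(1)] all_sectionsD[OF sec(2)])
      ultimately show ?thesis by (simp add: generated_sections_def)
    qed
    show "sec_scale X E c \<zeta> \<in> generated_sections X E S" if \<zeta>: "\<zeta> \<in> generated_sections X E S" for \<zeta> c
    proof -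
      have sec: "\<zeta> \<in> all_sections X E" using \<zeta> by (auto simp: generated_sections_def)
      have "locally_approximable X E S (sec_scale X E c \<zeta>)"
        unfolding locally_approximable_def
      proof (intro ballI allI impI)
        fix x and \<epsilon> :: real assume x: "x \<in> topspace X" and \<epsilon>: "0 < \<epsilon>"
        hence e: "0 < \<epsilon> / (cmod c + 1)" by (simp add: add_nonneg_pos)
        obtain U \<xi> where U: "openin X U" "x \<in> U" "\<xi> \<in> S" "\<forall>z\<in>U. ndist (E z) (\<zeta> z) (\<xi> z) \<le> \<epsilon> / (cmod c + 1)"
          using locally_approximableD[OF genD(2)[OF \<zeta>] x e] by blast
        have "ndist (E z) (sec_scale X E c \<zeta> z) (sec_scale X E c \<xi> z) \<le> \<epsilon>" if z: "z \<in> U" for z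
        proof -
          have zX: "z \<in> topspace X" using z openin_subset[OF U(1)] by blast
          note c = all_sectionsD[OF sec zX] Ssec[OF U(3) zX]
          have "cmod c * ndist (E z) (\<zeta> z) (\<xi> z) \<le> (cmod c + 1) * (\<epsilon> / (cmod c + 1))"
            using U(4)[rule_format, OF z] banach_space_on.nd_nonneg[OF fib[OF zX] c] by (intro mult_mono) auto
          also have "\<dots> = \<epsilon>" using add_nonneg_pos[of "cmod c" 1] by simp
          finally show ?thesis
            using banach_space_on.nd_scale[OF fib[OF zX] c] zX by (simp add: sec_scale_def)
        qed
        thus "\<exists>W. openin X W \<and> x \<in> W \<and> (\<exists>\<xi>\<in>S. \<forall>z\<in>W. ndist (E z) (sec_scale X E c \<zeta> z) (\<xi> z) \<le> \<epsilon>)"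
          using U Sscale[OF U(3)] by blast
      qed
      moreover have "sec_scale X E c \<zeta> \<in> all_sections X E"
        unfolding sec_scale_def
        by (intro restrict_all_sections banach_space_on.scale_closed[OF fib] all_sectionsD[OF sec])
      ultimately show ?thesis by (simp add: generated_sections_def)
    qed
    show "\<exists>\<xi>\<in>generated_sections X E S. nnorm (E x) (ndiff (E x) (\<xi> x) e) < \<epsilon>"
      if "x \<in> topspace X" "e \<in> ncar (E x)" "0 < \<epsilon>" for x e \<epsilon>
      using Sdense[OF that] sub by (auto simp: ndist_def)
    show "openin X {x \<in> topspace X. nnorm (E x) (\<zeta> x) < r}" if \<zeta>: "\<zeta> \<in> generated_sections X E S" for \<zeta> r
    proof (rule open_between)
      fix x assume "x \<in> {x \<in> topspace X. nnorm (E x) (\<zeta> x) < r}"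
      hence x: "x \<in> topspace X" and less: "nnorm (E x) (\<zeta> x) < r" by auto
      have sec: "\<zeta> \<in> all_sections X E" using \<zeta> by (auto simp: generated_sections_def)
      define \<delta> where "\<delta> = (r - nnorm (E x) (\<zeta> x)) / 3"
      have d: "0 < \<delta>" using less by (simp add: \<delta>_def)
      obtain U \<xi> where U: "openin X U" "x \<in> U" "\<xi> \<in> S" "\<forall>z\<in>U. ndist (E z) (\<zeta> z) (\<xi> z) \<le> \<delta>"
        using locally_approximableD[OF genD(2)[OF \<zeta>] x d] by blast
      let ?T = "U \<inter> {z \<in> topspace X. nnorm (E z) (\<xi> z) < r - \<delta>}"
      have "nnorm (E x) (\<xi> x) \<le> nnorm (E x) (\<zeta> x) + \<delta>"
        using banach_space_on.norm_le_nd[OF fib[OF x] Ssec[OF U(3) x] all_sectionsD[OF sec x]] U(4)[rule_format, OF U(2)]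
          banach_space_on.nd_commute[OF fib[OF x] Ssec[OF U(3) x] all_sectionsD[OF sec x]] by simp
      hence "x \<in> ?T" using U(2) x d by (simp add: \<delta>_def field_simps)
      moreover have "openin X ?T" by (intro openin_Int U Susc)
      moreover have "nnorm (E z) (\<zeta> z) < r" if "z \<in> ?T" for z
        using banach_space_on.norm_le_nd[OF fib all_sectionsD[OF sec] Ssec[OF U(3)], of z] U(4)[rule_format, of z] that by auto
      ultimately show "\<exists>T. openin X T \<and> x \<in> T \<and> T \<subseteq> {x \<in> topspace X. nnorm (E x) (\<zeta> x) < r}" by blast
    qed
    show "\<zeta> \<in> generated_sections X E S"
      if sec: "\<zeta> \<in> all_sections X E"
        and loc: "\<forall>x\<in>topspace X. \<forall>\<epsilon>>0. \<exists>U. openin X U \<and> x \<in> U \<and> (\<exists>\<xi>'\<in>generated_sections X E S. \<forall>z\<in>U. nnorm (E z) (ndiff (E z) (\<zeta> z) (\<xi>' z)) \<le> \<epsilon>)"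
      for \<zeta>
    proof -
      have "locally_approximable X E S \<zeta>"
        unfolding locally_approximable_def
      proof (intro ballI allI impI)
        fix x and \<epsilon> :: real assume x: "x \<in> topspace X" and "0 < \<epsilon>"
        hence e: "0 < \<epsilon> / 2" by simp
        obtain U \<eta> where U: "openin X U" "x \<in> U" "\<eta> \<in> generated_sections X E S" "\<forall>z\<in>U. ndist (E z) (\<zeta> z) (\<eta> z) \<le> \<epsilon> / 2"
          using loc x e unfolding ndist_def by meson
        have \<eta>: "\<eta> \<in> all_sections X E" "locally_approximable X E S \<eta>" using U(3) by (auto simp: generated_sections_def)
        obtain V \<xi> where V: "openin X V" "x \<in> V" "\<xi> \<in> S" "\<forall>z\<in>V. ndist (E z) (\<eta> z) (\<xi> z) \<le> \<epsilon> / 2"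
          using locally_approximableD[OF \<eta>(2) x e] by blast
        have "ndist (E z) (\<zeta> z) (\<xi> z) \<le> \<epsilon>" if z: "z \<in> U \<inter> V" for z
        proof -
          have zX: "z \<in> topspace X" using z openin_subset[OF U(1)] by blast
          show ?thesis
            using banach_space_on.nd_triangle[OF fib[OF zX] all_sectionsD[OF sec zX] all_sectionsD[OF \<eta>(1) zX] Ssec[OF V(3) zX]]
              U(4)[rule_format, of z] V(4)[rule_format, of z] z by auto
        qed
        thus "\<exists>W. openin X W \<and> x \<in> W \<and> (\<exists>\<xi>\<in>S. \<forall>z\<in>W. ndist (E z) (\<zeta> z) (\<xi> z) \<le> \<epsilon>)"
          using U V by (intro exI[of _ "U \<inter> V"] conjI bexI[of _ \<xi>]) auto
      qed
      thus ?thesis using sec by (simp add: generated_sections_def)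
    qed
  qed
  have "generated_sections X E S \<subseteq> T" if T: "usc_field X E T" "S \<subseteq> T" for T
  proof
    fix \<zeta> assume "\<zeta> \<in> generated_sections X E S"
    hence "\<zeta> \<in> all_sections X E" "locally_approximable X E T \<zeta>"
      using T(2) unfolding generated_sections_def locally_approximable_def by blast+
    thus "\<zeta> \<in> T" by (rule usc_field.C4'[OF T(1)])
  qed
  thus "usc_field X E hull S = generated_sections X E S"
    using gen sub unfolding hull_def by blast
qed

context usc_field
begin

lemma section_closed: "\<xi> \<in> \<Gamma> \<Longrightarrow> x \<in> topspace X \<Longrightarrow> \<xi> x \<in> ncar (E x)"
  by (rule all_sectionsD[OF subsetD[OF sections]])

context
  fixes Z :: "'z topology" and f :: "'z \<Rightarrow> 'x"
  assumes f: "continuous_map Z X f"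
begin

lemma pullback_base_in: "z \<in> topspace Z \<Longrightarrow> f z \<in> topspace X"
  using f by (auto simp: continuous_map_def)

lemma pullback_generated:
  defines "S \<equiv> (\<lambda>\<xi>. restrict (\<xi> \<circ> f) (topspace Z)) ` \<Gamma>"
  shows "usc_field Z (E \<circ> f) (pullback_sections Z f E \<Gamma>)" "S \<subseteq> pullback_sections Z f E \<Gamma>"
    "pullback_sections Z f E \<Gamma> = generated_sections Z (E \<circ> f) S"
proof -
  note fz = pullback_base_in
  have SI: "restrict (\<xi> \<circ> f) (topspace Z) \<in> S" if "\<xi> \<in> \<Gamma>" for \<xi> using that by (auto simp: S_def)
  have S: "S \<subseteq> all_sections Z (E \<circ> f)"
    unfolding S_def by (auto intro!: restrict_all_sections section_closed fz)
  have zero: "sec_zero Z (E \<circ> f) = restrict (sec_zero X E \<circ> f) (topspace Z)"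
    using fz by (auto simp: sec_zero_def fun_eq_iff restrict_def)
  have add: "sec_add Z (E \<circ> f) (restrict (\<xi> \<circ> f) (topspace Z)) (restrict (\<eta> \<circ> f) (topspace Z))
      = restrict (sec_add X E \<xi> \<eta> \<circ> f) (topspace Z)" for \<xi> \<eta>
    using fz by (auto simp: sec_add_def fun_eq_iff restrict_def)
  have scale: "sec_scale Z (E \<circ> f) c (restrict (\<xi> \<circ> f) (topspace Z))
      = restrict (sec_scale X E c \<xi> \<circ> f) (topspace Z)" for \<xi> c
    using fz by (auto simp: sec_scale_def fun_eq_iff restrict_def)
  have usc: "openin Z {z \<in> topspace Z. nnorm ((E \<circ> f) z) (\<zeta> z) < r}" if \<zeta>: "\<zeta> \<in> S" for \<zeta> r
  proof -
    obtain \<xi> where \<xi>: "\<xi> \<in> \<Gamma>" "\<zeta> = restrict (\<xi> \<circ> f) (topspace Z)" using \<zeta> by (auto simp: S_def)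
    have "openin Z {z \<in> topspace Z. f z \<in> {x \<in> topspace X. nnorm (E x) (\<xi> x) < r}}"
      by (rule openin_continuous_map_preimage[OF f C3[OF \<xi>(1)]])
    also have "{z \<in> topspace Z. f z \<in> {x \<in> topspace X. nnorm (E x) (\<xi> x) < r}}
        = {z \<in> topspace Z. nnorm ((E \<circ> f) z) (\<zeta> z) < r}" using fz by (auto simp: \<xi>(2))
    finally show ?thesis .
  qed
  have dense: "\<exists>\<zeta>\<in>S. ndist ((E \<circ> f) z) (\<zeta> z) e < \<epsilon>" if z: "z \<in> topspace Z" "e \<in> ncar ((E \<circ> f) z)" "0 < \<epsilon>" for z e \<epsilon>
  proof -
    obtain \<xi> where "\<xi> \<in> \<Gamma>" "nnorm (E (f z)) (ndiff (E (f z)) (\<xi> (f z)) e) < \<epsilon>"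
      using C2[OF fz[OF z(1)], of e \<epsilon>] z by auto
    thus ?thesis using SI z(1) by (intro bexI[of _ "restrict (\<xi> \<circ> f) (topspace Z)"]) (auto simp: ndist_def)
  qed
  have S0: "sec_zero Z (E \<circ> f) \<in> S" unfolding zero by (rule SI[OF C1_zero])
  have Sadd: "sec_add Z (E \<circ> f) \<xi> \<eta> \<in> S" if "\<xi> \<in> S" "\<eta> \<in> S" for \<xi> \<eta>
    using that add SI[OF C1_add] unfolding S_def by auto
  have Sscale: "sec_scale Z (E \<circ> f) c \<xi> \<in> S" if "\<xi> \<in> S" for \<xi> c
    using that scale SI[OF C1_scale] unfolding S_def by auto
  have fib: "banach_space_on ((E \<circ> f) z)" if "z \<in> topspace Z" for z using fibre_banach[OF fz[OF that]] by simp
  note gen = usc_field_generated[where E = "E \<circ> f", OF fib S S0 Sadd Sscale dense usc]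
  show "pullback_sections Z f E \<Gamma> = generated_sections Z (E \<circ> f) S"
    using gen(3) by (simp add: pullback_sections_def S_def)
  thus "usc_field Z (E \<circ> f) (pullback_sections Z f E \<Gamma>)" "S \<subseteq> pullback_sections Z f E \<Gamma>"
    using gen(1,2) by simp_all
qed

lemma pullback_of_section: "\<xi> \<in> \<Gamma> \<Longrightarrow> restrict (\<xi> \<circ> f) (topspace Z) \<in> pullback_sections Z f E \<Gamma>"
  using pullback_generated(2) by blast

text \<open>The restrictions of \<open>\<xi> \<circ> f\<close> satisfy C1 to C3, so the pullback consists of their local uniform limits.\<close>

lemma pullback_iff:
  "\<zeta> \<in> pullback_sections Z f E \<Gamma> \<longleftrightarrow> \<zeta> \<in> all_sections Z (E \<circ> f)
    \<and> (\<forall>z \<in> topspace Z. \<forall>\<epsilon>>0. \<exists>U. openin Z U \<and> z \<in> U \<and> (\<exists>\<xi> \<in> \<Gamma>. \<forall>w \<in> U. ndist (E (f w)) (\<zeta> w) (\<xi> (f w)) \<le> \<epsilon>))"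
proof -
  have "locally_approximable Z (E \<circ> f) ((\<lambda>\<xi>. restrict (\<xi> \<circ> f) (topspace Z)) ` \<Gamma>) \<zeta>
    \<longleftrightarrow> (\<forall>z \<in> topspace Z. \<forall>\<epsilon>>0. \<exists>U. openin Z U \<and> z \<in> U \<and> (\<exists>\<xi> \<in> \<Gamma>. \<forall>w \<in> U. ndist (E (f w)) (\<zeta> w) (\<xi> (f w)) \<le> \<epsilon>))"
  proof -
    have "(\<forall>w\<in>U. ndist (E (f w)) (\<zeta> w) (restrict (\<xi> \<circ> f) (topspace Z) w) \<le> \<epsilon>)
        \<longleftrightarrow> (\<forall>w\<in>U. ndist (E (f w)) (\<zeta> w) (\<xi> (f w)) \<le> \<epsilon>)" if "openin Z U" for U \<xi> \<epsilon>
      using openin_subset[OF that] by (intro ball_cong) auto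
    thus ?thesis unfolding locally_approximable_def by (simp cong: conj_cong)
  qed
  thus ?thesis unfolding pullback_generated(3) generated_sections_def by simp
qed

end

text \<open>Near \<open>x\<close> the section \<open>\<kappa> \<xi>\<close> is approximated by \<open>\<kappa>(x) \<xi>\<close>, because \<open>\<parallel>\<xi>\<parallel>\<close> is locally bounded.\<close>

lemma continuous_multiple:
  fixes \<kappa> :: "'x \<Rightarrow> real"
  assumes \<xi>: "\<xi> \<in> \<Gamma>" and \<kappa>: "continuous_map X euclideanreal \<kappa>"
  shows "(\<lambda>x \<in> topspace X. nscale (E x) (complex_of_real (\<kappa> x)) (\<xi> x)) \<in> \<Gamma>" (is "?\<eta> \<in> \<Gamma>")
proof (rule C4')
  show "?\<eta> \<in> all_sections X E"
    by (intro restrict_all_sections banach_space_on.scale_closed[OF fibre_banach] section_closed[OF \<xi>])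
  show "locally_approximable X E \<Gamma> ?\<eta>"
    unfolding locally_approximable_def
  proof (intro ballI allI impI)
    fix x and \<epsilon> :: real assume x: "x \<in> topspace X" and e: "0 < \<epsilon>"
    define r where "r = nnorm (E x) (\<xi> x) + 1"
    have r: "0 < r" using banach_space_on.norm_nonneg[OF fibre_banach[OF x] section_closed[OF \<xi> x]] by (simp add: r_def)
    let ?U = "{z \<in> topspace X. nnorm (E z) (\<xi> z) < r} \<inter> {z \<in> topspace X. \<kappa> z \<in> ball (\<kappa> x) (\<epsilon> / r)}"
    have "openin X ?U"
      by (intro openin_Int C3 \<xi> openin_continuous_map_preimage[OF \<kappa>]) simp
    moreover have "x \<in> ?U" using x e r by (simp add: r_def)
    moreover have "ndist (E z) (?\<eta> z) (sec_scale X E (complex_of_real (\<kappa> x)) \<xi> z) \<le> \<epsilon>" if z: "z \<in> ?U" for z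
    proof -
      have zX: "z \<in> topspace X" using z by auto
      interpret Ez: banach_space_on "E z" by (rule fibre_banach[OF zX])
      note c = section_closed[OF \<xi> zX]
      have "ndiff (E z) (nscale (E z) (complex_of_real (\<kappa> z)) (\<xi> z)) (nscale (E z) (complex_of_real (\<kappa> x)) (\<xi> z))
          = nscale (E z) (complex_of_real (\<kappa> z - \<kappa> x)) (\<xi> z)"
        using c by (simp add: ndiff_def Ez.scale_scale flip: Ez.add_scale)
      hence "ndist (E z) (?\<eta> z) (sec_scale X E (complex_of_real (\<kappa> x)) \<xi> z) = \<bar>\<kappa> z - \<kappa> x\<bar> * nnorm (E z) (\<xi> z)"
        using zX c by (simp only: ndist_def sec_scale_def restrict_apply' Ez.norm_scale norm_of_real)
      also have "\<dots> \<le> (\<epsilon> / r) * r"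
        using z e r Ez.norm_nonneg[OF c] by (intro mult_mono) (auto simp: dist_real_def abs_minus_commute)
      finally show ?thesis using r by simp
    qed
    ultimately show "\<exists>U. openin X U \<and> x \<in> U \<and> (\<exists>\<xi>\<in>\<Gamma>. \<forall>z\<in>U. ndist (E z) (?\<eta> z) (\<xi> z) \<le> \<epsilon>)"
      using C1_scale[OF \<xi>] by blast
  qed
qed

end

section \<open>The Banach space of sections vanishing at infinity\<close>

context groupoid_banach_algebra
begin

abbreviation \<Gamma>\<^sub>0 where "\<Gamma>\<^sub>0 \<equiv> Gamma0 Y B \<Gamma>"

lemma Gamma0_simps:
  "ncar \<Gamma>\<^sub>0 = sections_vanishing Y B \<Gamma>" "nzero \<Gamma>\<^sub>0 = sec_zero Y B" "nadd \<Gamma>\<^sub>0 = sec_add Y B"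
  "nscale \<Gamma>\<^sub>0 = sec_scale Y B" "nmul \<Gamma>\<^sub>0 = sec_mul Y B"
  by (simp_all add: Gamma0_def)

lemma Gamma0_norm: "nnorm \<Gamma>\<^sub>0 \<xi> = Sup (insert 0 ((\<lambda>y. nnorm (B y) (\<xi> y)) ` topspace Y))"
  by (simp add: Gamma0_def)

lemma Gamma0_section: "\<xi> \<in> ncar \<Gamma>\<^sub>0 \<Longrightarrow> \<xi> \<in> \<Gamma>"
  by (simp add: Gamma0_simps sections_vanishing_def)

lemma Gamma0_closed: "\<xi> \<in> ncar \<Gamma>\<^sub>0 \<Longrightarrow> y \<in> topspace Y \<Longrightarrow> \<xi> y \<in> ncar (B y)"
  by (rule section_closed[OF Gamma0_section])

lemma Gamma0_all_sections: "\<xi> \<in> ncar \<Gamma>\<^sub>0 \<Longrightarrow> \<xi> \<in> all_sections Y B"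
  using Gamma0_section sections by blast

lemma Gamma0_vanishes:
  assumes "\<xi> \<in> ncar \<Gamma>\<^sub>0" "0 < \<epsilon>"
  shows "\<exists>K. compactin Y K \<and> (\<forall>y \<in> topspace Y - K. nnorm (B y) (\<xi> y) < \<epsilon>)"
  using assms by (simp add: Gamma0_simps sections_vanishing_def)

lemma Gamma0I:
  assumes "\<xi> \<in> \<Gamma>" "\<And>\<epsilon>. 0 < \<epsilon> \<Longrightarrow> \<exists>K. compactin Y K \<and> (\<forall>y \<in> topspace Y - K. nnorm (B y) (\<xi> y) < \<epsilon>)"
  shows "\<xi> \<in> ncar \<Gamma>\<^sub>0"
  using assms by (simp add: Gamma0_simps sections_vanishing_def)

lemma Gamma0_compactI:
  assumes "\<xi> \<in> \<Gamma>" "compactin Y K" "\<And>y. y \<in> topspace Y - K \<Longrightarrow> \<xi> y = nzero (B y)"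
  shows "\<xi> \<in> ncar \<Gamma>\<^sub>0"
proof (rule Gamma0I[OF assms(1)])
  fix \<epsilon> :: real assume "0 < \<epsilon>"
  hence "\<forall>y \<in> topspace Y - K. nnorm (B y) (\<xi> y) < \<epsilon>"
    using assms(3) banach_space_on.nnorm_zero[OF fibre_banach] by simp
  thus "\<exists>K. compactin Y K \<and> (\<forall>y \<in> topspace Y - K. nnorm (B y) (\<xi> y) < \<epsilon>)" using assms(2) by blast
qed

text \<open>An upper semicontinuous function is bounded above on compact sets.\<close>

lemma section_bounded_on_compact:
  assumes \<xi>: "\<xi> \<in> \<Gamma>" and K: "compactin Y K"
  shows "\<exists>r. \<forall>y \<in> K. nnorm (B y) (\<xi> y) \<le> r"
proof -
  let ?U = "\<lambda>n :: nat. {y \<in> topspace Y. nnorm (B y) (\<xi> y) < real n}"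
  have cover: "K \<subseteq> \<Union>(range ?U)"
    using compactin_subset_topspace[OF K] reals_Archimedean2 by fastforce
  have op: "openin Y U" if "U \<in> range ?U" for U using that C3[OF \<xi>] by blast
  obtain \<F> where F: "finite \<F>" "\<F> \<subseteq> range ?U" "K \<subseteq> \<Union>\<F>"
    using compactinD[OF K op cover] by blast
  obtain N where N: "finite N" "\<F> = ?U ` N" using finite_subset_image[OF F(1,2)] by blast
  have "nnorm (B y) (\<xi> y) \<le> real (Max (insert 0 N))" if y: "y \<in> K" for y
  proof -
    obtain n where n: "n \<in> N" "nnorm (B y) (\<xi> y) < real n" using F(3) N y by blast
    thus ?thesis using Max_ge[of "insert 0 N" n] N(1) by (meson finite.insertI insertI2 less_imp_le less_le_trans of_nat_le_iff)
  qed
  thus ?thesis by blast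
qed

lemma Gamma0_bounded:
  assumes \<xi>: "\<xi> \<in> ncar \<Gamma>\<^sub>0"
  shows "bdd_above (insert 0 ((\<lambda>y. nnorm (B y) (\<xi> y)) ` topspace Y))"
proof -
  obtain K where K: "compactin Y K" "\<forall>y \<in> topspace Y - K. nnorm (B y) (\<xi> y) < 1"
    using Gamma0_vanishes[OF \<xi>, of 1] by auto
  obtain r where r: "\<forall>y \<in> K. nnorm (B y) (\<xi> y) \<le> r"
    using section_bounded_on_compact[OF Gamma0_section[OF \<xi>] K(1)] by blast
  have "nnorm (B y) (\<xi> y) \<le> max r 1" if "y \<in> topspace Y" for y
    using that K(2) r by (cases "y \<in> K") (auto intro: max.coboundedI1 max.coboundedI2 less_imp_le)
  thus ?thesis by (intro bdd_aboveI[of _ "max r 1"]) auto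
qed

lemma Gamma0_point_le: "\<xi> \<in> ncar \<Gamma>\<^sub>0 \<Longrightarrow> y \<in> topspace Y \<Longrightarrow> nnorm (B y) (\<xi> y) \<le> nnorm \<Gamma>\<^sub>0 \<xi>"
  unfolding Gamma0_norm by (rule cSup_upper[OF _ Gamma0_bounded]) auto

lemma Gamma0_norm_nonneg: "\<xi> \<in> ncar \<Gamma>\<^sub>0 \<Longrightarrow> 0 \<le> nnorm \<Gamma>\<^sub>0 \<xi>"
  unfolding Gamma0_norm by (rule cSup_upper[OF _ Gamma0_bounded]) auto

lemma Gamma0_norm_leI:
  "0 \<le> r \<Longrightarrow> (\<And>y. y \<in> topspace Y \<Longrightarrow> nnorm (B y) (\<xi> y) \<le> r) \<Longrightarrow> nnorm \<Gamma>\<^sub>0 \<xi> \<le> r"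
  unfolding Gamma0_norm by (rule cSup_least) auto

lemma Gamma0_apply:
  assumes "y \<in> topspace Y"
  shows "nzero \<Gamma>\<^sub>0 y = nzero (B y)" "nadd \<Gamma>\<^sub>0 \<xi> \<eta> y = nadd (B y) (\<xi> y) (\<eta> y)"
    "nscale \<Gamma>\<^sub>0 c \<xi> y = nscale (B y) c (\<xi> y)" "ndiff \<Gamma>\<^sub>0 \<xi> \<eta> y = ndiff (B y) (\<xi> y) (\<eta> y)"
    "nmul \<Gamma>\<^sub>0 \<xi> \<eta> y = nmul (B y) (\<xi> y) (\<eta> y)"
  using assms by (simp_all add: Gamma0_simps ndiff_def sec_zero_def sec_add_def sec_scale_def sec_mul_def)

lemma Gamma0_extensional: "\<xi> \<in> ncar \<Gamma>\<^sub>0 \<Longrightarrow> y \<notin> topspace Y \<Longrightarrow> \<xi> y = undefined"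
  using Gamma0_all_sections[of \<xi>] by (auto simp: all_sections_def)

lemma Gamma0_zero_closed: "nzero \<Gamma>\<^sub>0 \<in> ncar \<Gamma>\<^sub>0"
  by (rule Gamma0_compactI[of _ "{}"]) (simp_all add: Gamma0_simps(2) C1_zero, simp add: sec_zero_def)

lemma Gamma0_add_closed:
  assumes \<xi>: "\<xi> \<in> ncar \<Gamma>\<^sub>0" and \<eta>: "\<eta> \<in> ncar \<Gamma>\<^sub>0"
  shows "nadd \<Gamma>\<^sub>0 \<xi> \<eta> \<in> ncar \<Gamma>\<^sub>0"
proof (rule Gamma0I)
  show "nadd \<Gamma>\<^sub>0 \<xi> \<eta> \<in> \<Gamma>" unfolding Gamma0_simps by (rule C1_add[OF Gamma0_section[OF \<xi>] Gamma0_section[OF \<eta>]])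
  fix \<epsilon> :: real assume "0 < \<epsilon>"
  hence e: "0 < \<epsilon> / 2" by simp
  obtain K where K: "compactin Y K" "\<forall>y \<in> topspace Y - K. nnorm (B y) (\<xi> y) < \<epsilon> / 2" using Gamma0_vanishes[OF \<xi> e] by blast
  obtain L where L: "compactin Y L" "\<forall>y \<in> topspace Y - L. nnorm (B y) (\<eta> y) < \<epsilon> / 2" using Gamma0_vanishes[OF \<eta> e] by blast
  have "nnorm (B y) (nadd \<Gamma>\<^sub>0 \<xi> \<eta> y) < \<epsilon>" if y: "y \<in> topspace Y - (K \<union> L)" for y
    using banach_space_on.norm_triangle[OF fibre_banach Gamma0_closed[OF \<xi>] Gamma0_closed[OF \<eta>], of y] K(2)[rule_format, of y]
      L(2)[rule_format, of y] y by (simp add: Gamma0_apply)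
  thus "\<exists>K. compactin Y K \<and> (\<forall>y\<in>topspace Y - K. nnorm (B y) (nadd \<Gamma>\<^sub>0 \<xi> \<eta> y) < \<epsilon>)"
    using compactin_Un[OF K(1) L(1)] by blast
qed

lemma Gamma0_scale_closed:
  assumes \<xi>: "\<xi> \<in> ncar \<Gamma>\<^sub>0"
  shows "nscale \<Gamma>\<^sub>0 c \<xi> \<in> ncar \<Gamma>\<^sub>0"
proof (rule Gamma0I)
  show "nscale \<Gamma>\<^sub>0 c \<xi> \<in> \<Gamma>" unfolding Gamma0_simps by (rule C1_scale[OF Gamma0_section[OF \<xi>]])
  fix \<epsilon> :: real assume \<epsilon>: "0 < \<epsilon>"
  have pos: "0 < cmod c + 1" by (simp add: add_nonneg_pos)
  hence e: "0 < \<epsilon> / (cmod c + 1)" using \<epsilon> by simp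
  obtain K where K: "compactin Y K" "\<forall>y \<in> topspace Y - K. nnorm (B y) (\<xi> y) < \<epsilon> / (cmod c + 1)" using Gamma0_vanishes[OF \<xi> e] by blast
  have "nnorm (B y) (nscale \<Gamma>\<^sub>0 c \<xi> y) < \<epsilon>" if y: "y \<in> topspace Y - K" for y
  proof -
    have yY: "y \<in> topspace Y" using y by blast
    interpret By: banach_space_on "B y" by (rule fibre_banach[OF yY])
    have "cmod c * nnorm (B y) (\<xi> y) \<le> (cmod c + 1) * nnorm (B y) (\<xi> y)"
      using By.norm_nonneg[OF Gamma0_closed[OF \<xi> yY]] by (intro mult_right_mono) auto
    also have "\<dots> < \<epsilon>" using K(2)[rule_format, OF y] pos by (simp add: pos_less_divide_eq mult.commute)
    finally show ?thesis by (simp add: Gamma0_apply[OF yY] By.norm_scale[OF Gamma0_closed[OF \<xi> yY]])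
  qed
  thus "\<exists>K. compactin Y K \<and> (\<forall>y\<in>topspace Y - K. nnorm (B y) (nscale \<Gamma>\<^sub>0 c \<xi> y) < \<epsilon>)"
    using K(1) by blast
qed

lemma Gamma0_diff_closed: "\<xi> \<in> ncar \<Gamma>\<^sub>0 \<Longrightarrow> \<eta> \<in> ncar \<Gamma>\<^sub>0 \<Longrightarrow> ndiff \<Gamma>\<^sub>0 \<xi> \<eta> \<in> ncar \<Gamma>\<^sub>0"
  unfolding ndiff_def by (intro Gamma0_add_closed Gamma0_scale_closed)

lemma Gamma0_mul_closed:
  assumes \<xi>: "\<xi> \<in> ncar \<Gamma>\<^sub>0" and \<eta>: "\<eta> \<in> ncar \<Gamma>\<^sub>0"
  shows "nmul \<Gamma>\<^sub>0 \<xi> \<eta> \<in> ncar \<Gamma>\<^sub>0"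
proof (rule Gamma0I)
  show "nmul \<Gamma>\<^sub>0 \<xi> \<eta> \<in> \<Gamma>" unfolding Gamma0_simps by (rule continuous_mul[OF Gamma0_section[OF \<xi>] Gamma0_section[OF \<eta>]])
  fix \<epsilon> :: real assume \<epsilon>: "0 < \<epsilon>"
  let ?c = "nnorm \<Gamma>\<^sub>0 \<eta>"
  have pos: "0 < ?c + 1" using Gamma0_norm_nonneg[OF \<eta>] by simp
  hence e: "0 < \<epsilon> / (?c + 1)" using \<epsilon> by simp
  obtain K where K: "compactin Y K" "\<forall>y \<in> topspace Y - K. nnorm (B y) (\<xi> y) < \<epsilon> / (?c + 1)" using Gamma0_vanishes[OF \<xi> e] by blast
  have "nnorm (B y) (nmul \<Gamma>\<^sub>0 \<xi> \<eta> y) < \<epsilon>" if y: "y \<in> topspace Y - K" for y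
  proof -
    have yY: "y \<in> topspace Y" using y by blast
    interpret By: banach_algebra_on "B y" by (rule fibre_algebra[OF yY])
    note c = Gamma0_closed[OF \<xi> yY] Gamma0_closed[OF \<eta> yY]
    have "nnorm (B y) (nmul (B y) (\<xi> y) (\<eta> y)) \<le> nnorm (B y) (\<xi> y) * nnorm (B y) (\<eta> y)" by (rule By.norm_mul[OF c])
    also have "\<dots> \<le> nnorm (B y) (\<xi> y) * (?c + 1)"
      using Gamma0_point_le[OF \<eta> yY] By.norm_nonneg[OF c(1)] by (intro mult_left_mono) auto
    also have "\<dots> < \<epsilon>" using K(2)[rule_format, OF y] pos by (simp add: pos_less_divide_eq)
    finally show ?thesis by (simp add: Gamma0_apply[OF yY])
  qed
  thus "\<exists>K. compactin Y K \<and> (\<forall>y\<in>topspace Y - K. nnorm (B y) (nmul \<Gamma>\<^sub>0 \<xi> \<eta> y) < \<epsilon>)"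
    using K(1) by blast
qed

lemma Gamma0_eqI:
  "\<xi> \<in> ncar \<Gamma>\<^sub>0 \<Longrightarrow> \<eta> \<in> ncar \<Gamma>\<^sub>0 \<Longrightarrow> (\<And>y. y \<in> topspace Y \<Longrightarrow> \<xi> y = \<eta> y) \<Longrightarrow> \<xi> = \<eta>"
  by (rule all_sections_eqI[OF Gamma0_all_sections Gamma0_all_sections])

lemma Gamma0_nd_leI:
  "0 \<le> r \<Longrightarrow> (\<And>y. y \<in> topspace Y \<Longrightarrow> ndist (B y) (\<xi> y) (\<eta> y) \<le> r) \<Longrightarrow> ndist \<Gamma>\<^sub>0 \<xi> \<eta> \<le> r"
  unfolding ndist_def by (rule Gamma0_norm_leI) (simp_all add: Gamma0_apply)

lemma Gamma0_nd_point:
  "\<xi> \<in> ncar \<Gamma>\<^sub>0 \<Longrightarrow> \<eta> \<in> ncar \<Gamma>\<^sub>0 \<Longrightarrow> y \<in> topspace Y \<Longrightarrow> ndist (B y) (\<xi> y) (\<eta> y) \<le> ndist \<Gamma>\<^sub>0 \<xi> \<eta>"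
  unfolding ndist_def using Gamma0_point_le[OF Gamma0_diff_closed, of \<xi> \<eta> y] by (simp add: Gamma0_apply)

text \<open>A Cauchy sequence converges uniformly to its fibrewise limit, which is a section by C4.\<close>

lemma Gamma0_complete:
  assumes X: "\<And>n :: nat. X n \<in> ncar \<Gamma>\<^sub>0"
    and Cauchy: "\<And>\<epsilon>. 0 < \<epsilon> \<Longrightarrow> \<exists>N. \<forall>m\<ge>N. \<forall>n\<ge>N. ndist \<Gamma>\<^sub>0 (X m) (X n) < \<epsilon>"
  shows "\<exists>\<xi> \<in> ncar \<Gamma>\<^sub>0. (\<lambda>n. ndist \<Gamma>\<^sub>0 (X n) \<xi>) \<longlonglongrightarrow> 0"
proof -
  have "\<exists>b \<in> ncar (B y). (\<lambda>n. nnorm (B y) (ndiff (B y) (X n y) b)) \<longlonglongrightarrow> 0" if y: "y \<in> topspace Y" for y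
  proof (rule banach_space_on.complete[OF fibre_banach[OF y]])
    show "\<forall>n. X n y \<in> ncar (B y)" using Gamma0_closed[OF X y] by blast
    show "\<forall>\<epsilon>>0. \<exists>N. \<forall>m\<ge>N. \<forall>n\<ge>N. nnorm (B y) (ndiff (B y) (X m y) (X n y)) < \<epsilon>"
      using Cauchy Gamma0_nd_point[OF X X y] unfolding ndist_def by (meson le_less_trans)
  qed
  then obtain b where b: "\<And>y. y \<in> topspace Y \<Longrightarrow> b y \<in> ncar (B y)"
    "\<And>y. y \<in> topspace Y \<Longrightarrow> (\<lambda>n. ndist (B y) (X n y) (b y)) \<longlonglongrightarrow> 0"
    unfolding ndist_def by metis
  define \<xi> where "\<xi> = restrict b (topspace Y)"
  have \<xi>y: "\<xi> y = b y" if "y \<in> topspace Y" for y using that by (simp add: \<xi>_def)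
  have unif: "\<exists>N. \<forall>n\<ge>N. \<forall>y\<in>topspace Y. ndist (B y) (X n y) (\<xi> y) \<le> \<epsilon>" if e: "0 < \<epsilon>" for \<epsilon>
  proof -
    obtain N where N: "\<forall>m\<ge>N. \<forall>n\<ge>N. ndist \<Gamma>\<^sub>0 (X m) (X n) < \<epsilon>" using Cauchy[OF e] by blast
    have "ndist (B y) (X n y) (\<xi> y) \<le> \<epsilon>" if n: "n \<ge> N" and y: "y \<in> topspace Y" for n y
    proof -
      interpret By: banach_space_on "B y" by (rule fibre_banach[OF y])
      have "(\<lambda>m. \<epsilon> + ndist (B y) (X m y) (b y)) \<longlonglongrightarrow> \<epsilon> + 0" by (intro tendsto_intros b y)
      moreover have "\<exists>N. \<forall>m\<ge>N. ndist (B y) (X n y) (b y) \<le> \<epsilon> + ndist (B y) (X m y) (b y)"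
      proof (intro exI[of _ N] allI impI)
        fix m assume m: "m \<ge> N"
        show "ndist (B y) (X n y) (b y) \<le> \<epsilon> + ndist (B y) (X m y) (b y)"
          using By.nd_triangle[OF Gamma0_closed[OF X y] Gamma0_closed[OF X y] b(1)[OF y], of n m]
            Gamma0_nd_point[OF X X y, of n m] N[rule_format, OF n m] by linarith
      qed
      ultimately show ?thesis using LIMSEQ_le_const[of "\<lambda>m. \<epsilon> + ndist (B y) (X m y) (b y)" \<epsilon>] by (simp add: \<xi>y[OF y])
    qed
    thus ?thesis by blast
  qed
  have "\<xi> \<in> ncar \<Gamma>\<^sub>0"
  proof (rule Gamma0I)
    have sec: "\<xi> \<in> all_sections Y B" unfolding \<xi>_def by (rule restrict_all_sections[OF b(1)])
    show "\<xi> \<in> \<Gamma>"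
    proof (rule C4'[OF sec])
      show "locally_approximable Y B \<Gamma> \<xi>"
        unfolding locally_approximable_def
      proof (intro ballI allI impI)
        fix y and \<epsilon> :: real assume y: "y \<in> topspace Y" and e: "0 < \<epsilon>"
        obtain N where N: "\<forall>n\<ge>N. \<forall>y\<in>topspace Y. ndist (B y) (X n y) (\<xi> y) \<le> \<epsilon>" using unif[OF e] by blast
        have "\<forall>z\<in>topspace Y. ndist (B z) (\<xi> z) (X N z) \<le> \<epsilon>"
          using N banach_space_on.nd_commute[OF fibre_banach all_sectionsD[OF sec] Gamma0_closed[OF X]] by simp
        thus "\<exists>U. openin Y U \<and> y \<in> U \<and> (\<exists>\<xi>'\<in>\<Gamma>. \<forall>z\<in>U. ndist (B z) (\<xi> z) (\<xi>' z) \<le> \<epsilon>)"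
          using y Gamma0_section[OF X] openin_topspace by blast
      qed
    qed
    fix \<epsilon> :: real assume "0 < \<epsilon>"
    hence e: "0 < \<epsilon> / 2" by simp
    obtain N where N: "\<forall>n\<ge>N. \<forall>y\<in>topspace Y. ndist (B y) (X n y) (\<xi> y) \<le> \<epsilon> / 2" using unif[OF e] by blast
    obtain K where K: "compactin Y K" "\<forall>y\<in>topspace Y - K. nnorm (B y) (X N y) < \<epsilon> / 2" using Gamma0_vanishes[OF X e] by blast
    have "nnorm (B y) (\<xi> y) < \<epsilon>" if y: "y \<in> topspace Y - K" for y
    proof -
      have yY: "y \<in> topspace Y" using y by blast
      interpret By: banach_space_on "B y" by (rule fibre_banach[OF yY])
      note c = all_sectionsD[OF sec yY] Gamma0_closed[OF X yY, of N]
      show ?thesis using By.norm_le_nd[OF c] By.nd_commute[OF c] N yY K(2)[rule_format, OF y] by fastforce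
    qed
    thus "\<exists>K. compactin Y K \<and> (\<forall>y\<in>topspace Y - K. nnorm (B y) (\<xi> y) < \<epsilon>)" using K(1) by blast
  qed
  moreover have "(\<lambda>n. ndist \<Gamma>\<^sub>0 (X n) \<xi>) \<longlonglongrightarrow> 0"
  proof (rule LIMSEQ_I)
    fix r :: real assume "0 < r"
    hence e: "0 < r / 2" by simp
    obtain N where N: "\<forall>n\<ge>N. \<forall>y\<in>topspace Y. ndist (B y) (X n y) (\<xi> y) \<le> r / 2" using unif[OF e] by blast
    have "ndist \<Gamma>\<^sub>0 (X n) \<xi> \<le> r / 2" if "n \<ge> N" for n using N that e by (intro Gamma0_nd_leI) auto
    moreover have "0 \<le> ndist \<Gamma>\<^sub>0 (X n) \<xi>" for n
      unfolding ndist_def by (rule Gamma0_norm_nonneg[OF Gamma0_diff_closed[OF X \<open>\<xi> \<in> ncar \<Gamma>\<^sub>0\<close>]])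
    ultimately show "\<exists>no. \<forall>n\<ge>no. norm (ndist \<Gamma>\<^sub>0 (X n) \<xi> - 0) < r"
      using \<open>0 < r\<close> by (intro exI[of _ N]) fastforce
  qed
  ultimately show ?thesis by blast
qed

lemma Gamma0_banach_space: "banach_space_on \<Gamma>\<^sub>0"
proof (rule banach_space_on.intro)
  note ap = Gamma0_apply and cl = Gamma0_closed and fb = fibre_banach
  note clo = Gamma0_zero_closed Gamma0_add_closed Gamma0_scale_closed Gamma0_diff_closed
  show "nzero \<Gamma>\<^sub>0 \<in> ncar \<Gamma>\<^sub>0" by (rule clo)
  fix x assume x: "x \<in> ncar \<Gamma>\<^sub>0"
  show "nscale \<Gamma>\<^sub>0 c x \<in> ncar \<Gamma>\<^sub>0" for c by (rule clo(3)[OF x])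
  show "nadd \<Gamma>\<^sub>0 x (nzero \<Gamma>\<^sub>0) = x"
    by (rule Gamma0_eqI) (simp_all add: clo x ap banach_space_on.add_zero[OF fb] cl)
  show "ndiff \<Gamma>\<^sub>0 x x = nzero \<Gamma>\<^sub>0"
    by (rule Gamma0_eqI) (simp_all add: clo x ap banach_space_on.diff_self[OF fb] cl)
  show "nscale \<Gamma>\<^sub>0 (c + d) x = nadd \<Gamma>\<^sub>0 (nscale \<Gamma>\<^sub>0 c x) (nscale \<Gamma>\<^sub>0 d x)" for c d
    by (rule Gamma0_eqI) (simp_all add: clo x ap banach_space_on.add_scale[OF fb] cl)
  show "nscale \<Gamma>\<^sub>0 c (nscale \<Gamma>\<^sub>0 d x) = nscale \<Gamma>\<^sub>0 (c * d) x" for c d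
    by (rule Gamma0_eqI) (simp_all add: clo x ap banach_space_on.scale_scale[OF fb] cl)
  show "nscale \<Gamma>\<^sub>0 1 x = x"
    by (rule Gamma0_eqI) (simp_all add: clo x ap banach_space_on.scale_one[OF fb] cl)
  show "0 \<le> nnorm \<Gamma>\<^sub>0 x" by (rule Gamma0_norm_nonneg[OF x])
  show "nnorm \<Gamma>\<^sub>0 x = 0 \<longleftrightarrow> x = nzero \<Gamma>\<^sub>0"
  proof
    assume 0: "nnorm \<Gamma>\<^sub>0 x = 0"
    show "x = nzero \<Gamma>\<^sub>0"
    proof (rule Gamma0_eqI[OF x clo(1)])
      fix y assume y: "y \<in> topspace Y"
      have "nnorm (B y) (x y) = 0"
        using Gamma0_point_le[OF x y] banach_space_on.norm_nonneg[OF fb[OF y] cl[OF x y]] 0 by simp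
      thus "x y = nzero \<Gamma>\<^sub>0 y" using banach_space_on.norm_eq_zero[OF fb[OF y] cl[OF x y]] by (simp add: ap[OF y])
    qed
  next
    assume "x = nzero \<Gamma>\<^sub>0"
    hence "nnorm \<Gamma>\<^sub>0 x \<le> 0" by (intro Gamma0_norm_leI) (simp_all add: ap banach_space_on.nnorm_zero[OF fb])
    thus "nnorm \<Gamma>\<^sub>0 x = 0" using Gamma0_norm_nonneg[OF x] by simp
  qed
  show "nnorm \<Gamma>\<^sub>0 (nscale \<Gamma>\<^sub>0 c x) = cmod c * nnorm \<Gamma>\<^sub>0 x" for c
  proof -
    have le: "nnorm \<Gamma>\<^sub>0 (nscale \<Gamma>\<^sub>0 c x) \<le> cmod c * nnorm \<Gamma>\<^sub>0 x" if x: "x \<in> ncar \<Gamma>\<^sub>0" for c x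
      by (rule Gamma0_norm_leI)
        (simp_all add: Gamma0_norm_nonneg x ap banach_space_on.norm_scale[OF fb] cl mult_left_mono Gamma0_point_le)
    show ?thesis
    proof (cases "c = 0")
      case True
      thus ?thesis using le[OF x, of 0] Gamma0_norm_nonneg[OF clo(3)[OF x], of 0] by simp
    next
      case False
      have "nscale \<Gamma>\<^sub>0 (inverse c) (nscale \<Gamma>\<^sub>0 c x) = x"
        by (rule Gamma0_eqI) (simp_all add: clo x ap banach_space_on.scale_scale[OF fb] banach_space_on.scale_one[OF fb] cl False)
      hence "nnorm \<Gamma>\<^sub>0 x \<le> cmod (inverse c) * nnorm \<Gamma>\<^sub>0 (nscale \<Gamma>\<^sub>0 c x)"
        using le[OF clo(3)[OF x], of "inverse c" c] by simp
      hence "cmod c * nnorm \<Gamma>\<^sub>0 x \<le> nnorm \<Gamma>\<^sub>0 (nscale \<Gamma>\<^sub>0 c x)"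
        using False by (simp add: norm_inverse norm_divide field_simps)
      thus ?thesis using le[OF x, of c] by simp
    qed
  qed
  fix y assume y: "y \<in> ncar \<Gamma>\<^sub>0"
  show "nadd \<Gamma>\<^sub>0 x y \<in> ncar \<Gamma>\<^sub>0" by (rule clo(2)[OF x y])
  show "nadd \<Gamma>\<^sub>0 x y = nadd \<Gamma>\<^sub>0 y x"
    by (rule Gamma0_eqI) (simp_all add: clo x y ap banach_space_on.add_commute[OF fb] cl)
  show "nscale \<Gamma>\<^sub>0 c (nadd \<Gamma>\<^sub>0 x y) = nadd \<Gamma>\<^sub>0 (nscale \<Gamma>\<^sub>0 c x) (nscale \<Gamma>\<^sub>0 c y)" for c
    by (rule Gamma0_eqI) (simp_all add: clo x y ap banach_space_on.scale_add[OF fb] cl)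
  show "nnorm \<Gamma>\<^sub>0 (nadd \<Gamma>\<^sub>0 x y) \<le> nnorm \<Gamma>\<^sub>0 x + nnorm \<Gamma>\<^sub>0 y"
  proof (rule Gamma0_norm_leI)
    fix z assume z: "z \<in> topspace Y"
    show "nnorm (B z) (nadd \<Gamma>\<^sub>0 x y z) \<le> nnorm \<Gamma>\<^sub>0 x + nnorm \<Gamma>\<^sub>0 y"
      using banach_space_on.norm_triangle[OF fb[OF z] cl[OF x z] cl[OF y z]] Gamma0_point_le[OF x z] Gamma0_point_le[OF y z]
      by (simp add: ap[OF z])
  qed (simp add: Gamma0_norm_nonneg x y)
  show "nadd \<Gamma>\<^sub>0 (nadd \<Gamma>\<^sub>0 x y) z = nadd \<Gamma>\<^sub>0 x (nadd \<Gamma>\<^sub>0 y z)" if z: "z \<in> ncar \<Gamma>\<^sub>0" for z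
    by (rule Gamma0_eqI) (simp_all add: clo x y z ap banach_space_on.add_assoc[OF fb] cl)
next
  fix X :: "nat \<Rightarrow> 'y \<Rightarrow> 'e"
  assume "\<forall>n. X n \<in> ncar \<Gamma>\<^sub>0" "\<forall>\<epsilon>>0. \<exists>N. \<forall>m\<ge>N. \<forall>n\<ge>N. nnorm \<Gamma>\<^sub>0 (ndiff \<Gamma>\<^sub>0 (X m) (X n)) < \<epsilon>"
  thus "\<exists>x\<in>ncar \<Gamma>\<^sub>0. (\<lambda>n. nnorm \<Gamma>\<^sub>0 (ndiff \<Gamma>\<^sub>0 (X n) x)) \<longlonglongrightarrow> 0"
    using Gamma0_complete[of X] by (simp add: ndist_def)
qed

end

section \<open>Sections of the pulled back field as functions on the group\<close>

context banach_space_on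
begin

lemma Cc_bounded:
  fixes f :: "'g::topological_space \<Rightarrow> 'e"
  assumes f: "f \<in> Cc E"
  shows "\<exists>M\<ge>0. \<forall>g. nnorm E (f g) \<le> M"
proof -
  note fc = CcD(1)[OF f]
  obtain K where K: "compact K" "\<forall>g. g \<notin> K \<longrightarrow> f g = nzero E" using CcD(3)[OF f] by blast
  have "\<forall>g. \<exists>U. open U \<and> g \<in> U \<and> (\<forall>h\<in>U. nd (f h) (f g) < 1)" using CcD(2)[OF f, of 1] by simp
  then obtain U where U: "\<And>g. open (U g)" "\<And>g. g \<in> U g" "\<And>g. \<forall>h \<in> U g. nd (f h) (f g) < 1" by metis
  obtain D where D: "D \<subseteq> K" "finite D" "K \<subseteq> (\<Union>g\<in>D. U g)"
    using compactE_image[OF K(1), of K U] U(1,2) by blast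
  define M where "M = (\<Sum>d\<in>D. nnorm E (f d) + 1)"
  have M: "0 \<le> M" unfolding M_def by (intro sum_nonneg add_nonneg_nonneg norm_nonneg fc) simp
  have "nnorm E (f g) \<le> M" for g
  proof (cases "g \<in> K")
    case True
    then obtain d where d: "d \<in> D" "g \<in> U d" using D(3) by blast
    have "nnorm E (f g) \<le> nnorm E (f d) + 1" using norm_le_nd[OF fc fc, of g d] U(3)[of d] d(2) by fastforce
    also have "\<dots> \<le> M" unfolding M_def
      by (rule member_le_sum[OF d(1) _ D(2), of "\<lambda>d. nnorm E (f d) + 1"]) (intro add_nonneg_nonneg norm_nonneg fc, simp)
    finally show ?thesis .
  next
    case False
    thus ?thesis using K(2) M by (simp add: nnorm_zero)
  qed
  thus ?thesis using M by blast
qed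

lemma CcI:
  assumes "\<And>g. f g \<in> ncar E" "\<And>g \<epsilon>. 0 < \<epsilon> \<Longrightarrow> \<exists>U. open U \<and> g \<in> U \<and> (\<forall>h \<in> U. nd (f h) (f g) < \<epsilon>)"
    "compact K" "\<And>g. g \<notin> K \<Longrightarrow> f g = nzero E"
  shows "f \<in> Cc E"
proof -
  have "\<forall>g. \<forall>\<epsilon>>0. \<exists>U. open U \<and> g \<in> U \<and> (\<forall>h\<in>U. nd (f h) (f g) < \<epsilon>)"
    by (intro allI impI) (rule assms(2))
  moreover have "\<exists>K. compact K \<and> (\<forall>g. g \<notin> K \<longrightarrow> f g = nzero E)"
    using assms(3,4) by (intro exI[of _ K]) simp
  ultimately show ?thesis using assms(1) by (simp add: Cc_def ndist_def)
qed

end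

lemma (in banach_algebra_on) nmul_zero:
  assumes x: "x \<in> ncar E"
  shows "nmul E (nzero E) x = nzero E" "nmul E x (nzero E) = nzero E"
proof -
  have "nmul E (nzero E) x = nmul E (nscale E 0 (nzero E)) x" by (subst scale_zero_right) (rule refl)
  also have "\<dots> = nscale E 0 (nmul E (nzero E) x)" by (rule mul_scale_left[OF zero_closed x])
  also have "\<dots> = nzero E" by (rule scale_zero_left[OF mul_closed[OF zero_closed x]])
  finally show "nmul E (nzero E) x = nzero E" .
  have "nmul E x (nzero E) = nmul E x (nscale E 0 (nzero E))" by (subst scale_zero_right) (rule refl)
  also have "\<dots> = nscale E 0 (nmul E x (nzero E))" by (rule mul_scale_right[OF x zero_closed])
  also have "\<dots> = nzero E" by (rule scale_zero_left[OF mul_closed[OF x zero_closed]])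
  finally show "nmul E x (nzero E) = nzero E" .
qed

lemma (in banach_algebra_on) nd_mul:
  assumes "a \<in> ncar E" "b \<in> ncar E" "a' \<in> ncar E" "b' \<in> ncar E"
  shows "nd (nmul E a b) (nmul E a' b') \<le> nd a a' * nnorm E b + nnorm E a' * nd b b'"
proof -
  have "ndiff E (nmul E a b) (nmul E a' b) = nmul E (ndiff E a a') b"
    "ndiff E (nmul E a' b) (nmul E a' b') = nmul E a' (ndiff E b b')"
    using assms by (simp_all add: ndiff_def mul_add_left mul_add_right mul_scale_left mul_scale_right closed)
  hence "nd (nmul E a b) (nmul E a' b) \<le> nd a a' * nnorm E b" "nd (nmul E a' b) (nmul E a' b') \<le> nnorm E a' * nd b b'"
    using assms by (simp_all add: ndist_def norm_mul closed)
  thus ?thesis using nd_triangle[of "nmul E a b" "nmul E a' b" "nmul E a' b'"] assms by (simp add: mul_closed)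
qed

locale transformation_groupoid_algebra = groupoid_banach_algebra Y act B \<Gamma> \<alpha>
  for Y :: "'y topology"
    and act :: "'g::{topological_group_add, t2_space} \<Rightarrow> 'y \<Rightarrow> 'y"
    and B :: "'y \<Rightarrow> ('e, 'm) balgebra_scheme"
    and \<Gamma> :: "('y \<Rightarrow> 'e) set"
    and \<alpha> :: "'g \<Rightarrow> 'y \<Rightarrow> 'e \<Rightarrow> 'e" +
  fixes \<mu> :: "'g measure"
  assumes locally_compact_group: "locally_compact_space (euclidean :: 'g topology)"
    and measure_sets: "sets \<mu> = sets borel"
    and measure_compact: "compact K \<Longrightarrow> emeasure \<mu> K < \<infinity>"
    and locally_compact_Y: "locally_compact_space Y" and Hausdorff_Y: "Hausdorff_space Y"
    and action: "continuous_action Y act"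
begin

abbreviation Z where "Z \<equiv> groupoid_space Y :: ('g \<times> 'y) topology"
abbreviation PB where "PB \<equiv> pullback_sections Z groupoid_range B \<Gamma>"
abbreviation \<Gamma>\<^sub>c where "\<Gamma>\<^sub>c \<equiv> sections_compact Z (B \<circ> groupoid_range) PB"

lemma act_closed: "y \<in> topspace Y \<Longrightarrow> act g y \<in> topspace Y"
  using continuous_map_image_subset_topspace[of Z Y "\<lambda>(g, y). act g y"] action
  by (force simp: continuous_action_def)

lemma act_inverse: "y \<in> topspace Y \<Longrightarrow> act g (act (- g) y) = y" "y \<in> topspace Y \<Longrightarrow> act (- g) (act g y) = y"
  using action unfolding continuous_action_def by (metis add.right_inverse add.left_inverse)+

lemma act_continuous: "continuous_map Z Y (\<lambda>(g, y). act g y)"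
  using action by (simp add: continuous_action_def)

lemma act_map_continuous: "continuous_map Y Y (act g)"
proof -
  have "continuous_map Y Z (\<lambda>y. (g, y))" by (intro continuous_map_pairedI) auto
  from continuous_map_compose[OF this act_continuous] show ?thesis by (simp add: comp_def)
qed

lemma source_continuous: "continuous_map Z Y (groupoid_source act)"
proof -
  have "continuous_map (euclidean :: 'g topology) euclidean uminus"
    by (simp add: continuous_on_minus continuous_on_id)
  from continuous_map_compose[OF continuous_map_fst this]
  have "continuous_map Z Z (\<lambda>p. (- fst p, snd p))"
    by (intro continuous_map_pairedI) (auto simp: comp_def continuous_map_snd)
  from continuous_map_compose[OF this act_continuous] show ?thesis
    by (simp add: comp_def groupoid_source_def case_prod_beta')
qed

lemma source_closed: "y \<in> topspace Y \<Longrightarrow> act (- g) y \<in> topspace Y" by (rule act_closed)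

lemma \<alpha>_facts:
  assumes y: "y \<in> topspace Y" and b: "b \<in> ncar (B (act (- g) y))"
  shows "\<alpha> g y b \<in> ncar (B y)" "nnorm (B y) (\<alpha> g y b) = nnorm (B (act (- g) y)) b"
  using translation_iso[OF y, of g] b by (auto simp: isometric_algebra_iso_def bij_betw_def)

lemma \<alpha>_zero:
  assumes y: "y \<in> topspace Y"
  shows "\<alpha> g y (nzero (B (act (- g) y))) = nzero (B y)"
proof -
  note z = banach_space_on.zero_closed[OF fibre_banach[OF source_closed[OF y, of g]]]
  show ?thesis
    using \<alpha>_facts[OF y z] banach_space_on.nnorm_zero[OF fibre_banach[OF source_closed[OF y, of g]]]
      banach_space_on.norm_eq_zero[OF fibre_banach[OF y]] by simp
qed

lemma \<alpha>_nd:
  assumes y: "y \<in> topspace Y" and b: "b \<in> ncar (B (act (- g) y))" "c \<in> ncar (B (act (- g) y))"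
  shows "ndist (B y) (\<alpha> g y b) (\<alpha> g y c) = ndist (B (act (- g) y)) b c"
proof -
  interpret S: banach_space_on "B (act (- g) y)" by (rule fibre_banach[OF source_closed[OF y]])
  have "ndiff (B y) (\<alpha> g y b) (\<alpha> g y c) = \<alpha> g y (ndiff (B (act (- g) y)) b c)"
    using translation_iso[OF y, of g] b S.scale_closed unfolding isometric_algebra_iso_def ndiff_def by simp
  thus ?thesis using \<alpha>_facts(2)[OF y S.ndiff_closed[OF b]] by (simp add: ndist_def)
qed

subsection \<open>Slices and joint continuity\<close>

lemmas PB_iff = pullback_iff[OF continuous_map_snd]
lemmas PB_field = pullback_generated(1)[OF continuous_map_snd]

lemma PB_closed: "\<zeta> \<in> PB \<Longrightarrow> y \<in> topspace Y \<Longrightarrow> \<zeta> (g, y) \<in> ncar (B y)"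
  using all_sectionsD[of \<zeta> Z "B \<circ> groupoid_range" "(g, y)"] by (simp add: PB_iff)

lemma PB_slice:
  assumes \<zeta>: "\<zeta> \<in> PB"
  shows "(\<lambda>y \<in> topspace Y. \<zeta> (g, y)) \<in> \<Gamma>"
proof (rule C4')
  show "(\<lambda>y \<in> topspace Y. \<zeta> (g, y)) \<in> all_sections Y B" by (intro restrict_all_sections PB_closed[OF \<zeta>])
  show "locally_approximable Y B \<Gamma> (\<lambda>y \<in> topspace Y. \<zeta> (g, y))"
    unfolding locally_approximable_def
  proof (intro ballI allI impI)
    fix y and \<epsilon> :: real assume y: "y \<in> topspace Y" and e: "0 < \<epsilon>"
    have "(g, y) \<in> topspace Z" using y by simp
    with \<zeta> e obtain U \<xi> where U: "openin Z U" "(g, y) \<in> U" "\<xi> \<in> \<Gamma>" "\<forall>w\<in>U. ndist (B (snd w)) (\<zeta> w) (\<xi> (snd w)) \<le> \<epsilon>"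
      unfolding PB_iff by blast
    have "continuous_map Y Z (\<lambda>y. (g, y))" by (intro continuous_map_pairedI) auto
    from openin_continuous_map_preimage[OF this U(1)] have "openin Y {y \<in> topspace Y. (g, y) \<in> U}" .
    thus "\<exists>U. openin Y U \<and> y \<in> U \<and> (\<exists>\<xi>\<in>\<Gamma>. \<forall>z\<in>U. ndist (B z) ((\<lambda>y\<in>topspace Y. \<zeta> (g, y)) z) (\<xi> z) \<le> \<epsilon>)"
      using U y by (intro exI[of _ "{y \<in> topspace Y. (g, y) \<in> U}"]) fastforce
  qed
qed

lemma PB_const: "\<xi> \<in> \<Gamma> \<Longrightarrow> (\<lambda>(g, y) \<in> topspace Z. \<xi> y) \<in> PB"
proof -
  have "restrict (\<xi> \<circ> snd) (topspace Z) = (\<lambda>(g, y) \<in> topspace Z. \<xi> y)" by (auto simp: fun_eq_iff restrict_def)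
  thus "\<xi> \<in> \<Gamma> \<Longrightarrow> (\<lambda>(g, y) \<in> topspace Z. \<xi> y) \<in> PB" using pullback_of_section[OF continuous_map_snd, of \<xi>] by metis
qed

lemma PB_nd_open:
  assumes \<zeta>: "\<zeta> \<in> PB" and \<eta>: "\<eta> \<in> PB"
  shows "openin Z {z \<in> topspace Z. ndist (B (snd z)) (\<zeta> z) (\<eta> z) < r}"
proof -
  interpret P: usc_field Z "B \<circ> groupoid_range" PB by (rule PB_field)
  have "openin Z {z \<in> topspace Z. nnorm ((B \<circ> groupoid_range) z) (sec_add Z (B \<circ> groupoid_range) \<zeta> (sec_scale Z (B \<circ> groupoid_range) (-1) \<eta>) z) < r}"
    by (intro P.C3 P.C1_add P.C1_scale \<zeta> \<eta>)
  also have "{z \<in> topspace Z. nnorm ((B \<circ> groupoid_range) z) (sec_add Z (B \<circ> groupoid_range) \<zeta> (sec_scale Z (B \<circ> groupoid_range) (-1) \<eta>) z) < r}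
      = {z \<in> topspace Z. ndist (B (snd z)) (\<zeta> z) (\<eta> z) < r}"
    by (intro Collect_cong conj_cong refl) (simp add: sec_add_def sec_scale_def ndist_def ndiff_def)
  finally show ?thesis .
qed

text \<open>The section \<open>\<zeta>\<close> and the constant extension of its slice at \<open>g\<close> agree on \<open>{g} \<times> L\<close>.  They stay close on a
neighbourhood of this compact set, and the tube lemma makes the neighbourhood uniform in \<open>y\<close>.\<close>

lemma PB_uniformly_continuous:
  assumes \<zeta>: "\<zeta> \<in> PB" and L: "compactin Y L" and U: "open U" "g \<in> U"
    and supp: "\<And>h y. h \<in> U \<Longrightarrow> y \<in> topspace Y - L \<Longrightarrow> \<zeta> (h, y) = nzero (B y)" and e: "0 < \<epsilon>"
  shows "\<exists>V. open V \<and> g \<in> V \<and> V \<subseteq> U \<and> (\<forall>h\<in>V. \<forall>y\<in>topspace Y. ndist (B y) (\<zeta> (h, y)) (\<zeta> (g, y)) < \<epsilon>)"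
proof -
  define \<eta> where "\<eta> = (\<lambda>(h :: 'g, y) \<in> topspace Z. (\<lambda>y \<in> topspace Y. \<zeta> (g, y)) y)"
  have \<eta>: "\<eta> \<in> PB" unfolding \<eta>_def by (rule PB_const[OF PB_slice[OF \<zeta>]])
  have \<eta>_eq: "\<eta> (h, y) = \<zeta> (g, y)" if "y \<in> topspace Y" for h y using that by (simp add: \<eta>_def)
  let ?W = "{z \<in> topspace Z. ndist (B (snd z)) (\<zeta> z) (\<eta> z) < \<epsilon>}"
  have self: "ndist (B y) (\<zeta> (g, y)) (\<zeta> (g, y)) < \<epsilon>" if "y \<in> topspace Y" for y
    using banach_space_on.nd_self[OF fibre_banach[OF that] PB_closed[OF \<zeta> that]] e by simp
  have "{g} \<times> L \<subseteq> ?W"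
    using compactin_subset_topspace[OF L] self by (auto simp: \<eta>_eq)
  then obtain V V' where V: "openin euclidean V" "openin Y V'" "g \<in> V" "L \<subseteq> V'" "V \<times> V' \<subseteq> ?W"
    using tube_lemma_right[OF PB_nd_open[OF \<zeta> \<eta>, of \<epsilon>] L, of g] by auto
  have "ndist (B y) (\<zeta> (h, y)) (\<zeta> (g, y)) < \<epsilon>" if h: "h \<in> V \<inter> U" and y: "y \<in> topspace Y" for h y
  proof (cases "y \<in> L")
    case True
    hence "(h, y) \<in> ?W" using V h by blast
    thus ?thesis by (auto simp: \<eta>_eq)
  next
    case False
    hence "\<zeta> (h, y) = nzero (B y)" "\<zeta> (g, y) = nzero (B y)" using supp h y U(2) by auto
    thus ?thesis using self[OF y] by simp
  qed
  thus ?thesis using V U by (intro exI[of _ "V \<inter> U"]) auto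
qed

text \<open>Currying identifies the sections of the pulled back field with compact support with those functions in
\<open>C\<^sub>c(G, \<Gamma>\<^sub>0)\<close> whose values are all supported in one compact subset \<open>L\<close> of \<open>Y\<close>.\<close>

definition supported :: "('g \<Rightarrow> 'y \<Rightarrow> 'e) \<Rightarrow> 'y set \<Rightarrow> bool" where
  "supported f L \<longleftrightarrow> f \<in> Cc \<Gamma>\<^sub>0 \<and> compactin Y L \<and> (\<forall>g. \<forall>y \<in> topspace Y - L. f g y = nzero (B y))"

sublocale G0: banach_space_on "\<Gamma>\<^sub>0" by (rule Gamma0_banach_space)

lemma Gammac_in_PB: "\<zeta> \<in> \<Gamma>\<^sub>c \<Longrightarrow> \<zeta> \<in> PB"
  by (simp add: sections_compact_def)

lemma Gammac_outside: "\<zeta> \<in> \<Gamma>\<^sub>c \<Longrightarrow> y \<notin> topspace Y \<Longrightarrow> \<zeta> (g, y) = undefined"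
  using Gammac_in_PB[of \<zeta>] by (auto simp: PB_iff all_sections_def PiE_def extensional_def)

lemma Gammac_curry_slice: "\<zeta> \<in> \<Gamma>\<^sub>c \<Longrightarrow> curry \<zeta> g = (\<lambda>y \<in> topspace Y. \<zeta> (g, y))"
  using Gammac_outside by (auto simp: fun_eq_iff)

lemma Gammac_curry:
  assumes \<zeta>: "\<zeta> \<in> \<Gamma>\<^sub>c"
  shows "\<exists>L. supported (curry \<zeta>) L"
proof -
  note P = Gammac_in_PB[OF \<zeta>]
  obtain K where K: "compactin Z K" "\<forall>z \<in> topspace Z - K. \<zeta> z = nzero (B (snd z))"
    using \<zeta> by (auto simp: sections_compact_def)
  define K1 L where "K1 = fst ` K" and "L = snd ` K"
  have K1: "compact K1" using image_compactin[OF K(1) continuous_map_fst] by (simp add: K1_def)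
  have L: "compactin Y L" using image_compactin[OF K(1) continuous_map_snd] by (simp add: L_def)
  have zero: "\<zeta> (g, y) = nzero (B y)" if "y \<in> topspace Y" "g \<notin> K1 \<or> y \<notin> L" for g y
  proof -
    have "(g, y) \<in> topspace Z - K" using that by (force simp: K1_def L_def)
    thus ?thesis using K(2) by fastforce
  qed
  have zero': "\<zeta> (h, y) = nzero (B y)" if "h \<in> UNIV" "y \<in> topspace Y - L" for h y
    using zero that by simp
  have in0: "curry \<zeta> g \<in> ncar \<Gamma>\<^sub>0" for g
    unfolding Gammac_curry_slice[OF \<zeta>] using zero by (intro Gamma0_compactI[OF PB_slice[OF P] L]) simp
  have "curry \<zeta> \<in> Cc \<Gamma>\<^sub>0"
  proof (rule G0.CcI[OF in0 _ K1])
    fix g and \<epsilon> :: real assume "0 < \<epsilon>"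
    hence e: "0 < \<epsilon> / 2" by simp
    obtain V where V: "open V" "g \<in> V" "\<forall>h\<in>V. \<forall>y\<in>topspace Y. ndist (B y) (\<zeta> (h, y)) (\<zeta> (g, y)) < \<epsilon> / 2"
      using PB_uniformly_continuous[OF P L open_UNIV UNIV_I zero' e, of g] by blast
    have "ndist \<Gamma>\<^sub>0 (curry \<zeta> h) (curry \<zeta> g) \<le> \<epsilon> / 2" if "h \<in> V" for h
      using V(3) that e by (intro Gamma0_nd_leI) (auto simp: less_imp_le)
    thus "\<exists>U. open U \<and> g \<in> U \<and> (\<forall>h\<in>U. ndist \<Gamma>\<^sub>0 (curry \<zeta> h) (curry \<zeta> g) < \<epsilon>)"
      using V(1,2) e by (intro exI[of _ V]) fastforce
  next
    show "curry \<zeta> g = nzero \<Gamma>\<^sub>0" if "g \<notin> K1" for g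
      using zero that by (intro Gamma0_eqI[OF in0 Gamma0_zero_closed]) (simp add: Gamma0_apply)
  qed
  hence "supported (curry \<zeta>) L" using L zero unfolding supported_def by simp
  thus ?thesis ..
qed

text \<open>Near \<open>(g, y)\<close> the section is approximated by the pullback of \<open>f g\<close>.\<close>

lemma supported_uncurry:
  assumes f: "supported f L"
  shows "case_prod f \<in> \<Gamma>\<^sub>c"
proof -
  have fCc: "f \<in> Cc \<Gamma>\<^sub>0" and L: "compactin Y L" and supp: "\<And>g y. y \<in> topspace Y - L \<Longrightarrow> f g y = nzero (B y)"
    using f by (auto simp: supported_def)
  note f0 = G0.CcD(1)[OF fCc]
  obtain K where K: "compact K" "\<forall>g. g \<notin> K \<longrightarrow> f g = nzero \<Gamma>\<^sub>0" using G0.CcD(3)[OF fCc] by blast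
  have "case_prod f \<in> PB"
    unfolding PB_iff
  proof (intro conjI ballI allI impI)
    show "case_prod f \<in> all_sections Z (B \<circ> groupoid_range)"
      using Gamma0_closed[OF f0] Gamma0_extensional[OF f0] by (auto simp: all_sections_def PiE_def extensional_def)
    fix z and \<epsilon> :: real assume z: "z \<in> topspace Z" and e: "0 < \<epsilon>"
    obtain g y where gy: "z = (g, y)" "y \<in> topspace Y" using z by auto
    obtain U where U: "open U" "g \<in> U" "\<forall>h\<in>U. ndist \<Gamma>\<^sub>0 (f h) (f g) < \<epsilon>" using G0.CcD(2)[OF fCc e] by blast
    have "openin Z (U \<times> topspace Y)" using U(1) by (simp add: openin_prod_Times_iff)
    moreover have "ndist (B (snd w)) (case_prod f w) (f g (snd w)) \<le> \<epsilon>" if "w \<in> U \<times> topspace Y" for w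
      using that Gamma0_nd_point[OF f0 f0, of "snd w" "fst w" g] U(3) by fastforce
    ultimately show "\<exists>U. openin Z U \<and> z \<in> U \<and> (\<exists>\<xi>\<in>\<Gamma>. \<forall>w\<in>U. ndist (B (snd w)) (case_prod f w) (\<xi> (snd w)) \<le> \<epsilon>)"
      using U(2) gy Gamma0_section[OF f0] by (intro exI[of _ "U \<times> topspace Y"] conjI bexI[of _ "f g"]) auto
  qed
  moreover have "compactin Z (K \<times> L)" using K(1) L by (simp add: compactin_Times)
  moreover have "case_prod f z = nzero ((B \<circ> groupoid_range) z)" if "z \<in> topspace Z - K \<times> L" for z
    using that supp K(2) by (cases z) (auto simp: Gamma0_apply)
  ultimately show ?thesis unfolding sections_compact_def by blast
qed

end

section \<open>The action on sections and convolution\<close>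

context transformation_groupoid_algebra
begin

abbreviation gact where "gact \<equiv> section_action Y act \<alpha>"

lemma gact_apply: "y \<in> topspace Y \<Longrightarrow> gact h \<xi> y = \<alpha> h y (\<xi> (act (- h) y))"
  by (simp add: section_action_def)

lemma gact_PB:
  assumes \<xi>: "\<xi> \<in> \<Gamma>"
  shows "(\<lambda>(g, y) \<in> topspace Z. gact g \<xi> y) \<in> PB"
proof -
  let ?\<zeta> = "restrict (\<xi> \<circ> groupoid_source act) (topspace Z)"
  have "?\<zeta> \<in> pullback_sections Z (groupoid_source act) B \<Gamma>"
    by (rule pullback_of_section[OF source_continuous \<xi>])
  from translation_continuous[OF this]
  have "(\<lambda>(g, y)\<in>topspace Z. \<alpha> g y (?\<zeta> (g, y))) \<in> PB" .
  moreover have "(\<lambda>(g, y)\<in>topspace Z. \<alpha> g y (?\<zeta> (g, y))) = (\<lambda>(g, y) \<in> topspace Z. gact g \<xi> y)"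
    by (rule restrict_ext) (auto simp: gact_apply groupoid_source_def)
  ultimately show ?thesis by simp
qed

lemma gact_closed:
  assumes \<xi>: "\<xi> \<in> ncar \<Gamma>\<^sub>0"
  shows "gact h \<xi> \<in> ncar \<Gamma>\<^sub>0"
proof (rule Gamma0I)
  have "(\<lambda>y\<in>topspace Y. (\<lambda>(g, y) \<in> topspace Z. gact g \<xi> y) (h, y)) \<in> \<Gamma>"
    by (rule PB_slice[OF gact_PB[OF Gamma0_section[OF \<xi>]]])
  also have "(\<lambda>y\<in>topspace Y. (\<lambda>(g, y) \<in> topspace Z. gact g \<xi> y) (h, y)) = gact h \<xi>"
    by (auto simp: section_action_def fun_eq_iff)
  finally show "gact h \<xi> \<in> \<Gamma>" .
  fix \<epsilon> :: real assume e: "0 < \<epsilon>"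
  obtain K where K: "compactin Y K" "\<forall>y \<in> topspace Y - K. nnorm (B y) (\<xi> y) < \<epsilon>"
    using Gamma0_vanishes[OF \<xi> e] by blast
  have "nnorm (B y) (gact h \<xi> y) < \<epsilon>" if y: "y \<in> topspace Y - act h ` K" for y
  proof -
    have yY: "y \<in> topspace Y" using y by blast
    have "act (- h) y \<notin> K" using y act_inverse(1)[OF yY, of h] by (metis DiffD2 image_eqI)
    hence "nnorm (B (act (- h) y)) (\<xi> (act (- h) y)) < \<epsilon>" using K(2) source_closed[OF yY, of h] by blast
    thus ?thesis using \<alpha>_facts(2)[OF yY Gamma0_closed[OF \<xi> source_closed[OF yY]]] by (simp add: gact_apply[OF yY])
  qed
  thus "\<exists>K. compactin Y K \<and> (\<forall>y\<in>topspace Y - K. nnorm (B y) (gact h \<xi> y) < \<epsilon>)"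
    using image_compactin[OF K(1) act_map_continuous[of h]] by blast
qed

lemma gact_nd:
  assumes "\<xi> \<in> ncar \<Gamma>\<^sub>0" "\<eta> \<in> ncar \<Gamma>\<^sub>0"
  shows "ndist \<Gamma>\<^sub>0 (gact h \<xi>) (gact h \<eta>) \<le> ndist \<Gamma>\<^sub>0 \<xi> \<eta>"
proof (rule Gamma0_nd_leI)
  show "0 \<le> ndist \<Gamma>\<^sub>0 \<xi> \<eta>" by (rule G0.nd_nonneg[OF assms])
  fix y assume y: "y \<in> topspace Y"
  show "ndist (B y) (gact h \<xi> y) (gact h \<eta> y) \<le> ndist \<Gamma>\<^sub>0 \<xi> \<eta>"
    using \<alpha>_nd[OF y Gamma0_closed[OF assms(1) source_closed[OF y]] Gamma0_closed[OF assms(2) source_closed[OF y]], of h]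
      Gamma0_nd_point[OF assms source_closed[OF y, of h]] by (simp add: gact_apply[OF y])
qed

lemma gact_norm:
  assumes "\<xi> \<in> ncar \<Gamma>\<^sub>0"
  shows "nnorm \<Gamma>\<^sub>0 (gact h \<xi>) \<le> nnorm \<Gamma>\<^sub>0 \<xi>"
proof (rule Gamma0_norm_leI[OF Gamma0_norm_nonneg[OF assms]])
  fix y assume y: "y \<in> topspace Y"
  show "nnorm (B y) (gact h \<xi> y) \<le> nnorm \<Gamma>\<^sub>0 \<xi>"
    using \<alpha>_facts(2)[OF y Gamma0_closed[OF assms source_closed[OF y]], of h]
      Gamma0_point_le[OF assms source_closed[OF y, of h]] by (simp add: gact_apply[OF y])
qed

lemma gact_zero: "y \<in> topspace Y \<Longrightarrow> \<xi> (act (- h) y) = nzero (B (act (- h) y)) \<Longrightarrow> gact h \<xi> y = nzero (B y)"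
  by (simp add: gact_apply \<alpha>_zero)

text \<open>The translates \<open>gact k \<xi>\<close> are the slices of one section of the pulled back field, and for \<open>k\<close> in a compact
neighbourhood of \<open>h\<close> they are supported in the compact set of all translates of \<open>L\<close>.\<close>

lemma gact_strongly_continuous:
  assumes \<xi>: "\<xi> \<in> ncar \<Gamma>\<^sub>0" and L: "compactin Y L" and supp: "\<And>y. y \<in> topspace Y - L \<Longrightarrow> \<xi> y = nzero (B y)"
    and e: "0 < \<epsilon>"
  shows "\<exists>V. open V \<and> h \<in> V \<and> (\<forall>k\<in>V. ndist \<Gamma>\<^sub>0 (gact k \<xi>) (gact h \<xi>) < \<epsilon>)"
proof -
  obtain U C where U: "open U" "compact C" "h \<in> U" "U \<subseteq> C"
    using locally_compact_group unfolding locally_compact_space_def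
    by (metis UNIV_I compactin_euclidean_iff open_openin topspace_euclidean)
  let ?M = "(\<lambda>(g, y). act g y) ` (C \<times> L)"
  have M: "compactin Y ?M"
    using U(2) L by (intro image_compactin[OF _ act_continuous]) (simp add: compactin_Times)
  let ?\<zeta> = "\<lambda>(g, y) \<in> topspace Z. gact g \<xi> y"
  have \<zeta>: "?\<zeta> (g, y) = gact g \<xi> y" if "y \<in> topspace Y" for g y using that by simp
  have s: "?\<zeta> (k, y) = nzero (B y)" if k: "k \<in> U" and y: "y \<in> topspace Y - ?M" for k y
  proof -
    have yY: "y \<in> topspace Y" using y by blast
    have "act (- k) y \<notin> L"
    proof
      assume "act (- k) y \<in> L"
      hence "act k (act (- k) y) \<in> ?M" using k U(4) by force
      thus False using y act_inverse(1)[OF yY, of k] by simp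
    qed
    thus ?thesis unfolding \<zeta>[OF yY] using source_closed[OF yY, of k] by (intro gact_zero[OF yY] supp) simp
  qed
  have e2: "0 < \<epsilon> / 2" using e by simp
  obtain V where V: "open V" "h \<in> V" "\<forall>k\<in>V. \<forall>y\<in>topspace Y. ndist (B y) (?\<zeta> (k, y)) (?\<zeta> (h, y)) < \<epsilon> / 2"
    using PB_uniformly_continuous[OF gact_PB[OF Gamma0_section[OF \<xi>]] M U(1,3) s e2] by blast
  have "ndist \<Gamma>\<^sub>0 (gact k \<xi>) (gact h \<xi>) \<le> \<epsilon> / 2" if "k \<in> V" for k
  proof (rule Gamma0_nd_leI)
    fix y assume y: "y \<in> topspace Y"
    have "ndist (B y) (?\<zeta> (k, y)) (?\<zeta> (h, y)) < \<epsilon> / 2" using V(3) that y by blast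
    thus "ndist (B y) (gact k \<xi> y) (gact h \<xi> y) \<le> \<epsilon> / 2" using y by simp
  qed (use e in simp)
  thus ?thesis using V(1,2) e by (intro exI[of _ V]) fastforce
qed

lemma Gamma0_nd_mul:
  assumes "a \<in> ncar \<Gamma>\<^sub>0" "b \<in> ncar \<Gamma>\<^sub>0" "a' \<in> ncar \<Gamma>\<^sub>0" "b' \<in> ncar \<Gamma>\<^sub>0"
  shows "ndist \<Gamma>\<^sub>0 (nmul \<Gamma>\<^sub>0 a b) (nmul \<Gamma>\<^sub>0 a' b') \<le> ndist \<Gamma>\<^sub>0 a a' * nnorm \<Gamma>\<^sub>0 b + nnorm \<Gamma>\<^sub>0 a' * ndist \<Gamma>\<^sub>0 b b'"
proof (rule Gamma0_nd_leI)
  note nn = G0.nd_nonneg[OF assms(1,3)] G0.nd_nonneg[OF assms(2,4)] Gamma0_norm_nonneg[OF assms(2)] Gamma0_norm_nonneg[OF assms(3)]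
  show "0 \<le> ndist \<Gamma>\<^sub>0 a a' * nnorm \<Gamma>\<^sub>0 b + nnorm \<Gamma>\<^sub>0 a' * ndist \<Gamma>\<^sub>0 b b'"
    using nn by simp
  fix y assume y: "y \<in> topspace Y"
  interpret By: banach_algebra_on "B y" by (rule fibre_algebra[OF y])
  note c = assms[THEN Gamma0_closed, OF y]
  have "ndist (B y) (nmul (B y) (a y) (b y)) (nmul (B y) (a' y) (b' y))
      \<le> ndist (B y) (a y) (a' y) * nnorm (B y) (b y) + nnorm (B y) (a' y) * ndist (B y) (b y) (b' y)"
    by (rule By.nd_mul[OF c])
  also have "\<dots> \<le> ndist \<Gamma>\<^sub>0 a a' * nnorm \<Gamma>\<^sub>0 b + nnorm \<Gamma>\<^sub>0 a' * ndist \<Gamma>\<^sub>0 b b'"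
    by (intro add_mono mult_mono Gamma0_nd_point Gamma0_point_le assms y nn By.norm_nonneg By.nd_nonneg c)
  finally show "ndist (B y) (nmul \<Gamma>\<^sub>0 a b y) (nmul \<Gamma>\<^sub>0 a' b' y) \<le> ndist \<Gamma>\<^sub>0 a a' * nnorm \<Gamma>\<^sub>0 b + nnorm \<Gamma>\<^sub>0 a' * ndist \<Gamma>\<^sub>0 b b'"
    by (simp add: Gamma0_apply[OF y])
qed

text \<open>Evaluation at \<open>y\<close> is linear and decreases the norm, so it maps approximating simple functions to
approximating simple functions.  This makes the two convolution products agree.\<close>

lemma bochner_evaluate:
  assumes v: "has_bochner_integral_on \<mu> \<Gamma>\<^sub>0 F v" and F: "F \<in> Cc \<Gamma>\<^sub>0" and y: "y \<in> topspace Y"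
  shows "has_bochner_integral_on \<mu> (B y) (\<lambda>h. F h y) (v y)" "(\<lambda>h. F h y) \<in> Cc (B y)"
proof -
  interpret By: banach_space_on "B y" by (rule fibre_banach[OF y])
  note F0 = G0.CcD(1)[OF F]
  obtain K where K: "compact K" "\<forall>g. g \<notin> K \<longrightarrow> F g = nzero \<Gamma>\<^sub>0" using G0.CcD(3)[OF F] by blast
  show Fy: "(\<lambda>h. F h y) \<in> Cc (B y)"
  proof (rule By.CcI[OF Gamma0_closed[OF F0 y] _ K(1)])
    fix g and \<epsilon> :: real assume e: "0 < \<epsilon>"
    obtain U where U: "open U" "g \<in> U" "\<forall>h\<in>U. ndist \<Gamma>\<^sub>0 (F h) (F g) < \<epsilon>" using G0.CcD(2)[OF F e] by blast
    have "ndist (B y) (F h y) (F g y) < \<epsilon>" if "h \<in> U" for h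
      using Gamma0_nd_point[OF F0 F0 y, of h g] U(3) that by fastforce
    thus "\<exists>U. open U \<and> g \<in> U \<and> (\<forall>h\<in>U. ndist (B y) (F h y) (F g y) < \<epsilon>)" using U(1,2) by blast
  qed (use K(2) in \<open>simp add: Gamma0_apply[OF y]\<close>)
  have vc: "v \<in> ncar \<Gamma>\<^sub>0" using v by (simp add: G0.has_bochner_iff)
  have ev: "simple_repr \<mu> (B y) (map (\<lambda>(A, e). (A, e y)) L)
      \<and> (\<forall>x. simple_value (B y) (map (\<lambda>(A, e). (A, e y)) L) x = simple_value \<Gamma>\<^sub>0 L x y)
      \<and> simple_integral_on \<mu> (B y) (map (\<lambda>(A, e). (A, e y)) L) = simple_integral_on \<mu> \<Gamma>\<^sub>0 L y"
    if "simple_repr \<mu> \<Gamma>\<^sub>0 L" for L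
    using that
  proof (induction L)
    case Nil
    show ?case by (simp add: By.simple_repr_simps By.simple_value_simps By.simple_integral_simps
        G0.simple_value_simps G0.simple_integral_simps Gamma0_apply[OF y])
  next
    case (Cons p L)
    obtain A e where p: "p = (A, e)" by (cases p)
    show ?case using Cons Gamma0_closed[OF _ y, of e]
      by (auto simp: p By.simple_repr_simps By.simple_value_simps By.simple_integral_simps
        G0.simple_repr_simps G0.simple_value_simps G0.simple_integral_simps Gamma0_apply[OF y])
  qed
  show "has_bochner_integral_on \<mu> (B y) (\<lambda>h. F h y) (v y)"
    unfolding By.has_bochner_iff
  proof (intro conjI allI impI Gamma0_closed[OF vc y])
    fix \<epsilon> :: real assume e: "0 < \<epsilon>"
    obtain L where L: "simple_repr \<mu> \<Gamma>\<^sub>0 L" "(\<integral>\<^sup>+x. ennreal (ndist \<Gamma>\<^sub>0 (F x) (simple_value \<Gamma>\<^sub>0 L x)) \<partial>\<mu>) < ennreal \<epsilon>"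
      "ndist \<Gamma>\<^sub>0 v (simple_integral_on \<mu> \<Gamma>\<^sub>0 L) < \<epsilon>"
      using v e unfolding G0.has_bochner_iff by blast
    let ?L = "map (\<lambda>(A, e). (A, e y)) L"
    note evL = ev[OF L(1)]
    have "(\<integral>\<^sup>+x. ennreal (ndist (B y) (F x y) (simple_value (B y) ?L x)) \<partial>\<mu>)
        \<le> (\<integral>\<^sup>+x. ennreal (ndist \<Gamma>\<^sub>0 (F x) (simple_value \<Gamma>\<^sub>0 L x)) \<partial>\<mu>)"
      using evL Gamma0_nd_point[OF F0 G0.simple_value_closed[OF L(1)] y]
      by (intro nn_integral_mono ennreal_leI) simp
    also note L(2)
    finally have 1: "(\<integral>\<^sup>+x. ennreal (ndist (B y) (F x y) (simple_value (B y) ?L x)) \<partial>\<mu>) < ennreal \<epsilon>" .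
    have 2: "ndist (B y) (v y) (simple_integral_on \<mu> (B y) ?L) < \<epsilon>"
      using Gamma0_nd_point[OF vc G0.simple_integral_closed[OF L(1)] y] L(3) evL by simp
    have 3: "(\<lambda>x. ndist (B y) (F x y) (simple_value (B y) ?L x)) \<in> borel_measurable \<mu>"
      using evL by (intro By.simple_measurable By.Cc_nd_const_measurable[OF Fy _ measure_sets]) auto
    show "\<exists>L. simple_repr \<mu> (B y) L \<and> (\<lambda>x. ndist (B y) (F x y) (simple_value (B y) L x)) \<in> borel_measurable \<mu>
        \<and> (\<integral>\<^sup>+x. ennreal (ndist (B y) (F x y) (simple_value (B y) L x)) \<partial>\<mu>) < ennreal \<epsilon>
        \<and> ndist (B y) (v y) (simple_integral_on \<mu> (B y) L) < \<epsilon>"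
      using evL 1 2 3 by blast
  qed
qed

context
  fixes f1 f2 :: "'g \<Rightarrow> 'y \<Rightarrow> 'e" and L1 L2 :: "'y set"
  assumes f1: "supported f1 L1" and f2: "supported f2 L2"
begin

definition kernel_fun where "kernel_fun g h = nmul \<Gamma>\<^sub>0 (f1 h) (gact h (f2 (- h + g)))"

lemma f_Cc: "f1 \<in> Cc \<Gamma>\<^sub>0" "f2 \<in> Cc \<Gamma>\<^sub>0" using f1 f2 by (auto simp: supported_def)

lemma f_supp: "compactin Y L1" "y \<in> topspace Y - L1 \<Longrightarrow> f1 g y = nzero (B y)"
  "compactin Y L2" "y \<in> topspace Y - L2 \<Longrightarrow> f2 g y = nzero (B y)"
  using f1 f2 by (auto simp: supported_def)

lemmas f_closed = G0.CcD(1)[OF f_Cc(1)] G0.CcD(1)[OF f_Cc(2)]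

lemma kernel_closed: "kernel_fun g h \<in> ncar \<Gamma>\<^sub>0"
  unfolding kernel_fun_def by (intro Gamma0_mul_closed gact_closed f_closed)

lemma kernel_apply: "y \<in> topspace Y \<Longrightarrow> kernel_fun g h y = nmul (B y) (f1 h y) (\<alpha> h y (f2 (- h + g) (act (- h) y)))"
  by (simp add: kernel_fun_def Gamma0_apply gact_apply)

lemma kernel_zero_left:
  assumes z: "f1 h y = nzero (B y)" and y: "y \<in> topspace Y"
  shows "kernel_fun g h y = nzero (B y)"
  unfolding kernel_apply[OF y] z
  by (rule banach_algebra_on.nmul_zero(1)[OF fibre_algebra[OF y] \<alpha>_facts(1)[OF y Gamma0_closed[OF f_closed(2) source_closed[OF y]]]])

lemma kernel_zero_right:
  assumes z: "f2 (- h + g) (act (- h) y) = nzero (B (act (- h) y))" and y: "y \<in> topspace Y"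
  shows "kernel_fun g h y = nzero (B y)"
  unfolding kernel_apply[OF y] z \<alpha>_zero[OF y]
  by (rule banach_algebra_on.nmul_zero(2)[OF fibre_algebra[OF y] Gamma0_closed[OF f_closed(1) y]])

lemma kernel_jointly_continuous:
  assumes e: "0 < \<epsilon>"
  shows "\<exists>A C. open A \<and> open C \<and> g0 \<in> A \<and> h0 \<in> C
    \<and> (\<forall>g\<in>A. \<forall>h\<in>C. ndist \<Gamma>\<^sub>0 (kernel_fun g h) (kernel_fun g0 h0) < \<epsilon>)"
proof -
  let ?k = "- h0 + g0"
  define c where "c = nnorm \<Gamma>\<^sub>0 (f1 h0) + nnorm \<Gamma>\<^sub>0 (f2 ?k) + 1"
  have nn: "0 \<le> nnorm \<Gamma>\<^sub>0 (f1 h0)" "0 \<le> nnorm \<Gamma>\<^sub>0 (f2 ?k)" by (intro Gamma0_norm_nonneg f_closed)+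
  have c: "0 < c" "nnorm \<Gamma>\<^sub>0 (f1 h0) \<le> c" "nnorm \<Gamma>\<^sub>0 (f2 ?k) + 1 \<le> c" using nn by (simp_all add: c_def)
  define \<delta> where "\<delta> = min 1 (\<epsilon> / (4 * c))"
  have d: "0 < \<delta>" "\<delta> \<le> 1" "\<delta> * (4 * c) \<le> \<epsilon>"
    using e c(1) by (simp_all add: \<delta>_def min_def field_simps)
  obtain U1 where U1: "open U1" "h0 \<in> U1" "\<forall>h\<in>U1. ndist \<Gamma>\<^sub>0 (f1 h) (f1 h0) < \<delta>"
    using G0.CcD(2)[OF f_Cc(1) d(1), of h0] by (elim exE conjE) (rule that)
  obtain U2 where U2: "open U2" "?k \<in> U2" "\<forall>k\<in>U2. ndist \<Gamma>\<^sub>0 (f2 k) (f2 ?k) < \<delta>"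
    using G0.CcD(2)[OF f_Cc(2) d(1), of ?k] by (elim exE conjE) (rule that)
  have "\<exists>V. open V \<and> h0 \<in> V \<and> (\<forall>k\<in>V. ndist \<Gamma>\<^sub>0 (gact k (f2 ?k)) (gact h0 (f2 ?k)) < \<delta>)"
    by (rule gact_strongly_continuous[OF f_closed(2) f_supp(3) _ d(1)]) (rule f_supp(4))
  then obtain U3 where U3: "open U3" "h0 \<in> U3" "\<forall>h\<in>U3. ndist \<Gamma>\<^sub>0 (gact h (f2 ?k)) (gact h0 (f2 ?k)) < \<delta>"
    by (elim exE conjE) (rule that)
  have "open ((\<lambda>p :: 'g \<times> 'g. - snd p + fst p) -` U2)"
    by (intro open_vimage U2 continuous_intros)
  then obtain A C where AC: "open A" "open C" "g0 \<in> A" "h0 \<in> C" "A \<times> C \<subseteq> (\<lambda>p. - snd p + fst p) -` U2"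
    using U2(2) by (elim open_prod_elim[where x = "(g0, h0)"]) auto
  have "ndist \<Gamma>\<^sub>0 (kernel_fun g h) (kernel_fun g0 h0) < \<epsilon>" if g: "g \<in> A" and h: "h \<in> C \<inter> U1 \<inter> U3" for g h
  proof -
    let ?l = "- h + g"
    have l: "?l \<in> U2" using AC(5) g h by auto
    have n1: "ndist \<Gamma>\<^sub>0 (f1 h) (f1 h0) \<le> \<delta>" using U1(3) h by fastforce
    have n2: "ndist \<Gamma>\<^sub>0 (f2 ?l) (f2 ?k) \<le> \<delta>" using U2(3) l by fastforce
    have n3: "ndist \<Gamma>\<^sub>0 (gact h (f2 ?k)) (gact h0 (f2 ?k)) \<le> \<delta>" using U3(3) h by fastforce
    have n4: "nnorm \<Gamma>\<^sub>0 (gact h (f2 ?l)) \<le> c"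
      using gact_norm[OF f_closed(2), of h ?l] G0.norm_le_nd[OF f_closed(2) f_closed(2), of ?l ?k] n2 d(2) c(3) by linarith
    have n5: "ndist \<Gamma>\<^sub>0 (gact h (f2 ?l)) (gact h0 (f2 ?k)) \<le> 2 * \<delta>"
      using G0.nd_triangle[of "gact h (f2 ?l)" "gact h (f2 ?k)" "gact h0 (f2 ?k)", OF gact_closed[OF f_closed(2)] gact_closed[OF f_closed(2)] gact_closed[OF f_closed(2)]]
        gact_nd[OF f_closed(2) f_closed(2), of h ?l ?k] n2 n3 by linarith
    have "ndist \<Gamma>\<^sub>0 (kernel_fun g h) (kernel_fun g0 h0)
        \<le> ndist \<Gamma>\<^sub>0 (f1 h) (f1 h0) * nnorm \<Gamma>\<^sub>0 (gact h (f2 ?l)) + nnorm \<Gamma>\<^sub>0 (f1 h0) * ndist \<Gamma>\<^sub>0 (gact h (f2 ?l)) (gact h0 (f2 ?k))"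
      unfolding kernel_fun_def by (intro Gamma0_nd_mul f_closed gact_closed)
    also have "\<dots> \<le> \<delta> * c + c * (2 * \<delta>)"
      using d c by (intro add_mono mult_mono n1 n4 n5 nn c G0.nd_nonneg Gamma0_norm_nonneg f_closed gact_closed) simp_all
    also have "\<dots> < \<delta> * (4 * c)" using d c by simp
    finally show ?thesis using d(3) by simp
  qed
  thus ?thesis using AC U1 U3 by (intro exI[of _ A] exI[of _ "C \<inter> U1 \<inter> U3"]) auto
qed

lemma kernel_Cc: "kernel_fun g \<in> Cc \<Gamma>\<^sub>0"
proof -
  obtain K where K: "compact K" "\<forall>h. h \<notin> K \<longrightarrow> f1 h = nzero \<Gamma>\<^sub>0" using G0.CcD(3)[OF f_Cc(1)] by (elim exE conjE) (rule that)
  show ?thesis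
  proof (rule G0.CcI[OF kernel_closed _ K(1)])
    fix h and \<epsilon> :: real assume e: "0 < \<epsilon>"
    obtain A C where "open A" "open C" "g \<in> A" "h \<in> C" "\<forall>g'\<in>A. \<forall>h'\<in>C. ndist \<Gamma>\<^sub>0 (kernel_fun g' h') (kernel_fun g h) < \<epsilon>"
      using kernel_jointly_continuous[OF e, of g h] by (elim exE conjE) (rule that)
    thus "\<exists>U. open U \<and> h \<in> U \<and> (\<forall>h'\<in>U. ndist \<Gamma>\<^sub>0 (kernel_fun g h') (kernel_fun g h) < \<epsilon>)" by blast
  next
    fix h assume "h \<notin> K"
    thus "kernel_fun g h = nzero \<Gamma>\<^sub>0"
      using K(2) by (intro Gamma0_eqI[OF kernel_closed Gamma0_zero_closed]) (simp add: kernel_zero_left Gamma0_apply)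
  qed
qed

definition conv where "conv g = bochner_integral_on \<mu> \<Gamma>\<^sub>0 (kernel_fun g)"

lemma conv_bochner: "has_bochner_integral_on \<mu> \<Gamma>\<^sub>0 (kernel_fun g) (conv g)"
proof -
  from G0.Cc_has_bochner[OF kernel_Cc measure_sets measure_compact]
  obtain v where v: "has_bochner_integral_on \<mu> \<Gamma>\<^sub>0 (kernel_fun g) v" ..
  show ?thesis unfolding conv_def G0.bochner_integral_unique[OF v kernel_closed] by (rule v)
qed

lemma conv_closed: "conv g \<in> ncar \<Gamma>\<^sub>0"
  using conv_bochner by (simp add: G0.has_bochner_iff)

lemma conv_apply:
  assumes y: "y \<in> topspace Y"
  shows "conv g y = bochner_integral_on \<mu> (B y) (\<lambda>h. nmul (B y) (f1 h y) (\<alpha> h y (f2 (- h + g) (act (- h) y))))"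
proof -
  interpret By: banach_space_on "B y" by (rule fibre_banach[OF y])
  have "bochner_integral_on \<mu> (B y) (\<lambda>h. kernel_fun g h y) = conv g y"
    by (rule By.bochner_integral_unique[OF bochner_evaluate(1)[OF conv_bochner kernel_Cc y] Gamma0_closed[OF kernel_closed y]])
  thus ?thesis by (simp add: kernel_apply[OF y])
qed

lemma conv_zero:
  assumes y: "y \<in> topspace Y" and zero: "\<And>h. kernel_fun g h y = nzero (B y)"
  shows "conv g y = nzero (B y)"
proof -
  interpret By: banach_space_on "B y" by (rule fibre_banach[OF y])
  have v: "has_bochner_integral_on \<mu> (B y) (\<lambda>h. nzero (B y)) (conv g y)"
    using bochner_evaluate(1)[OF conv_bochner kernel_Cc y, of g] by (simp add: zero)
  show ?thesis
    using By.bochner_integral_unique[OF v By.zero_closed] By.bochner_integral_unique[OF By.bochner_zero[of \<mu>] By.zero_closed] by simp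
qed

text \<open>The factor \<open>f\<^sub>2\<close> is estimated in the supremum norm over the whole groupoid, so that only the fibrewise
\<open>L\<^sup>1\<close>-norm of \<open>f\<^sub>1\<close> remains.\<close>

lemma conv_norm_le:
  assumes y: "y \<in> topspace Y" and M: "\<And>k. nnorm \<Gamma>\<^sub>0 (f2 k) \<le> M"
  shows "ennreal (nnorm (B y) (conv g y)) \<le> (\<integral>\<^sup>+h. ennreal (nnorm (B y) (f1 h y)) \<partial>\<mu>) * ennreal M"
proof -
  interpret By: banach_algebra_on "B y" by (rule fibre_algebra[OF y])
  note ev = bochner_evaluate[OF conv_bochner kernel_Cc y, of g]
  have f1y: "(\<lambda>h. f1 h y) \<in> Cc (B y)"
  proof -
    from G0.Cc_has_bochner[OF f_Cc(1) measure_sets measure_compact]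
    obtain v where "has_bochner_integral_on \<mu> \<Gamma>\<^sub>0 f1 v" ..
    from bochner_evaluate(2)[OF this f_Cc(1) y] show ?thesis .
  qed
  have "ennreal (nnorm (B y) (conv g y)) \<le> (\<integral>\<^sup>+h. ennreal (nnorm (B y) (kernel_fun g h y)) \<partial>\<mu>)"
    by (rule By.bochner_integral_norm_le[OF ev(1) Gamma0_closed[OF kernel_closed y] By.Cc_norm_measurable[OF ev(2) measure_sets]])
  also have "\<dots> \<le> (\<integral>\<^sup>+h. ennreal (nnorm (B y) (f1 h y)) * ennreal M \<partial>\<mu>)"
  proof (rule nn_integral_mono)
    fix h
    let ?b = "f2 (- h + g) (act (- h) y)"
    have bc: "?b \<in> ncar (B (act (- h) y))" by (intro Gamma0_closed f_closed source_closed y)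
    have "nnorm (B y) (kernel_fun g h y) \<le> nnorm (B y) (f1 h y) * nnorm (B y) (\<alpha> h y ?b)"
      unfolding kernel_apply[OF y] by (intro By.norm_mul Gamma0_closed[OF f_closed(1) y] \<alpha>_facts(1)[OF y bc])
    also have "\<dots> \<le> nnorm (B y) (f1 h y) * M"
      unfolding \<alpha>_facts(2)[OF y bc]
      using Gamma0_point_le[OF f_closed(2) source_closed[OF y], of h "- h + g"] M[of "- h + g"]
      by (intro mult_left_mono By.norm_nonneg Gamma0_closed[OF f_closed(1) y]) linarith
    finally have "ennreal (nnorm (B y) (kernel_fun g h y)) \<le> ennreal (nnorm (B y) (f1 h y) * M)" by (rule ennreal_leI)
    also have "\<dots> = ennreal (nnorm (B y) (f1 h y)) * ennreal M"
      using order_trans[OF Gamma0_norm_nonneg[OF f_closed(2)] M] By.norm_nonneg[OF Gamma0_closed[OF f_closed(1) y]]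
      by (intro ennreal_mult) auto
    finally show "ennreal (nnorm (B y) (kernel_fun g h y)) \<le> ennreal (nnorm (B y) (f1 h y)) * ennreal M" .
  qed
  also have "\<dots> = (\<integral>\<^sup>+h. ennreal (nnorm (B y) (f1 h y)) \<partial>\<mu>) * ennreal M"
    using By.Cc_norm_measurable[OF f1y measure_sets] by (intro nn_integral_multc) auto
  finally show ?thesis .
qed

text \<open>The integrand is jointly continuous and vanishes outside the compact support of \<open>f\<^sub>1\<close>, so it is uniformly
close for neighbouring \<open>g\<close>.  The values of the convolution vanish wherever those of \<open>f\<^sub>1\<close> do.\<close>

lemma conv_supported: "supported conv L1"
proof -
  obtain K1 where K1: "compact K1" "\<forall>h. h \<notin> K1 \<longrightarrow> f1 h = nzero \<Gamma>\<^sub>0" using G0.CcD(3)[OF f_Cc(1)] by (elim exE conjE) (rule that)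
  obtain K2 where K2: "compact K2" "\<forall>h. h \<notin> K2 \<longrightarrow> f2 h = nzero \<Gamma>\<^sub>0" using G0.CcD(3)[OF f_Cc(2)] by (elim exE conjE) (rule that)
  let ?K = "(\<lambda>p. fst p + snd p) ` (K1 \<times> K2)"
  have K: "compact ?K"
    by (intro compact_continuous_image compact_Times K1 K2 continuous_intros)
  have supp: "conv g y = nzero (B y)" if y: "y \<in> topspace Y - L1" for g y
    using y f_supp(2)[OF y] by (intro conv_zero kernel_zero_left) auto
  have "conv \<in> Cc \<Gamma>\<^sub>0"
  proof (rule G0.CcI[OF conv_closed _ K])
    fix g assume g: "g \<notin> ?K"
    show "conv g = nzero \<Gamma>\<^sub>0"
    proof (rule Gamma0_eqI[OF conv_closed Gamma0_zero_closed])
      fix y assume y: "y \<in> topspace Y"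
      have "kernel_fun g h y = nzero (B y)" for h
      proof (cases "h \<in> K1")
        case True
        have "- h + g \<notin> K2"
        proof
          assume "- h + g \<in> K2"
          hence "h + (- h + g) \<in> ?K" using True by force
          moreover have "h + (- h + g) = g" by (metis add.assoc add.right_inverse add_0)
          ultimately show False using g by simp
        qed
        thus ?thesis using K2(2) source_closed[OF y, of h] by (intro kernel_zero_right y) (simp add: Gamma0_apply)
      next
        case False
        thus ?thesis using K1(2) y by (intro kernel_zero_left) (simp_all add: Gamma0_apply)
      qed
      thus "conv g y = nzero \<Gamma>\<^sub>0 y" using conv_zero[OF y] y by (simp add: Gamma0_apply)
    qed
  next
    fix g and \<epsilon> :: real assume e: "0 < \<epsilon>"
    define m where "m = measure \<mu> K1 + 1"
    have m: "0 < m" by (simp add: m_def add_nonneg_pos)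
    define \<delta> where "\<delta> = \<epsilon> / (2 * m)"
    have d: "0 < \<delta> / 2" using e m by (simp add: \<delta>_def)
    have "\<forall>h. \<exists>A C. open A \<and> open C \<and> g \<in> A \<and> h \<in> C \<and> (\<forall>g'\<in>A. \<forall>h'\<in>C. ndist \<Gamma>\<^sub>0 (kernel_fun g' h') (kernel_fun g h) < \<delta> / 2)"
      by (intro allI kernel_jointly_continuous d)
    then obtain A C where AC: "\<And>h. open (A h)" "\<And>h. open (C h)" "\<And>h. g \<in> A h" "\<And>h. h \<in> C h"
      "\<And>h. \<forall>g'\<in>A h. \<forall>h'\<in>C h. ndist \<Gamma>\<^sub>0 (kernel_fun g' h') (kernel_fun g h) < \<delta> / 2" by metis
    obtain D where D: "D \<subseteq> K1" "finite D" "K1 \<subseteq> (\<Union>h\<in>D. C h)"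
      using compactE_image[OF K1(1), of K1 C] AC(2,4) by blast
    define V where "V = (\<Inter>h\<in>D. A h)"
    have V: "open V" "g \<in> V" using D(2) AC(1,3) by (auto simp: V_def)
    have close: "ndist \<Gamma>\<^sub>0 (kernel_fun g' h) (kernel_fun g h) \<le> \<delta> * indicator K1 h" if g': "g' \<in> V" for g' h
    proof (cases "h \<in> K1")
      case True
      then obtain k where k: "k \<in> D" "h \<in> C k" using D(3) by blast
      have "ndist \<Gamma>\<^sub>0 (kernel_fun g' h) (kernel_fun g k) < \<delta> / 2" "ndist \<Gamma>\<^sub>0 (kernel_fun g h) (kernel_fun g k) < \<delta> / 2"
        using AC(5)[of k] AC(3)[of k] g' k by (auto simp: V_def)
      thus ?thesis using True G0.nd_triangle[OF kernel_closed[of g' h] kernel_closed[of g k] kernel_closed[of g h]]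
          G0.nd_commute[OF kernel_closed[of g h] kernel_closed[of g k]] by simp
    next
      case False
      have "kernel_fun g' h = nzero \<Gamma>\<^sub>0" for g'
        using K1(2) False by (intro Gamma0_eqI[OF kernel_closed Gamma0_zero_closed]) (simp add: kernel_zero_left Gamma0_apply)
      thus ?thesis using False by (simp add: G0.nd_self[OF Gamma0_zero_closed])
    qed
    have "ndist \<Gamma>\<^sub>0 (conv g') (conv g) < \<epsilon>" if g': "g' \<in> V" for g'
    proof -
      have Kb: "K1 \<in> sets \<mu>" using compact_imp_closed[OF K1(1)] by (simp add: measure_sets)
      have "ennreal (ndist \<Gamma>\<^sub>0 (conv g') (conv g)) \<le> (\<integral>\<^sup>+h. ennreal (ndist \<Gamma>\<^sub>0 (kernel_fun g' h) (kernel_fun g h)) \<partial>\<mu>)"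
        by (rule G0.bochner_integral_nd_le[OF conv_bochner conv_bochner kernel_closed kernel_closed G0.Cc_nd_measurable[OF kernel_Cc kernel_Cc measure_sets]])
      also have "\<dots> \<le> (\<integral>\<^sup>+h. ennreal \<delta> * indicator K1 h \<partial>\<mu>)"
      proof (rule nn_integral_mono)
        fix h show "ennreal (ndist \<Gamma>\<^sub>0 (kernel_fun g' h) (kernel_fun g h)) \<le> ennreal \<delta> * indicator K1 h"
          using close[OF g', of h] by (cases "h \<in> K1") (auto intro: ennreal_leI simp: ennreal_neg)
      qed
      also have "\<dots> = ennreal (\<delta> * measure \<mu> K1)"
        using measure_compact[OF K1(1)] Kb d by (simp add: nn_integral_cmult emeasure_eq_ennreal_measure ennreal_mult)
      finally have "ndist \<Gamma>\<^sub>0 (conv g') (conv g) \<le> \<delta> * measure \<mu> K1"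
        using d by (subst (asm) ennreal_le_iff) auto
      also have "\<dots> \<le> \<delta> * m" using d by (simp add: m_def)
      also have "\<dots> < \<epsilon>" using e m by (simp add: \<delta>_def)
      finally show ?thesis .
    qed
    thus "\<exists>U. open U \<and> g \<in> U \<and> (\<forall>h\<in>U. ndist \<Gamma>\<^sub>0 (conv h) (conv g) < \<epsilon>)" using V by blast
  qed
  thus ?thesis using f_supp(1) supp by (simp add: supported_def)
qed

end

end

section \<open>The two convolution algebras\<close>

context banach_space_on
begin

lemma Cc_integrable:
  fixes f :: "'g::t2_space \<Rightarrow> 'e"
  assumes f: "f \<in> Cc E" and \<mu>: "sets \<mu> = sets borel" and fin: "\<And>K. compact K \<Longrightarrow> emeasure \<mu> K < \<infinity>"
  shows "integrable \<mu> (\<lambda>g. nnorm E (f g))"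
proof -
  obtain M where M: "0 \<le> M" "\<forall>g. nnorm E (f g) \<le> M" using Cc_bounded[OF f] by blast
  from CcD(3)[OF f] obtain K where K: "compact K" "\<forall>g. g \<notin> K \<longrightarrow> f g = nzero E" by (elim exE conjE)
  have Kb: "K \<in> sets \<mu>" using compact_imp_closed[OF K(1)] by (simp add: \<mu>)
  have "integrable \<mu> (\<lambda>g. M * indicator K g)"
    using Kb fin[OF K(1)] by (intro integrable_mult_right integrable_real_indicator)
  thus ?thesis
  proof (rule Bochner_Integration.integrable_bound[OF _ Cc_norm_measurable[OF f \<mu>]])
    have "norm (nnorm E (f g)) \<le> norm (M * indicator K g)" for g
      using M K(2) norm_nonneg[OF CcD(1)[OF f]] by (cases "g \<in> K") (auto simp: nnorm_zero)
    thus "AE g in \<mu>. norm (nnorm E (f g)) \<le> norm (M * indicator K g)" by simp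
  qed
qed

lemma Cc_scale:
  assumes f: "f \<in> Cc E"
  shows "(\<lambda>g. nscale E c (f g)) \<in> Cc E"
proof -
  note fc = CcD(1)[OF f]
  from CcD(3)[OF f] obtain K where K: "compact K" "\<forall>g. g \<notin> K \<longrightarrow> f g = nzero E" by (elim exE conjE)
  show ?thesis
  proof (rule CcI[OF scale_closed[OF fc] _ K(1)])
    fix g and \<epsilon> :: real assume e: "0 < \<epsilon>"
    have pos: "0 < cmod c + 1" by (simp add: add_nonneg_pos)
    hence "0 < \<epsilon> / (cmod c + 1)" using e by simp
    from CcD(2)[OF f this, of g]
    obtain U where U: "open U" "g \<in> U" "\<forall>h\<in>U. nd (f h) (f g) < \<epsilon> / (cmod c + 1)" by (elim exE conjE)
    have "nd (nscale E c (f h)) (nscale E c (f g)) < \<epsilon>" if "h \<in> U" for h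
    proof -
      have "cmod c * nd (f h) (f g) \<le> (cmod c + 1) * nd (f h) (f g)"
        using nd_nonneg[OF fc fc] by (intro mult_right_mono) simp_all
      also have "\<dots> < \<epsilon>" using U(3) that by (simp add: pos_less_divide_eq[OF pos] mult.commute)
      finally show ?thesis by (simp add: nd_scale[OF fc fc])
    qed
    thus "\<exists>U. open U \<and> g \<in> U \<and> (\<forall>h\<in>U. nd (nscale E c (f h)) (nscale E c (f g)) < \<epsilon>)"
      using U(1,2) by (intro exI[of _ U]) simp
  qed (use K(2) in \<open>simp add: scale_zero_right\<close>)
qed

lemma Cc_add:
  assumes f: "f \<in> Cc E" and f': "f' \<in> Cc E"
  shows "(\<lambda>g. nadd E (f g) (f' g)) \<in> Cc E"
proof -
  note fc = CcD(1)[OF f] and fc' = CcD(1)[OF f']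
  from CcD(3)[OF f] obtain K where K: "compact K" "\<forall>g. g \<notin> K \<longrightarrow> f g = nzero E" by (elim exE conjE)
  from CcD(3)[OF f'] obtain K' where K': "compact K'" "\<forall>g. g \<notin> K' \<longrightarrow> f' g = nzero E" by (elim exE conjE)
  show ?thesis
  proof (rule CcI[OF add_closed[OF fc fc'] _ compact_Un[OF K(1) K'(1)]])
    fix g and \<epsilon> :: real assume e: "0 < \<epsilon>"
    hence e2: "0 < \<epsilon> / 2" by simp
    from CcD(2)[OF f e2, of g] obtain U where U: "open U" "g \<in> U" "\<forall>h\<in>U. nd (f h) (f g) < \<epsilon> / 2" by (elim exE conjE)
    from CcD(2)[OF f' e2, of g] obtain U' where U': "open U'" "g \<in> U'" "\<forall>h\<in>U'. nd (f' h) (f' g) < \<epsilon> / 2" by (elim exE conjE)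
    have "nd (nadd E (f h) (f' h)) (nadd E (f g) (f' g)) < \<epsilon>" if "h \<in> U \<inter> U'" for h
      using nd_add[OF fc fc' fc fc', of h h g g] U(3) U'(3) that by fastforce
    thus "\<exists>U. open U \<and> g \<in> U \<and> (\<forall>h\<in>U. nd (nadd E (f h) (f' h)) (nadd E (f g) (f' g)) < \<epsilon>)"
      using U(1,2) U'(1,2) by (intro exI[of _ "U \<inter> U'"]) (simp add: open_Int)
  qed (use K(2) K'(2) in \<open>simp add: add_zero zero_closed\<close>)
qed

lemma nd_multiple:
  assumes x: "x \<in> ncar E"
  shows "nd x (nscale E (complex_of_real r) x) = \<bar>1 - r\<bar> * nnorm E x"
proof -
  have "ndiff E x (nscale E (complex_of_real r) x) = nadd E (nscale E 1 x) (nscale E (- complex_of_real r) x)"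
    using x by (simp add: ndiff_def scale_scale scale_one)
  also have "\<dots> = nscale E (complex_of_real (1 - r)) x" using x by (simp flip: add_scale)
  finally show ?thesis unfolding ndist_def using norm_scale[OF x, of "complex_of_real (1 - r)"] by (simp only: norm_of_real)
qed

end

lemma integral_le_of_support:
  fixes f :: "'g::t2_space \<Rightarrow> real"
  assumes f: "integrable \<mu> f" and \<mu>: "sets \<mu> = sets borel" and K: "compact K" "emeasure \<mu> K < \<infinity>"
    and le: "\<And>g. f g \<le> c * indicator K g"
  shows "(\<integral>g. f g \<partial>\<mu>) \<le> c * measure \<mu> K"
proof -
  have Kb: "K \<in> sets \<mu>" using compact_imp_closed[OF K(1)] by (simp add: \<mu>)
  have "(\<integral>g. f g \<partial>\<mu>) \<le> (\<integral>g. c * indicator K g \<partial>\<mu>)"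
    using Kb K(2) by (intro integral_mono f le integrable_mult_right integrable_real_indicator)
  also have "\<dots> = c * measure \<mu> K" using Kb sets.sets_into_space[OF Kb] by (simp add: Int_absorb1 Int_absorb2)
  finally show ?thesis .
qed

context transformation_groupoid_algebra
begin

abbreviation NG where "NG \<equiv> group_convolution_algebra \<mu> \<Gamma>\<^sub>0 gact"
abbreviation NP where "NP \<equiv> groupoid_convolution_algebra \<mu> Y act B \<Gamma> \<alpha>"

lemma NG_simps: "ncar NG = Cc \<Gamma>\<^sub>0" "nadd NG \<xi> \<eta> = (\<lambda>g. nadd \<Gamma>\<^sub>0 (\<xi> g) (\<eta> g))" "nscale NG c \<xi> = (\<lambda>g. nscale \<Gamma>\<^sub>0 c (\<xi> g))"
  "nnorm NG \<xi> = (\<integral>g. nnorm \<Gamma>\<^sub>0 (\<xi> g) \<partial>\<mu>)"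
  "nmul NG \<xi> \<eta> = (\<lambda>g. bochner_integral_on \<mu> \<Gamma>\<^sub>0 (\<lambda>h. nmul \<Gamma>\<^sub>0 (\<xi> h) (gact h (\<eta> (- h + g)))))"
  by (simp_all add: group_convolution_algebra_def)

lemma NP_simps: "ncar NP = \<Gamma>\<^sub>c"
  "nnorm NP \<xi> = Sup (insert 0 ((\<lambda>y. \<integral>g. nnorm (B y) (\<xi> (g, y)) \<partial>\<mu>) ` topspace Y))"
  "nmul NP \<xi> \<eta> = (\<lambda>(g, y) \<in> topspace Z. bochner_integral_on \<mu> (B y)
        (\<lambda>h. nmul (B y) (\<xi> (h, y)) (\<alpha> h y (\<eta> (- h + g, act (- h) y)))))"
  by (simp_all add: groupoid_convolution_algebra_def Let_def)

lemma NG_mul: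
  assumes f: "supported f1 L1" "supported f2 L2"
  shows "nmul NG f1 f2 = conv f1 f2"
proof
  fix g
  have "kernel_fun f1 f2 g = (\<lambda>h. nmul \<Gamma>\<^sub>0 (f1 h) (gact h (f2 (- h + g))))"
    by (rule ext) (rule kernel_fun_def[OF f])
  thus "nmul NG f1 f2 g = conv f1 f2 g" unfolding NG_simps conv_def[OF f] by simp
qed

text \<open>The product in the groupoid algebra is computed fibre by fibre, the one in \<open>C\<^sub>c(G, \<Gamma>\<^sub>0)\<close> by integrals of
sections; both evaluate to the same elements of the fibres.\<close>

lemma NP_mul:
  assumes \<xi>: "supported (curry \<xi>) L1" and \<eta>: "supported (curry \<eta>) L2"
  shows "nmul NP \<xi> \<eta> = case_prod (conv (curry \<xi>) (curry \<eta>))"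
proof
  fix p :: "'g \<times> 'y"
  obtain g y where p: "p = (g, y)" by (cases p)
  show "nmul NP \<xi> \<eta> p = case_prod (conv (curry \<xi>) (curry \<eta>)) p"
  proof (cases "y \<in> topspace Y")
    case True
    show ?thesis using conv_apply[OF \<xi> \<eta> True, of g] True by (simp add: p NP_simps)
  next
    case False
    show ?thesis using Gamma0_extensional[OF conv_closed[OF \<xi> \<eta>] False, of g] False by (simp add: p NP_simps)
  qed
qed

lemma supported_Cc: "supported f L \<Longrightarrow> f \<in> Cc \<Gamma>\<^sub>0"
  by (simp add: supported_def)

lemma fibre_Cc:
  fixes f :: "'g \<Rightarrow> 'y \<Rightarrow> 'e"
  assumes f: "f \<in> Cc \<Gamma>\<^sub>0" and y: "y \<in> topspace Y"
  shows "(\<lambda>h. f h y) \<in> Cc (B y)"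
proof -
  from G0.Cc_has_bochner[OF f measure_sets measure_compact]
  obtain v where "has_bochner_integral_on \<mu> \<Gamma>\<^sub>0 f v" ..
  from bochner_evaluate(2)[OF this f y] show ?thesis .
qed

lemma fibre_integrable:
  assumes f: "f \<in> Cc \<Gamma>\<^sub>0" and y: "y \<in> topspace Y"
  shows "integrable \<mu> (\<lambda>g. nnorm (B y) (f g y))"
  by (rule banach_space_on.Cc_integrable[OF fibre_banach[OF y] fibre_Cc[OF f y] measure_sets measure_compact])

lemma NG_integrable: "f \<in> Cc \<Gamma>\<^sub>0 \<Longrightarrow> integrable \<mu> (\<lambda>g. nnorm \<Gamma>\<^sub>0 (f g))"
  by (rule G0.Cc_integrable[OF _ measure_sets measure_compact])

lemma NP_bounded:
  assumes \<xi>: "supported (curry \<xi>) L"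
  shows "bdd_above (insert 0 ((\<lambda>y. \<integral>g. nnorm (B y) (\<xi> (g, y)) \<partial>\<mu>) ` topspace Y))"
proof (intro bdd_aboveI[of _ "\<integral>g. nnorm \<Gamma>\<^sub>0 (curry \<xi> g) \<partial>\<mu>"])
  note f = supported_Cc[OF \<xi>]
  fix x assume "x \<in> insert 0 ((\<lambda>y. \<integral>g. nnorm (B y) (\<xi> (g, y)) \<partial>\<mu>) ` topspace Y)"
  then consider "x = 0" | y where "y \<in> topspace Y" "x = (\<integral>g. nnorm (B y) (curry \<xi> g y) \<partial>\<mu>)" by auto
  thus "x \<le> (\<integral>g. nnorm \<Gamma>\<^sub>0 (curry \<xi> g) \<partial>\<mu>)"
  proof cases
    case 1
    show ?thesis unfolding 1 by (intro Bochner_Integration.integral_nonneg Gamma0_norm_nonneg G0.CcD(1)[OF f])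
  next
    case (2 y)
    show ?thesis unfolding 2(2)
      by (intro integral_mono fibre_integrable[OF f 2(1)] NG_integrable f Gamma0_point_le[OF G0.CcD(1)[OF f] 2(1)])
  qed
qed

lemma NP_fibre_le:
  assumes "supported (curry \<xi>) L" "y \<in> topspace Y"
  shows "(\<integral>g. nnorm (B y) (\<xi> (g, y)) \<partial>\<mu>) \<le> nnorm NP \<xi>"
  unfolding NP_simps by (rule cSup_upper[OF _ NP_bounded[OF assms(1)]]) (use assms(2) in auto)

lemma NP_nonneg: "supported (curry \<xi>) L \<Longrightarrow> 0 \<le> nnorm NP \<xi>"
  unfolding NP_simps by (rule cSup_upper[OF _ NP_bounded]) simp

subsection \<open>The estimates behind properness and discreteness\<close>

text \<open>This is the discrete case: the supremum over a finite \<open>L\<close> is at most the sum over \<open>L\<close>, which commutes with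
the integral.\<close>

lemma fibre_le_of_finite_support:
  assumes \<zeta>: "supported (curry \<zeta>) L" and fin: "finite L"
  shows "nnorm NG (curry \<zeta>) \<le> real (card L) * nnorm NP \<zeta>"
proof -
  note f = supported_Cc[OF \<zeta>]
  have L: "L \<subseteq> topspace Y" and supp: "\<And>g y. y \<in> topspace Y - L \<Longrightarrow> curry \<zeta> g y = nzero (B y)"
    using \<zeta> compactin_subset_topspace by (auto simp: supported_def)
  have nn: "0 \<le> nnorm (B y) (curry \<zeta> g y)" if "y \<in> L" for g y
    using banach_space_on.norm_nonneg[OF fibre_banach Gamma0_closed[OF G0.CcD(1)[OF f]]] L that by blast
  have le: "nnorm \<Gamma>\<^sub>0 (curry \<zeta> g) \<le> (\<Sum>y\<in>L. nnorm (B y) (curry \<zeta> g y))" for g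
  proof (rule Gamma0_norm_leI)
    show "0 \<le> (\<Sum>y\<in>L. nnorm (B y) (curry \<zeta> g y))" by (intro sum_nonneg nn)
    fix y assume y: "y \<in> topspace Y"
    show "nnorm (B y) (curry \<zeta> g y) \<le> (\<Sum>y\<in>L. nnorm (B y) (curry \<zeta> g y))"
    proof (cases "y \<in> L")
      case True
      show ?thesis by (rule member_le_sum[OF True _ fin]) (rule nn, simp)
    next
      case False
      thus ?thesis unfolding supp[OF DiffI[OF y False]] banach_space_on.nnorm_zero[OF fibre_banach[OF y]]
        by (intro sum_nonneg nn)
    qed
  qed
  have int: "integrable \<mu> (\<lambda>g. nnorm (B y) (curry \<zeta> g y))" if "y \<in> L" for y
    using fibre_integrable[OF f] L that by blast
  have "nnorm NG (curry \<zeta>) \<le> (\<integral>g. (\<Sum>y\<in>L. nnorm (B y) (curry \<zeta> g y)) \<partial>\<mu>)"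
    unfolding NG_simps by (intro integral_mono NG_integrable f Bochner_Integration.integrable_sum int le)
  also have "\<dots> = (\<Sum>y\<in>L. \<integral>g. nnorm (B y) (curry \<zeta> g y) \<partial>\<mu>)" by (rule Bochner_Integration.integral_sum[OF int])
  also have "\<dots> \<le> (\<Sum>y\<in>L. nnorm NP \<zeta>)"
    using NP_fibre_le[OF \<zeta>] L by (intro sum_mono) auto
  finally show ?thesis by simp
qed

text \<open>This is where properness enters.  If the convolution is nonzero at \<open>(g, y)\<close>, then for some \<open>h\<close> the element
\<open>k = h\<^sup>-\<^sup>1 g\<close> lies in the support \<open>K\<^sub>2\<close> of \<open>f\<^sub>2\<close> and \<open>h\<^sup>-\<^sup>1 y\<close> in \<open>L\<^sub>2\<close>.  Hence \<open>g\<^sup>-\<^sup>1 y = k\<^sup>-\<^sup>1 (h\<^sup>-\<^sup>1 y)\<close> lies in the compact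
set \<open>L\<^sub>3 = K\<^sub>2\<^sup>-\<^sup>1 L\<^sub>2\<close> while \<open>y \<in> L\<^sub>1\<close>, and the preimage of \<open>L\<^sub>3 \<times> L\<^sub>1\<close> under the proper map is compact.  The
resulting set depends on \<open>f\<^sub>1\<close> only through \<open>L\<^sub>1\<close>.\<close>

lemma conv_support_compact:
  assumes proper: "proper_action Y act" and \<eta>: "supported f2 L2" and L1: "compactin Y L1"
  shows "\<exists>K. compact K \<and> (\<forall>f1 g. supported f1 L1 \<longrightarrow> g \<notin> K \<longrightarrow> conv f1 f2 g = nzero \<Gamma>\<^sub>0)"
proof -
  from G0.CcD(3)[OF supported_Cc[OF \<eta>]]
  obtain K2 where K2: "compact K2" "\<forall>h. h \<notin> K2 \<longrightarrow> f2 h = nzero \<Gamma>\<^sub>0" by (elim exE conjE)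
  have L2: "compactin Y L2" and supp2: "\<And>g y. y \<in> topspace Y - L2 \<Longrightarrow> f2 g y = nzero (B y)" using \<eta> by (auto simp: supported_def)
  define L3 where "L3 = (\<lambda>(g, y). act g y) ` ((uminus ` K2) \<times> L2)"
  have mK2: "compact (uminus ` K2)" by (intro compact_continuous_image continuous_intros K2(1))
  have L3: "compactin Y L3"
    unfolding L3_def using mK2 L2 by (intro image_compactin[OF _ act_continuous]) (simp add: compactin_Times)
  define P where "P = {p \<in> topspace Z. (\<lambda>(g, y). (act g y, y)) p \<in> L3 \<times> L1}"
  have P: "compactin Z P"
    unfolding P_def using proper L3 L1 unfolding proper_action_def
    by (intro compactin_proper_map_preimage) (auto simp: compactin_Times)
  have fP: "compact (fst ` P)" using image_compactin[OF P continuous_map_fst] by simp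
  have K: "compact (uminus ` fst ` P)" by (intro compact_continuous_image[OF _ fP] continuous_intros)
  have "conv f1 f2 g = nzero \<Gamma>\<^sub>0" if f1: "supported f1 L1" and g: "g \<notin> uminus ` fst ` P" for f1 g
  proof (rule Gamma0_eqI[OF conv_closed[OF f1 \<eta>] Gamma0_zero_closed])
    fix y assume y: "y \<in> topspace Y"
    have "kernel_fun f1 f2 g h y = nzero (B y)" for h
    proof (rule ccontr)
      assume ne: "kernel_fun f1 f2 g h y \<noteq> nzero (B y)"
      have y1: "y \<in> L1"
      proof (rule ccontr)
        assume "y \<notin> L1"
        hence "f1 h y = nzero (B y)" using f1 y by (auto simp: supported_def)
        thus False using kernel_zero_left[OF f1 \<eta> _ y] ne by blast
      qed
      let ?k = "- h + g" and ?z = "act (- h) y"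
      have ne2: "f2 ?k ?z \<noteq> nzero (B ?z)" using kernel_zero_right[OF f1 \<eta> _ y] ne by blast
      have z: "?z \<in> topspace Y" by (rule source_closed[OF y])
      have k2: "?k \<in> K2" using ne2 K2(2) z by (auto simp: Gamma0_apply)
      have z2: "?z \<in> L2" using ne2 supp2 z by blast
      have "- ?k + - h = - g" by (simp add: minus_add add.assoc)
      hence "act (- g) y = act (- ?k) ?z" using action y unfolding continuous_action_def by metis
      hence "act (- g) y \<in> L3" using k2 z2 unfolding L3_def by force
      hence "(- g, y) \<in> P" using y y1 by (simp add: P_def)
      hence "- (- g) \<in> uminus ` fst ` P" by (metis fst_conv image_eqI)
      thus False using g by simp
    qed
    thus "conv f1 f2 g y = nzero \<Gamma>\<^sub>0 y" using conv_zero[OF f1 \<eta> y] y by (simp add: Gamma0_apply)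
  qed
  thus ?thesis using K by (intro exI[of _ "uminus ` fst ` P"]) blast
qed

lemma conv_bound_of_proper:
  assumes proper: "proper_action Y act" and \<eta>: "supported f2 L2" and L1: "compactin Y L1"
  shows "\<exists>M\<ge>0. \<forall>\<zeta>. supported (curry \<zeta>) L1 \<longrightarrow> nnorm NG (conv (curry \<zeta>) f2) \<le> M * nnorm NP \<zeta>"
proof -
  from conv_support_compact[OF assms]
  obtain K where K: "compact K" "\<forall>f1 g. supported f1 L1 \<longrightarrow> g \<notin> K \<longrightarrow> conv f1 f2 g = nzero \<Gamma>\<^sub>0" by (elim exE conjE)
  from G0.Cc_bounded[OF supported_Cc[OF \<eta>]]
  obtain m where m: "0 \<le> m" "\<forall>g. nnorm \<Gamma>\<^sub>0 (f2 g) \<le> m" by (elim exE conjE)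
  have "nnorm NG (conv (curry \<zeta>) f2) \<le> (m * measure \<mu> K) * nnorm NP \<zeta>" if \<zeta>: "supported (curry \<zeta>) L1" for \<zeta>
  proof -
    note f = supported_Cc[OF \<zeta>]
    have nn: "0 \<le> nnorm NP \<zeta>" by (rule NP_nonneg[OF \<zeta>])
    have "nnorm \<Gamma>\<^sub>0 (conv (curry \<zeta>) f2 g) \<le> nnorm NP \<zeta> * m" for g
    proof (rule Gamma0_norm_leI)
      fix y assume y: "y \<in> topspace Y"
      interpret By: banach_space_on "B y" by (rule fibre_banach[OF y])
      have "ennreal (nnorm (B y) (conv (curry \<zeta>) f2 g y)) \<le> (\<integral>\<^sup>+h. ennreal (nnorm (B y) (curry \<zeta> h y)) \<partial>\<mu>) * ennreal m"
        by (rule conv_norm_le[OF \<zeta> \<eta> y]) (use m(2) in blast)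
      also have "(\<integral>\<^sup>+h. ennreal (nnorm (B y) (curry \<zeta> h y)) \<partial>\<mu>) = ennreal (\<integral>h. nnorm (B y) (curry \<zeta> h y) \<partial>\<mu>)"
        by (intro nn_integral_eq_integral fibre_integrable[OF f y] AE_I2 By.norm_nonneg Gamma0_closed[OF G0.CcD(1)[OF f] y])
      also have "\<dots> * ennreal m \<le> ennreal (nnorm NP \<zeta>) * ennreal m"
        using NP_fibre_le[OF \<zeta> y] by (intro mult_right_mono ennreal_leI) simp_all
      also have "\<dots> = ennreal (nnorm NP \<zeta> * m)" using nn m(1) by (simp add: ennreal_mult)
      finally show "nnorm (B y) (conv (curry \<zeta>) f2 g y) \<le> nnorm NP \<zeta> * m"
        by (simp only: ennreal_le_iff[OF mult_nonneg_nonneg[OF nn m(1)]])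
    qed (use nn m(1) in simp)
    hence "nnorm \<Gamma>\<^sub>0 (conv (curry \<zeta>) f2 g) \<le> (nnorm NP \<zeta> * m) * indicator K g" for g
      using K(2) \<zeta> by (cases "g \<in> K") (auto simp: G0.nnorm_zero)
    from integral_le_of_support[OF NG_integrable[OF supported_Cc[OF conv_supported[OF \<zeta> \<eta>]]] measure_sets K(1) measure_compact[OF K(1)] this]
    show ?thesis unfolding NG_simps by (simp add: mult_ac)
  qed
  thus ?thesis using m(1) by (intro exI[of _ "m * measure \<mu> K"]) simp
qed

subsection \<open>Density of the sections with compact support\<close>

text \<open>On the compact support of \<open>f\<close> the values are uniformly small outside one compact subset of \<open>Y\<close>; multiply
with a continuous cutoff function on \<open>Y\<close> that is 1 there.\<close>

lemma Cc_approximated: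
  assumes f: "f \<in> Cc \<Gamma>\<^sub>0" and e: "0 < \<epsilon>"
  shows "\<exists>F L. supported F L \<and> nnorm NG (nadd NG f (nscale NG (-1) F)) < \<epsilon>"
proof -
  note f0 = G0.CcD(1)[OF f]
  from G0.CcD(3)[OF f] obtain K where K: "compact K" "\<forall>g. g \<notin> K \<longrightarrow> f g = nzero \<Gamma>\<^sub>0" by (elim exE conjE)
  define m where "m = measure \<mu> K + 1"
  have m: "0 < m" by (simp add: m_def add_nonneg_pos)
  define \<delta> where "\<delta> = \<epsilon> / (2 * m)"
  have d: "0 < \<delta> / 2" "0 < \<delta>" using e m by (simp_all add: \<delta>_def)
  have "\<forall>g. \<exists>U. open U \<and> g \<in> U \<and> (\<forall>h\<in>U. ndist \<Gamma>\<^sub>0 (f h) (f g) < \<delta> / 2)" by (intro allI G0.CcD(2)[OF f d(1)])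
  then obtain U where U: "\<And>g. open (U g)" "\<And>g. g \<in> U g" "\<And>g. \<forall>h\<in>U g. ndist \<Gamma>\<^sub>0 (f h) (f g) < \<delta> / 2" by metis
  obtain D where D: "D \<subseteq> K" "finite D" "K \<subseteq> (\<Union>g\<in>D. U g)"
    using compactE_image[OF K(1), of K U] U(1,2) by blast
  have "\<forall>g. \<exists>L. compactin Y L \<and> (\<forall>y \<in> topspace Y - L. nnorm (B y) (f g y) < \<delta> / 2)"
    by (intro allI Gamma0_vanishes f0 d)
  then obtain L' where L': "\<And>g. compactin Y (L' g)" "\<And>g. \<forall>y \<in> topspace Y - L' g. nnorm (B y) (f g y) < \<delta> / 2" by metis
  define L where "L = (\<Union>g\<in>D. L' g)"
  have L: "compactin Y L" unfolding L_def using D(2) L'(1) by (intro compactin_Union) auto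
  have small: "nnorm (B y) (f g y) < \<delta>" if y: "y \<in> topspace Y - L" and g: "g \<in> K" for g y
  proof -
    obtain d where d: "d \<in> D" "g \<in> U d" using D(3) g by blast
    have yY: "y \<in> topspace Y" using y by blast
    have "nnorm (B y) (f d y) < \<delta> / 2" using L'(2)[of d] y d(1) by (auto simp: L_def)
    moreover have "ndist (B y) (f g y) (f d y) < \<delta> / 2"
      using Gamma0_nd_point[OF f0 f0 yY, of g d] U(3)[of d] d(2) by fastforce
    ultimately show ?thesis
      using banach_space_on.norm_le_nd[OF fibre_banach[OF yY] Gamma0_closed[OF f0 yY] Gamma0_closed[OF f0 yY], of g d] by linarith
  qed
  have reg: "regular_space Y" using locally_compact_Hausdorff_imp_regular_space[OF locally_compact_Y Hausdorff_Y] .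
  obtain V C where V: "openin Y V" "compactin Y C" "L \<subseteq> V" "V \<subseteq> C"
    using locally_compact_space_compact_closed_compact[of Y] Hausdorff_Y locally_compact_Y L by metis
  have cr: "completely_regular_space Y" by (rule locally_compact_regular_imp_completely_regular_space[OF locally_compact_Y]) (simp add: reg)
  \<comment> \<open>Urysohn's lemma puts the smaller value on the compact set, hence the change of sign.\<close>
  obtain \<kappa> where \<kappa>: "continuous_map Y (top_of_set {-1..0::real}) \<kappa>" "\<kappa> ` L \<subseteq> {-1}" "\<kappa> ` (topspace Y - V) \<subseteq> {0}"
    by (rule Urysohn_completely_regular_closed_compact[of "-1" 0 Y "topspace Y - V" L])
      (use V cr L in \<open>auto simp: disjnt_def\<close>)
  define k where "k y = - \<kappa> y" for y
  have kc: "continuous_map Y euclideanreal k"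
    unfolding k_def using \<kappa>(1) by (intro continuous_map_minus) (simp add: continuous_map_in_subtopology)
  have k01: "0 \<le> k y \<and> k y \<le> 1" if "y \<in> topspace Y" for y
    using \<kappa>(1) that by (auto simp: k_def continuous_map_in_subtopology Pi_iff image_subset_iff)
  have kL: "k y = 1" if "y \<in> L" for y using \<kappa>(2) that by (auto simp: k_def)
  have kV: "k y = 0" if "y \<in> topspace Y - C" for y using \<kappa>(3) V(4) that by (auto simp: k_def)
  define F where "F g = (\<lambda>y \<in> topspace Y. nscale (B y) (complex_of_real (k y)) (f g y))" for g
  have F_apply: "F g y = nscale (B y) (complex_of_real (k y)) (f g y)" if "y \<in> topspace Y" for g y
    using that by (simp add: F_def)
  have supp: "F g y = nzero (B y)" if y: "y \<in> topspace Y - C" for g y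
    using y kV[OF y] banach_space_on.scale_zero_left[OF fibre_banach Gamma0_closed[OF f0]] by (simp add: F_apply)
  have F0: "F g \<in> ncar \<Gamma>\<^sub>0" for g
    by (rule Gamma0_compactI[OF _ V(2) supp]) (unfold F_def, rule continuous_multiple[OF Gamma0_section[OF f0] kc])
  have F_nd: "ndist \<Gamma>\<^sub>0 (F g) (F h) \<le> ndist \<Gamma>\<^sub>0 (f g) (f h)" for g h
  proof (rule Gamma0_nd_leI[OF G0.nd_nonneg[OF f0 f0]])
    fix y assume y: "y \<in> topspace Y"
    interpret By: banach_space_on "B y" by (rule fibre_banach[OF y])
    have "ndist (B y) (F g y) (F h y) = k y * ndist (B y) (f g y) (f h y)"
      unfolding F_apply[OF y] using k01[OF y] by (subst By.nd_scale[OF Gamma0_closed[OF f0 y] Gamma0_closed[OF f0 y]]) simp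
    also have "\<dots> \<le> ndist (B y) (f g y) (f h y)"
      using k01[OF y] By.nd_nonneg[OF Gamma0_closed[OF f0 y] Gamma0_closed[OF f0 y], of g h] by (simp add: mult_left_le_one_le)
    also have "\<dots> \<le> ndist \<Gamma>\<^sub>0 (f g) (f h)" by (rule Gamma0_nd_point[OF f0 f0 y])
    finally show "ndist (B y) (F g y) (F h y) \<le> ndist \<Gamma>\<^sub>0 (f g) (f h)" .
  qed
  have F_zero: "F g = nzero \<Gamma>\<^sub>0" if "g \<notin> K" for g
    using K(2) that
    by (intro Gamma0_eqI[OF F0 Gamma0_zero_closed]) (simp add: F_apply Gamma0_apply banach_space_on.scale_zero_right[OF fibre_banach])
  have F_Cc: "F \<in> Cc \<Gamma>\<^sub>0"
  proof (rule G0.CcI[OF F0 _ K(1) F_zero])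
    fix g and \<epsilon> :: real assume e: "0 < \<epsilon>"
    from G0.CcD(2)[OF f e, of g]
    obtain U where U: "open U" "g \<in> U" "\<forall>h\<in>U. ndist \<Gamma>\<^sub>0 (f h) (f g) < \<epsilon>" by (elim exE conjE)
    have "\<forall>h\<in>U. ndist \<Gamma>\<^sub>0 (F h) (F g) < \<epsilon>" using U(3) F_nd order_le_less_trans by blast
    thus "\<exists>U. open U \<and> g \<in> U \<and> (\<forall>h\<in>U. ndist \<Gamma>\<^sub>0 (F h) (F g) < \<epsilon>)" using U(1,2) by (intro exI[of _ U]) simp
  qed
  have FC: "supported F C" using F_Cc V(2) supp by (simp add: supported_def)
  let ?h = "\<lambda>g. ndiff \<Gamma>\<^sub>0 (f g) (F g)"
  have close: "ndist \<Gamma>\<^sub>0 (f g) (F g) \<le> \<delta> * indicator K g" for g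
  proof (rule Gamma0_nd_leI)
    show "0 \<le> \<delta> * indicator K g" using d by (simp add: indicator_def)
    fix y assume y: "y \<in> topspace Y"
    interpret By: banach_space_on "B y" by (rule fibre_banach[OF y])
    note fy = Gamma0_closed[OF f0 y]
    have eq: "ndist (B y) (f g y) (F g y) = \<bar>1 - k y\<bar> * nnorm (B y) (f g y)"
      unfolding F_apply[OF y] by (rule By.nd_multiple[OF fy])
    show "ndist (B y) (f g y) (F g y) \<le> \<delta> * indicator K g"
    proof (cases "g \<in> K")
      case False
      thus ?thesis unfolding eq using K(2) by (simp add: Gamma0_apply[OF y] By.nnorm_zero)
    next
      case True
      have "\<bar>1 - k y\<bar> * nnorm (B y) (f g y) \<le> \<delta>"
      proof (cases "y \<in> L")
        case True
        thus ?thesis using kL d by simp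
      next
        case False
        have "\<bar>1 - k y\<bar> * nnorm (B y) (f g y) \<le> 1 * nnorm (B y) (f g y)"
          using k01[OF y] by (intro mult_right_mono By.norm_nonneg fy) auto
        thus ?thesis using small[of y g] False True y \<open>g \<in> K\<close> by simp
      qed
      thus ?thesis unfolding eq using True by simp
    qed
  qed
  have hint: "integrable \<mu> (\<lambda>g. ndist \<Gamma>\<^sub>0 (f g) (F g))"
  proof (rule Bochner_Integration.integrable_bound[OF _ G0.Cc_nd_measurable[OF f F_Cc measure_sets]])
    have "K \<in> sets \<mu>" using compact_imp_closed[OF K(1)] by (simp add: measure_sets)
    thus "integrable \<mu> (\<lambda>g. \<delta> * indicator K g)"
      using measure_compact[OF K(1)] by (intro integrable_mult_right integrable_real_indicator)
    have "norm (ndist \<Gamma>\<^sub>0 (f g) (F g)) \<le> norm (\<delta> * indicator K g)" for g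
      using close[of g] G0.nd_nonneg[OF f0 F0, of g g] by simp
    thus "AE g in \<mu>. norm (ndist \<Gamma>\<^sub>0 (f g) (F g)) \<le> norm (\<delta> * indicator K g)" by simp
  qed
  have "nnorm NG (nadd NG f (nscale NG (-1) F)) = (\<integral>g. ndist \<Gamma>\<^sub>0 (f g) (F g) \<partial>\<mu>)"
    by (simp add: NG_simps ndist_def ndiff_def)
  also have "\<dots> \<le> \<delta> * measure \<mu> K"
    by (rule integral_le_of_support[OF hint measure_sets K(1) measure_compact[OF K(1)] close])
  also have "\<dots> \<le> \<delta> * m" using d by (simp add: m_def)
  also have "\<dots> < \<epsilon>" using e m by (simp add: \<delta>_def)
  finally show ?thesis using FC by blast
qed

end

section \<open>The canonical homomorphism\<close>

context transformation_groupoid_algebra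
begin

context
  fixes j :: "('g \<Rightarrow> 'y \<Rightarrow> 'e) \<Rightarrow> 'l::complex_banach_algebra"
    and j' :: "('g \<times> 'y \<Rightarrow> 'e) \<Rightarrow> 'l'::complex_banach_algebra"
    and \<psi> :: "'l \<Rightarrow> 'l'"
  assumes geometry: "proper_action Y act \<or> Y = discrete_topology (topspace Y)"
    and j: "is_completion NG j" and j': "is_completion NP j'"
    and compatible: "\<And>\<xi>. \<xi> \<in> \<Gamma>\<^sub>c \<Longrightarrow> \<psi> (j (curry \<xi>)) = j' \<xi>"
begin

lemma j_norm: "f \<in> Cc \<Gamma>\<^sub>0 \<Longrightarrow> norm (j f) = nnorm NG f"
  and j_dense: "closure (j ` Cc \<Gamma>\<^sub>0) = UNIV"
  and j_mul: "f \<in> Cc \<Gamma>\<^sub>0 \<Longrightarrow> f' \<in> Cc \<Gamma>\<^sub>0 \<Longrightarrow> j (nmul NG f f') = j f * j f'"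
  using j by (auto simp: is_completion_def NG_simps)

lemma j'_norm: "\<xi> \<in> \<Gamma>\<^sub>c \<Longrightarrow> norm (j' \<xi>) = nnorm NP \<xi>"
  and j'_dense: "closure (j' ` \<Gamma>\<^sub>c) = UNIV"
  and j'_mul: "\<xi> \<in> \<Gamma>\<^sub>c \<Longrightarrow> \<eta> \<in> \<Gamma>\<^sub>c \<Longrightarrow> j' (nmul NP \<xi> \<eta>) = j' \<xi> * j' \<eta>"
  using j' by (auto simp: is_completion_def NP_simps)

lemma curry_mul:
  assumes \<xi>: "supported (curry \<xi>) L1" "\<xi> \<in> \<Gamma>\<^sub>c" and \<eta>: "supported (curry \<eta>) L2" "\<eta> \<in> \<Gamma>\<^sub>c"
  shows "supported (curry (nmul NP \<xi> \<eta>)) L1" "nmul NP \<xi> \<eta> \<in> \<Gamma>\<^sub>c"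
    "j (curry (nmul NP \<xi> \<eta>)) = j (curry \<xi>) * j (curry \<eta>)"
proof -
  have eq: "curry (nmul NP \<xi> \<eta>) = conv (curry \<xi>) (curry \<eta>)" unfolding NP_mul[OF \<xi>(1) \<eta>(1)] by simp
  show "supported (curry (nmul NP \<xi> \<eta>)) L1" unfolding eq by (rule conv_supported[OF \<xi>(1) \<eta>(1)])
  show "nmul NP \<xi> \<eta> \<in> \<Gamma>\<^sub>c" unfolding NP_mul[OF \<xi>(1) \<eta>(1)] by (rule supported_uncurry[OF conv_supported[OF \<xi>(1) \<eta>(1)]])
  show "j (curry (nmul NP \<xi> \<eta>)) = j (curry \<xi>) * j (curry \<eta>)"
    unfolding eq NG_mul[OF \<xi>(1) \<eta>(1), symmetric] by (rule j_mul[OF supported_Cc[OF \<xi>(1)] supported_Cc[OF \<eta>(1)]])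
qed

text \<open>The common conclusion of the two cases.  The constant depends on \<open>\<zeta>\<close> only through its support in \<open>Y\<close>.\<close>

lemma right_multiplication_bounded:
  assumes L1: "compactin Y L1" and \<eta>: "supported (curry \<eta>) L2" "\<eta> \<in> \<Gamma>\<^sub>c"
  shows "\<exists>M. \<forall>\<zeta>\<in>\<Gamma>\<^sub>c. supported (curry \<zeta>) L1 \<longrightarrow> norm (j (curry \<zeta>) * j (curry \<eta>)) \<le> M * norm (j' \<zeta>)"
  using geometry
proof
  assume "proper_action Y act"
  from conv_bound_of_proper[OF this \<eta>(1) L1]
  obtain M where M: "\<forall>\<zeta>. supported (curry \<zeta>) L1 \<longrightarrow> nnorm NG (conv (curry \<zeta>) (curry \<eta>)) \<le> M * nnorm NP \<zeta>" by (elim exE conjE)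
  have "norm (j (curry \<zeta>) * j (curry \<eta>)) \<le> M * norm (j' \<zeta>)" if \<zeta>: "\<zeta> \<in> \<Gamma>\<^sub>c" "supported (curry \<zeta>) L1" for \<zeta>
    using M[rule_format, OF \<zeta>(2)] j_norm[OF supported_Cc[OF conv_supported[OF \<zeta>(2) \<eta>(1)]]]
    by (simp only: j'_norm[OF \<zeta>(1)] j_mul[OF supported_Cc[OF \<zeta>(2)] supported_Cc[OF \<eta>(1)]] NG_mul[OF \<zeta>(2) \<eta>(1), symmetric])
  thus ?thesis by (intro exI[of _ M] ballI impI)
next
  assume "Y = discrete_topology (topspace Y)"
  hence fin: "finite L1" using L1 by (metis compactin_discrete_topology)
  have "norm (j (curry \<zeta>) * j (curry \<eta>)) \<le> (real (card L1) * norm (j (curry \<eta>))) * norm (j' \<zeta>)"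
    if \<zeta>: "\<zeta> \<in> \<Gamma>\<^sub>c" "supported (curry \<zeta>) L1" for \<zeta>
  proof -
    have "norm (j (curry \<zeta>) * j (curry \<eta>)) \<le> norm (j (curry \<zeta>)) * norm (j (curry \<eta>))" by (rule norm_mult_ineq)
    also have "\<dots> \<le> (real (card L1) * norm (j' \<zeta>)) * norm (j (curry \<eta>))"
      unfolding j_norm[OF supported_Cc[OF \<zeta>(2)]] j'_norm[OF \<zeta>(1)]
      by (intro mult_right_mono fibre_le_of_finite_support[OF \<zeta>(2) fin] norm_ge_zero)
    finally show ?thesis by (simp only: mult_ac)
  qed
  thus ?thesis by (intro exI[of _ "real (card L1) * norm (j (curry \<eta>))"] ballI impI)
qed

text \<open>The image of \<open>\<Gamma>\<^sub>c(G \<ltimes> Y, r\<^sup>*B)\<close> in \<open>L\<^sup>1(G, \<Gamma>\<^sub>0)\<close>, on which \<open>\<psi>\<close> is the identity of sections.\<close>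

definition core where "core = (\<lambda>\<xi>. j (curry \<xi>)) ` \<Gamma>\<^sub>c"

text \<open>The product of \<open>\<xi>\<close> and \<open>a\<close> is supported where \<open>\<xi>\<close> is, whatever \<open>a\<close> is, so one constant serves for all \<open>a\<close>.\<close>

lemma core_sandwich:
  assumes "x \<in> core" "y \<in> core"
  shows "\<exists>M. \<forall>a\<in>core. norm (x * a * y) \<le> M * norm (\<psi> a)"
proof -
  obtain \<xi> \<eta> where x: "\<xi> \<in> \<Gamma>\<^sub>c" "x = j (curry \<xi>)" and y: "\<eta> \<in> \<Gamma>\<^sub>c" "y = j (curry \<eta>)" using assms by (auto simp: core_def)
  from Gammac_curry[OF x(1)] obtain L1 where L1: "supported (curry \<xi>) L1" ..
  from Gammac_curry[OF y(1)] obtain L2 where L2: "supported (curry \<eta>) L2" ..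
  have c: "compactin Y L1" using L1 by (simp add: supported_def)
  from right_multiplication_bounded[OF c L2 y(1)]
  obtain M where M: "\<forall>\<zeta>\<in>\<Gamma>\<^sub>c. supported (curry \<zeta>) L1 \<longrightarrow> norm (j (curry \<zeta>) * j (curry \<eta>)) \<le> M * norm (j' \<zeta>)" ..
  have "norm (x * a * y) \<le> (max M 0 * norm (j' \<xi>)) * norm (\<psi> a)" if a: "a \<in> core" for a
  proof -
    obtain \<theta> where \<theta>: "\<theta> \<in> \<Gamma>\<^sub>c" "a = j (curry \<theta>)" using a by (auto simp: core_def)
    from Gammac_curry[OF \<theta>(1)] obtain L where L: "supported (curry \<theta>) L" ..
    note m = curry_mul[OF L1 x(1) L \<theta>(1)]
    have "norm (x * a * y) \<le> M * norm (j' (nmul NP \<xi> \<theta>))"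
      using M[rule_format, OF m(2,1)] by (simp only: m(3) x(2) y(2) \<theta>(2))
    also have "\<dots> \<le> max M 0 * norm (j' (nmul NP \<xi> \<theta>))" by (intro mult_right_mono) simp_all
    also have "\<dots> \<le> max M 0 * (norm (j' \<xi>) * norm (j' \<theta>))"
      unfolding j'_mul[OF x(1) \<theta>(1)] by (intro mult_left_mono norm_mult_ineq) simp
    finally show ?thesis unfolding \<theta>(2) compatible[OF \<theta>(1)] by (simp only: mult.assoc)
  qed
  thus ?thesis by (intro exI[of _ "max M 0 * norm (j' \<xi>)"] ballI)
qed

lemma core_dense: "closure core = UNIV"
proof -
  have "j ` Cc \<Gamma>\<^sub>0 \<subseteq> closure core"
  proof (rule image_subsetI)
    fix f :: "'g \<Rightarrow> 'y \<Rightarrow> 'e" assume f: "f \<in> Cc \<Gamma>\<^sub>0"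
    show "j f \<in> closure core" unfolding closure_approachable
    proof (intro allI impI)
      fix \<epsilon> :: real assume "0 < \<epsilon>"
      from Cc_approximated[OF f this]
      obtain F L where F: "supported F L" "nnorm NG (nadd NG f (nscale NG (-1) F)) < \<epsilon>" by (elim exE conjE)
      have FC: "F \<in> Cc \<Gamma>\<^sub>0" by (rule supported_Cc[OF F(1)])
      have sc: "nscale NG (-1) F \<in> Cc \<Gamma>\<^sub>0" using G0.Cc_scale[OF FC] by (simp add: NG_simps)
      have h: "\<forall>x\<in>Cc \<Gamma>\<^sub>0. \<forall>y\<in>Cc \<Gamma>\<^sub>0. j (nadd NG x y) = j x + j y" "\<forall>x\<in>Cc \<Gamma>\<^sub>0. \<forall>c. j (nscale NG c x) = c *\<^sub>C j x"
        using j by (simp_all add: is_completion_def NG_simps(1))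
      have m: "(-1) *\<^sub>C j F = - j F" using scaleC_of_real[of "-1" "j F"] by simp
      have 1: "j (nscale NG (-1) F) = - j F" using h(2) FC m by simp
      have "j (nadd NG f (nscale NG (-1) F)) = j f - j F" using h(1) f sc 1 by simp
      moreover have "nadd NG f (nscale NG (-1) F) \<in> Cc \<Gamma>\<^sub>0"
        using G0.Cc_add[OF f G0.Cc_scale[OF FC]] by (simp add: NG_simps)
      ultimately have "norm (j f - j F) < \<epsilon>" using F(2) j_norm by metis
      moreover have "j F \<in> core" unfolding core_def
        by (rule image_eqI[OF _ supported_uncurry[OF F(1)]]) simp
      ultimately show "\<exists>y\<in>core. dist y (j f) < \<epsilon>" by (intro bexI[of _ "j F"]) (simp_all add: dist_norm norm_minus_commute)
    qed
  qed
  hence "closure (j ` Cc \<Gamma>\<^sub>0) \<subseteq> closure core" by (rule closure_minimal) simp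
  thus ?thesis unfolding j_dense by blast
qed

lemma core_image_dense: "closure (\<psi> ` core) = UNIV"
proof -
  have "\<psi> ` core = j' ` \<Gamma>\<^sub>c" unfolding core_def image_image using compatible by simp
  thus ?thesis using j'_dense by simp
qed

end

end

theorem proposition2p1:
  fixes \<mu> :: "'g::{topological_group_add, t2_space} measure"
    and Y :: "'y topology"
    and act :: "'g \<Rightarrow> 'y \<Rightarrow> 'y"
    and B :: "'y \<Rightarrow> 'e balgebra"
    and \<Gamma> :: "('y \<Rightarrow> 'e) set"
    and \<alpha> :: "'g \<Rightarrow> 'y \<Rightarrow> 'e \<Rightarrow> 'e"
    and j :: "('g \<Rightarrow> 'y \<Rightarrow> 'e) \<Rightarrow> 'l::complex_banach_algebra"
    and j' :: "('g \<times> 'y \<Rightarrow> 'e) \<Rightarrow> 'l'::complex_banach_algebra"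
    and \<psi> :: "'l \<Rightarrow> 'l'"
  assumes "locally_compact_space (euclidean :: 'g topology)"
    and "left_haar_measure \<mu>"
    and "locally_compact_space Y" and "Hausdorff_space Y"
    and "continuous_action Y act"
    and "groupoid_banach_algebra Y act B \<Gamma> \<alpha>"
    and "proper_action Y act \<or> Y = discrete_topology (topspace Y)"
    and "is_completion (group_convolution_algebra \<mu> (Gamma0 Y B \<Gamma>) (section_action Y act \<alpha>)) j"
    and "is_completion (groupoid_convolution_algebra \<mu> Y act B \<Gamma> \<alpha>) j'"
    and "banach_algebra_hom \<psi>"
    and "\<forall>\<xi> \<in> ncar (groupoid_convolution_algebra \<mu> Y act B \<Gamma> \<alpha>). \<psi> (j (curry \<xi>)) = j' \<xi>"
  shows "K0_map \<psi> \<in> iso (K0 TYPE('l)) (K0 TYPE('l'))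
    \<and> K1_map \<psi> \<in> iso (K1 TYPE('l)) (K1 TYPE('l'))"
proof -
  interpret groupoid_banach_algebra Y act B \<Gamma> \<alpha> by fact
  interpret transformation_groupoid_algebra Y act B \<Gamma> \<alpha> \<mu>
    using assms(1-5) by unfold_locales (auto simp: left_haar_measure_def)
  have compatible: "\<psi> (j (curry \<xi>)) = j' \<xi>" if "\<xi> \<in> \<Gamma>\<^sub>c" for \<xi>
    using assms(11) that by (simp add: NP_simps(1))
  note core = assms(7-9) compatible
  interpret hereditary_morphism \<psi> "generated_ideal (core j)"
    by (rule hereditary_morphism_of_dense[OF assms(10) core_dense[OF core] core_image_dense[OF core] core_sandwich[OF core]])
  show ?thesis using K0_iso K1_iso by blast
qed

end
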